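(* Let $\Gamma\curvearrowright X$ and $\Lambda\curvearrowright Y$ be free ergodic pmp actions of countable discrete groups, where $\Gamma$ is icc. Assume that $\Theta:L^\infty(X)\rtimes\Gamma\to L^\infty(Y)\rtimes\Lambda$ is a $\ast$-isomorphism such that $\Theta(L^\infty(X))=L^\infty(Y)$ and there exists a unitary $u\in L^\infty(Y)\rtimes\Lambda$ such that $\Theta(L(\Gamma))=uL(\Lambda)u^*$. Then one can find $x\in\mathcal N_{L^\infty(Y)\rtimes\Lambda}(L^\infty(Y))$, a character $\eta:\Gamma\to\mathbb T$, and a group isomorphism $\delta:\Gamma\to\Lambda$ such that $xu\in\mathcal U(L(\Lambda))$ and for all $a\in L^\infty(X)$, $\gamma\in\Gamma$ we have $$\Theta(au_\gamma)=\eta(\gamma)\,\Theta(a)\,x^*v_{\delta(\gamma)}x .$$ In particular, $\Gamma\curvearrowright X$ is conjugate to $\Lambda\curvearrowright Y$.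
   Context: A group is icc if all its nontrivial conjugacy classes are infinite. Pmp means probability measure preserving on a standard probability space. $\{u_\gamma\}_{\gamma\in\Gamma}$ and $\{v_\lambda\}_{\lambda\in\Lambda}$ are the canonical group unitaries implementing the actions in $L^\infty(X)\rtimes\Gamma$ and $L^\infty(Y)\rtimes\Lambda$, generating $L(\Gamma)$ and $L(\Lambda)$ respectively. For $N\subseteq M$, $\mathcal N_M(N)=\{w\in\mathcal U(M): wNw^*=N\}$, and $\mathcal U(\cdot)$ denotes the unitary group. *)

theory Defs
  imports
    "HOL-Probability.Probability"
    "HOL-Algebra.Group_Action"
begin

section \<open>Groups and actions\<close>

definition icc :: "('g, 'm) monoid_scheme \<Rightarrow> bool" where
  "icc G \<longleftrightarrow> group G \<and>
     (\<forall>g \<in> carrier G. g \<noteq> \<one>\<^bsub>G\<^esub> \<longrightarrow>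
        infinite {h \<otimes>\<^bsub>G\<^esub> g \<otimes>\<^bsub>G\<^esub> inv\<^bsub>G\<^esub> h | h. h \<in> carrier G})"

definition circle_group :: "complex monoid" where
  "circle_group = \<lparr>carrier = {z. cmod z = 1}, mult = (*), one = 1\<rparr>"

text \<open>The \<sigma>-algebra is the Borel \<sigma>-algebra of some Polish topology on the space.\<close>
definition standard_prob_space :: "'x measure \<Rightarrow> bool" where
  "standard_prob_space M \<longleftrightarrow> prob_space M \<and>
     (\<exists>T. completely_metrizable_space T \<and> second_countable T \<and> topspace T = space M \<and>
          sets M = sigma_sets (space M) {U. openin T U})"

definition pmp_action ::
  "('g, 'm) monoid_scheme \<Rightarrow> 'x measure \<Rightarrow> ('g \<Rightarrow> 'x \<Rightarrow> 'x) \<Rightarrow> bool" where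
  "pmp_action G M \<phi> \<longleftrightarrow> standard_prob_space M \<and> group_action G (space M) \<phi> \<and>
     (\<forall>g \<in> carrier G. \<phi> g \<in> M \<rightarrow>\<^sub>M M \<and> distr M M (\<phi> g) = M)"

text \<open>Freeness is understood almost everywhere, as usual for measure preserving actions.\<close>
definition free_pmp ::
  "('g, 'm) monoid_scheme \<Rightarrow> 'x measure \<Rightarrow> ('g \<Rightarrow> 'x \<Rightarrow> 'x) \<Rightarrow> bool" where
  "free_pmp G M \<phi> \<longleftrightarrow> (\<forall>g \<in> carrier G. g \<noteq> \<one>\<^bsub>G\<^esub> \<longrightarrow> (AE x in M. \<phi> g x \<noteq> x))"

definition ergodic_pmp ::
  "('g, 'm) monoid_scheme \<Rightarrow> 'x measure \<Rightarrow> ('g \<Rightarrow> 'x \<Rightarrow> 'x) \<Rightarrow> bool" where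
  "ergodic_pmp G M \<phi> \<longleftrightarrow>
     (\<forall>A \<in> sets M. (\<forall>g \<in> carrier G. \<phi> g ` A = A) \<longrightarrow> measure M A = 0 \<or> measure M A = 1)"

text \<open>\<open>\<theta>\<close> is an isomorphism of measure spaces after discarding null sets.\<close>
definition iso_mod_null :: "'x measure \<Rightarrow> 'y measure \<Rightarrow> ('x \<Rightarrow> 'y) \<Rightarrow> bool" where
  "iso_mod_null M N \<theta> \<longleftrightarrow>
     (\<exists>A \<in> sets M. \<exists>B \<in> sets N. (AE x in M. x \<in> A) \<and> (AE y in N. y \<in> B) \<and>
        bij_betw \<theta> A B \<and>
        \<theta> \<in> restrict_space M A \<rightarrow>\<^sub>M restrict_space N B \<and>
        the_inv_into A \<theta> \<in> restrict_space N B \<rightarrow>\<^sub>M restrict_space M A \<and>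
        distr (restrict_space M A) (restrict_space N B) \<theta> = restrict_space N B)"

definition conjugate_actions ::
  "('g, 'm) monoid_scheme \<Rightarrow> 'x measure \<Rightarrow> ('g \<Rightarrow> 'x \<Rightarrow> 'x) \<Rightarrow>
   ('h, 'n) monoid_scheme \<Rightarrow> 'y measure \<Rightarrow> ('h \<Rightarrow> 'y \<Rightarrow> 'y) \<Rightarrow> bool" where
  "conjugate_actions G M \<phi> H N \<psi> \<longleftrightarrow>
     (\<exists>\<theta> \<delta>. iso_mod_null M N \<theta> \<and> \<delta> \<in> iso G H \<and>
        (\<forall>g \<in> carrier G. AE x in M. \<theta> (\<phi> g x) = \<psi> (\<delta> g) (\<theta> x)))"


section \<open>The Hilbert space of square integrable functions\<close>

text \<open>A vector is an almost-everywhere equality class of functions.\<close>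

type_synonym 'a l2vec = "('a \<Rightarrow> complex) set"
type_synonym 'a l2op = "'a l2vec \<Rightarrow> 'a l2vec"

definition ae_class :: "'a measure \<Rightarrow> ('a \<Rightarrow> complex) \<Rightarrow> 'a l2vec" where
  "ae_class M f = {g \<in> borel_measurable M. AE x in M. g x = f x}"

definition l2 :: "'a measure \<Rightarrow> 'a l2vec set" where
  "l2 M = ae_class M ` {f \<in> borel_measurable M. integrable M (\<lambda>x. (cmod (f x))\<^sup>2)}"

text \<open>The operations below do not depend on the chosen representatives.\<close>
definition rep :: "'a l2vec \<Rightarrow> 'a \<Rightarrow> complex" where
  "rep c = (SOME f. f \<in> c)"

definition l2_add :: "'a measure \<Rightarrow> 'a l2vec \<Rightarrow> 'a l2vec \<Rightarrow> 'a l2vec" where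
  "l2_add M c d = ae_class M (\<lambda>x. rep c x + rep d x)"

definition l2_scale :: "'a measure \<Rightarrow> complex \<Rightarrow> 'a l2vec \<Rightarrow> 'a l2vec" where
  "l2_scale M z c = ae_class M (\<lambda>x. z * rep c x)"

definition l2_inner :: "'a measure \<Rightarrow> 'a l2vec \<Rightarrow> 'a l2vec \<Rightarrow> complex" where
  "l2_inner M c d = (LINT x|M. rep c x * cnj (rep d x))"

definition l2_norm :: "'a measure \<Rightarrow> 'a l2vec \<Rightarrow> real" where
  "l2_norm M c = sqrt (LINT x|M. (cmod (rep c x))\<^sup>2)"


section \<open>Bounded operators and von Neumann algebras\<close>

definition bounded_ops :: "'a measure \<Rightarrow> 'a l2op set" where
  "bounded_ops M = {T \<in> l2 M \<rightarrow>\<^sub>E l2 M.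
     (\<forall>c \<in> l2 M. \<forall>d \<in> l2 M. T (l2_add M c d) = l2_add M (T c) (T d)) \<and>
     (\<forall>z. \<forall>c \<in> l2 M. T (l2_scale M z c) = l2_scale M z (T c)) \<and>
     (\<exists>K. \<forall>c \<in> l2 M. l2_norm M (T c) \<le> K * l2_norm M c)}"

definition op_one :: "'a measure \<Rightarrow> 'a l2op" where
  "op_one M = (\<lambda>c \<in> l2 M. c)"

definition op_add :: "'a measure \<Rightarrow> 'a l2op \<Rightarrow> 'a l2op \<Rightarrow> 'a l2op" where
  "op_add M S T = (\<lambda>c \<in> l2 M. l2_add M (S c) (T c))"

definition op_scale :: "'a measure \<Rightarrow> complex \<Rightarrow> 'a l2op \<Rightarrow> 'a l2op" where
  "op_scale M z T = (\<lambda>c \<in> l2 M. l2_scale M z (T c))"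

definition op_mult :: "'a measure \<Rightarrow> 'a l2op \<Rightarrow> 'a l2op \<Rightarrow> 'a l2op" where
  "op_mult M S T = compose (l2 M) S T"

definition op_adj :: "'a measure \<Rightarrow> 'a l2op \<Rightarrow> 'a l2op" where
  "op_adj M T = (THE S. S \<in> bounded_ops M \<and>
     (\<forall>c \<in> l2 M. \<forall>d \<in> l2 M. l2_inner M (T c) d = l2_inner M c (S d)))"

definition commutant :: "'a measure \<Rightarrow> 'a l2op set \<Rightarrow> 'a l2op set" where
  "commutant M A = {T \<in> bounded_ops M. \<forall>S \<in> A. op_mult M S T = op_mult M T S}"

definition vN_generated :: "'a measure \<Rightarrow> 'a l2op set \<Rightarrow> 'a l2op set" where
  "vN_generated M A = commutant M (commutant M (A \<union> op_adj M ` A))"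

definition unitaries :: "'a measure \<Rightarrow> 'a l2op set \<Rightarrow> 'a l2op set" where
  "unitaries M A = {w \<in> A. op_mult M (op_adj M w) w = op_one M \<and>
                          op_mult M w (op_adj M w) = op_one M}"

definition op_conj :: "'a measure \<Rightarrow> 'a l2op \<Rightarrow> 'a l2op \<Rightarrow> 'a l2op" where
  "op_conj M w T = op_mult M w (op_mult M T (op_adj M w))"

definition vN_normalizer :: "'a measure \<Rightarrow> 'a l2op set \<Rightarrow> 'a l2op set \<Rightarrow> 'a l2op set" where
  "vN_normalizer M A B = {w \<in> unitaries M A. op_conj M w ` B = B}"

definition star_isomorphism ::
  "'a measure \<Rightarrow> 'a l2op set \<Rightarrow> 'b measure \<Rightarrow> 'b l2op set \<Rightarrow> ('a l2op \<Rightarrow> 'b l2op) \<Rightarrow> bool" where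
  "star_isomorphism M A N B \<Theta> \<longleftrightarrow> bij_betw \<Theta> A B \<and>
     (\<forall>S \<in> A. \<forall>T \<in> A. \<Theta> (op_add M S T) = op_add N (\<Theta> S) (\<Theta> T)) \<and>
     (\<forall>z. \<forall>T \<in> A. \<Theta> (op_scale M z T) = op_scale N z (\<Theta> T)) \<and>
     (\<forall>S \<in> A. \<forall>T \<in> A. \<Theta> (op_mult M S T) = op_mult N (\<Theta> S) (\<Theta> T)) \<and>
     (\<forall>T \<in> A. \<Theta> (op_adj M T) = op_adj N (\<Theta> T))"


section \<open>The group measure space construction\<close>

text \<open>
  The crossed product acts on \<open>L\<^sup>2(X) \<otimes> \<ell>\<^sup>2(\<Gamma>)\<close>, realised as \<open>L\<^sup>2\<close> of \<open>X \<times> \<Gamma>\<close> with the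
  product of the given measure and the counting measure.  A function \<open>a\<close> acts as \<open>a \<otimes> 1\<close>, and
  \<open>u\<^sub>\<gamma>\<close> as the tensor product of the Koopman unitary of \<open>\<gamma>\<close> and the left translation by \<open>\<gamma>\<close>;
  in particular \<open>u\<^sub>\<gamma> a u\<^sub>\<gamma>\<^sup>* = a \<circ> \<gamma>\<^sup>-\<^sup>1\<close>.
\<close>

definition gms_measure ::
  "('g, 'm) monoid_scheme \<Rightarrow> 'x measure \<Rightarrow> ('x \<times> 'g) measure" where
  "gms_measure G M = M \<Otimes>\<^sub>M count_space (carrier G)"

definition mult_op ::
  "('g, 'm) monoid_scheme \<Rightarrow> 'x measure \<Rightarrow> ('x \<Rightarrow> complex) \<Rightarrow> ('x \<times> 'g) l2op" where
  "mult_op G M a = (\<lambda>c \<in> l2 (gms_measure G M).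
     ae_class (gms_measure G M) (\<lambda>(x, h). a x * rep c (x, h)))"

definition Linf :: "('g, 'm) monoid_scheme \<Rightarrow> 'x measure \<Rightarrow> ('x \<times> 'g) l2op set" where
  "Linf G M = mult_op G M ` {a \<in> borel_measurable M. \<exists>K. AE x in M. cmod (a x) \<le> K}"

definition group_unitary ::
  "('g, 'm) monoid_scheme \<Rightarrow> 'x measure \<Rightarrow> ('g \<Rightarrow> 'x \<Rightarrow> 'x) \<Rightarrow> 'g \<Rightarrow> ('x \<times> 'g) l2op" where
  "group_unitary G M \<phi> g = (\<lambda>c \<in> l2 (gms_measure G M).
     ae_class (gms_measure G M)
       (\<lambda>(x, h). rep c (\<phi> (inv\<^bsub>G\<^esub> g) x, inv\<^bsub>G\<^esub> g \<otimes>\<^bsub>G\<^esub> h)))"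

definition group_vN ::
  "('g, 'm) monoid_scheme \<Rightarrow> 'x measure \<Rightarrow> ('g \<Rightarrow> 'x \<Rightarrow> 'x) \<Rightarrow> ('x \<times> 'g) l2op set" where
  "group_vN G M \<phi> = vN_generated (gms_measure G M) (group_unitary G M \<phi> ` carrier G)"

definition crossed_product ::
  "('g, 'm) monoid_scheme \<Rightarrow> 'x measure \<Rightarrow> ('g \<Rightarrow> 'x \<Rightarrow> 'x) \<Rightarrow> ('x \<times> 'g) l2op set" where
  "crossed_product G M \<phi> =
     vN_generated (gms_measure G M) (Linf G M \<union> group_unitary G M \<phi> ` carrier G)"

end

theory Submission
  imports Defs
begin

text \<open>
  Write \<open>\<Theta>(u\<^sub>\<gamma>)u = uw\<^sub>\<gamma>\<close> with \<open>w\<^sub>\<gamma> \<in> L(\<Lambda>)\<close>, expand \<open>u = \<Sum>\<^sub>\<sigma> u\<^sub>\<sigma> v\<^sub>\<sigma>\<close> and let \<open>U(y) = (u\<^sub>\<sigma>(y))\<^sub>\<sigma> \<in> \<ell>\<^sup>2(\<Lambda>)\<close>.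
  Since \<open>\<Theta>(u\<^sub>\<gamma>)\<close> normalises \<open>L\<^sup>\<infinity>(Y)\<close> and the action is free, it is locally of the form \<open>a v\<^sub>\<sigma>\<close>, so
  \<open>U\<close> moves along \<open>\<Theta>(u\<^sub>\<gamma>)\<close> by a left translation and the right convolution by the coefficients of
  \<open>w\<^sub>\<gamma>\<close>, which preserves inner products.  Hence the functions \<open>F(y, z)(\<rho>) = \<langle>U(y), \<rho>U(z)\<rangle>\<close> transform under
  \<open>\<Theta>(u\<^sub>\<gamma>)\<close> by translations of \<open>\<rho>\<close> on both sides, and a normalised integral over \<open>y\<close> and \<open>z\<close> of the
  correlation \<open>\<Sum>\<^sub>\<rho> |F(y, z)(\<rho>)|\<^sup>2 |F(y, z)(\<rho>\<kappa>)|\<^sup>2\<close> is a summable conjugation invariant function of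
  \<open>\<kappa> \<in> \<Lambda>\<close>.  As \<open>\<Lambda>\<close> is icc (because \<open>L(\<Lambda>) \<cong> L(\<Gamma>)\<close> is a factor), it vanishes for \<open>\<kappa> \<noteq> 1\<close>, so \<open>F(y, z)\<close> is
  supported on at most one point.  It follows that \<open>U(y)\<close> is, up to a phase, a left translate of a fixed
  \<open>t \<in> \<ell>\<^sup>2(\<Lambda>)\<close> with orthonormal translates, i.e. \<open>u = x\<^sup>*T\<close> where \<open>T \<in> L(\<Lambda>)\<close> is the unitary of convolution
  by \<open>t\<close> and \<open>x\<close> normalises \<open>L\<^sup>\<infinity>(Y)\<close>.  Then \<open>x\<Theta>(u\<^sub>\<gamma>)x\<^sup>*\<close> lies in \<open>L(\<Lambda>)\<close> and normalises \<open>L\<^sup>\<infinity>(Y)\<close>, which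
  forces it to be a multiple of some \<open>v\<^sub>\<delta>\<^sub>(\<^sub>\<gamma>\<^sub>)\<close>.  The conjugacy is the point realisation of \<open>Ad(x) \<circ> \<Theta>\<close> on
  \<open>L\<^sup>\<infinity>(X)\<close>; it preserves the measure by ergodicity.
\<close>

section \<open>Square integrable functions\<close>

text \<open>The obstacle is twofold: \<open>\<Theta>\<close> of a group unitary is a group element
  only piecewise, with pieces varying from point to point, and the conjugated unitaries
  \<open>wg \<gamma>\<close> are unknown elements of the group algebra. Inner products of two rows
  of u eliminate \<open>wg \<gamma>\<close> but leave left translations depending on the points y
  and z. Summing the correlation over \<rho> absorbs the translation at y and turns the one at z
  into a conjugation of \<kappa>. The integral over y is then unaffected by the pieces, while at
  each z one may use whichever \<gamma> acts there by a prescribed \<mu>; hence two independent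
  points, and hence the covering property of the supports. The correlation is quartic in F because
  it has to detect two points in one support. Isometry of u controls only the integral of
  \<open>q\<close>, which is quadratic in F, so the quartic sums are divided by
  \<open>1 + q\<close>. On the operator side everything is reduced to kernels. Convolution series
  converge pointwise by Cauchy-Schwarz, but their partial sums need not converge in operator norm,
  so limits are repeatedly identified by Fatou's lemma.\<close>

definition L2 :: "'a measure \<Rightarrow> ('a \<Rightarrow> complex) set" where
  "L2 M = {f \<in> borel_measurable M. integrable M (\<lambda>x. (cmod (f x))\<^sup>2)}"

definition ip :: "'a measure \<Rightarrow> ('a \<Rightarrow> complex) \<Rightarrow> ('a \<Rightarrow> complex) \<Rightarrow> complex" where
  "ip M f g = (LINT x|M. f x * cnj (g x))"

definition sqn :: "'a measure \<Rightarrow> ('a \<Rightarrow> complex) \<Rightarrow> real" where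
  "sqn M f = (LINT x|M. (cmod (f x))\<^sup>2)"

lemma borel_measurable_cnj [measurable (raw)]:
  "f \<in> borel_measurable M \<Longrightarrow> (\<lambda>x. cnj (f x)) \<in> borel_measurable M"
  by (rule borel_measurable_continuous_on[of cnj]) (intro continuous_intros)

lemma L2_measurable [measurable_dest]: "f \<in> L2 M \<Longrightarrow> f \<in> borel_measurable M"
  by (simp add: L2_def)

lemma L2_integrable: "f \<in> L2 M \<Longrightarrow> integrable M (\<lambda>x. (cmod (f x))\<^sup>2)"
  by (simp add: L2_def)

lemma L2_iff_nn_integral:
  "f \<in> L2 M \<longleftrightarrow> f \<in> borel_measurable M \<and> (\<integral>\<^sup>+x. ennreal ((cmod (f x))\<^sup>2) \<partial>M) < \<infinity>"
  unfolding L2_def by (auto simp: integrable_iff_bounded)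

lemma nn_integral_eq_sqn:
  "f \<in> L2 M \<Longrightarrow> (\<integral>\<^sup>+x. ennreal ((cmod (f x))\<^sup>2) \<partial>M) = ennreal (sqn M f)"
  unfolding sqn_def by (rule nn_integral_eq_integral) (auto simp: L2_integrable)

lemma sqn_nonneg [simp]: "0 \<le> sqn M f"
  by (simp add: sqn_def)

lemma L2_bound:
  assumes "f \<in> borel_measurable M" "(\<integral>\<^sup>+x. ennreal ((cmod (f x))\<^sup>2) \<partial>M) \<le> ennreal K"
  shows "f \<in> L2 M" and "0 \<le> K \<Longrightarrow> sqn M f \<le> K"
proof -
  show f: "f \<in> L2 M"
    using assms by (auto simp: L2_iff_nn_integral intro: le_less_trans)
  show "sqn M f \<le> K" if "0 \<le> K"
    using assms(2) that by (simp add: nn_integral_eq_sqn[OF f])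
qed

lemma cmod_sq_add_le: "(cmod (a + b))\<^sup>2 \<le> 2 * (cmod a)\<^sup>2 + 2 * (cmod b)\<^sup>2"
proof -
  have "(cmod (a + b))\<^sup>2 \<le> (cmod a + cmod b)\<^sup>2"
    by (intro power_mono norm_triangle_ineq norm_ge_zero)
  also have "\<dots> \<le> 2 * (cmod a)\<^sup>2 + 2 * (cmod b)\<^sup>2"
    using sum_squares_bound[of "cmod a" "cmod b"] by (simp add: power2_sum)
  finally show ?thesis .
qed

lemma L2_add: assumes "f \<in> L2 M" "g \<in> L2 M" shows "(\<lambda>x. f x + g x) \<in> L2 M"
proof -
  have [measurable]: "f \<in> borel_measurable M" "g \<in> borel_measurable M"
    using assms by (auto simp: L2_def)
  have "integrable M (\<lambda>x. 2 * (cmod (f x))\<^sup>2 + 2 * (cmod (g x))\<^sup>2)"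
    using assms by (auto simp: L2_def)
  then have "integrable M (\<lambda>x. (cmod (f x + g x))\<^sup>2)"
    by (rule Bochner_Integration.integrable_bound)
      (auto intro!: AE_I2 order_trans[OF cmod_sq_add_le])
  then show ?thesis by (simp add: L2_def)
qed

lemma L2_bounded_mult:
  assumes "f \<in> L2 M" "a \<in> borel_measurable M" "AE x in M. cmod (a x) \<le> K"
  shows "(\<lambda>x. a x * f x) \<in> L2 M" "sqn M (\<lambda>x. a x * f x) \<le> K\<^sup>2 * sqn M f"
proof -
  have [measurable]: "f \<in> borel_measurable M" "a \<in> borel_measurable M"
    using assms by (auto simp: L2_def)
  have *: "AE x in M. (cmod (a x * f x))\<^sup>2 \<le> K\<^sup>2 * (cmod (f x))\<^sup>2"
    using assms(3) by eventually_elim (auto simp: norm_mult power_mult_distrib intro!: mult_right_mono power_mono)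
  have i: "integrable M (\<lambda>x. K\<^sup>2 * (cmod (f x))\<^sup>2)"
    using assms by (auto simp: L2_def)
  then have i': "integrable M (\<lambda>x. (cmod (a x * f x))\<^sup>2)"
    by (rule Bochner_Integration.integrable_bound) (use * in auto)
  then show "(\<lambda>x. a x * f x) \<in> L2 M" by (simp add: L2_def)
  show "sqn M (\<lambda>x. a x * f x) \<le> K\<^sup>2 * sqn M f"
    unfolding sqn_def using integral_mono_AE[OF i' i *] by simp
qed

lemma L2_scale: assumes "f \<in> L2 M" shows "(\<lambda>x. c * f x) \<in> L2 M"
  using L2_bounded_mult(1)[OF assms, of "\<lambda>_. c" "cmod c"] by simp

lemma L2_diff: "f \<in> L2 M \<Longrightarrow> g \<in> L2 M \<Longrightarrow> (\<lambda>x. f x - g x) \<in> L2 M"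
  using L2_add[of f M "\<lambda>x. (-1) * g x"] L2_scale[of g M "-1"] by simp

lemma L2_zero [simp]: "(\<lambda>x. 0) \<in> L2 M"
  by (simp add: L2_def)

lemma L2_cnj: "f \<in> L2 M \<Longrightarrow> (\<lambda>x. cnj (f x)) \<in> L2 M"
  by (auto simp: L2_def)

lemma L2_cong_AE:
  assumes "f \<in> L2 M" "g \<in> borel_measurable M" "AE x in M. f x = g x"
  shows "g \<in> L2 M" "sqn M g = sqn M f"
proof -
  have [measurable]: "f \<in> borel_measurable M" "g \<in> borel_measurable M"
    using assms by (auto simp: L2_def)
  have "integrable M (\<lambda>x. (cmod (f x))\<^sup>2) \<longleftrightarrow> integrable M (\<lambda>x. (cmod (g x))\<^sup>2)"
    by (rule integrable_cong_AE) (use assms(3) in auto)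
  then show "g \<in> L2 M" using assms by (simp add: L2_def)
  show "sqn M g = sqn M f" unfolding sqn_def
    by (rule integral_cong_AE) (use assms(3) in auto)
qed

section \<open>Inner products, completeness and the Riesz representation\<close>

lemma mult_le_sum_squares:
  fixes a b :: real
  assumes "0 \<le> a" "0 \<le> b" shows "a * b \<le> a\<^sup>2 + b\<^sup>2"
  using sum_squares_bound[of a b] mult_nonneg_nonneg[OF assms] by linarith

lemma ip_integrable:
  assumes "f \<in> L2 M" "g \<in> L2 M"
  shows "integrable M (\<lambda>x. f x * cnj (g x))"
proof -
  have [measurable]: "f \<in> borel_measurable M" "g \<in> borel_measurable M"
    using assms by (auto simp: L2_def)
  have "integrable M (\<lambda>x. (cmod (f x))\<^sup>2 + (cmod (g x))\<^sup>2)"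
    using assms by (auto simp: L2_def)
  then show ?thesis
  proof (rule Bochner_Integration.integrable_bound)
    show "AE x in M. norm (f x * cnj (g x)) \<le> norm ((cmod (f x))\<^sup>2 + (cmod (g x))\<^sup>2)"
    proof (rule AE_I2)
      fix x
      show "norm (f x * cnj (g x)) \<le> norm ((cmod (f x))\<^sup>2 + (cmod (g x))\<^sup>2)"
        using mult_le_sum_squares[of "cmod (f x)" "cmod (g x)"] by (simp add: norm_mult)
    qed
  qed auto
qed

lemma ip_integrable': "f \<in> L2 M \<Longrightarrow> g \<in> L2 M \<Longrightarrow> integrable M (\<lambda>x. f x * g x)"
  using ip_integrable[of f M "\<lambda>x. cnj (g x)"] by (simp add: L2_cnj)

lemma ip_self: "ip M f f = complex_of_real (sqn M f)"
proof -
  have "ip M f f = (LINT x|M. complex_of_real ((cmod (f x))\<^sup>2))"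
    unfolding ip_def by (simp only: complex_norm_square)
  also have "\<dots> = complex_of_real (sqn M f)"
    unfolding sqn_def by (rule integral_complex_of_real)
  finally show ?thesis .
qed

lemma ip_add_left: "\<lbrakk>f \<in> L2 M; g \<in> L2 M; h \<in> L2 M\<rbrakk> \<Longrightarrow> ip M (\<lambda>x. f x + g x) h = ip M f h + ip M g h"
  unfolding ip_def by (simp add: distrib_right ip_integrable)

lemma ip_add_right: "\<lbrakk>f \<in> L2 M; g \<in> L2 M; h \<in> L2 M\<rbrakk> \<Longrightarrow> ip M h (\<lambda>x. f x + g x) = ip M h f + ip M h g"
  unfolding ip_def by (simp add: distrib_left ip_integrable)

lemma ip_scale_left: "ip M (\<lambda>x. c * f x) h = c * ip M f h"
  unfolding ip_def by (simp add: mult.assoc)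

lemma ip_scale_right: "ip M h (\<lambda>x. c * f x) = cnj c * ip M h f"
  unfolding ip_def by (simp flip: integral_mult_right_zero) (simp add: ac_simps)

lemma ip_diff_left: "\<lbrakk>f \<in> L2 M; g \<in> L2 M; h \<in> L2 M\<rbrakk> \<Longrightarrow> ip M (\<lambda>x. f x - g x) h = ip M f h - ip M g h"
  unfolding ip_def by (simp add: left_diff_distrib ip_integrable)

lemma ip_diff_right: "\<lbrakk>f \<in> L2 M; g \<in> L2 M; h \<in> L2 M\<rbrakk> \<Longrightarrow> ip M h (\<lambda>x. f x - g x) = ip M h f - ip M h g"
  unfolding ip_def by (simp add: right_diff_distrib ip_integrable)

lemma ip_cnj: "ip M g f = cnj (ip M f g)"
  unfolding ip_def by (subst Bochner_Integration.integral_cnj[symmetric]) (simp add: mult.commute)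

lemma ip_cong_AE:
  assumes "AE x in M. f x = f' x" "AE x in M. g x = g' x"
    "f \<in> borel_measurable M" "f' \<in> borel_measurable M" "g \<in> borel_measurable M" "g' \<in> borel_measurable M"
  shows "ip M f g = ip M f' g'"
  unfolding ip_def by (rule integral_cong_AE) (use assms in auto)

lemma sqn_scale: "sqn M (\<lambda>x. c * f x) = (cmod c)\<^sup>2 * sqn M f"
  unfolding sqn_def by (simp add: norm_mult power_mult_distrib)

lemma sqn_add:
  assumes "f \<in> L2 M" "g \<in> L2 M"
  shows "sqn M (\<lambda>x. f x + g x) = sqn M f + sqn M g + 2 * Re (ip M f g)"
proof -
  have "complex_of_real (sqn M (\<lambda>x. f x + g x)) = ip M f f + ip M g f + (ip M f g + ip M g g)"
    using assms by (simp add: ip_self[symmetric] ip_add_left ip_add_right L2_add)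
  then have "sqn M (\<lambda>x. f x + g x) = Re (ip M f f + ip M g f + (ip M f g + ip M g g))"
    by (metis Re_complex_of_real)
  also have "\<dots> = sqn M f + sqn M g + 2 * Re (ip M f g)"
    by (subst (2) ip_cnj) (simp add: ip_self)
  finally show ?thesis .
qed

lemma sqn_diff:
  assumes "f \<in> L2 M" "g \<in> L2 M"
  shows "sqn M (\<lambda>x. f x - g x) = sqn M f + sqn M g - 2 * Re (ip M f g)"
  using sqn_add[OF assms(1) L2_scale[OF assms(2), of "-1"]] sqn_scale[of M "-1" g]
    ip_scale_right[of M f "-1" g] by simp

lemma sqn_eq_0_iff: "f \<in> L2 M \<Longrightarrow> sqn M f = 0 \<longleftrightarrow> (AE x in M. f x = 0)"
  unfolding sqn_def by (subst integral_nonneg_eq_0_iff_AE) (auto simp: L2_integrable)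

lemma Cauchy_Schwarz_ip:
  assumes "f \<in> L2 M" "g \<in> L2 M"
  shows "(cmod (ip M f g))\<^sup>2 \<le> sqn M f * sqn M g"
proof -
  have [measurable]: "f \<in> borel_measurable M" "g \<in> borel_measurable M"
    using assms by (auto simp: L2_def)
  have i: "integrable M (\<lambda>x. cmod (f x) * cmod (g x))"
    using integrable_norm[OF ip_integrable[OF assms]] by (simp add: norm_mult)
  have "cmod (ip M f g) \<le> (LINT x|M. cmod (f x) * cmod (g x))"
    unfolding ip_def by (rule order_trans[OF integral_norm_bound]) (simp add: norm_mult)
  then have "(cmod (ip M f g))\<^sup>2 \<le> (LINT x|M. cmod (f x) * cmod (g x))\<^sup>2"
    by (rule power_mono) simp
  moreover have "ennreal ((LINT x|M. cmod (f x) * cmod (g x))\<^sup>2) \<le> ennreal (sqn M f * sqn M g)"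
  proof -
    have "ennreal ((LINT x|M. cmod (f x) * cmod (g x))\<^sup>2) = (\<integral>\<^sup>+x. ennreal (cmod (f x)) * ennreal (cmod (g x)) \<partial>M)\<^sup>2"
      using nn_integral_eq_integral[OF i] by (simp add: ennreal_power ennreal_mult)
    also have "\<dots> \<le> (\<integral>\<^sup>+x. (ennreal (cmod (f x)))\<^sup>2 \<partial>M) * (\<integral>\<^sup>+x. (ennreal (cmod (g x)))\<^sup>2 \<partial>M)"
      by (rule Cauchy_Schwarz_nn_integral) auto
    also have "\<dots> = ennreal (sqn M f * sqn M g)"
      using nn_integral_eq_sqn[OF assms(1)] nn_integral_eq_sqn[OF assms(2)]
      by (simp add: ennreal_power ennreal_mult)
    finally show ?thesis .
  qed
  ultimately show ?thesis
    by (meson ennreal_le_iff mult_nonneg_nonneg order_trans sqn_nonneg)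
qed

lemma cmod_ip_le: "f \<in> L2 M \<Longrightarrow> g \<in> L2 M \<Longrightarrow> cmod (ip M f g) \<le> sqrt (sqn M f) * sqrt (sqn M g)"
  using Cauchy_Schwarz_ip[of f M g]
  by (metis real_le_rsqrt real_sqrt_mult)

lemma sqrt_sqn_triangle:
  assumes "f \<in> L2 M" "g \<in> L2 M"
  shows "sqrt (sqn M (\<lambda>x. f x + g x)) \<le> sqrt (sqn M f) + sqrt (sqn M g)"
proof (rule real_le_lsqrt)
  have "sqn M (\<lambda>x. f x + g x) \<le> sqn M f + sqn M g + 2 * (sqrt (sqn M f) * sqrt (sqn M g))"
    using sqn_add[OF assms] cmod_ip_le[OF assms] complex_Re_le_cmod[of "ip M f g"] by linarith
  then show "sqn M (\<lambda>x. f x + g x) \<le> (sqrt (sqn M f) + sqrt (sqn M g))\<^sup>2"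
    by (simp add: power2_sum)
qed auto

text \<open>The squared norms of the increments decay like 4^-n, so they remain summable after
  multiplication by 2^n. Finiteness of the weighted integral gives absolute convergence almost
  everywhere, and Fatou's lemma turns the pointwise limit into a limit in norm. This rate is the one
  that the minimising sequence in \<open>L2_Riesz\<close> delivers.\<close>

lemma L2_fast_Cauchy_limit:
  assumes f: "\<And>n. f n \<in> L2 M"
    and b: "\<And>n. sqn M (\<lambda>x. f (Suc n) x - f n x) \<le> C * (1/4) ^ n"
  shows "\<exists>g\<in>L2 M. (\<lambda>n. sqn M (\<lambda>x. f n x - g x)) \<longlonglongrightarrow> 0"
proof -
  note [measurable] = L2_measurable[OF f]
  have C: "0 \<le> C" using order_trans[OF sqn_nonneg b[of 0]] by simp
  define d where "d n x = f (Suc n) x - f n x" for n x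
  have d: "d n \<in> L2 M" for n unfolding d_def by (intro L2_diff f)
  note [measurable] = L2_measurable[OF d]
  have "(\<integral>\<^sup>+x. (\<Sum>n. ennreal (2 ^ n * (cmod (d n x))\<^sup>2)) \<partial>M) = (\<Sum>n. \<integral>\<^sup>+x. ennreal (2 ^ n * (cmod (d n x))\<^sup>2) \<partial>M)"
    by (rule nn_integral_suminf) auto
  also have "\<dots> \<le> (\<Sum>n. ennreal (C * (1/2) ^ n))"
  proof (rule suminf_le)
    fix n
    have "(\<integral>\<^sup>+x. ennreal (2 ^ n * (cmod (d n x))\<^sup>2) \<partial>M) = ennreal (2 ^ n) * ennreal (sqn M (d n))"
      by (simp add: ennreal_mult nn_integral_cmult nn_integral_eq_sqn[OF d])
    also have "\<dots> = ennreal (2 ^ n * sqn M (d n))" by (simp add: ennreal_mult)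
    also have "\<dots> \<le> ennreal (2 ^ n * (C * (1/4) ^ n))"
      using b[of n] by (intro ennreal_leI mult_left_mono) (auto simp: d_def[abs_def])
    also have "(2::real) ^ n * (C * (1/4) ^ n) = C * (1/2) ^ n"
      by (simp add: power_divide field_simps flip: power_mult_distrib)
    finally show "(\<integral>\<^sup>+x. ennreal (2 ^ n * (cmod (d n x))\<^sup>2) \<partial>M) \<le> ennreal (C * (1/2) ^ n)" .
  qed auto
  also have "\<dots> < \<infinity>"
  proof -
    have "summable (\<lambda>n. C * (1/2::real) ^ n)" by (intro summable_mult summable_geometric) auto
    then show ?thesis using C by (subst suminf_ennreal2) (auto)
  qed
  finally have "AE x in M. (\<Sum>n. ennreal (2 ^ n * (cmod (d n x))\<^sup>2)) \<noteq> \<infinity>"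
    by (intro nn_integral_noteq_infinite) auto
  then have conv: "AE x in M. convergent (\<lambda>n. f n x)"
  proof eventually_elim
    fix x assume "(\<Sum>n. ennreal (2 ^ n * (cmod (d n x))\<^sup>2)) \<noteq> \<infinity>"
    then have s1: "summable (\<lambda>n. 2 ^ n * (cmod (d n x))\<^sup>2)"
      by (intro summable_suminf_not_top) auto
    have s2: "summable (\<lambda>n. (1/2::real) ^ n)" by (intro summable_geometric) auto
    have "summable (\<lambda>n. 2 ^ n * (cmod (d n x))\<^sup>2 + (1/2::real) ^ n)"
      by (rule summable_add[OF s1 s2])
    then have "summable (\<lambda>n. d n x)"
    proof (rule summable_comparison_test')
      fix n :: nat assume "0 \<le> n"
      let ?a = "sqrt (2 ^ n) * cmod (d n x)" and ?b = "sqrt ((1/2) ^ n)"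
      \<comment> \<open>The weight is inserted and removed again: the squares of \<open>?a\<close>
        are summable by the weighted integral, those of \<open>?b\<close> by the geometric
        series.\<close>
      have "cmod (d n x) = ?a * ?b"
      proof -
        have "sqrt (2 ^ n) * sqrt ((1/2) ^ n) = 1"
          by (simp only: real_sqrt_mult[symmetric] power_mult_distrib[symmetric]) simp
        then show ?thesis by (metis mult.commute mult.left_commute mult_1_right)
      qed
      also have "?a * ?b \<le> ?a\<^sup>2 + ?b\<^sup>2" by (rule mult_le_sum_squares) auto
      also have "?a\<^sup>2 = 2 ^ n * (cmod (d n x))\<^sup>2"
        by (simp add: power_mult_distrib)
      also have "?b\<^sup>2 = (1/2) ^ n" by simp
      finally show "norm (d n x) \<le> 2 ^ n * (cmod (d n x))\<^sup>2 + (1/2::real) ^ n" .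
    qed
    then have "convergent (\<lambda>n. (\<Sum>i<n. d i x) + f 0 x)"
      by (intro convergent_add convergent_const) (simp add: summable_iff_convergent)
    moreover have "(\<Sum>i<n. d i x) + f 0 x = f n x" for n
      unfolding d_def by (subst sum_lessThan_telescope) simp
    ultimately show "convergent (\<lambda>n. f n x)" by simp
  qed
  define g where "g x = lim (\<lambda>n. f n x)" for x
  have [measurable]: "g \<in> borel_measurable M" unfolding g_def by measurable
  have lim: "AE x in M. (\<lambda>n. f n x) \<longlonglongrightarrow> g x"
    using conv by eventually_elim (simp add: g_def convergent_LIMSEQ_iff)
  \<comment> \<open>Telescoping and the triangle inequality. Summing the geometric series makes the
    bound uniform in \<open>k\<close>, as required for letting \<open>k\<close> tend to infinity
    under Fatou's lemma.\<close>
  have tail: "sqrt (sqn M (\<lambda>x. f (n + k) x - f n x)) \<le> sqrt C * (\<Sum>i<k. (1/2) ^ (n + i))" for n k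
  proof (induction k)
    case (Suc k)
    have "sqrt (sqn M (\<lambda>x. f (n + Suc k) x - f n x)) = sqrt (sqn M (\<lambda>x. d (n + k) x + (f (n + k) x - f n x)))"
      by (simp add: d_def)
    also have "\<dots> \<le> sqrt (sqn M (d (n + k))) + sqrt (sqn M (\<lambda>x. f (n + k) x - f n x))"
      by (intro sqrt_sqn_triangle d L2_diff f)
    also have "sqrt (sqn M (d (n + k))) \<le> sqrt (C * (1/4) ^ (n + k))"
      using b[of "n + k"] by (auto simp: d_def[abs_def])
    also have "\<dots> = sqrt C * (1/2) ^ (n + k)"
      by (simp add: real_sqrt_mult real_sqrt_power real_sqrt_divide)
    finally show ?case using Suc by (simp add: algebra_simps)
  qed (simp add: sqn_def)
  have tail': "sqn M (\<lambda>x. f (n + k) x - f n x) \<le> C * 4 * (1/4) ^ n" for n k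
  proof -
    have "(\<Sum>i<k. (1/2::real) ^ (n + i)) = (1/2) ^ n * (\<Sum>i<k. (1/2) ^ i)"
      by (simp add: power_add sum_distrib_left)
    also have "(\<Sum>i<k. (1/2::real) ^ i) \<le> 2"
      by (simp add: sum_gp_strict)
    finally have "(\<Sum>i<k. (1/2::real) ^ (n + i)) \<le> 2 * (1/2) ^ n" by simp
    then have "sqrt (sqn M (\<lambda>x. f (n + k) x - f n x)) \<le> sqrt C * (2 * (1/2) ^ n)"
      using tail[of n k] C by (meson mult_left_mono order_trans real_sqrt_ge_0_iff)
    then have "(sqrt (sqn M (\<lambda>x. f (n + k) x - f n x)))\<^sup>2 \<le> (sqrt C * (2 * (1/2) ^ n))\<^sup>2"
      by (rule power_mono) simp
    also have "\<dots> = C * 4 * (1/4) ^ n"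
    proof -
      have "((1/2::real) ^ n)\<^sup>2 = (1/4) ^ n"
        by (simp only: power2_eq_square power_mult_distrib[symmetric]) simp
      then show ?thesis using C by (simp only: power_mult_distrib) simp
    qed
    finally show ?thesis by simp
  qed
  have fatou: "(\<integral>\<^sup>+x. ennreal ((cmod (f n x - g x))\<^sup>2) \<partial>M) \<le> ennreal (C * 4 * (1/4) ^ n)" for n
  proof -
    have "(\<integral>\<^sup>+x. ennreal ((cmod (f n x - g x))\<^sup>2) \<partial>M)
        = (\<integral>\<^sup>+x. liminf (\<lambda>k. ennreal ((cmod (f (n + k) x - f n x))\<^sup>2)) \<partial>M)"
    proof (rule nn_integral_cong_AE, use lim in eventually_elim)
      fix x assume l: "(\<lambda>n. f n x) \<longlonglongrightarrow> g x"
      have "(\<lambda>k. f (n + k) x) \<longlonglongrightarrow> g x" using LIMSEQ_ignore_initial_segment[OF l, of n] by (simp add: add.commute)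
      then have "(\<lambda>k. ennreal ((cmod (f (n + k) x - f n x))\<^sup>2)) \<longlonglongrightarrow> ennreal ((cmod (g x - f n x))\<^sup>2)"
        by (intro tendsto_intros)
      then show "ennreal ((cmod (f n x - g x))\<^sup>2) = liminf (\<lambda>k. ennreal ((cmod (f (n + k) x - f n x))\<^sup>2))"
        by (metis lim_imp_Liminf norm_minus_commute trivial_limit_sequentially)
    qed
    also have "\<dots> \<le> liminf (\<lambda>k. \<integral>\<^sup>+x. ennreal ((cmod (f (n + k) x - f n x))\<^sup>2) \<partial>M)"
      by (rule nn_integral_liminf) auto
    also have "\<dots> \<le> liminf (\<lambda>k::nat. ennreal (C * 4 * (1/4) ^ n))"
      by (intro Liminf_mono always_eventually allI)
        (subst nn_integral_eq_sqn, auto intro!: L2_diff f ennreal_leI tail')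
    finally show ?thesis by (simp add: Liminf_const)
  qed
  have "(\<lambda>x. f 0 x - (f 0 x - g x)) \<in> L2 M"
    by (intro L2_diff f L2_bound(1)[OF _ fatou[of 0]]) measurable
  then have g: "g \<in> L2 M" by simp
  have "(\<lambda>n. sqn M (\<lambda>x. f n x - g x)) \<longlonglongrightarrow> 0"
  proof (rule tendsto_sandwich[of "\<lambda>_. 0" _ _ "\<lambda>n. C * 4 * (1/4) ^ n"])
    show "\<forall>\<^sub>F n in sequentially. sqn M (\<lambda>x. f n x - g x) \<le> C * 4 * (1/4) ^ n"
      by (intro always_eventually allI L2_bound(2)[OF _ fatou]) (use C in \<open>auto\<close>)
    show "(\<lambda>n. C * 4 * (1/4) ^ n) \<longlonglongrightarrow> 0"
      by (rule tendsto_mult_right_zero) (rule LIMSEQ_power_zero, simp)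
  qed auto
  with g show ?thesis by blast
qed

text \<open>A variational argument: \<open>J\<close> is bounded below, and the real first variation
  of \<open>J\<close> at a minimiser \<open>g\<close> in direction \<open>h\<close> is twice the
  real part of \<open>ip M h g - l h\<close>. If that difference were nonzero, a small move in a
  suitably rotated direction would push \<open>J\<close> below its infimum.\<close>

lemma L2_Riesz:
  fixes l :: "('a \<Rightarrow> complex) \<Rightarrow> complex"
  assumes add: "\<And>f g. f \<in> L2 M \<Longrightarrow> g \<in> L2 M \<Longrightarrow> l (\<lambda>x. f x + g x) = l f + l g"
    and scale: "\<And>c f. f \<in> L2 M \<Longrightarrow> l (\<lambda>x. c * f x) = c * l f"
    and bnd: "\<And>f. f \<in> L2 M \<Longrightarrow> cmod (l f) \<le> K * sqrt (sqn M f)"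
  shows "\<exists>g\<in>L2 M. \<forall>f\<in>L2 M. l f = ip M f g"
proof -
  define J where "J f = sqn M f - 2 * Re (l f)" for f
  have K0: "cmod (l f) \<le> \<bar>K\<bar> * sqrt (sqn M f)" if "f \<in> L2 M" for f
    using bnd[OF that] by (meson abs_ge_self mult_right_mono order_trans real_sqrt_ge_0_iff sqn_nonneg)
  have Jlow: "- \<bar>K\<bar>\<^sup>2 \<le> J f" if "f \<in> L2 M" for f
  proof -
    let ?s = "sqrt (sqn M f)"
    have "0 \<le> (?s - \<bar>K\<bar>)\<^sup>2" by simp
    then have "2 * (\<bar>K\<bar> * ?s) \<le> sqn M f + \<bar>K\<bar>\<^sup>2" by (simp add: power2_diff ac_simps)
    then show ?thesis using K0[OF that] complex_Re_le_cmod[of "l f"] unfolding J_def by linarith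
  qed
  define m where "m = (INF f\<in>L2 M. J f)"
  have bdd: "bdd_below (J ` L2 M)" using Jlow by (auto intro!: bdd_belowI2)
  have mle: "m \<le> J f" if "f \<in> L2 M" for f
    unfolding m_def by (rule cINF_lower[OF bdd that])
  \<comment> \<open>The excess 4^-n over the infimum is dictated by the rate in
    \<open>L2_fast_Cauchy_limit\<close>.\<close>
  have "\<exists>f\<in>L2 M. J f < m + (1/4) ^ n" for n :: nat
  proof -
    have "m < m + (1/4) ^ n" by simp
    then show ?thesis
      using cINF_less_iff[OF _ bdd, of "m + (1/4) ^ n"] L2_zero unfolding m_def by blast
  qed
  then obtain f where f: "\<And>n. f n \<in> L2 M" and Jf: "\<And>n. J (f n) < m + (1/4) ^ n" by metis
  have lin2: "l (\<lambda>x. (1/2) * (h x + k x)) = (1/2) * (l h + l k)" if "h \<in> L2 M" "k \<in> L2 M" for h k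
    by (simp only: scale[OF L2_add[OF that]] add[OF that])
  \<comment> \<open>In the parallelogram law for \<open>J\<close> the linear part cancels, so
    near-minimisers are close to each other.\<close>
  have para: "sqn M (\<lambda>x. h x - k x) = 2 * J h + 2 * J k - 4 * J (\<lambda>x. (1/2) * (h x + k x))"
    if "h \<in> L2 M" "k \<in> L2 M" for h k
    using that unfolding J_def lin2[OF that] sqn_scale
    by (simp add: sqn_add sqn_diff power_divide field_simps)
  have diff: "sqn M (\<lambda>x. f (Suc n) x - f n x) \<le> 4 * (1/4) ^ n" for n
  proof -
    have "m \<le> J (\<lambda>x. (1/2) * (f (Suc n) x + f n x))"
      by (intro mle L2_scale L2_add f)
    then have "sqn M (\<lambda>x. f (Suc n) x - f n x) \<le> 2 * (1/4) ^ Suc n + 2 * (1/4) ^ n"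
      using Jf[of n] Jf[of "Suc n"] para[OF f[of "Suc n"] f[of n]] by linarith
    also have "\<dots> \<le> 4 * (1/4) ^ n" by simp
    finally show ?thesis .
  qed
  obtain g where g: "g \<in> L2 M" and lim: "(\<lambda>n. sqn M (\<lambda>x. f n x - g x)) \<longlonglongrightarrow> 0"
    using L2_fast_Cauchy_limit[OF f diff] by blast
  have J_add: "J (\<lambda>x. h x + k x) = J h + sqn M k + 2 * Re (ip M h k) - 2 * Re (l k)"
    if "h \<in> L2 M" "k \<in> L2 M" for h k
    using that unfolding J_def by (simp add: sqn_add add)
  have Jg: "J g \<le> m"
  proof (rule LIMSEQ_le_const)
    let ?d = "\<lambda>n x. f n x - g x"
    let ?s = "\<lambda>n. sqrt (sqn M (?d n))"
    have s0: "?s \<longlonglongrightarrow> 0" using tendsto_real_sqrt[OF lim] by simp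
    show "(\<lambda>n. m + (1/4) ^ n + 2 * (sqrt (sqn M g) * ?s n) + 2 * (\<bar>K\<bar> * ?s n)) \<longlonglongrightarrow> m"
    proof -
      have "(\<lambda>n. (1/4::real) ^ n) \<longlonglongrightarrow> 0" by (rule LIMSEQ_power_zero) simp
      then have "(\<lambda>n. m + (1/4) ^ n + 2 * (sqrt (sqn M g) * ?s n) + 2 * (\<bar>K\<bar> * ?s n)) \<longlonglongrightarrow> m + 0 + 2 * (sqrt (sqn M g) * 0) + 2 * (\<bar>K\<bar> * 0)"
        using s0 by (intro tendsto_add tendsto_mult tendsto_const)
      then show ?thesis by simp
    qed
    have "J g \<le> m + (1/4) ^ n + 2 * (sqrt (sqn M g) * ?s n) + 2 * (\<bar>K\<bar> * ?s n)" for n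
    proof -
      have d: "?d n \<in> L2 M" by (intro L2_diff f g)
      have "J (\<lambda>x. g x + ?d n x) = J (f n)" by simp
      then have "J (f n) = J g + sqn M (?d n) + 2 * Re (ip M g (?d n)) - 2 * Re (l (?d n))"
        using J_add[OF g d] by simp
      moreover have "- Re (ip M g (?d n)) \<le> sqrt (sqn M g) * ?s n"
        using cmod_ip_le[OF g d] abs_Re_le_cmod[of "ip M g (?d n)"] by linarith
      moreover have "Re (l (?d n)) \<le> \<bar>K\<bar> * ?s n"
        using K0[OF d] complex_Re_le_cmod[of "l (?d n)"] by linarith
      ultimately show ?thesis using Jf[of n] sqn_nonneg[of M "?d n"] by linarith
    qed
    then show "\<exists>N. \<forall>n\<ge>N. J g \<le> m + (1/4) ^ n + 2 * (sqrt (sqn M g) * ?s n) + 2 * (\<bar>K\<bar> * ?s n)" by blast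
  qed
  have "l h = ip M h g" if h: "h \<in> L2 M" for h
  proof (rule ccontr)
    assume ne: "l h \<noteq> ip M h g"
    define w where "w = l h - ip M h g"
    have *: "0 \<le> s\<^sup>2 * (cmod w)\<^sup>2 * sqn M h - 2 * s * (cmod w)\<^sup>2" for s :: real
    proof -
      \<comment> \<open>The factor \<open>cnj w\<close> rotates the direction so that the
        first-order change of \<open>J\<close> is the negative real number -2 s |w|^2.\<close>
      define c where "c = complex_of_real s * cnj w"
      have c: "(\<lambda>x. c * h x) \<in> L2 M" by (rule L2_scale[OF h])
      have "J g \<le> J (\<lambda>x. g x + c * h x)" using Jg mle[OF L2_add[OF g c]] by linarith
      then have "0 \<le> sqn M (\<lambda>x. c * h x) + 2 * Re (ip M g (\<lambda>x. c * h x)) - 2 * Re (l (\<lambda>x. c * h x))"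
        using J_add[OF g c] by linarith
      also have "Re (ip M g (\<lambda>x. c * h x)) = Re (c * ip M h g)"
        by (subst ip_cnj) (simp add: ip_scale_left)
      also have "l (\<lambda>x. c * h x) = c * l h" by (rule scale[OF h])
      also have "sqn M (\<lambda>x. c * h x) = s\<^sup>2 * (cmod w)\<^sup>2 * sqn M h"
        by (simp add: sqn_scale c_def norm_mult power_mult_distrib)
      also have "s\<^sup>2 * (cmod w)\<^sup>2 * sqn M h + 2 * Re (c * ip M h g) - 2 * Re (c * l h)
         = s\<^sup>2 * (cmod w)\<^sup>2 * sqn M h - 2 * Re (c * w)" by (simp add: w_def algebra_simps)
      also have "Re (c * w) = s * (cmod w)\<^sup>2"
        unfolding c_def cmod_power2 by (simp add: power2_eq_square algebra_simps)
      finally show ?thesis by simp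
    qed
    have w: "0 < (cmod w)\<^sup>2" using ne by (simp add: w_def)
    \<comment> \<open>This makes the quadratic term at most half of the linear one; the summand 1
      covers the case of a null \<open>h\<close>.\<close>
    define s where "s = 1 / (sqn M h + 1)"
    have sp: "0 < s" unfolding s_def using sqn_nonneg[of M h] by (simp add: add_nonneg_pos)
    have "s * sqn M h \<le> 1" unfolding s_def using sqn_nonneg[of M h] by (simp add: divide_le_eq add_nonneg_pos)
    then have "(s * (cmod w)\<^sup>2) * (s * sqn M h) \<le> (s * (cmod w)\<^sup>2) * 1"
      by (intro mult_left_mono) (use sp in auto)
    moreover have "0 < s * (cmod w)\<^sup>2" using sp w by simp
    ultimately show False using *[of s] by (simp add: power2_eq_square ac_simps)
  qed
  with g show ?thesis by blast
qed

section \<open>Bounded operators and commutants\<close>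

lemma ae_class_cong: "AE x in M. f x = g x \<Longrightarrow> ae_class M f = ae_class M g"
  unfolding ae_class_def by (intro Collect_cong conj_cong refl) (auto elim: eventually_elim2)

lemma mem_ae_class: "f \<in> borel_measurable M \<Longrightarrow> f \<in> ae_class M f"
  by (simp add: ae_class_def)

lemma rep_ae_class:
  assumes "f \<in> borel_measurable M"
  shows "rep (ae_class M f) \<in> borel_measurable M" "AE x in M. rep (ae_class M f) x = f x"
proof -
  have "rep (ae_class M f) \<in> ae_class M f"
    unfolding rep_def by (rule someI[of _ f]) (rule mem_ae_class[OF assms])
  then show "rep (ae_class M f) \<in> borel_measurable M" "AE x in M. rep (ae_class M f) x = f x"
    by (auto simp: ae_class_def)
qed

lemma ae_class_eqD: "ae_class M f = ae_class M g \<Longrightarrow> f \<in> borel_measurable M \<Longrightarrow> AE x in M. f x = g x"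
  using mem_ae_class[of f M] by (auto simp: ae_class_def)

lemma ae_class_l2 [intro, simp]: "f \<in> L2 M \<Longrightarrow> ae_class M f \<in> l2 M"
  by (auto simp: l2_def L2_def)

lemma rep_ae_class_L2 [intro, simp]: "f \<in> L2 M \<Longrightarrow> rep (ae_class M f) \<in> L2 M"
  using L2_cong_AE(1)[of f M "rep (ae_class M f)"] rep_ae_class[of f M] by (simp add: L2_measurable eq_commute)

lemma l2_cases:
  assumes "c \<in> l2 M" obtains f where "f \<in> L2 M" "c = ae_class M f"
  using assms by (auto simp: l2_def L2_def)

lemma rep_L2 [intro, simp]: "c \<in> l2 M \<Longrightarrow> rep c \<in> L2 M"
  by (elim l2_cases) simp

lemma ae_class_rep [simp]: assumes "c \<in> l2 M" shows "ae_class M (rep c) = c"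
  using assms
proof (rule l2_cases)
  fix f assume "f \<in> L2 M" "c = ae_class M f"
  then show ?thesis using rep_ae_class(2)[of f M] by (auto intro!: ae_class_cong simp: L2_def)
qed

lemma l2_add_ae_class: "f \<in> L2 M \<Longrightarrow> g \<in> L2 M \<Longrightarrow>
  l2_add M (ae_class M f) (ae_class M g) = ae_class M (\<lambda>x. f x + g x)"
  unfolding l2_add_def
  using rep_ae_class(2)[of f M] rep_ae_class(2)[of g M]
  by (intro ae_class_cong) (auto simp: L2_def elim: eventually_elim2)

lemma l2_scale_ae_class: "f \<in> L2 M \<Longrightarrow> l2_scale M z (ae_class M f) = ae_class M (\<lambda>x. z * f x)"
  unfolding l2_scale_def
  using rep_ae_class(2)[of f M] by (intro ae_class_cong) (auto simp: L2_def)

lemma l2_inner_ae_class: "f \<in> L2 M \<Longrightarrow> g \<in> L2 M \<Longrightarrow> l2_inner M (ae_class M f) (ae_class M g) = ip M f g"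
  using ip_cong_AE[OF rep_ae_class(2) rep_ae_class(2), of f M g] rep_ae_class(1)[of f M] rep_ae_class(1)[of g M]
  unfolding l2_inner_def ip_def by (auto simp: L2_def)

lemma l2_norm_ae_class: "f \<in> L2 M \<Longrightarrow> l2_norm M (ae_class M f) = sqrt (sqn M f)"
  using L2_cong_AE(2)[of f M "rep (ae_class M f)"] rep_ae_class[of f M]
  unfolding l2_norm_def sqn_def by (simp add: L2_measurable eq_commute)

lemma l2_norm_eq: "c \<in> l2 M \<Longrightarrow> l2_norm M c = sqrt (sqn M (rep c))"
  by (simp add: l2_norm_def sqn_def)

lemma l2_inner_eq: "l2_inner M c d = ip M (rep c) (rep d)"
  by (simp add: l2_inner_def ip_def)

lemma l2_add_closed [intro, simp]: "c \<in> l2 M \<Longrightarrow> d \<in> l2 M \<Longrightarrow> l2_add M c d \<in> l2 M"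
  unfolding l2_add_def by (intro ae_class_l2 L2_add rep_L2)

lemma l2_scale_closed [intro, simp]: "c \<in> l2 M \<Longrightarrow> l2_scale M z c \<in> l2 M"
  unfolding l2_scale_def by (intro ae_class_l2 L2_scale rep_L2)

lemma l2_eqI:
  assumes "c \<in> l2 M" "d \<in> l2 M" "\<And>e. e \<in> l2 M \<Longrightarrow> l2_inner M e c = l2_inner M e d"
  shows "c = d"
proof -
  let ?h = "\<lambda>x. rep c x - rep d x"
  have h: "?h \<in> L2 M" using assms by (intro L2_diff rep_L2)
  have "ip M ?h ?h = l2_inner M (ae_class M ?h) c - l2_inner M (ae_class M ?h) d"
    using l2_inner_ae_class[OF h rep_L2[OF assms(1)]] l2_inner_ae_class[OF h rep_L2[OF assms(2)]] assms h
    by (simp add: ip_diff_right)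
  also have "\<dots> = 0" using assms(3)[OF ae_class_l2[OF h]] by simp
  finally have "sqn M ?h = 0" by (simp add: ip_self)
  then have "AE x in M. rep c x = rep d x" using sqn_eq_0_iff[OF h] by simp
  then have "ae_class M (rep c) = ae_class M (rep d)" by (rule ae_class_cong)
  then show ?thesis using assms by simp
qed

section \<open>Bounded operators and their adjoints\<close>

lemma bounded_ops_l2 [intro, simp]: "T \<in> bounded_ops M \<Longrightarrow> c \<in> l2 M \<Longrightarrow> T c \<in> l2 M"
  by (auto simp: bounded_ops_def)

lemma bounded_ops_add: "T \<in> bounded_ops M \<Longrightarrow> c \<in> l2 M \<Longrightarrow> d \<in> l2 M \<Longrightarrow> T (l2_add M c d) = l2_add M (T c) (T d)"
  by (auto simp: bounded_ops_def)

lemma bounded_ops_scale: "T \<in> bounded_ops M \<Longrightarrow> c \<in> l2 M \<Longrightarrow> T (l2_scale M z c) = l2_scale M z (T c)"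
  by (auto simp: bounded_ops_def)

lemma bounded_ops_bound:
  assumes "T \<in> bounded_ops M"
  obtains K where "0 \<le> K" "\<And>c. c \<in> l2 M \<Longrightarrow> l2_norm M (T c) \<le> K * l2_norm M c"
proof -
  obtain K where K: "\<And>c. c \<in> l2 M \<Longrightarrow> l2_norm M (T c) \<le> K * l2_norm M c"
    using assms unfolding bounded_ops_def by blast
  have "l2_norm M (T c) \<le> \<bar>K\<bar> * l2_norm M c" if "c \<in> l2 M" for c
  proof -
    have "0 \<le> l2_norm M c" by (simp add: l2_norm_eq[OF that])
    then have "K * l2_norm M c \<le> \<bar>K\<bar> * l2_norm M c" by (intro mult_right_mono) auto
    then show ?thesis using K[OF that] by linarith
  qed
  then show ?thesis using that[of "\<bar>K\<bar>"] by simp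
qed

lemma bounded_ops_eqI:
  assumes "S \<in> bounded_ops M" "T \<in> bounded_ops M" "\<And>c. c \<in> l2 M \<Longrightarrow> S c = T c"
  shows "S = T"
  using assms by (intro PiE_ext[of S _ _ T]) (auto simp: bounded_ops_def)

lemma bounded_opsI:
  assumes "T \<in> extensional (l2 M)" "\<And>c. c \<in> l2 M \<Longrightarrow> T c \<in> l2 M"
    "\<And>c d. c \<in> l2 M \<Longrightarrow> d \<in> l2 M \<Longrightarrow> T (l2_add M c d) = l2_add M (T c) (T d)"
    "\<And>z c. c \<in> l2 M \<Longrightarrow> T (l2_scale M z c) = l2_scale M z (T c)"
    "\<And>c. c \<in> l2 M \<Longrightarrow> l2_norm M (T c) \<le> K * l2_norm M c"
  shows "T \<in> bounded_ops M"
  using assms unfolding bounded_ops_def by (auto simp: PiE_def intro!: exI[of _ K])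

text \<open>All concrete operators below (multiplications, translations, averages, convolutions)
  come from a map on representatives that respects almost everywhere equality. Boundedness and
  linearity are then checked on functions rather than on classes.\<close>

definition fun_op :: "'a measure \<Rightarrow> (('a \<Rightarrow> complex) \<Rightarrow> 'a \<Rightarrow> complex) \<Rightarrow> 'a l2op" where
  "fun_op M F = (\<lambda>c \<in> l2 M. ae_class M (F (rep c)))"

lemma fun_op_apply:
  assumes "\<And>f g. f \<in> L2 M \<Longrightarrow> g \<in> L2 M \<Longrightarrow> AE x in M. f x = g x \<Longrightarrow> AE x in M. F f x = F g x"
    and "f \<in> L2 M"
  shows "fun_op M F (ae_class M f) = ae_class M (F f)"
proof -
  have "AE x in M. F (rep (ae_class M f)) x = F f x"
    by (rule assms(1)) (use assms(2) rep_ae_class(2)[of f M] in \<open>auto simp: L2_measurable\<close>)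
  then show ?thesis using assms(2) unfolding fun_op_def by (auto intro!: ae_class_cong)
qed

lemma fun_op_bounded:
  assumes cong: "\<And>f g. f \<in> L2 M \<Longrightarrow> g \<in> L2 M \<Longrightarrow> AE x in M. f x = g x \<Longrightarrow> AE x in M. F f x = F g x"
    and L2: "\<And>f. f \<in> L2 M \<Longrightarrow> F f \<in> L2 M"
    and add: "\<And>f g. f \<in> L2 M \<Longrightarrow> g \<in> L2 M \<Longrightarrow> AE x in M. F (\<lambda>x. f x + g x) x = F f x + F g x"
    and scale: "\<And>z f. f \<in> L2 M \<Longrightarrow> AE x in M. F (\<lambda>x. z * f x) x = z * F f x"
    and bound: "\<And>f. f \<in> L2 M \<Longrightarrow> sqn M (F f) \<le> K\<^sup>2 * sqn M f"
  shows "fun_op M F \<in> bounded_ops M"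
proof (rule bounded_opsI[where K="\<bar>K\<bar>"])
  note ap = fun_op_apply[of M F, OF cong]
  show "fun_op M F \<in> extensional (l2 M)" by (simp add: fun_op_def)
  fix c assume "c \<in> l2 M"
  then obtain f where f: "f \<in> L2 M" "c = ae_class M f" by (rule l2_cases)
  show "fun_op M F c \<in> l2 M" using f by (simp add: ap L2)
  show "fun_op M F (l2_scale M z c) = l2_scale M z (fun_op M F c)" for z
    using f by (simp add: ap L2 L2_scale l2_scale_ae_class) (intro ae_class_cong scale f)
  have "l2_norm M (fun_op M F c) = sqrt (sqn M (F f))" using f by (simp add: ap L2 l2_norm_ae_class)
  also have "\<dots> \<le> sqrt (K\<^sup>2 * sqn M f)" using bound[OF f(1)] by simp
  finally show "l2_norm M (fun_op M F c) \<le> \<bar>K\<bar> * l2_norm M c"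
    using f by (simp add: l2_norm_ae_class real_sqrt_mult)
  fix d assume "d \<in> l2 M"
  then obtain g where g: "g \<in> L2 M" "d = ae_class M g" by (rule l2_cases)
  show "fun_op M F (l2_add M c d) = l2_add M (fun_op M F c) (fun_op M F d)"
    using f g by (simp add: ap L2 L2_add l2_add_ae_class) (intro ae_class_cong add f g)
qed

text \<open>\<open>op_adj\<close> is a definite description, so every fact about adjoints depends on
  existence. For a fixed vector \<open>h\<close>, Riesz is applied to the functional sending
  \<open>f\<close> to the inner product of \<open>T f\<close> with \<open>h\<close>; linearity of
  the resulting assignment follows from uniqueness of representing vectors.\<close>

lemma ex_adjoint:
  assumes T: "T \<in> bounded_ops M"
  shows "\<exists>S \<in> bounded_ops M. \<forall>c\<in>l2 M. \<forall>d\<in>l2 M. l2_inner M (T c) d = l2_inner M c (S d)"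
proof -
  obtain K where K: "0 \<le> K" "\<And>c. c \<in> l2 M \<Longrightarrow> l2_norm M (T c) \<le> K * l2_norm M c"
    by (rule bounded_ops_bound[OF T]) blast
  have "\<exists>g\<in>L2 M. \<forall>f\<in>L2 M. l2_inner M (T (ae_class M f)) (ae_class M h) = ip M f g" if h: "h \<in> L2 M" for h
  proof (rule L2_Riesz)
    fix f g assume f: "f \<in> L2 M" and g: "g \<in> L2 M"
    have "T (ae_class M (\<lambda>x. f x + g x)) = l2_add M (T (ae_class M f)) (T (ae_class M g))"
      using f g T by (simp add: l2_add_ae_class[symmetric] bounded_ops_add)
    also have "\<dots> = ae_class M (\<lambda>x. rep (T (ae_class M f)) x + rep (T (ae_class M g)) x)"
      by (simp add: l2_add_def)
    finally have "l2_inner M (T (ae_class M (\<lambda>x. f x + g x))) (ae_class M h)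
       = ip M (\<lambda>x. rep (T (ae_class M f)) x + rep (T (ae_class M g)) x) h"
      using f g T h by (simp add: l2_inner_ae_class L2_add)
    also have "\<dots> = ip M (rep (T (ae_class M f))) h + ip M (rep (T (ae_class M g))) h"
      using f g T h by (simp add: ip_add_left)
    also have "\<dots> = l2_inner M (T (ae_class M f)) (ae_class M h) + l2_inner M (T (ae_class M g)) (ae_class M h)"
      using l2_inner_ae_class[of "rep (T (ae_class M f))" M h] l2_inner_ae_class[of "rep (T (ae_class M g))" M h]
        f g T h by simp
    finally show "l2_inner M (T (ae_class M (\<lambda>x. f x + g x))) (ae_class M h) = \<dots>" .
  next
    fix z f assume f: "f \<in> L2 M"
    have "T (ae_class M (\<lambda>x. z * f x)) = ae_class M (\<lambda>x. z * rep (T (ae_class M f)) x)"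
      unfolding l2_scale_ae_class[OF f, symmetric] bounded_ops_scale[OF T ae_class_l2[OF f]]
      by (simp add: l2_scale_def)
    then have "l2_inner M (T (ae_class M (\<lambda>x. z * f x))) (ae_class M h) = z * ip M (rep (T (ae_class M f))) h"
      using f T h by (simp add: l2_inner_ae_class L2_scale ip_scale_left)
    then show "l2_inner M (T (ae_class M (\<lambda>x. z * f x))) (ae_class M h) = z * l2_inner M (T (ae_class M f)) (ae_class M h)"
      using l2_inner_ae_class[of "rep (T (ae_class M f))" M h] f T h by simp
  next
    fix f assume f: "f \<in> L2 M"
    have "cmod (l2_inner M (T (ae_class M f)) (ae_class M h)) = cmod (ip M (rep (T (ae_class M f))) h)"
      using l2_inner_ae_class[of "rep (T (ae_class M f))" M h] f T h by simp
    also have "\<dots> \<le> sqrt (sqn M (rep (T (ae_class M f)))) * sqrt (sqn M h)"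
      using f T h by (intro cmod_ip_le) auto
    also have "\<dots> \<le> (K * sqrt (sqn M f)) * sqrt (sqn M h)"
      using K(2)[of "ae_class M f"] f T by (intro mult_right_mono) (auto simp: l2_norm_ae_class[OF f] l2_norm_eq[of "T _"])
    finally show "cmod (l2_inner M (T (ae_class M f)) (ae_class M h)) \<le> (K * sqrt (sqn M h)) * sqrt (sqn M f)"
      by (simp add: ac_simps)
  qed
  then obtain A where A: "\<And>h. h \<in> L2 M \<Longrightarrow> A h \<in> L2 M"
    and A': "\<And>f h. h \<in> L2 M \<Longrightarrow> f \<in> L2 M \<Longrightarrow> l2_inner M (T (ae_class M f)) (ae_class M h) = ip M f (A h)"
    by metis
  define S where "S = (\<lambda>c\<in>l2 M. ae_class M (A (rep c)))"
  have Sl2: "S c \<in> l2 M" if "c \<in> l2 M" for c using that by (simp add: S_def A)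
  have S: "l2_inner M (T c) d = l2_inner M c (S d)" if "c \<in> l2 M" "d \<in> l2 M" for c d
    using that A'[of "rep d" "rep c"] l2_inner_ae_class[of "rep c" M "A (rep d)"] by (simp add: S_def A)
  have "S \<in> bounded_ops M"
  proof (rule bounded_opsI[where K=K])
    show "S \<in> extensional (l2 M)" by (simp add: S_def)
    show "S c \<in> l2 M" if "c \<in> l2 M" for c by (rule Sl2[OF that])
    have add: "l2_inner M e (l2_add M c d) = l2_inner M e c + l2_inner M e d" if "c \<in> l2 M" "d \<in> l2 M" "e \<in> l2 M" for c d e
      using that l2_inner_ae_class[of "rep e" M "\<lambda>x. rep c x + rep d x"]
      by (simp add: l2_add_def L2_add ip_add_right l2_inner_eq)
    have scale: "l2_inner M e (l2_scale M z c) = cnj z * l2_inner M e c" if "c \<in> l2 M" "e \<in> l2 M" for c z e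
      using that l2_inner_ae_class[of "rep e" M "\<lambda>x. z * rep c x"]
      by (simp add: l2_scale_def L2_scale ip_scale_right l2_inner_eq)
    show "S (l2_add M c d) = l2_add M (S c) (S d)" if "c \<in> l2 M" "d \<in> l2 M" for c d
      by (rule l2_eqI) (use that in \<open>auto simp: Sl2 add S[symmetric] T\<close>)
    show "S (l2_scale M z c) = l2_scale M z (S c)" if "c \<in> l2 M" for c z
      by (rule l2_eqI) (use that in \<open>auto simp: Sl2 scale S[symmetric] T\<close>)
    \<comment> \<open>The square of the norm of \<open>S c\<close> is the inner product of
      \<open>T (S c)\<close> with \<open>c\<close>, hence at most \<open>K\<close> times the norms
      of \<open>S c\<close> and \<open>c\<close>; one factor cancels unless it is zero.\<close>
    show "l2_norm M (S c) \<le> K * l2_norm M c" if c: "c \<in> l2 M" for c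
    proof -
      let ?n = "l2_norm M (S c)"
      have n0: "0 \<le> ?n" "0 \<le> l2_norm M c" by (auto simp: Sl2[OF c] c l2_norm_eq)
      have "complex_of_real (?n\<^sup>2) = l2_inner M (S c) (S c)"
        by (simp add: l2_inner_eq ip_self l2_norm_eq Sl2[OF c])
      also have "\<dots> = l2_inner M (T (S c)) c" by (rule S[symmetric]) (auto simp: Sl2 c)
      finally have "complex_of_real (?n\<^sup>2) = \<dots>" .
      then have "?n\<^sup>2 = cmod (l2_inner M (T (S c)) c)"
        by (metis abs_of_nonneg norm_of_real zero_le_power2)
      also have "\<dots> \<le> l2_norm M (T (S c)) * l2_norm M c"
        using cmod_ip_le[of "rep (T (S c))" M "rep c"] Sl2[OF c] c T by (simp add: l2_inner_eq l2_norm_eq)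
      also have "\<dots> \<le> (K * ?n) * l2_norm M c"
        by (intro mult_right_mono K(2) Sl2 c n0)
      finally have "?n * ?n \<le> (K * l2_norm M c) * ?n" by (simp add: power2_eq_square ac_simps)
      then show ?thesis
        using n0 K(1) by (cases "?n = 0") (auto simp: mult_le_cancel_right)
    qed
  qed
  with S show ?thesis by blast
qed

lemma op_adj_eqI:
  assumes "S \<in> bounded_ops M" "T \<in> bounded_ops M"
    and "\<And>c d. c \<in> l2 M \<Longrightarrow> d \<in> l2 M \<Longrightarrow> l2_inner M (T c) d = l2_inner M c (S d)"
  shows "op_adj M T = S"
  unfolding op_adj_def
proof (rule the_equality)
  fix S' assume "S' \<in> bounded_ops M \<and> (\<forall>c\<in>l2 M. \<forall>d\<in>l2 M. l2_inner M (T c) d = l2_inner M c (S' d))"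
  then have S': "S' \<in> bounded_ops M" "\<And>c d. c \<in> l2 M \<Longrightarrow> d \<in> l2 M \<Longrightarrow> l2_inner M (T c) d = l2_inner M c (S' d)"
    by auto
  show "S' = S"
  proof (rule bounded_ops_eqI)
    fix c assume "c \<in> l2 M"
    then show "S' c = S c"
      by (intro l2_eqI[of _ M]) (use S'(1) assms(1) in \<open>auto simp flip: assms(3) S'(2)\<close>)
  qed (use S' assms in auto)
qed (use assms in auto)

lemma
  assumes "T \<in> bounded_ops M"
  shows op_adj_bounded [intro, simp]: "op_adj M T \<in> bounded_ops M"
    and op_adj_inner: "c \<in> l2 M \<Longrightarrow> d \<in> l2 M \<Longrightarrow> l2_inner M (T c) d = l2_inner M c (op_adj M T d)"
proof -
  obtain S where S: "S \<in> bounded_ops M" "\<And>c d. c \<in> l2 M \<Longrightarrow> d \<in> l2 M \<Longrightarrow> l2_inner M (T c) d = l2_inner M c (S d)"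
    using ex_adjoint[OF assms] by blast
  then have "op_adj M T = S" by (intro op_adj_eqI assms)
  with S show "op_adj M T \<in> bounded_ops M"
    "c \<in> l2 M \<Longrightarrow> d \<in> l2 M \<Longrightarrow> l2_inner M (T c) d = l2_inner M c (op_adj M T d)" by auto
qed

lemma l2_inner_cnj: "l2_inner M d c = cnj (l2_inner M c d)"
  unfolding l2_inner_eq by (rule ip_cnj)

lemma op_adj_inner': "T \<in> bounded_ops M \<Longrightarrow> c \<in> l2 M \<Longrightarrow> d \<in> l2 M \<Longrightarrow>
    l2_inner M c (T d) = l2_inner M (op_adj M T c) d"
  using op_adj_inner[of T M d c] l2_inner_cnj[of M c "T d"] l2_inner_cnj[of M "op_adj M T c" d] by simp

lemma op_adj_adj [simp]: "T \<in> bounded_ops M \<Longrightarrow> op_adj M (op_adj M T) = T"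
  by (rule op_adj_eqI) (auto simp: op_adj_inner')

lemma op_mult_apply [simp]: "c \<in> l2 M \<Longrightarrow> op_mult M S T c = S (T c)"
  by (simp add: op_mult_def compose_def)

lemma op_mult_bounded [intro, simp]:
  assumes S: "S \<in> bounded_ops M" and T: "T \<in> bounded_ops M"
  shows "op_mult M S T \<in> bounded_ops M"
proof -
  obtain K where K: "0 \<le> K" "\<And>c. c \<in> l2 M \<Longrightarrow> l2_norm M (S c) \<le> K * l2_norm M c"
    by (rule bounded_ops_bound[OF S]) blast
  obtain L where L: "0 \<le> L" "\<And>c. c \<in> l2 M \<Longrightarrow> l2_norm M (T c) \<le> L * l2_norm M c"
    by (rule bounded_ops_bound[OF T]) blast
  show ?thesis
  proof (rule bounded_opsI[where K="K * L"])
    show "op_mult M S T \<in> extensional (l2 M)" by (simp add: op_mult_def compose_def)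
    fix c assume c: "c \<in> l2 M"
    have "l2_norm M (S (T c)) \<le> K * (L * l2_norm M c)"
      using K(2)[of "T c"] L(2)[OF c] K(1) T c by (meson bounded_ops_l2 mult_left_mono order_trans)
    then show "l2_norm M (op_mult M S T c) \<le> K * L * l2_norm M c" using c by simp
  qed (use S T in \<open>auto simp: bounded_ops_add bounded_ops_scale\<close>)
qed

lemma op_mult_assoc:
  assumes "R \<in> bounded_ops M" "S \<in> bounded_ops M" "T \<in> bounded_ops M"
  shows "op_mult M (op_mult M R S) T = op_mult M R (op_mult M S T)"
  by (rule bounded_ops_eqI) (use assms in auto)

lemma op_one_apply [simp]: "c \<in> l2 M \<Longrightarrow> op_one M c = c"
  by (simp add: op_one_def)

lemma op_one_bounded [intro, simp]: "op_one M \<in> bounded_ops M"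
  by (rule bounded_opsI[where K=1]) (auto simp: op_one_def)

lemma op_mult_one [simp]:
  assumes "T \<in> bounded_ops M"
  shows "op_mult M (op_one M) T = T" "op_mult M T (op_one M) = T"
  by (auto intro!: bounded_ops_eqI[of _ M] simp: assms)

lemma op_adj_mult:
  assumes "S \<in> bounded_ops M" "T \<in> bounded_ops M"
  shows "op_adj M (op_mult M S T) = op_mult M (op_adj M T) (op_adj M S)"
  by (rule op_adj_eqI) (use assms in \<open>auto simp: op_adj_inner\<close>)

lemma op_scale_apply: "c \<in> l2 M \<Longrightarrow> op_scale M z T c = l2_scale M z (T c)"
  by (simp add: op_scale_def)

lemma l2_scale_scale: "c \<in> l2 M \<Longrightarrow> l2_scale M z (l2_scale M w c) = l2_scale M (z * w) c"
  by (elim l2_cases) (simp add: l2_scale_ae_class L2_scale ac_simps)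

lemma l2_scale_one [simp]: "c \<in> l2 M \<Longrightarrow> l2_scale M 1 c = c"
  by (simp add: l2_scale_def)

lemma l2_scale_add: "c \<in> l2 M \<Longrightarrow> d \<in> l2 M \<Longrightarrow> l2_scale M z (l2_add M c d) = l2_add M (l2_scale M z c) (l2_scale M z d)"
  by (elim l2_cases) (simp add: l2_scale_ae_class l2_add_ae_class L2_scale L2_add distrib_left)

lemma l2_norm_scale: "c \<in> l2 M \<Longrightarrow> l2_norm M (l2_scale M z c) = cmod z * l2_norm M c"
  by (elim l2_cases) (simp add: l2_scale_ae_class l2_norm_ae_class L2_scale sqn_scale real_sqrt_mult)

lemma op_scale_bounded [intro, simp]:
  assumes T: "T \<in> bounded_ops M" shows "op_scale M z T \<in> bounded_ops M"
proof -
  obtain K where K: "0 \<le> K" "\<And>c. c \<in> l2 M \<Longrightarrow> l2_norm M (T c) \<le> K * l2_norm M c"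
    by (rule bounded_ops_bound[OF T]) blast
  show ?thesis
  proof (rule bounded_opsI[where K="cmod z * K"])
    fix c assume c: "c \<in> l2 M"
    show "l2_norm M (op_scale M z T c) \<le> cmod z * K * l2_norm M c"
      using K(2)[OF c] c T by (simp add: op_scale_apply l2_norm_scale mult.assoc mult_left_mono)
    show "op_scale M z T (l2_scale M w c) = l2_scale M w (op_scale M z T c)" for w
      using c T by (simp add: op_scale_apply bounded_ops_scale l2_scale_scale mult.commute)
  qed (use T in \<open>auto simp: op_scale_apply bounded_ops_add l2_scale_add\<close>, simp add: op_scale_def)
qed

lemma l2_add_interchange: "\<lbrakk>a \<in> l2 M; b \<in> l2 M; c \<in> l2 M; d \<in> l2 M\<rbrakk> \<Longrightarrow>
   l2_add M (l2_add M a b) (l2_add M c d) = l2_add M (l2_add M a c) (l2_add M b d)"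
  by (elim l2_cases) (simp add: l2_add_ae_class L2_add ac_simps)

lemma l2_norm_add: "c \<in> l2 M \<Longrightarrow> d \<in> l2 M \<Longrightarrow> l2_norm M (l2_add M c d) \<le> l2_norm M c + l2_norm M d"
  by (elim l2_cases) (simp add: l2_add_ae_class l2_norm_ae_class L2_add sqrt_sqn_triangle)

lemma op_add_bounded [intro, simp]:
  assumes S: "S \<in> bounded_ops M" and T: "T \<in> bounded_ops M"
  shows "op_add M S T \<in> bounded_ops M"
proof -
  obtain K where K: "0 \<le> K" "\<And>c. c \<in> l2 M \<Longrightarrow> l2_norm M (S c) \<le> K * l2_norm M c"
    by (rule bounded_ops_bound[OF S]) blast
  obtain L where L: "0 \<le> L" "\<And>c. c \<in> l2 M \<Longrightarrow> l2_norm M (T c) \<le> L * l2_norm M c"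
    by (rule bounded_ops_bound[OF T]) blast
  show ?thesis
  proof (rule bounded_opsI[where K="K + L"])
    show "op_add M S T \<in> extensional (l2 M)" by (simp add: op_add_def)
    fix c assume c: "c \<in> l2 M"
    have "l2_norm M (l2_add M (S c) (T c)) \<le> l2_norm M (S c) + l2_norm M (T c)"
      using S T c by (intro l2_norm_add) auto
    then show "l2_norm M (op_add M S T c) \<le> (K + L) * l2_norm M c"
      using K(2)[OF c] L(2)[OF c] c by (simp add: op_add_def distrib_right)
  qed (use S T in \<open>auto simp: op_add_def bounded_ops_add bounded_ops_scale l2_scale_add l2_add_interchange\<close>)
qed

lemma op_mult_scale:
  assumes "S \<in> bounded_ops M" "T \<in> bounded_ops M"
  shows "op_mult M S (op_scale M z T) = op_scale M z (op_mult M S T)"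
    "op_mult M (op_scale M z S) T = op_scale M z (op_mult M S T)"
  by (auto intro!: bounded_ops_eqI[of _ M] simp: assms op_scale_apply bounded_ops_scale)

lemma op_scale_scale: "T \<in> bounded_ops M \<Longrightarrow> op_scale M z (op_scale M w T) = op_scale M (z * w) T"
  by (rule bounded_ops_eqI) (auto simp: op_scale_apply l2_scale_scale)

lemma op_scale_one [simp]: "T \<in> bounded_ops M \<Longrightarrow> op_scale M 1 T = T"
  by (rule bounded_ops_eqI) (auto simp: op_scale_apply)

section \<open>Commutants and generated von Neumann algebras\<close>

lemma commutant_bounded: "T \<in> commutant M A \<Longrightarrow> T \<in> bounded_ops M"
  by (simp add: commutant_def)

lemma commutantD: "T \<in> commutant M A \<Longrightarrow> S \<in> A \<Longrightarrow> op_mult M S T = op_mult M T S"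
  by (simp add: commutant_def)

lemma commutant_mono: "A \<subseteq> B \<Longrightarrow> commutant M B \<subseteq> commutant M A"
  by (auto simp: commutant_def)

lemma commutant_mult:
  assumes "A \<subseteq> bounded_ops M" "S \<in> commutant M A" "T \<in> commutant M A"
  shows "op_mult M S T \<in> commutant M A"
proof -
  have "op_mult M R (op_mult M S T) = op_mult M (op_mult M S T) R" if R: "R \<in> A" for R
  proof -
    have b: "R \<in> bounded_ops M" "S \<in> bounded_ops M" "T \<in> bounded_ops M"
      using assms R commutant_bounded by blast+
    have "op_mult M R (op_mult M S T) = op_mult M (op_mult M R S) T" using b by (simp add: op_mult_assoc)
    also have "op_mult M R S = op_mult M S R" by (rule commutantD[OF assms(2) R])
    also have "op_mult M (op_mult M S R) T = op_mult M S (op_mult M R T)" using b by (simp add: op_mult_assoc)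
    also have "op_mult M R T = op_mult M T R" by (rule commutantD[OF assms(3) R])
    also have "op_mult M S (op_mult M T R) = op_mult M (op_mult M S T) R" using b by (simp add: op_mult_assoc)
    finally show ?thesis .
  qed
  moreover have "op_mult M S T \<in> bounded_ops M" using assms(2,3) by (intro op_mult_bounded commutant_bounded)
  ultimately show ?thesis unfolding commutant_def by blast
qed

lemma commutant_one: "A \<subseteq> bounded_ops M \<Longrightarrow> op_one M \<in> commutant M A"
  by (auto simp: commutant_def)

lemma commutant_scale: "A \<subseteq> bounded_ops M \<Longrightarrow> T \<in> commutant M A \<Longrightarrow> op_scale M z T \<in> commutant M A"
  by (auto simp: commutant_def op_mult_scale subset_iff)

lemma commutant_add: 
  assumes "A \<subseteq> bounded_ops M" "S \<in> commutant M A" "T \<in> commutant M A"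
  shows "op_add M S T \<in> commutant M A"
proof -
  have "op_mult M R (op_add M S T) = op_mult M (op_add M S T) R" if R: "R \<in> A" for R
  proof (rule bounded_ops_eqI)
    fix c assume c: "c \<in> l2 M"
    have "op_mult M R S c = op_mult M S R c" "op_mult M R T c = op_mult M T R c"
      using commutantD[OF assms(2) R] commutantD[OF assms(3) R] by simp_all
    then show "op_mult M R (op_add M S T) c = op_mult M (op_add M S T) R c"
      using assms R c by (auto simp: op_add_def bounded_ops_add commutant_bounded subset_iff)
  qed (use assms R in \<open>auto simp: commutant_bounded subset_iff\<close>)
  moreover have "op_add M S T \<in> bounded_ops M" using assms(2,3) by (intro op_add_bounded commutant_bounded)
  ultimately show ?thesis unfolding commutant_def by blast
qed

lemma commutant_adj:
  assumes "A \<subseteq> bounded_ops M" "op_adj M ` A \<subseteq> A" "T \<in> commutant M A"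
  shows "op_adj M T \<in> commutant M A"
proof -
  have "op_mult M S (op_adj M T) = op_mult M (op_adj M T) S" if S: "S \<in> A" for S
  proof -
    have "op_mult M (op_adj M S) T = op_mult M T (op_adj M S)"
      by (rule commutantD[OF assms(3)]) (use assms(2) S in blast)
    moreover have b: "S \<in> bounded_ops M" "T \<in> bounded_ops M"
      using assms(1) S commutant_bounded[OF assms(3)] by blast+
    have "op_mult M S (op_adj M T) = op_adj M (op_mult M T (op_adj M S))"
      using b by (simp add: op_adj_mult)
    moreover have "op_mult M (op_adj M T) S = op_adj M (op_mult M (op_adj M S) T)"
      using b by (simp add: op_adj_mult)
    ultimately show ?thesis by argo
  qed
  moreover have "op_adj M T \<in> bounded_ops M" using commutant_bounded[OF assms(3)] by simp
  ultimately show ?thesis unfolding commutant_def by blast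
qed

lemma commutant_subset_bounded: "commutant M A \<subseteq> bounded_ops M"
  by (auto simp: commutant_def)

lemma vN_generated_mono: "A \<subseteq> B \<Longrightarrow> vN_generated M A \<subseteq> vN_generated M B"
  unfolding vN_generated_def by (intro commutant_mono) auto

lemma vN_generated_superset: "A \<subseteq> bounded_ops M \<Longrightarrow> A \<subseteq> vN_generated M A"
  using commutantD[of _ M "A \<union> op_adj M ` A"] unfolding vN_generated_def commutant_def[of M "commutant _ _"] by fastforce

lemma vN_generated_mult: "S \<in> vN_generated M A \<Longrightarrow> T \<in> vN_generated M A \<Longrightarrow> op_mult M S T \<in> vN_generated M A"
  unfolding vN_generated_def by (rule commutant_mult[OF commutant_subset_bounded])

lemma vN_generated_one: "op_one M \<in> vN_generated M A"
  unfolding vN_generated_def by (rule commutant_one[OF commutant_subset_bounded])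

lemma vN_generated_scale: "T \<in> vN_generated M A \<Longrightarrow> op_scale M z T \<in> vN_generated M A"
  unfolding vN_generated_def by (rule commutant_scale[OF commutant_subset_bounded])

lemma vN_generated_add: "S \<in> vN_generated M A \<Longrightarrow> T \<in> vN_generated M A \<Longrightarrow> op_add M S T \<in> vN_generated M A"
  unfolding vN_generated_def by (rule commutant_add[OF commutant_subset_bounded])

lemma vN_generated_adj:
  assumes "A \<subseteq> bounded_ops M" "T \<in> vN_generated M A"
  shows "op_adj M T \<in> vN_generated M A"
  using assms(2) unfolding vN_generated_def
proof (rule commutant_adj[OF commutant_subset_bounded, rotated])
  have "op_adj M S \<in> commutant M (A \<union> op_adj M ` A)" if "S \<in> commutant M (A \<union> op_adj M ` A)" for S
  proof (rule commutant_adj[OF _ _ that])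
    show "A \<union> op_adj M ` A \<subseteq> bounded_ops M" using assms(1) by auto
    have "op_adj M (op_adj M R) = R" if "R \<in> A" for R using assms(1) that by auto
    then show "op_adj M ` (A \<union> op_adj M ` A) \<subseteq> A \<union> op_adj M ` A" by auto
  qed
  then show "op_adj M ` commutant M (A \<union> op_adj M ` A) \<subseteq> commutant M (A \<union> op_adj M ` A)" by auto
qed

lemma unitaries_mem: "w \<in> unitaries M A \<Longrightarrow> w \<in> A"
  by (simp add: unitaries_def)

lemma unitaries_adj_mult: "w \<in> unitaries M A \<Longrightarrow> op_mult M (op_adj M w) w = op_one M"
  by (simp add: unitaries_def)

lemma unitaries_mult_adj: "w \<in> unitaries M A \<Longrightarrow> op_mult M w (op_adj M w) = op_one M"
  by (simp add: unitaries_def)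

section \<open>The group measure space construction\<close>

text \<open>Countability of the group serves two purposes: the counting measure becomes
  sigma-finite, so Fubini applies on the product, and an almost everywhere statement holds along
  whole orbits at once.\<close>

locale gms =
  fixes G :: "('g, 'm) monoid_scheme" (structure) and Y :: "'y measure" and \<psi> :: "'g \<Rightarrow> 'y \<Rightarrow> 'y"
  assumes countable_carrier: "countable (carrier G)" and pmp: "pmp_action G Y \<psi>"
begin

sublocale group_action G "space Y" \<psi>
  using pmp by (simp add: pmp_action_def)

sublocale group G
  using group_hom by (rule group_hom.axioms)

sublocale prob_space Y
  using pmp by (simp add: pmp_action_def standard_prob_space_def)

abbreviation C :: "'g measure" where "C \<equiv> count_space (carrier G)"
abbreviation N :: "('y \<times> 'g) measure" where "N \<equiv> gms_measure G Y"

sublocale C: sigma_finite_measure C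
  by (rule sigma_finite_measure_count_space_countable[OF countable_carrier])

sublocale YC: pair_sigma_finite Y C ..

lemma act_measurable [measurable (raw)]: "g \<in> carrier G \<Longrightarrow> \<psi> g \<in> Y \<rightarrow>\<^sub>M Y"
  using pmp by (simp add: pmp_action_def)

lemma distr_act: "g \<in> carrier G \<Longrightarrow> distr Y Y (\<psi> g) = Y"
  using pmp by (simp add: pmp_action_def)

lemma act_space [simp]: "g \<in> carrier G \<Longrightarrow> z \<in> space Y \<Longrightarrow> \<psi> g z \<in> space Y"
  using act_measurable by (rule measurable_space)

lemma act_mult: "g \<in> carrier G \<Longrightarrow> h \<in> carrier G \<Longrightarrow> z \<in> space Y \<Longrightarrow> \<psi> g (\<psi> h z) = \<psi> (g \<otimes> h) z"
  by (simp add: composition_rule)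

lemma act_one [simp]: "z \<in> space Y \<Longrightarrow> \<psi> \<one> z = z"
  by (metis id_eq_one restrict_apply')

lemma nn_integral_act:
  "g \<in> carrier G \<Longrightarrow> f \<in> borel_measurable Y \<Longrightarrow> (\<integral>\<^sup>+z. f (\<psi> g z) \<partial>Y) = (\<integral>\<^sup>+z. f z \<partial>Y)"
  using nn_integral_distr[of "\<psi> g" Y Y f] by (simp add: distr_act act_measurable)

lemma integral_act:
  fixes f :: "'y \<Rightarrow> complex"
  shows "g \<in> carrier G \<Longrightarrow> f \<in> borel_measurable Y \<Longrightarrow> (LINT z|Y. f (\<psi> g z)) = (LINT z|Y. f z)"
  using integral_distr[of "\<psi> g" Y Y f] by (simp add: distr_act act_measurable)

lemma AE_act:
  assumes "g \<in> carrier G" "AE z in Y. P z"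
  shows "AE z in Y. P (\<psi> g z)"
proof -
  have "AE z in distr Y Y (\<psi> g). P z" unfolding distr_act[OF assms(1)] by (rule assms)
  then show ?thesis using AE_distrD[OF act_measurable[OF assms(1)]] by blast
qed

lemma AE_act_all:
  assumes "AE z in Y. P z"
  shows "AE z in Y. \<forall>g\<in>carrier G. P (\<psi> g z)"
  by (subst AE_ball_countable[OF countable_carrier]) (auto intro: AE_act assms)

lemma measurable_pair_C:
  assumes "\<And>\<rho>. \<rho> \<in> carrier G \<Longrightarrow> (\<lambda>x. f x \<rho>) \<in> measurable K L"
  shows "(\<lambda>(x, \<rho>). f x \<rho>) \<in> measurable (K \<Otimes>\<^sub>M C) L"
proof -
  have "(\<lambda>p. f (snd p) (fst p)) \<in> measurable (C \<Otimes>\<^sub>M K) L"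
    by (rule measurable_pair_measure_countable1[OF countable_carrier]) (use assms in auto)
  from measurable_compose[OF measurable_pair_swap' this] show ?thesis by (simp add: split_beta')
qed

lemma measurable_N_iff: "f \<in> measurable N L \<longleftrightarrow> (\<forall>\<rho>\<in>carrier G. (\<lambda>z. f (z, \<rho>)) \<in> measurable Y L)"
proof (intro iffI ballI)
  assume "f \<in> measurable N L" then have [measurable]: "f \<in> measurable (Y \<Otimes>\<^sub>M C) L" by (simp add: gms_measure_def)
  fix \<rho> assume "\<rho> \<in> carrier G"
  then have "\<rho> \<in> space C" by simp
  then show "(\<lambda>z. f (z, \<rho>)) \<in> measurable Y L" by measurable
next
  assume "\<forall>\<rho>\<in>carrier G. (\<lambda>z. f (z, \<rho>)) \<in> measurable Y L"
  then have "(\<lambda>(z, \<rho>). f (z, \<rho>)) \<in> measurable (Y \<Otimes>\<^sub>M C) L" by (intro measurable_pair_C) blast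
  then show "f \<in> measurable N L" by (simp add: gms_measure_def)
qed

lemma N_section [measurable (raw)]:
  "f \<in> measurable N L \<Longrightarrow> \<rho> \<in> carrier G \<Longrightarrow> h \<in> measurable K Y \<Longrightarrow> (\<lambda>z. f (h z, \<rho>)) \<in> measurable K L"
  using measurable_compose[of h K Y "\<lambda>z. f (z, \<rho>)" L] by (auto simp: measurable_N_iff)

lemma space_N: "space N = space Y \<times> carrier G"
  by (simp add: gms_measure_def space_pair_measure)

lemma AE_N_iff: "(AE p in N. P p) \<longleftrightarrow> (AE z in Y. \<forall>\<rho>\<in>carrier G. P (z, \<rho>))"
proof
  assume "AE p in N. P p"
  then have "AE z in Y. AE \<rho> in C. P (z, \<rho>)" unfolding gms_measure_def by (rule YC.AE_pair)
  then show "AE z in Y. \<forall>\<rho>\<in>carrier G. P (z, \<rho>)" by (simp add: AE_count_space)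
next
  assume "AE z in Y. \<forall>\<rho>\<in>carrier G. P (z, \<rho>)"
  then obtain A where A: "A \<in> null_sets Y" "{z\<in>space Y. \<not> (\<forall>\<rho>\<in>carrier G. P (z, \<rho>))} \<subseteq> A"
    by (auto simp: eventually_ae_filter)
  \<comment> \<open>A null set times the whole group is null even if the group is infinite, because
    0 times \<infinity> is 0 in \<open>ennreal\<close>.\<close>
  have "emeasure N (A \<times> carrier G) = emeasure Y A * emeasure C (carrier G)"
    unfolding gms_measure_def by (rule C.emeasure_pair_measure_Times) (use A in auto)
  then have "A \<times> carrier G \<in> null_sets N"
    using A by (auto simp: null_sets_def gms_measure_def)
  moreover have "{p\<in>space N. \<not> P p} \<subseteq> A \<times> carrier G"
    using A(2) by (auto simp: space_N)
  ultimately show "AE p in N. P p" by (auto simp: eventually_ae_filter)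
qed

lemma nn_integral_N:
  "f \<in> borel_measurable N \<Longrightarrow> (\<integral>\<^sup>+p. f p \<partial>N) = (\<integral>\<^sup>+z. \<integral>\<^sup>+\<rho>. f (z, \<rho>) \<partial>C \<partial>Y)"
  unfolding gms_measure_def by (rule C.nn_integral_fst[symmetric])

lemma nn_integral_N':
  "f \<in> borel_measurable N \<Longrightarrow> (\<integral>\<^sup>+p. f p \<partial>N) = (\<integral>\<^sup>+\<rho>. \<integral>\<^sup>+z. f (z, \<rho>) \<partial>Y \<partial>C)"
  unfolding gms_measure_def by (subst YC.nn_integral_snd[symmetric]) auto

lemma nn_integral_swap:
  assumes "\<And>\<rho>. \<rho> \<in> carrier G \<Longrightarrow> (\<lambda>z. f z \<rho>) \<in> borel_measurable Y"
  shows "(\<integral>\<^sup>+z. \<integral>\<^sup>+\<rho>. f z \<rho> \<partial>C \<partial>Y) = (\<integral>\<^sup>+\<rho>. \<integral>\<^sup>+z. f z \<rho> \<partial>Y \<partial>C)"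
proof -
  have "(\<lambda>(z, \<rho>). f z \<rho>) \<in> borel_measurable N" using assms by (simp add: measurable_N_iff)
  from nn_integral_N[OF this] nn_integral_N'[OF this] show ?thesis by simp
qed

lemma borel_measurable_nn_integral_C [measurable (raw)]:
  assumes "\<And>\<rho>. \<rho> \<in> carrier G \<Longrightarrow> (\<lambda>x. f x \<rho>) \<in> borel_measurable K"
  shows "(\<lambda>x. \<integral>\<^sup>+\<rho>. f x \<rho> \<partial>C) \<in> borel_measurable K"
  using measurable_pair_C[OF assms] by (rule C.borel_measurable_nn_integral)

lemma borel_measurable_integral_C [measurable (raw)]:
  fixes f :: "'a \<Rightarrow> 'g \<Rightarrow> complex"
  assumes "\<And>\<rho>. \<rho> \<in> carrier G \<Longrightarrow> (\<lambda>x. f x \<rho>) \<in> borel_measurable K"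
  shows "(\<lambda>x. LINT \<rho>|C. f x \<rho>) \<in> borel_measurable K"
  using measurable_pair_C[OF assms] by (rule C.borel_measurable_lebesgue_integral)

section \<open>Translations of the group and sums over it\<close>

lemma bij_inv: "bij_betw (\<lambda>\<sigma>. inv \<sigma>) (carrier G) (carrier G)"
  by (rule bij_betwI[where g="\<lambda>\<sigma>. inv \<sigma>"]) auto

lemma bij_lmult: "g \<in> carrier G \<Longrightarrow> bij_betw (\<lambda>\<sigma>. g \<otimes> \<sigma>) (carrier G) (carrier G)"
  by (rule bij_betwI[where g="\<lambda>\<sigma>. inv g \<otimes> \<sigma>"]) (auto simp flip: m_assoc)

lemma bij_rmult: "g \<in> carrier G \<Longrightarrow> bij_betw (\<lambda>\<sigma>. \<sigma> \<otimes> g) (carrier G) (carrier G)"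
  by (rule bij_betwI[where g="\<lambda>\<sigma>. \<sigma> \<otimes> inv g"]) (auto simp: m_assoc)

lemma nn_integral_C_inv: "(\<integral>\<^sup>+\<sigma>. f (inv \<sigma>) \<partial>C) = (\<integral>\<^sup>+\<sigma>. f \<sigma> \<partial>C)"
  by (rule nn_integral_bij_count_space[OF bij_inv])

lemma nn_integral_C_lmult: "g \<in> carrier G \<Longrightarrow> (\<integral>\<^sup>+\<sigma>. f (g \<otimes> \<sigma>) \<partial>C) = (\<integral>\<^sup>+\<sigma>. f \<sigma> \<partial>C)"
  by (rule nn_integral_bij_count_space[OF bij_lmult])

lemma nn_integral_C_rmult: "g \<in> carrier G \<Longrightarrow> (\<integral>\<^sup>+\<sigma>. f (\<sigma> \<otimes> g) \<partial>C) = (\<integral>\<^sup>+\<sigma>. f \<sigma> \<partial>C)"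
  by (rule nn_integral_bij_count_space[OF bij_rmult])

lemma integral_C_inv: "(LINT \<sigma>|C. f (inv \<sigma>)) = (LINT \<sigma>|C. (f \<sigma> :: complex))"
  by (rule integral_bij_count_space[OF bij_inv])

lemma integral_C_lmult: "g \<in> carrier G \<Longrightarrow> (LINT \<sigma>|C. f (g \<otimes> \<sigma>)) = (LINT \<sigma>|C. (f \<sigma> :: complex))"
  by (rule integral_bij_count_space[OF bij_lmult])

lemma integral_C_rmult: "g \<in> carrier G \<Longrightarrow> (LINT \<sigma>|C. f (\<sigma> \<otimes> g)) = (LINT \<sigma>|C. (f \<sigma> :: complex))"
  by (rule integral_bij_count_space[OF bij_rmult])

lemma L2_C_iff: "f \<in> L2 C \<longleftrightarrow> (\<integral>\<^sup>+\<sigma>. ennreal ((cmod (f \<sigma>))\<^sup>2) \<partial>C) < \<infinity>"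
  by (simp add: L2_iff_nn_integral)

lemma L2_C_inv: "f \<in> L2 C \<Longrightarrow> (\<lambda>\<sigma>. f (inv \<sigma>)) \<in> L2 C"
  using nn_integral_C_inv[of "\<lambda>\<sigma>. ennreal ((cmod (f \<sigma>))\<^sup>2)"] by (simp add: L2_C_iff)

lemma L2_C_lmult: "g \<in> carrier G \<Longrightarrow> f \<in> L2 C \<Longrightarrow> (\<lambda>\<sigma>. f (g \<otimes> \<sigma>)) \<in> L2 C"
  using nn_integral_C_lmult[of g "\<lambda>\<sigma>. ennreal ((cmod (f \<sigma>))\<^sup>2)"] by (simp add: L2_C_iff)

lemma L2_C_rmult: "g \<in> carrier G \<Longrightarrow> f \<in> L2 C \<Longrightarrow> (\<lambda>\<sigma>. f (\<sigma> \<otimes> g)) \<in> L2 C"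
  using nn_integral_C_rmult[of g "\<lambda>\<sigma>. ennreal ((cmod (f \<sigma>))\<^sup>2)"] by (simp add: L2_C_iff)

lemma integral_C_single:
  fixes f :: "'g \<Rightarrow> complex"
  assumes "\<sigma> \<in> carrier G" "\<And>\<tau>. \<tau> \<in> carrier G \<Longrightarrow> \<tau> \<noteq> \<sigma> \<Longrightarrow> f \<tau> = 0"
  shows "(LINT \<tau>|C. f \<tau>) = f \<sigma>"
proof -
  have "(LINT \<tau>|C. f \<tau>) = (\<Sum>a | a \<in> carrier G \<and> f a \<noteq> 0. f a)"
    by (rule lebesgue_integral_count_space_finite_support, rule finite_subset[of _ "{\<sigma>}"]) (use assms in auto)
  also have "\<dots> = (\<Sum>a\<in>{\<sigma>}. f a)"
    by (rule sum.mono_neutral_left) (use assms in auto)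
  finally show ?thesis by simp
qed

text \<open>\<open>conv k \<xi>\<close> is the action of the formal sum \<open>\<Sum>\<^sub>\<sigma> k(\<cdot>,\<sigma>) v\<^sub>\<sigma>\<close> on the vector \<open>\<xi>\<close>.\<close>

definition conv :: "('y \<times> 'g \<Rightarrow> complex) \<Rightarrow> ('y \<times> 'g \<Rightarrow> complex) \<Rightarrow> 'y \<times> 'g \<Rightarrow> complex" where
  "conv k \<xi> = (\<lambda>(z, \<rho>). LINT \<sigma>|C. k (z, \<sigma>) * \<xi> (\<psi> (inv \<sigma>) z, inv \<sigma> \<otimes> \<rho>))"

lemma conv_apply: "conv k \<xi> (z, \<rho>) = (LINT \<sigma>|C. k (z, \<sigma>) * \<xi> (\<psi> (inv \<sigma>) z, inv \<sigma> \<otimes> \<rho>))"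
  by (simp add: conv_def)

text \<open>Substituting \<sigma> = \<rho> \<mu>^-1 indexes the sum by the group coordinate at which
  \<open>\<xi>\<close> is read, so it collapses to one term when \<open>\<xi>\<close> lives over a
  single \<mu>.\<close>

lemma conv_apply':
  assumes \<rho>: "\<rho> \<in> carrier G"
  shows "conv k \<xi> (z, \<rho>) = (LINT \<mu>|C. k (z, \<rho> \<otimes> inv \<mu>) * \<xi> (\<psi> (inv (\<rho> \<otimes> inv \<mu>)) z, \<mu>))"
proof -
  let ?f = "\<lambda>\<sigma>. k (z, \<sigma>) * \<xi> (\<psi> (inv \<sigma>) z, inv \<sigma> \<otimes> \<rho>)"
  have "conv k \<xi> (z, \<rho>) = (LINT \<mu>|C. ?f (\<rho> \<otimes> \<mu>))"
    unfolding conv_apply by (rule integral_C_lmult[OF \<rho>, symmetric])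
  also have "\<dots> = (LINT \<mu>|C. ?f (\<rho> \<otimes> inv \<mu>))"
    by (rule integral_C_inv[symmetric, of "\<lambda>\<mu>. ?f (\<rho> \<otimes> \<mu>)"])
  also have "\<dots> = (LINT \<mu>|C. k (z, \<rho> \<otimes> inv \<mu>) * \<xi> (\<psi> (inv (\<rho> \<otimes> inv \<mu>)) z, \<mu>))"
    by (rule Bochner_Integration.integral_cong)
       (use \<rho> in \<open>auto simp: inv_mult_group m_assoc\<close>)
  finally show ?thesis .
qed

lemma conv_measurable [measurable (raw)]:
  assumes [measurable]: "k \<in> borel_measurable N" "\<xi> \<in> borel_measurable N"
  shows "conv k \<xi> \<in> borel_measurable N"
  unfolding measurable_N_iff conv_apply by measurable

lemma L2_N_section:
  assumes k: "k \<in> L2 N"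
  shows "AE z in Y. (\<lambda>\<sigma>. k (z, \<sigma>)) \<in> L2 C"
proof -
  have [measurable]: "k \<in> borel_measurable N" using k by (rule L2_measurable)
  have "(\<integral>\<^sup>+z. \<integral>\<^sup>+\<rho>. ennreal ((cmod (k (z, \<rho>)))\<^sup>2) \<partial>C \<partial>Y) < \<infinity>"
    using k nn_integral_N[of "\<lambda>p. ennreal ((cmod (k p))\<^sup>2)"] by (simp add: L2_iff_nn_integral)
  then have "AE z in Y. (\<integral>\<^sup>+\<rho>. ennreal ((cmod (k (z, \<rho>)))\<^sup>2) \<partial>C) \<noteq> \<infinity>"
    by (intro nn_integral_noteq_infinite) auto
  then show ?thesis by (simp add: L2_C_iff less_top)
qed

text \<open>The map from (z, \<sigma>) to (\<sigma>^-1 z, \<sigma>^-1) is inversion in the groupoid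
  of the action and preserves \<open>N\<close>. It is needed because \<open>conv\<close> and
  adjoints read the second factor at translated points.\<close>

lemma L2_N_act:
  assumes k: "k \<in> L2 N"
  shows "AE z in Y. (\<lambda>\<sigma>. k (\<psi> (inv \<sigma>) z, inv \<sigma>)) \<in> L2 C"
proof -
  have [measurable]: "k \<in> borel_measurable N" using k by (rule L2_measurable)
  have "(\<integral>\<^sup>+z. \<integral>\<^sup>+\<rho>. ennreal ((cmod (k (\<psi> (inv \<rho>) z, inv \<rho>)))\<^sup>2) \<partial>C \<partial>Y) 
    = (\<integral>\<^sup>+\<rho>. \<integral>\<^sup>+z. ennreal ((cmod (k (\<psi> (inv \<rho>) z, inv \<rho>)))\<^sup>2) \<partial>Y \<partial>C)"
    by (rule nn_integral_swap) auto
  also have "\<dots> = (\<integral>\<^sup>+\<rho>. \<integral>\<^sup>+z. ennreal ((cmod (k (z, inv \<rho>)))\<^sup>2) \<partial>Y \<partial>C)"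
    by (intro nn_integral_cong nn_integral_act[of _ "\<lambda>z. ennreal ((cmod (k (z, inv _)))\<^sup>2)"]) auto
  also have "\<dots> = (\<integral>\<^sup>+\<rho>. \<integral>\<^sup>+z. ennreal ((cmod (k (z, \<rho>)))\<^sup>2) \<partial>Y \<partial>C)"
    by (rule nn_integral_C_inv)
  also have "\<dots> = (\<integral>\<^sup>+p. ennreal ((cmod (k p))\<^sup>2) \<partial>N)"
    by (rule nn_integral_N'[symmetric]) auto
  also have "\<dots> < \<infinity>" using k by (simp add: L2_iff_nn_integral)
  finally have "AE z in Y. (\<integral>\<^sup>+\<rho>. ennreal ((cmod (k (\<psi> (inv \<rho>) z, inv \<rho>)))\<^sup>2) \<partial>C) \<noteq> \<infinity>"
    by (intro nn_integral_noteq_infinite) auto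
  then show ?thesis by (simp add: L2_C_iff less_top)
qed

lemma L2_N_rshift:
  assumes k: "k \<in> L2 N" and \<mu>: "\<mu> \<in> carrier G"
  shows "(\<lambda>(z, \<rho>). k (z, \<rho> \<otimes> \<mu>)) \<in> L2 N" "sqn N (\<lambda>(z, \<rho>). k (z, \<rho> \<otimes> \<mu>)) = sqn N k"
proof -
  have [measurable]: "k \<in> borel_measurable N" using k by (rule L2_measurable)
  have m: "(\<lambda>(z, \<rho>). k (z, \<rho> \<otimes> \<mu>)) \<in> borel_measurable N"
    unfolding measurable_N_iff using \<mu> by auto
  note [measurable] = m
  have eq: "(\<integral>\<^sup>+p. ennreal ((cmod ((\<lambda>(z, \<rho>). k (z, \<rho> \<otimes> \<mu>)) p))\<^sup>2) \<partial>N) = (\<integral>\<^sup>+p. ennreal ((cmod (k p))\<^sup>2) \<partial>N)"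
    by (subst (1 2) nn_integral_N) (auto simp: nn_integral_C_rmult[OF \<mu>, of "\<lambda>\<rho>. ennreal ((cmod (k (_, \<rho>)))\<^sup>2)"])
  then show L: "(\<lambda>(z, \<rho>). k (z, \<rho> \<otimes> \<mu>)) \<in> L2 N" using k m by (simp add: L2_iff_nn_integral)
  from eq show "sqn N (\<lambda>(z, \<rho>). k (z, \<rho> \<otimes> \<mu>)) = sqn N k"
    by (simp add: nn_integral_eq_sqn[OF L] nn_integral_eq_sqn[OF k])
qed

lemma L2_N_lshift:
  assumes k: "k \<in> L2 N" and g: "g \<in> carrier G"
  shows "(\<lambda>(z, \<rho>). k (\<psi> g z, g \<otimes> \<rho>)) \<in> L2 N" "sqn N (\<lambda>(z, \<rho>). k (\<psi> g z, g \<otimes> \<rho>)) = sqn N k"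
proof -
  have [measurable]: "k \<in> borel_measurable N" using k by (rule L2_measurable)
  have m: "(\<lambda>(z, \<rho>). k (\<psi> g z, g \<otimes> \<rho>)) \<in> borel_measurable N"
    unfolding measurable_N_iff using g by auto
  note [measurable] = m
  have "(\<integral>\<^sup>+p. ennreal ((cmod ((\<lambda>(z, \<rho>). k (\<psi> g z, g \<otimes> \<rho>)) p))\<^sup>2) \<partial>N)
      = (\<integral>\<^sup>+\<rho>. \<integral>\<^sup>+z. ennreal ((cmod (k (\<psi> g z, g \<otimes> \<rho>)))\<^sup>2) \<partial>Y \<partial>C)"
    by (subst nn_integral_N') auto
  also have "\<dots> = (\<integral>\<^sup>+\<rho>. \<integral>\<^sup>+z. ennreal ((cmod (k (z, g \<otimes> \<rho>)))\<^sup>2) \<partial>Y \<partial>C)"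
    using g by (intro nn_integral_cong nn_integral_act[of _ "\<lambda>z. ennreal ((cmod (k (z, _)))\<^sup>2)"]) auto
  also have "\<dots> = (\<integral>\<^sup>+\<rho>. \<integral>\<^sup>+z. ennreal ((cmod (k (z, \<rho>)))\<^sup>2) \<partial>Y \<partial>C)"
    by (rule nn_integral_C_lmult[OF g])
  also have "\<dots> = (\<integral>\<^sup>+p. ennreal ((cmod (k p))\<^sup>2) \<partial>N)"
    by (subst nn_integral_N') auto
  finally have eq: "(\<integral>\<^sup>+p. ennreal ((cmod ((\<lambda>(z, \<rho>). k (\<psi> g z, g \<otimes> \<rho>)) p))\<^sup>2) \<partial>N) = (\<integral>\<^sup>+p. ennreal ((cmod (k p))\<^sup>2) \<partial>N)" .
  then show L: "(\<lambda>(z, \<rho>). k (\<psi> g z, g \<otimes> \<rho>)) \<in> L2 N" using k m by (simp add: L2_iff_nn_integral)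
  from eq show "sqn N (\<lambda>(z, \<rho>). k (\<psi> g z, g \<otimes> \<rho>)) = sqn N k"
    by (simp add: nn_integral_eq_sqn[OF L] nn_integral_eq_sqn[OF k])
qed

text \<open>Pointwise Cauchy-Schwarz along almost every orbit: the convolution of two square
  integrable functions makes sense at almost every point, although it need not be square integrable
  again.\<close>

lemma conv_integrable:
  assumes k: "k \<in> L2 N" and \<xi>: "\<xi> \<in> L2 N"
  shows "AE z in Y. \<forall>\<rho>\<in>carrier G. integrable C (\<lambda>\<sigma>. k (z, \<sigma>) * \<xi> (\<psi> (inv \<sigma>) z, inv \<sigma> \<otimes> \<rho>))"
proof -
  have "AE z in Y. \<forall>\<rho>\<in>carrier G. (\<lambda>\<sigma>. \<xi> (\<psi> (inv \<sigma>) z, inv \<sigma> \<otimes> \<rho>)) \<in> L2 C"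
    unfolding AE_ball_countable[OF countable_carrier]
    using L2_N_act[OF L2_N_rshift(1)[OF \<xi>]] by simp
  with L2_N_section[OF k] show ?thesis
    by eventually_elim (auto intro!: ip_integrable')
qed

lemma conv_cong_AE:
  assumes "AE p in N. k p = k' p" "AE p in N. \<xi> p = \<xi>' p"
  shows "AE p in N. conv k \<xi> p = conv k' \<xi>' p"
proof -
  have "AE z in Y. \<forall>g\<in>carrier G. \<forall>\<rho>\<in>carrier G. \<xi> (\<psi> g z, \<rho>) = \<xi>' (\<psi> g z, \<rho>)"
    using assms(2) unfolding AE_N_iff by (rule AE_act_all)
  moreover have "AE z in Y. \<forall>\<sigma>\<in>carrier G. k (z, \<sigma>) = k' (z, \<sigma>)" using assms(1) by (simp add: AE_N_iff)
  ultimately show ?thesis unfolding AE_N_iff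
    by eventually_elim (auto simp: conv_apply intro!: Bochner_Integration.integral_cong)
qed

section \<open>Multiplication, translation and right-hand operators\<close>

definition bdd :: "('y \<Rightarrow> complex) \<Rightarrow> bool" where
  "bdd a \<longleftrightarrow> a \<in> borel_measurable Y \<and> (\<exists>K. AE z in Y. cmod (a z) \<le> K)"

lemma bddI: "a \<in> borel_measurable Y \<Longrightarrow> AE z in Y. cmod (a z) \<le> K \<Longrightarrow> bdd a"
  by (auto simp: bdd_def)

lemma bdd_measurable [measurable_dest]: "bdd a \<Longrightarrow> a \<in> borel_measurable Y"
  by (simp add: bdd_def)

lemma bdd_act:
  assumes "bdd a" "g \<in> carrier G" shows "bdd (\<lambda>z. a (\<psi> g z))"
proof -
  obtain K where "AE z in Y. cmod (a z) \<le> K" using assms by (auto simp: bdd_def)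
  from AE_act[OF assms(2) this] show ?thesis
    using assms by (intro bddI) (auto simp: bdd_def)
qed

lemma bdd_cnj: "bdd a \<Longrightarrow> bdd (\<lambda>z. cnj (a z))"
  by (auto simp: bdd_def)

lemma bdd_const [simp]: "bdd (\<lambda>z. c)"
  by (auto simp: bdd_def)

lemma bdd_mult: assumes "bdd a" "bdd b" shows "bdd (\<lambda>z. a z * b z)"
proof -
  obtain K L where K: "AE z in Y. cmod (a z) \<le> K" and L: "AE z in Y. cmod (b z) \<le> L"
    using assms by (auto simp: bdd_def)
  have "AE z in Y. cmod (a z * b z) \<le> \<bar>K\<bar> * \<bar>L\<bar>"
    using K L by eventually_elim (auto simp: norm_mult intro!: mult_mono)
  then show ?thesis using assms by (intro bddI) (auto simp: bdd_def)
qed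

lemma bdd_indicator: "A \<in> sets Y \<Longrightarrow> bdd (indicator A)"
  by (rule bddI[where K=1]) (auto simp: indicator_def)

lemma Linf_eq: "Linf G Y = mult_op G Y ` Collect bdd"
proof -
  have "Collect bdd = {a \<in> borel_measurable Y. \<exists>K. AE x in Y. cmod (a x) \<le> K}" unfolding bdd_def by (rule refl)
  then show ?thesis by (simp add: Linf_def)
qed

text \<open>Right multiplication by \<open>b\<close>. Together with \<open>rshift_op\<close> it
  supplies enough of the commutant of the crossed product to reach a dense set of vectors from
  \<open>delta \<one>\<close>.\<close>

definition rmult_op :: "('y \<Rightarrow> complex) \<Rightarrow> ('y \<times> 'g) l2op" where
  "rmult_op b = fun_op N (\<lambda>\<xi> (z, \<rho>). b (\<psi> (inv \<rho>) z) * \<xi> (z, \<rho>))"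

definition rshift_op :: "'g \<Rightarrow> ('y \<times> 'g) l2op" where
  "rshift_op \<mu> = fun_op N (\<lambda>\<xi> (z, \<rho>). \<xi> (z, \<rho> \<otimes> \<mu>))"

lemma L2_pointwise_mult:
  assumes f: "f \<in> L2 N" and a: "\<And>\<rho>. \<rho> \<in> carrier G \<Longrightarrow> (\<lambda>z. a (z, \<rho>)) \<in> borel_measurable Y"
    and b: "AE z in Y. \<forall>\<rho>\<in>carrier G. cmod (a (z, \<rho>)) \<le> K"
  shows "(\<lambda>(z, \<rho>). a (z, \<rho>) * f (z, \<rho>)) \<in> L2 N" "sqn N (\<lambda>(z, \<rho>). a (z, \<rho>) * f (z, \<rho>)) \<le> K\<^sup>2 * sqn N f"
  using L2_bounded_mult[OF f, of a K] a b by (auto simp: AE_N_iff measurable_N_iff split_beta')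

lemma mult_op_fun_op: "mult_op G Y a = fun_op N (\<lambda>\<xi> (z, \<rho>). a z * \<xi> (z, \<rho>))"
  by (simp add: mult_op_def fun_op_def)

lemma group_unitary_fun_op:
  "group_unitary G Y \<psi> g = fun_op N (\<lambda>\<xi> (z, \<rho>). \<xi> (\<psi> (inv g) z, inv g \<otimes> \<rho>))"
  by (simp add: group_unitary_def fun_op_def)

lemma mult_op_apply: "f \<in> L2 N \<Longrightarrow> mult_op G Y a (ae_class N f) = ae_class N (\<lambda>(z, \<rho>). a z * f (z, \<rho>))"
  unfolding mult_op_fun_op by (rule fun_op_apply) (auto simp: AE_N_iff)

lemma rmult_op_apply: "f \<in> L2 N \<Longrightarrow> rmult_op b (ae_class N f) = ae_class N (\<lambda>(z, \<rho>). b (\<psi> (inv \<rho>) z) * f (z, \<rho>))"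
  unfolding rmult_op_def by (rule fun_op_apply) (auto simp: AE_N_iff)

lemma AE_N_act: 
  assumes "AE z in Y. \<forall>\<rho>\<in>carrier G. f (z, \<rho>) = h (z, \<rho>)" "g \<in> carrier G"
  shows "AE z in Y. \<forall>\<rho>\<in>carrier G. f (\<psi> g z, g \<otimes> \<rho>) = h (\<psi> g z, g \<otimes> \<rho>)"
  using AE_act[OF assms(2,1)] by eventually_elim (use assms(2) in auto)

lemma group_unitary_apply: "g \<in> carrier G \<Longrightarrow> f \<in> L2 N \<Longrightarrow>
    group_unitary G Y \<psi> g (ae_class N f) = ae_class N (\<lambda>(z, \<rho>). f (\<psi> (inv g) z, inv g \<otimes> \<rho>))"
  unfolding group_unitary_fun_op
proof (rule fun_op_apply)
  fix f h assume "g \<in> carrier G" "AE p in N. f p = h p"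
  then show "AE p in N. (case p of (z, \<rho>) \<Rightarrow> f (\<psi> (inv g) z, inv g \<otimes> \<rho>)) = (case p of (z, \<rho>) \<Rightarrow> h (\<psi> (inv g) z, inv g \<otimes> \<rho>))"
    using AE_N_act[of f h "inv g"] by (simp add: AE_N_iff)
qed

lemma rshift_op_apply: "\<mu> \<in> carrier G \<Longrightarrow> f \<in> L2 N \<Longrightarrow>
    rshift_op \<mu> (ae_class N f) = ae_class N (\<lambda>(z, \<rho>). f (z, \<rho> \<otimes> \<mu>))"
  unfolding rshift_op_def by (rule fun_op_apply) (auto simp: AE_N_iff)

lemma mult_op_bounded:
  assumes "bdd a" shows "mult_op G Y a \<in> bounded_ops N"
proof -
  obtain K where K: "AE z in Y. cmod (a z) \<le> K" using assms by (auto simp: bdd_def)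
  have [measurable]: "a \<in> borel_measurable Y" using assms by (simp add: bdd_def)
  show ?thesis unfolding mult_op_fun_op
    by (rule fun_op_bounded[where K=K])
      (auto simp: AE_N_iff distrib_left ac_simps intro!: L2_pointwise_mult[where a="\<lambda>(z, \<rho>). a z", simplified] K)
qed

lemma rmult_op_bounded:
  assumes "bdd b" shows "rmult_op b \<in> bounded_ops N"
proof -
  obtain K where "AE z in Y. cmod (b z) \<le> K" using assms by (auto simp: bdd_def)
  from AE_act_all[OF this] have K: "AE z in Y. \<forall>\<rho>\<in>carrier G. cmod (b (\<psi> (inv \<rho>) z)) \<le> K"
    by eventually_elim auto
  have [measurable]: "b \<in> borel_measurable Y" using assms by (simp add: bdd_def)
  show ?thesis unfolding rmult_op_def
    by (rule fun_op_bounded[where K=K])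
      (auto simp: AE_N_iff distrib_left ac_simps intro!: L2_pointwise_mult[where a="\<lambda>(z, \<rho>). b (\<psi> (inv \<rho>) z)", simplified] K)
qed

lemma group_unitary_bounded: "g \<in> carrier G \<Longrightarrow> group_unitary G Y \<psi> g \<in> bounded_ops N"
  unfolding group_unitary_fun_op
proof (rule fun_op_bounded[where K=1])
  fix f h assume "g \<in> carrier G" "AE p in N. f p = h p"
  then show "AE p in N. (case p of (z, \<rho>) \<Rightarrow> f (\<psi> (inv g) z, inv g \<otimes> \<rho>)) = (case p of (z, \<rho>) \<Rightarrow> h (\<psi> (inv g) z, inv g \<otimes> \<rho>))"
    using AE_N_act[of f h "inv g"] by (simp add: AE_N_iff)
qed (auto simp: AE_N_iff L2_N_lshift)

lemma rshift_op_bounded: "\<mu> \<in> carrier G \<Longrightarrow> rshift_op \<mu> \<in> bounded_ops N"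
  unfolding rshift_op_def
  by (rule fun_op_bounded[where K=1]) (auto simp: AE_N_iff L2_N_rshift)

lemma mult_op_L2: "bdd a \<Longrightarrow> f \<in> L2 N \<Longrightarrow> (\<lambda>(z, \<rho>). a z * f (z, \<rho>)) \<in> L2 N"
  using L2_pointwise_mult(1)[of f "\<lambda>(z, \<rho>). a z"] by (auto simp: bdd_def)

lemma rmult_op_L2:
  assumes "bdd b" "f \<in> L2 N" shows "(\<lambda>(z, \<rho>). b (\<psi> (inv \<rho>) z) * f (z, \<rho>)) \<in> L2 N"
proof -
  obtain K where "AE z in Y. cmod (b z) \<le> K" using assms by (auto simp: bdd_def)
  from AE_act_all[OF this] have K: "AE z in Y. \<forall>\<rho>\<in>carrier G. cmod (b (\<psi> (inv \<rho>) z)) \<le> K"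
    by eventually_elim auto
  have [measurable]: "b \<in> borel_measurable Y" using assms by (simp add: bdd_def)
  show ?thesis using L2_pointwise_mult(1)[of f "\<lambda>(z, \<rho>). b (\<psi> (inv \<rho>) z)" K] K assms(2) by auto
qed

lemma mult_op_adj:
  assumes "bdd a" shows "op_adj N (mult_op G Y a) = mult_op G Y (\<lambda>z. cnj (a z))"
proof (rule op_adj_eqI)
  fix c d assume "c \<in> l2 N" "d \<in> l2 N"
  then obtain f h where f: "f \<in> L2 N" "c = ae_class N f" and h: "h \<in> L2 N" "d = ae_class N h"
    by (metis l2_cases)
  show "l2_inner N (mult_op G Y a c) d = l2_inner N c (mult_op G Y (\<lambda>z. cnj (a z)) d)"
  proof -
    have "l2_inner N (mult_op G Y a c) d = ip N (\<lambda>(z, \<rho>). a z * f (z, \<rho>)) h"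
      unfolding f(2) h(2) mult_op_apply[OF f(1)] by (rule l2_inner_ae_class[OF mult_op_L2[OF assms f(1)] h(1)])
    also have "\<dots> = ip N f (\<lambda>(z, \<rho>). cnj (a z) * h (z, \<rho>))"
      by (auto simp: ip_def ac_simps intro!: Bochner_Integration.integral_cong)
    also have "\<dots> = l2_inner N c (mult_op G Y (\<lambda>z. cnj (a z)) d)"
      unfolding f(2) h(2) mult_op_apply[OF h(1)] by (rule l2_inner_ae_class[OF f(1) mult_op_L2[OF bdd_cnj[OF assms] h(1)], symmetric])
    finally show ?thesis .
  qed
qed (auto intro: mult_op_bounded bdd_cnj assms)

lemma op_mult_eqI:
  assumes "S \<in> bounded_ops M" "T \<in> bounded_ops M" "R \<in> bounded_ops M"
    "\<And>f. f \<in> L2 M \<Longrightarrow> S (T (ae_class M f)) = R (ae_class M f)"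
  shows "op_mult M S T = R"
proof (rule bounded_ops_eqI[of _ M])
  fix c assume "c \<in> l2 M"
  then show "op_mult M S T c = R c" using assms(4) by (auto elim!: l2_cases)
qed (use assms in auto)

lemma op_mult_commI:
  assumes "S \<in> bounded_ops M" "T \<in> bounded_ops M"
    "\<And>f. f \<in> L2 M \<Longrightarrow> S (T (ae_class M f)) = T (S (ae_class M f))"
  shows "op_mult M S T = op_mult M T S"
  by (rule op_mult_eqI) (use assms in auto)

lemma group_unitary_mult:
  assumes "g \<in> carrier G" "h \<in> carrier G"
  shows "op_mult N (group_unitary G Y \<psi> g) (group_unitary G Y \<psi> h) = group_unitary G Y \<psi> (g \<otimes> h)"
  by (rule op_mult_eqI) (use assms in \<open>auto simp: group_unitary_bounded group_unitary_apply
    L2_N_lshift[of _ "inv _"] AE_N_iff inv_mult_group act_mult m_assoc space_N intro!: ae_class_cong AE_I2\<close>)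

lemma group_unitary_one: "group_unitary G Y \<psi> \<one> = op_one N"
proof (rule bounded_ops_eqI)
  fix c assume "c \<in> l2 N"
  then obtain f where f: "f \<in> L2 N" "c = ae_class N f" by (metis l2_cases)
  then show "group_unitary G Y \<psi> \<one> c = op_one N c"
    by (auto simp: group_unitary_apply space_N intro!: ae_class_cong AE_I2)
qed (auto intro: group_unitary_bounded)

lemma distr_lmap:
  assumes g: "g \<in> carrier G"
  shows "distr N N (\<lambda>(z, \<rho>). (\<psi> g z, g \<otimes> \<rho>)) = N"
proof (rule measure_eqI)
  have m: "(\<lambda>(z, \<rho>). (\<psi> g z, g \<otimes> \<rho>)) \<in> measurable N N"
    unfolding measurable_N_iff using g by (auto simp: gms_measure_def intro!: measurable_Pair)
  fix A assume "A \<in> sets (distr N N (\<lambda>(z, \<rho>). (\<psi> g z, g \<otimes> \<rho>)))"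
  then have [measurable]: "A \<in> sets N" by simp
  have "emeasure (distr N N (\<lambda>(z, \<rho>). (\<psi> g z, g \<otimes> \<rho>))) A = (\<integral>\<^sup>+p. indicator A p \<partial>distr N N (\<lambda>(z, \<rho>). (\<psi> g z, g \<otimes> \<rho>)))"
    by simp
  also have "\<dots> = (\<integral>\<^sup>+p. indicator A (\<psi> g (fst p), g \<otimes> snd p) \<partial>N)"
    by (subst nn_integral_distr[OF m]) (auto simp: split_beta')
  also have "\<dots> = (\<integral>\<^sup>+\<rho>. \<integral>\<^sup>+z. indicator A (\<psi> g z, g \<otimes> \<rho>) \<partial>Y \<partial>C)"
    using m by (subst nn_integral_N') (auto simp: split_beta')
  also have "\<dots> = (\<integral>\<^sup>+\<rho>. \<integral>\<^sup>+z. indicator A (z, g \<otimes> \<rho>) \<partial>Y \<partial>C)"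
    using g by (intro nn_integral_cong nn_integral_act[of _ "\<lambda>z. indicator A (z, _)"]) (auto simp: measurable_N_iff[symmetric])
  also have "\<dots> = (\<integral>\<^sup>+\<rho>. \<integral>\<^sup>+z. indicator A (z, \<rho>) \<partial>Y \<partial>C)"
    by (rule nn_integral_C_lmult[OF g])
  also have "\<dots> = emeasure N A"
    by (subst nn_integral_N'[symmetric]) auto
  finally show "emeasure (distr N N (\<lambda>(z, \<rho>). (\<psi> g z, g \<otimes> \<rho>))) A = emeasure N A" .
qed simp

lemma ip_lshift:
  assumes g: "g \<in> carrier G" and f: "f \<in> L2 N" and h: "h \<in> L2 N"
  shows "ip N (\<lambda>(z, \<rho>). f (\<psi> g z, g \<otimes> \<rho>)) h = ip N f (\<lambda>(z, \<rho>). h (\<psi> (inv g) z, inv g \<otimes> \<rho>))"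
proof -
  let ?m = "\<lambda>(z, \<rho>). (\<psi> g z, g \<otimes> \<rho>)"
  have m: "?m \<in> measurable N N"
    unfolding measurable_N_iff using g by (auto simp: gms_measure_def intro!: measurable_Pair)
  let ?h = "\<lambda>(z, \<rho>). h (\<psi> (inv g) z, inv g \<otimes> \<rho>)"
  have [measurable]: "f \<in> borel_measurable N" "?h \<in> borel_measurable N"
    using f L2_N_lshift(1)[OF h, of "inv g"] g by (auto intro: L2_measurable)
  have "ip N f ?h = (LINT p|distr N N ?m. f p * cnj (?h p))"
    unfolding ip_def by (simp add: distr_lmap[OF g])
  also have "\<dots> = (LINT p|N. f (?m p) * cnj (?h (?m p)))"
    by (rule integral_distr[OF m]) measurable
  also have "\<dots> = ip N (\<lambda>(z, \<rho>). f (\<psi> g z, g \<otimes> \<rho>)) h"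
    unfolding ip_def by (rule Bochner_Integration.integral_cong)
      (use g in \<open>auto simp: space_N act_mult m_assoc[symmetric]\<close>)
  finally show ?thesis by simp
qed

lemma group_unitary_adj:
  assumes g: "g \<in> carrier G" shows "op_adj N (group_unitary G Y \<psi> g) = group_unitary G Y \<psi> (inv g)"
proof (rule op_adj_eqI)
  fix c d assume "c \<in> l2 N" "d \<in> l2 N"
  then obtain f h where f: "f \<in> L2 N" "c = ae_class N f" and h: "h \<in> L2 N" "d = ae_class N h"
    by (metis l2_cases)
  show "l2_inner N (group_unitary G Y \<psi> g c) d = l2_inner N c (group_unitary G Y \<psi> (inv g) d)"
    using f h g ip_lshift[of "inv g" f h]
    by (simp add: group_unitary_apply l2_inner_ae_class L2_N_lshift)
qed (use g in \<open>auto intro: group_unitary_bounded\<close>)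

lemma mult_op_cong: "AE z in Y. a z = b z \<Longrightarrow> mult_op G Y a = mult_op G Y b"
  unfolding mult_op_def
  by (intro restrict_ext ae_class_cong) (auto simp: AE_N_iff)

section \<open>The crossed product, its commutant and coefficients\<close>

definition gens :: "('y \<times> 'g) l2op set" where
  "gens = Linf G Y \<union> group_unitary G Y \<psi> ` carrier G"

lemma gens_bounded: "gens \<subseteq> bounded_ops N"
  by (auto simp: gens_def Linf_eq mult_op_bounded group_unitary_bounded)

lemma gens_adj: "gens \<union> op_adj N ` gens = gens"
  by (auto simp: gens_def Linf_eq mult_op_adj group_unitary_adj bdd_cnj)

lemma unitaries_adj_closed: "group_unitary G Y \<psi> ` carrier G \<union> op_adj N ` group_unitary G Y \<psi> ` carrier G = group_unitary G Y \<psi> ` carrier G"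
  by (auto simp: group_unitary_adj)

lemma crossed_product_eq: "crossed_product G Y \<psi> = commutant N (commutant N gens)"
  by (simp add: crossed_product_def vN_generated_def gens_def[symmetric] gens_adj)

lemma group_vN_eq: "group_vN G Y \<psi> = commutant N (commutant N (group_unitary G Y \<psi> ` carrier G))"
  by (simp add: group_vN_def vN_generated_def unitaries_adj_closed)

lemma crossed_product_gens: "crossed_product G Y \<psi> = vN_generated N gens"
  by (simp add: crossed_product_def gens_def)

lemma crossed_product_bounded [simp]: "T \<in> crossed_product G Y \<psi> \<Longrightarrow> T \<in> bounded_ops N"
  by (simp add: crossed_product_eq commutant_bounded)

lemma group_vN_subset: "group_vN G Y \<psi> \<subseteq> crossed_product G Y \<psi>"
  unfolding crossed_product_def group_vN_def by (rule vN_generated_mono) auto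

lemma mult_op_crossed [simp]: "bdd a \<Longrightarrow> mult_op G Y a \<in> crossed_product G Y \<psi>"
  using vN_generated_superset[OF gens_bounded] by (auto simp: crossed_product_gens gens_def Linf_eq)

lemma group_unitary_group_vN [simp]: "g \<in> carrier G \<Longrightarrow> group_unitary G Y \<psi> g \<in> group_vN G Y \<psi>"
proof -
  have "group_unitary G Y \<psi> ` carrier G \<subseteq> bounded_ops N" using group_unitary_bounded by blast
  from vN_generated_superset[OF this] show "g \<in> carrier G \<Longrightarrow> group_unitary G Y \<psi> g \<in> group_vN G Y \<psi>"
    by (auto simp: group_vN_def)
qed

lemma group_unitary_crossed [simp]: "g \<in> carrier G \<Longrightarrow> group_unitary G Y \<psi> g \<in> crossed_product G Y \<psi>"
  using group_vN_subset group_unitary_group_vN by blast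

lemma crossed_product_mult [simp]: "S \<in> crossed_product G Y \<psi> \<Longrightarrow> T \<in> crossed_product G Y \<psi> \<Longrightarrow> op_mult N S T \<in> crossed_product G Y \<psi>"
  unfolding crossed_product_gens by (rule vN_generated_mult)

lemma crossed_product_adj [simp]: "T \<in> crossed_product G Y \<psi> \<Longrightarrow> op_adj N T \<in> crossed_product G Y \<psi>"
  unfolding crossed_product_gens by (rule vN_generated_adj[OF gens_bounded])

lemma crossed_product_one [simp]: "op_one N \<in> crossed_product G Y \<psi>"
  unfolding crossed_product_gens by (rule vN_generated_one)

lemma crossed_product_scale [simp]: "T \<in> crossed_product G Y \<psi> \<Longrightarrow> op_scale N z T \<in> crossed_product G Y \<psi>"
  unfolding crossed_product_gens by (rule vN_generated_scale)

lemma group_vN_mult [simp]: "S \<in> group_vN G Y \<psi> \<Longrightarrow> T \<in> group_vN G Y \<psi> \<Longrightarrow> op_mult N S T \<in> group_vN G Y \<psi>"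
  unfolding group_vN_def by (rule vN_generated_mult)

lemma group_vN_add: "S \<in> group_vN G Y \<psi> \<Longrightarrow> T \<in> group_vN G Y \<psi> \<Longrightarrow> op_add N S T \<in> group_vN G Y \<psi>"
  unfolding group_vN_def by (rule vN_generated_add)

lemma group_vN_scale: "T \<in> group_vN G Y \<psi> \<Longrightarrow> op_scale N z T \<in> group_vN G Y \<psi>"
  unfolding group_vN_def by (rule vN_generated_scale)

lemma group_vN_adj [simp]: "T \<in> group_vN G Y \<psi> \<Longrightarrow> op_adj N T \<in> group_vN G Y \<psi>"
  unfolding group_vN_def by (rule vN_generated_adj) (auto simp: group_unitary_bounded)

text \<open>The point \<rho>^-1 z is unchanged when z and \<rho> are both translated on the left by
  the same group element; therefore a function of it commutes with the group unitaries as well as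
  with multiplications.\<close>

lemma rmult_op_commutant:
  assumes b: "bdd b" shows "rmult_op b \<in> commutant N gens"
proof -
  have "op_mult N S (rmult_op b) = op_mult N (rmult_op b) S" if "S \<in> gens" for S
  proof (rule op_mult_commI)
    show "S \<in> bounded_ops N" using that gens_bounded by blast
    show "rmult_op b \<in> bounded_ops N" by (rule rmult_op_bounded[OF b])
    fix f assume f: "f \<in> L2 N"
    consider a where "bdd a" "S = mult_op G Y a" | g where "g \<in> carrier G" "S = group_unitary G Y \<psi> g"
      using \<open>S \<in> gens\<close> by (auto simp: gens_def Linf_eq)
    then show "S (rmult_op b (ae_class N f)) = rmult_op b (S (ae_class N f))"
    proof cases
      case 1
      then show ?thesis using f b mult_op_L2[of a f] rmult_op_L2[of b f]
        by (auto simp: mult_op_apply rmult_op_apply intro!: ae_class_cong AE_I2)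
    next
      case 2
      then show ?thesis using f b L2_N_lshift(1)[of f "inv g"] rmult_op_L2[of b f]
        by (auto simp: group_unitary_apply rmult_op_apply space_N act_mult inv_mult_group m_assoc intro!: ae_class_cong AE_I2)
    qed
  qed
  then show ?thesis using rmult_op_bounded[OF b] by (simp add: commutant_def)
qed

lemma rshift_op_commutant:
  assumes \<mu>: "\<mu> \<in> carrier G" shows "rshift_op \<mu> \<in> commutant N gens"
proof -
  have "op_mult N S (rshift_op \<mu>) = op_mult N (rshift_op \<mu>) S" if "S \<in> gens" for S
  proof (rule op_mult_commI)
    show "S \<in> bounded_ops N" using that gens_bounded by blast
    show "rshift_op \<mu> \<in> bounded_ops N" by (rule rshift_op_bounded[OF \<mu>])
    fix f assume f: "f \<in> L2 N"
    consider a where "bdd a" "S = mult_op G Y a" | g where "g \<in> carrier G" "S = group_unitary G Y \<psi> g"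
      using \<open>S \<in> gens\<close> by (auto simp: gens_def Linf_eq)
    then show "S (rshift_op \<mu> (ae_class N f)) = rshift_op \<mu> (S (ae_class N f))"
    proof cases
      case 1
      then show ?thesis using f \<mu> mult_op_L2[of a f] L2_N_rshift(1)[of f \<mu>]
        by (auto simp: mult_op_apply rshift_op_apply intro!: ae_class_cong AE_I2)
    next
      case 2
      then show ?thesis using f \<mu> L2_N_lshift(1)[of f "inv g"] L2_N_rshift(1)[of f \<mu>]
        by (auto simp: group_unitary_apply rshift_op_apply space_N m_assoc intro!: ae_class_cong AE_I2)
    qed
  qed
  then show ?thesis using rshift_op_bounded[OF \<mu>] by (simp add: commutant_def)
qed

definition delta :: "'g \<Rightarrow> 'y \<times> 'g \<Rightarrow> complex" where
  "delta \<mu> = (\<lambda>(z, \<rho>). if \<rho> = \<mu> then 1 else 0)"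

text \<open>The elementary tensor of \<open>f\<close> with the point mass at \<mu>. For bounded
  \<open>f\<close> these vectors span a dense subspace, and convolving any kernel with one of them
  involves a single term.\<close>

definition nice :: "('y \<Rightarrow> complex) \<Rightarrow> 'g \<Rightarrow> 'y \<times> 'g \<Rightarrow> complex" where
  "nice f \<mu> = (\<lambda>(z, \<rho>). if \<rho> = \<mu> then f z else 0)"

text \<open>The coefficients of \<open>T = \<Sum>\<^sub>\<sigma> k(\<cdot>,\<sigma>) v\<^sub>\<sigma>\<close> are read off from \<open>T(1 \<otimes> \<delta>\<^sub>1)\<close>.\<close>

definition kern :: "('y \<times> 'g) l2op \<Rightarrow> 'y \<times> 'g \<Rightarrow> complex" where
  "kern T = rep (T (ae_class N (delta \<one>)))"

lemma bdd_integrable_sq: assumes "bdd f" shows "integrable Y (\<lambda>z. (cmod (f z))\<^sup>2)"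
proof -
  obtain K where K: "AE z in Y. cmod (f z) \<le> K" using assms by (auto simp: bdd_def)
  have [measurable]: "f \<in> borel_measurable Y" using assms by (simp add: bdd_def)
  have "AE z in Y. norm ((cmod (f z))\<^sup>2) \<le> K\<^sup>2" using K by eventually_elim (auto intro: power_mono)
  then show ?thesis by (rule integrable_const_bound) auto
qed

lemma nice_L2: assumes "f \<in> L2 Y" "\<mu> \<in> carrier G" shows "nice f \<mu> \<in> L2 N"
proof -
  have [measurable]: "f \<in> borel_measurable Y" using assms by (simp add: L2_def)
  have [measurable]: "nice f \<mu> \<in> borel_measurable N" by (simp add: measurable_N_iff nice_def)
  have "(\<integral>\<^sup>+p. ennreal ((cmod (nice f \<mu> p))\<^sup>2) \<partial>N) = (\<integral>\<^sup>+z. (\<integral>\<^sup>+\<rho>. ennreal ((cmod (f z))\<^sup>2) * indicator {\<mu>} \<rho> \<partial>C) \<partial>Y)"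
    by (subst nn_integral_N, measurable) (auto simp: nice_def intro!: nn_integral_cong split: split_indicator)
  also have "\<dots> = (\<integral>\<^sup>+z. ennreal ((cmod (f z))\<^sup>2) \<partial>Y)"
    using assms(2) by (simp add: nn_integral_cmult)
  also have "\<dots> < \<infinity>" using assms(1) by (simp add: L2_iff_nn_integral)
  finally show ?thesis by (simp add: L2_iff_nn_integral)
qed

lemma bdd_L2: "bdd f \<Longrightarrow> f \<in> L2 Y"
  by (simp add: L2_def bdd_integrable_sq bdd_measurable)

lemma delta_nice: "delta \<mu> = nice (\<lambda>z. 1) \<mu>"
  by (simp add: delta_def nice_def)

lemma delta_L2 [simp]: "\<mu> \<in> carrier G \<Longrightarrow> delta \<mu> \<in> L2 N"
  unfolding delta_nice by (intro nice_L2 bdd_L2) auto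

lemma kern_L2 [simp]: "T \<in> bounded_ops N \<Longrightarrow> kern T \<in> L2 N"
  unfolding kern_def by simp

lemma ae_class_kern: "T \<in> bounded_ops N \<Longrightarrow> ae_class N (kern T) = T (ae_class N (delta \<one>))"
  unfolding kern_def by simp

lemma kern_unique: "T \<in> bounded_ops N \<Longrightarrow> T (ae_class N (delta \<one>)) = ae_class N k \<Longrightarrow> AE p in N. kern T p = k p"
  using ae_class_kern[of T] kern_L2[of T] by (intro ae_class_eqD) (auto intro: L2_measurable)

text \<open>Cyclicity of \<open>delta \<one>\<close> for the commutant, in concrete form. It makes
  an element of the crossed product recoverable from its value at this one vector.\<close>

lemma nice_eq_right_ops:
  assumes f: "bdd f" and \<mu>: "\<mu> \<in> carrier G"
  shows "ae_class N (nice f \<mu>) = rmult_op (\<lambda>z. f (\<psi> \<mu> z)) (rshift_op (inv \<mu>) (ae_class N (delta \<one>)))"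
proof -
  have "\<rho> = \<mu> \<longleftrightarrow> \<rho> \<otimes> inv \<mu> = \<one>" if "\<rho> \<in> carrier G" for \<rho>
    using that \<mu> by (auto simp: inv_solve_right')
  note eq = this
  have "rmult_op (\<lambda>z. f (\<psi> \<mu> z)) (rshift_op (inv \<mu>) (ae_class N (delta \<one>)))
    = ae_class N (\<lambda>(z, \<rho>). f (\<psi> \<mu> (\<psi> (inv \<rho>) z)) * delta \<one> (z, \<rho> \<otimes> inv \<mu>))"
    using \<mu> L2_N_rshift(1)[OF delta_L2[OF one_closed], of "inv \<mu>"] by (simp add: rshift_op_apply rmult_op_apply)
  also have "\<dots> = ae_class N (nice f \<mu>)"
    using \<mu> by (intro ae_class_cong AE_I2) (auto simp: delta_def nice_def space_N act_mult eq[symmetric])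
  finally show ?thesis by simp
qed

text \<open>\<open>T\<close> commutes with the right-hand operators of
  \<open>nice_eq_right_ops\<close>, so its value here is obtained by applying them to
  \<open>kern T\<close>; the outcome is the one surviving term of the convolution.\<close>

lemma crossed_apply_nice:
  assumes T: "T \<in> crossed_product G Y \<psi>" and f: "bdd f" and \<mu>: "\<mu> \<in> carrier G"
  shows "T (ae_class N (nice f \<mu>)) = ae_class N (conv (kern T) (nice f \<mu>))"
proof -
  note b = crossed_product_bounded[OF T]
  have f': "bdd (\<lambda>z. f (\<psi> \<mu> z))" by (rule bdd_act[OF f \<mu>])
  have comm: "T (R c) = R (T c)" if "R \<in> commutant N gens" "c \<in> l2 N" for R c
  proof -
    have "op_mult N R T c = op_mult N T R c"
      using T commutantD[of T N "commutant N gens" R] that(1) by (simp add: crossed_product_eq)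
    then show ?thesis using that(2) by simp
  qed
  have k: "kern T \<in> L2 N" using b by simp
  have "T (ae_class N (nice f \<mu>)) = rmult_op (\<lambda>z. f (\<psi> \<mu> z)) (rshift_op (inv \<mu>) (ae_class N (kern T)))"
    unfolding nice_eq_right_ops[OF f \<mu>] ae_class_kern[OF b] using \<mu> f'
    by (simp add: comm rmult_op_commutant rshift_op_commutant rshift_op_bounded)
  also have "\<dots> = ae_class N (\<lambda>(z, \<rho>). f (\<psi> \<mu> (\<psi> (inv \<rho>) z)) * kern T (z, \<rho> \<otimes> inv \<mu>))"
    using \<mu> k L2_N_rshift(1)[OF k, of "inv \<mu>"] by (simp add: rshift_op_apply rmult_op_apply)
  also have "\<dots> = ae_class N (conv (kern T) (nice f \<mu>))"
  proof (rule ae_class_cong, rule AE_I2, clarsimp simp: space_N)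
    fix z \<rho> assume z: "z \<in> space Y" and \<rho>: "\<rho> \<in> carrier G"
    have "conv (kern T) (nice f \<mu>) (z, \<rho>) = kern T (z, \<rho> \<otimes> inv \<mu>) * nice f \<mu> (\<psi> (inv (\<rho> \<otimes> inv \<mu>)) z, \<mu>)"
      unfolding conv_apply'[OF \<rho>] by (rule integral_C_single[OF \<mu>]) (simp add: nice_def)
    then show "f (\<psi> \<mu> (\<psi> (inv \<rho>) z)) * kern T (z, \<rho> \<otimes> inv \<mu>) = conv (kern T) (nice f \<mu>) (z, \<rho>)"
      using z \<rho> \<mu> by (simp add: nice_def act_mult inv_mult_group)
  qed
  finally show ?thesis .
qed

end

section \<open>Coefficients of elements of the crossed product\<close>

text \<open>This extracts square integrability of a convolution from boundedness of the operator it
  computes, where no direct estimate is available.\<close>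

lemma ae_class_l2D:
  assumes "ae_class M f \<in> l2 M" "f \<in> borel_measurable M" shows "f \<in> L2 M"
proof -
  obtain g where g: "g \<in> L2 M" "ae_class M f = ae_class M g"
    by (rule l2_cases[OF assms(1)])
  have "AE x in M. g x = f x" by (rule ae_class_eqD[OF g(2)[symmetric] L2_measurable[OF g(1)]])
  with g(1) assms(2) show ?thesis by (rule L2_cong_AE(1))
qed

lemma sqn_dominated_limit:
  assumes f: "f \<in> L2 M" and [measurable]: "\<And>n. g n \<in> borel_measurable M"
    and le: "\<And>n x. x \<in> space M \<Longrightarrow> cmod (g n x) \<le> cmod (f x)"
    and lim: "\<And>x. x \<in> space M \<Longrightarrow> (\<lambda>n. g n x) \<longlonglongrightarrow> 0"
  shows "(\<lambda>n. sqn M (g n)) \<longlonglongrightarrow> 0"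
proof -
  have [measurable]: "f \<in> borel_measurable M" using f by (rule L2_measurable)
  have "(\<lambda>n. LINT x|M. (cmod (g n x))\<^sup>2) \<longlonglongrightarrow> (LINT x|M. (0::real))"
  proof (rule integral_dominated_convergence[where w="\<lambda>x. (cmod (f x))\<^sup>2"])
    show "AE x in M. (\<lambda>n. (cmod (g n x))\<^sup>2) \<longlonglongrightarrow> 0"
    proof (rule AE_I2)
      fix x assume "x \<in> space M"
      from tendsto_power[OF tendsto_norm[OF lim[OF this]], of 2]
      show "(\<lambda>n. (cmod (g n x))\<^sup>2) \<longlonglongrightarrow> 0" by simp
    qed
    show "AE x in M. norm ((cmod (g n x))\<^sup>2) \<le> (cmod (f x))\<^sup>2" for n
      using le by (auto intro!: AE_I2 power_mono)
  qed (auto simp: L2_integrable[OF f])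
  then show ?thesis by (simp add: sqn_def)
qed

context gms
begin

lemma conv_add:
  assumes "k \<in> L2 N" "f \<in> L2 N" "g \<in> L2 N"
  shows "AE p in N. conv k (\<lambda>p. f p + g p) p = conv k f p + conv k g p"
  using conv_integrable[OF assms(1,2)] conv_integrable[OF assms(1,3)] unfolding AE_N_iff
  by eventually_elim (auto simp: conv_apply distrib_left)

text \<open>The truncation bounds both the number of group coordinates and the size of the values,
  so it is a finite sum of \<open>nice\<close> vectors with bounded functions. Summing over the
  image of the enumeration, not over indices, prevents repeated elements of a finite group from
  being counted several times.\<close>

definition trunc :: "nat \<Rightarrow> ('y \<times> 'g \<Rightarrow> complex) \<Rightarrow> 'y \<times> 'g \<Rightarrow> complex" where
  "trunc n \<xi> = (\<lambda>(z, \<rho>). \<Sum>\<mu>\<in>from_nat_into (carrier G) ` {..n}.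
     nice (\<lambda>z. if cmod (\<xi> (z, \<mu>)) \<le> real n then \<xi> (z, \<mu>) else 0) \<mu> (z, \<rho>))"

lemma trunc_eq: "trunc n \<xi> (z, \<rho>) =
  (if \<rho> \<in> from_nat_into (carrier G) ` {..n} \<and> cmod (\<xi> (z, \<rho>)) \<le> real n then \<xi> (z, \<rho>) else 0)"
proof (cases "\<rho> \<in> from_nat_into (carrier G) ` {..n}")
  case True
  then show ?thesis unfolding trunc_def nice_def
    by (simp add: sum.delta) 
next
  case False
  then show ?thesis unfolding trunc_def nice_def by (auto intro!: sum.neutral)
qed

lemma from_nat_into_carrier [simp]: "from_nat_into (carrier G) n \<in> carrier G"
  by (rule from_nat_into) auto

lemma trunc_le: "cmod (trunc n \<xi> p) \<le> cmod (\<xi> p)"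
  by (cases p) (simp add: trunc_eq)

lemma trunc_tendsto:
  assumes "\<rho> \<in> carrier G" shows "(\<lambda>n. trunc n \<xi> (z, \<rho>)) \<longlonglongrightarrow> \<xi> (z, \<rho>)"
proof -
  obtain m where m: "\<rho> = from_nat_into (carrier G) m"
    using from_nat_into_surj[OF countable_carrier assms] by metis
  obtain l :: nat where l: "cmod (\<xi> (z, \<rho>)) \<le> l" using real_arch_simple by blast
  have "trunc n \<xi> (z, \<rho>) = \<xi> (z, \<rho>)" if "n \<ge> max m l" for n
    using that m l by (auto simp: trunc_eq)
  then have "\<forall>\<^sub>F n in sequentially. trunc n \<xi> (z, \<rho>) = \<xi> (z, \<rho>)"
    unfolding eventually_sequentially by blast
  then show ?thesis by (rule tendsto_eventually)
qed

lemma trunc_measurable: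
  assumes [measurable]: "\<xi> \<in> borel_measurable N" shows "trunc n \<xi> \<in> borel_measurable N"
  unfolding measurable_N_iff trunc_eq by measurable

lemma trunc_tendsto_L2:
  assumes "\<xi> \<in> L2 N" shows "(\<lambda>n. sqn N (\<lambda>p. \<xi> p - trunc n \<xi> p)) \<longlonglongrightarrow> 0"
proof (rule sqn_dominated_limit[OF assms])
  have [measurable]: "\<xi> \<in> borel_measurable N" using assms by (rule L2_measurable)
  show "(\<lambda>p. \<xi> p - trunc n \<xi> p) \<in> borel_measurable N" for n
    using trunc_measurable[of \<xi> n] by measurable
  fix p assume "p \<in> space N"
  then obtain z \<rho> where p: "p = (z, \<rho>)" "\<rho> \<in> carrier G" by (auto simp: space_N)
  show "cmod (\<xi> p - trunc n \<xi> p) \<le> cmod (\<xi> p)" for n unfolding p by (simp add: trunc_eq)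
  show "(\<lambda>n. \<xi> p - trunc n \<xi> p) \<longlonglongrightarrow> 0"
    using tendsto_diff[OF tendsto_const[of "\<xi> p"] trunc_tendsto[OF p(2), of \<xi> z]] p by simp
qed

lemma crossed_apply_trunc:
  assumes T: "T \<in> crossed_product G Y \<psi>" and \<xi>: "\<xi> \<in> L2 N"
  shows "trunc n \<xi> \<in> L2 N \<and> T (ae_class N (trunc n \<xi>)) = ae_class N (conv (kern T) (trunc n \<xi>))"
proof -
  note b = crossed_product_bounded[OF T]
  have k: "kern T \<in> L2 N" using b by simp
  have [measurable]: "\<xi> \<in> borel_measurable N" using \<xi> by (rule L2_measurable)
  define h where "h \<mu> z = (if cmod (\<xi> (z, \<mu>)) \<le> real n then \<xi> (z, \<mu>) else 0)" for \<mu> z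
  have h: "bdd (h \<mu>)" if "\<mu> \<in> carrier G" for \<mu>
  proof (rule bddI)
    show "h \<mu> \<in> borel_measurable Y" unfolding h_def using that by measurable
    show "AE z in Y. cmod (h \<mu> z) \<le> real n" by (auto simp: h_def)
  qed
  have sums: "(\<lambda>p. \<Sum>\<mu>\<in>F. nice (h \<mu>) \<mu> p) \<in> L2 N \<and>
      T (ae_class N (\<lambda>p. \<Sum>\<mu>\<in>F. nice (h \<mu>) \<mu> p)) = ae_class N (conv (kern T) (\<lambda>p. \<Sum>\<mu>\<in>F. nice (h \<mu>) \<mu> p))"
    if "finite F" "F \<subseteq> carrier G" for F
    using that
  proof (induction F)
    case empty
    have "l2_scale N 0 (ae_class N (\<lambda>p. 0)) = ae_class N (\<lambda>p. 0)" by (simp add: l2_scale_ae_class)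
    then have "T (ae_class N (\<lambda>p. 0)) = l2_scale N 0 (T (ae_class N (\<lambda>p. 0)))"
      using bounded_ops_scale[OF b, of "ae_class N (\<lambda>p. 0)" 0] by simp
    also have "\<dots> = ae_class N (\<lambda>p. 0)" by (simp add: l2_scale_def)
    finally show ?case by (auto simp: conv_def intro!: ae_class_cong)
  next
    case (insert \<mu> F)
    let ?s = "\<lambda>p. \<Sum>\<mu>\<in>F. nice (h \<mu>) \<mu> p"
    have s: "?s \<in> L2 N" "T (ae_class N ?s) = ae_class N (conv (kern T) ?s)" using insert by auto
    have n: "nice (h \<mu>) \<mu> \<in> L2 N" using insert h by (intro nice_L2 bdd_L2) auto
    have Tn: "T (ae_class N (nice (h \<mu>) \<mu>)) = ae_class N (conv (kern T) (nice (h \<mu>) \<mu>))"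
      using insert h by (intro crossed_apply_nice[OF T]) auto
    have [measurable]: "?s \<in> borel_measurable N" "nice (h \<mu>) \<mu> \<in> borel_measurable N" "kern T \<in> borel_measurable N"
      using s n k by (auto intro: L2_measurable)
    have c: "conv (kern T) ?s \<in> L2 N" "conv (kern T) (nice (h \<mu>) \<mu>) \<in> L2 N"
      using bounded_ops_l2[OF b ae_class_l2[OF s(1)]] bounded_ops_l2[OF b ae_class_l2[OF n]]
      unfolding s(2) Tn by (auto intro!: ae_class_l2D)
    have "T (ae_class N (\<lambda>p. nice (h \<mu>) \<mu> p + ?s p)) = ae_class N (\<lambda>p. conv (kern T) (nice (h \<mu>) \<mu>) p + conv (kern T) ?s p)"
      using s n c Tn by (simp add: l2_add_ae_class[symmetric] bounded_ops_add[OF b])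
    also have "\<dots> = ae_class N (conv (kern T) (\<lambda>p. nice (h \<mu>) \<mu> p + ?s p))"
      using conv_add[OF k n s(1)] by (intro ae_class_cong) auto
    finally show ?case using insert n s(1) by (simp add: L2_add)
  qed
  have "from_nat_into (carrier G) ` {..n} \<subseteq> carrier G" by auto
  note sums[OF finite_imageI[OF finite_atMost] this]
  moreover have "trunc n \<xi> = (\<lambda>p. \<Sum>\<mu>\<in>from_nat_into (carrier G) ` {..n}. nice (h \<mu>) \<mu> p)"
    by (auto simp: trunc_def h_def[abs_def])
  ultimately show ?thesis by simp
qed

text \<open>The formula is known on truncations. Along them the left side converges in norm because
  \<open>T\<close> is bounded, the right side pointwise because the convolution series is dominated;
  Fatou's lemma shows that both limits agree. No bound for convolution by \<open>kern T\<close> is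
  presupposed.\<close>

theorem crossed_apply:
  assumes T: "T \<in> crossed_product G Y \<psi>" and \<xi>: "\<xi> \<in> L2 N"
  shows "T (ae_class N \<xi>) = ae_class N (conv (kern T) \<xi>)"
proof -
  note b = crossed_product_bounded[OF T]
  have k: "kern T \<in> L2 N" using b by simp
  have [measurable]: "\<xi> \<in> borel_measurable N" "kern T \<in> borel_measurable N" "trunc n \<xi> \<in> borel_measurable N" for n
    using \<xi> k by (auto intro: L2_measurable trunc_measurable)
  define \<eta> where "\<eta> = rep (T (ae_class N \<xi>))"
  have \<eta>: "\<eta> \<in> L2 N" "ae_class N \<eta> = T (ae_class N \<xi>)" using b \<xi> by (auto simp: \<eta>_def)
  have [measurable]: "\<eta> \<in> borel_measurable N" using \<eta>(1) by (rule L2_measurable)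
  obtain K where K: "0 \<le> K" "\<And>c. c \<in> l2 N \<Longrightarrow> l2_norm N (T c) \<le> K * l2_norm N c"
    by (rule bounded_ops_bound[OF b]) blast
  have t: "trunc n \<xi> \<in> L2 N" "T (ae_class N (trunc n \<xi>)) = ae_class N (conv (kern T) (trunc n \<xi>))" for n
    using crossed_apply_trunc[OF T \<xi>] by auto
  have c: "conv (kern T) (trunc n \<xi>) \<in> L2 N" for n
    using bounded_ops_l2[OF b ae_class_l2[OF t(1)]] unfolding t(2) by (auto intro!: ae_class_l2D)
  have bnd: "sqn N (\<lambda>p. \<eta> p - conv (kern T) (trunc n \<xi>) p) \<le> K\<^sup>2 * sqn N (\<lambda>p. \<xi> p - trunc n \<xi> p)" for n
  proof -
    have d: "(\<lambda>p. \<xi> p - trunc n \<xi> p) \<in> L2 N" by (intro L2_diff \<xi> t)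
    have "ae_class N (\<lambda>p. \<xi> p - trunc n \<xi> p) = l2_add N (ae_class N \<xi>) (l2_scale N (-1) (ae_class N (trunc n \<xi>)))"
      using \<xi> t by (simp add: l2_scale_ae_class l2_add_ae_class L2_scale[of _ _ "-1", simplified])
    then have "T (ae_class N (\<lambda>p. \<xi> p - trunc n \<xi> p)) = l2_add N (T (ae_class N \<xi>)) (l2_scale N (-1) (T (ae_class N (trunc n \<xi>))))"
      using \<xi> t by (simp add: bounded_ops_add[OF b] bounded_ops_scale[OF b])
    also have "\<dots> = ae_class N (\<lambda>p. \<eta> p - conv (kern T) (trunc n \<xi>) p)"
      unfolding t(2) \<eta>(2)[symmetric] using \<eta>(1) c by (simp add: l2_scale_ae_class l2_add_ae_class L2_scale[of _ _ "-1", simplified])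
    finally have "sqrt (sqn N (\<lambda>p. \<eta> p - conv (kern T) (trunc n \<xi>) p)) \<le> K * sqrt (sqn N (\<lambda>p. \<xi> p - trunc n \<xi> p))"
      using K(2)[OF ae_class_l2[OF d]] \<eta>(1) c by (simp add: l2_norm_ae_class d L2_diff)
    then have "(sqrt (sqn N (\<lambda>p. \<eta> p - conv (kern T) (trunc n \<xi>) p)))\<^sup>2 \<le> (K * sqrt (sqn N (\<lambda>p. \<xi> p - trunc n \<xi> p)))\<^sup>2"
      by (rule power_mono) simp
    then show ?thesis by (simp add: power_mult_distrib)
  qed
  \<comment> \<open>Truncation only decreases absolute values, so the terms of the full series at
    \<open>\<xi>\<close>, summable by \<open>conv_integrable\<close>, dominate.\<close>
  have lim: "AE p in N. (\<lambda>n. conv (kern T) (trunc n \<xi>) p) \<longlonglongrightarrow> conv (kern T) \<xi> p"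
    unfolding AE_N_iff using conv_integrable[OF k \<xi>] AE_space
  proof eventually_elim
    fix z assume i: "\<forall>\<rho>\<in>carrier G. integrable C (\<lambda>\<sigma>. kern T (z, \<sigma>) * \<xi> (\<psi> (inv \<sigma>) z, inv \<sigma> \<otimes> \<rho>))"
    show "\<forall>\<rho>\<in>carrier G. (\<lambda>n. conv (kern T) (trunc n \<xi>) (z, \<rho>)) \<longlonglongrightarrow> conv (kern T) \<xi> (z, \<rho>)"
    proof
      fix \<rho> assume \<rho>: "\<rho> \<in> carrier G"
      show "(\<lambda>n. conv (kern T) (trunc n \<xi>) (z, \<rho>)) \<longlonglongrightarrow> conv (kern T) \<xi> (z, \<rho>)"
        unfolding conv_apply
      proof (rule integral_dominated_convergence[where w="\<lambda>\<sigma>. norm (kern T (z, \<sigma>) * \<xi> (\<psi> (inv \<sigma>) z, inv \<sigma> \<otimes> \<rho>))"])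
        show "integrable C (\<lambda>\<sigma>. norm (kern T (z, \<sigma>) * \<xi> (\<psi> (inv \<sigma>) z, inv \<sigma> \<otimes> \<rho>)))"
          using i \<rho> by (intro integrable_norm) auto
        show "AE \<sigma> in C. (\<lambda>n. kern T (z, \<sigma>) * trunc n \<xi> (\<psi> (inv \<sigma>) z, inv \<sigma> \<otimes> \<rho>))
            \<longlonglongrightarrow> kern T (z, \<sigma>) * \<xi> (\<psi> (inv \<sigma>) z, inv \<sigma> \<otimes> \<rho>)"
          using \<rho> by (auto simp: AE_count_space intro!: tendsto_mult trunc_tendsto)
        show "AE \<sigma> in C. norm (kern T (z, \<sigma>) * trunc n \<xi> (\<psi> (inv \<sigma>) z, inv \<sigma> \<otimes> \<rho>))
            \<le> norm (kern T (z, \<sigma>) * \<xi> (\<psi> (inv \<sigma>) z, inv \<sigma> \<otimes> \<rho>))" for n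
          by (auto simp: norm_mult intro!: mult_left_mono trunc_le)
      qed auto
    qed
  qed
  have "(\<integral>\<^sup>+p. ennreal ((cmod (\<eta> p - conv (kern T) \<xi> p))\<^sup>2) \<partial>N)
      = (\<integral>\<^sup>+p. liminf (\<lambda>n. ennreal ((cmod (\<eta> p - conv (kern T) (trunc n \<xi>) p))\<^sup>2)) \<partial>N)"
  proof (rule nn_integral_cong_AE, use lim in eventually_elim)
    fix p assume "(\<lambda>n. conv (kern T) (trunc n \<xi>) p) \<longlonglongrightarrow> conv (kern T) \<xi> p"
    then have "(\<lambda>n. ennreal ((cmod (\<eta> p - conv (kern T) (trunc n \<xi>) p))\<^sup>2)) \<longlonglongrightarrow> ennreal ((cmod (\<eta> p - conv (kern T) \<xi> p))\<^sup>2)"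
      by (intro tendsto_intros)
    then show "ennreal ((cmod (\<eta> p - conv (kern T) \<xi> p))\<^sup>2) = liminf (\<lambda>n. ennreal ((cmod (\<eta> p - conv (kern T) (trunc n \<xi>) p))\<^sup>2))"
      using lim_imp_Liminf[OF trivial_limit_sequentially] by metis
  qed
  also have "\<dots> \<le> liminf (\<lambda>n. \<integral>\<^sup>+p. ennreal ((cmod (\<eta> p - conv (kern T) (trunc n \<xi>) p))\<^sup>2) \<partial>N)"
    by (rule nn_integral_liminf) auto
  also have "\<dots> \<le> liminf (\<lambda>n. ennreal (K\<^sup>2 * sqn N (\<lambda>p. \<xi> p - trunc n \<xi> p)))"
    by (intro Liminf_mono always_eventually allI)
      (subst nn_integral_eq_sqn, auto intro!: L2_diff \<eta> c ennreal_leI bnd)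
  also have "(\<lambda>n. ennreal (K\<^sup>2 * sqn N (\<lambda>p. \<xi> p - trunc n \<xi> p))) \<longlonglongrightarrow> ennreal (K\<^sup>2 * 0)"
    by (intro tendsto_ennrealI tendsto_mult tendsto_const trunc_tendsto_L2 \<xi>)
  then have "liminf (\<lambda>n. ennreal (K\<^sup>2 * sqn N (\<lambda>p. \<xi> p - trunc n \<xi> p))) = 0"
    using lim_imp_Liminf[OF trivial_limit_sequentially] by fastforce
  finally have "AE p in N. \<eta> p = conv (kern T) \<xi> p"
    by (simp add: nn_integral_0_iff_AE)
  then have "ae_class N \<eta> = ae_class N (conv (kern T) \<xi>)" by (rule ae_class_cong)
  then show ?thesis using \<eta>(2) by simp
qed

lemma conv_kern_L2:
  assumes T: "T \<in> crossed_product G Y \<psi>" and \<xi>: "\<xi> \<in> L2 N" shows "conv (kern T) \<xi> \<in> L2 N"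
proof (rule ae_class_l2D)
  show "ae_class N (conv (kern T) \<xi>) \<in> l2 N"
    unfolding crossed_apply[OF T \<xi>, symmetric] using T \<xi> by simp
  show "conv (kern T) \<xi> \<in> borel_measurable N"
    using L2_measurable[OF \<xi>] L2_measurable[OF kern_L2[OF crossed_product_bounded[OF T]]]
    by (rule conv_measurable[rotated])
qed

text \<open>In other words, \<open>delta \<one>\<close> is a separating vector. Operator identities
  can from here on be verified coefficient by coefficient.\<close>

lemma crossed_eqI:
  assumes "S \<in> crossed_product G Y \<psi>" "T \<in> crossed_product G Y \<psi>" "AE p in N. kern S p = kern T p"
  shows "S = T"
proof (rule bounded_ops_eqI[of _ N])
  fix c assume "c \<in> l2 N"
  then obtain f where f: "f \<in> L2 N" "c = ae_class N f" by (metis l2_cases)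
  have "AE p in N. conv (kern S) f p = conv (kern T) f p" by (rule conv_cong_AE[OF assms(3)]) simp
  then show "S c = T c" using assms f by (simp add: crossed_apply ae_class_cong)
qed (use assms in auto)

lemma conv_cong_AE_left: "AE p in N. k p = k' p \<Longrightarrow> AE p in N. conv k \<xi> p = conv k' \<xi> p"
  by (rule conv_cong_AE) auto

lemma conv_cong_AE_right: "AE p in N. \<xi> p = \<xi>' p \<Longrightarrow> AE p in N. conv k \<xi> p = conv k \<xi>' p"
  by (rule conv_cong_AE) auto

lemma kern_mult:
  assumes "S \<in> crossed_product G Y \<psi>" "T \<in> crossed_product G Y \<psi>"
  shows "AE p in N. kern (op_mult N S T) p = conv (kern S) (kern T) p"
proof (rule kern_unique)
  have "kern T \<in> L2 N" using assms by simp
  then show "op_mult N S T (ae_class N (delta \<one>)) = ae_class N (conv (kern S) (kern T))"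
    using assms by (simp add: ae_class_kern[of T, symmetric] crossed_apply[of S])
qed (use assms in auto)

lemma kern_mult_op: "bdd a \<Longrightarrow> AE p in N. kern (mult_op G Y a) p = nice a \<one> p"
proof (rule kern_unique)
  show "mult_op G Y a (ae_class N (delta \<one>)) = ae_class N (nice a \<one>)"
    unfolding mult_op_apply[OF delta_L2[OF one_closed]] by (auto simp: delta_def nice_def intro!: ae_class_cong)
qed (rule mult_op_bounded)

lemma kern_group_unitary:
  assumes "g \<in> carrier G" shows "AE p in N. kern (group_unitary G Y \<psi> g) p = delta g p"
proof (rule kern_unique)
  have "group_unitary G Y \<psi> g (ae_class N (delta \<one>)) = ae_class N (\<lambda>(z, \<rho>). delta \<one> (\<psi> (inv g) z, inv g \<otimes> \<rho>))"
    using assms by (simp add: group_unitary_apply)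
  also have "\<dots> = ae_class N (delta g)"
    using assms by (intro ae_class_cong AE_I2) (auto simp: delta_def space_N inv_solve_left')
  finally show "group_unitary G Y \<psi> g (ae_class N (delta \<one>)) = ae_class N (delta g)" .
qed (use assms in \<open>auto simp: group_unitary_bounded\<close>)

lemma kern_one: "AE p in N. kern (op_one N) p = delta \<one> p"
  by (rule kern_unique) auto

lemma kern_scale: 
  assumes "T \<in> bounded_ops N" shows "AE p in N. kern (op_scale N c T) p = c * kern T p"
  by (rule kern_unique) (use assms in \<open>auto simp: op_scale_apply ae_class_kern[of T, symmetric] l2_scale_ae_class\<close>)

lemma op_add_apply: "c \<in> l2 M \<Longrightarrow> op_add M S T c = l2_add M (S c) (T c)"
  by (simp add: op_add_def)

lemma kern_add: 
  assumes "S \<in> bounded_ops N" "T \<in> bounded_ops N" shows "AE p in N. kern (op_add N S T) p = kern S p + kern T p"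
  by (rule kern_unique) (use assms in \<open>auto simp: op_add_apply ae_class_kern[of T, symmetric] ae_class_kern[of S, symmetric] l2_add_ae_class\<close>)

lemma conv_delta_left:
  assumes "g \<in> carrier G" shows "conv (delta g) \<xi> (z, \<rho>) = \<xi> (\<psi> (inv g) z, inv g \<otimes> \<rho>)"
  unfolding conv_apply by (subst integral_C_single[OF assms]) (auto simp: delta_def)

lemma conv_nice_left: "conv (nice a \<one>) \<xi> (z, \<rho>) = a z * \<xi> (\<psi> \<one> z, \<one> \<otimes> \<rho>)"
  unfolding conv_apply by (subst integral_C_single[OF one_closed]) (auto simp: nice_def)

lemma conv_nice_right:
  assumes "g \<in> carrier G" "\<rho> \<in> carrier G"
  shows "conv k (nice a g) (z, \<rho>) = k (z, \<rho> \<otimes> inv g) * a (\<psi> (inv (\<rho> \<otimes> inv g)) z)"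
  unfolding conv_apply'[OF assms(2)] by (subst integral_C_single[OF assms(1)]) (auto simp: nice_def)

lemma kern_mult_op_left:
  assumes "bdd a" "T \<in> crossed_product G Y \<psi>"
  shows "AE z in Y. \<forall>\<rho>\<in>carrier G. kern (op_mult N (mult_op G Y a) T) (z, \<rho>) = a z * kern T (z, \<rho>)"
proof -
  have "AE p in N. kern (op_mult N (mult_op G Y a) T) p = conv (nice a \<one>) (kern T) p"
    using kern_mult[OF mult_op_crossed[OF assms(1)] assms(2)]
      conv_cong_AE_left[OF kern_mult_op[OF assms(1)], of "kern T"] by eventually_elim auto
  then show ?thesis unfolding AE_N_iff using AE_space by eventually_elim (auto simp: conv_nice_left)
qed

lemma kern_mult_op_right:
  assumes "bdd a" "T \<in> crossed_product G Y \<psi>"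
  shows "AE z in Y. \<forall>\<rho>\<in>carrier G. kern (op_mult N T (mult_op G Y a)) (z, \<rho>) = kern T (z, \<rho>) * a (\<psi> (inv \<rho>) z)"
proof -
  have "AE p in N. kern (op_mult N T (mult_op G Y a)) p = conv (kern T) (nice a \<one>) p"
    using kern_mult[OF assms(2) mult_op_crossed[OF assms(1)]]
      conv_cong_AE_right[OF kern_mult_op[OF assms(1)], of "kern T"] by eventually_elim auto
  then show ?thesis unfolding AE_N_iff using AE_space by eventually_elim (auto simp: conv_nice_right)
qed

lemma kern_group_unitary_left:
  assumes "g \<in> carrier G" "T \<in> crossed_product G Y \<psi>"
  shows "AE z in Y. \<forall>\<rho>\<in>carrier G. kern (op_mult N (group_unitary G Y \<psi> g) T) (z, \<rho>) = kern T (\<psi> (inv g) z, inv g \<otimes> \<rho>)"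
proof -
  have "AE p in N. kern (op_mult N (group_unitary G Y \<psi> g) T) p = conv (delta g) (kern T) p"
    using kern_mult[OF group_unitary_crossed[OF assms(1)] assms(2)]
      conv_cong_AE_left[OF kern_group_unitary[OF assms(1)], of "kern T"] by eventually_elim auto
  then show ?thesis unfolding AE_N_iff by eventually_elim (use assms in \<open>auto simp: conv_delta_left\<close>)
qed

lemma kern_group_unitary_right:
  assumes "g \<in> carrier G" "T \<in> crossed_product G Y \<psi>"
  shows "AE z in Y. \<forall>\<rho>\<in>carrier G. kern (op_mult N T (group_unitary G Y \<psi> g)) (z, \<rho>) = kern T (z, \<rho> \<otimes> inv g)"
proof -
  have "AE p in N. kern (op_mult N T (group_unitary G Y \<psi> g)) p = conv (kern T) (delta g) p"
    using kern_mult[OF assms(2) group_unitary_crossed[OF assms(1)]]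
      conv_cong_AE_right[OF kern_group_unitary[OF assms(1)], of "kern T"] by eventually_elim auto
  then show ?thesis unfolding AE_N_iff delta_nice by eventually_elim (use assms in \<open>auto simp: conv_nice_right\<close>)
qed

end

text \<open>Fatou's lemma bounds the distance from the norm limit to the pointwise limit by the
  lower limit of the distances, which is zero. The pointwise limit itself is not assumed to be
  square integrable.\<close>

lemma L2_limit_unique:
  assumes f: "f \<in> L2 M" and h: "\<And>n. h n \<in> L2 M" and [measurable]: "g \<in> borel_measurable M"
    and lim: "(\<lambda>n. sqn M (\<lambda>x. f x - h n x)) \<longlonglongrightarrow> 0"
    and pt: "AE x in M. (\<lambda>n. h n x) \<longlonglongrightarrow> g x"
  shows "AE x in M. f x = g x"
proof -
  have [measurable]: "f \<in> borel_measurable M" "h n \<in> borel_measurable M" for n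
    using f h by (auto simp: L2_measurable)
  have "(\<integral>\<^sup>+x. ennreal ((cmod (f x - g x))\<^sup>2) \<partial>M) = (\<integral>\<^sup>+x. liminf (\<lambda>n. ennreal ((cmod (f x - h n x))\<^sup>2)) \<partial>M)"
  proof (rule nn_integral_cong_AE, use pt in eventually_elim)
    fix x assume "(\<lambda>n. h n x) \<longlonglongrightarrow> g x"
    then have "(\<lambda>n. ennreal ((cmod (f x - h n x))\<^sup>2)) \<longlonglongrightarrow> ennreal ((cmod (f x - g x))\<^sup>2)"
      by (intro tendsto_intros)
    then show "ennreal ((cmod (f x - g x))\<^sup>2) = liminf (\<lambda>n. ennreal ((cmod (f x - h n x))\<^sup>2))"
      using lim_imp_Liminf[OF trivial_limit_sequentially] by metis
  qed
  also have "\<dots> \<le> liminf (\<lambda>n. \<integral>\<^sup>+x. ennreal ((cmod (f x - h n x))\<^sup>2) \<partial>M)"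
    by (rule nn_integral_liminf) auto
  also have "\<dots> = liminf (\<lambda>n. ennreal (sqn M (\<lambda>x. f x - h n x)))"
    by (simp add: nn_integral_eq_sqn L2_diff f h)
  also have "(\<lambda>n. ennreal (sqn M (\<lambda>x. f x - h n x))) \<longlonglongrightarrow> ennreal 0"
    by (intro tendsto_ennrealI lim)
  then have "liminf (\<lambda>n. ennreal (sqn M (\<lambda>x. f x - h n x))) = 0"
    using lim_imp_Liminf[OF trivial_limit_sequentially] by fastforce
  finally show ?thesis by (simp add: nn_integral_0_iff_AE)
qed

text \<open>Norms of sums determine the real part of an inner product, and a factor
  \<open>\<i>\<close> on one vector the imaginary part. Two measures are allowed so that vectors can
  be compared with their images.\<close>

lemma ip_polarization:
  assumes f: "f \<in> L2 M" "g \<in> L2 M" and f': "f' \<in> L2 M'" "g' \<in> L2 M'"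
    and "sqn M f = sqn M' f'" "sqn M g = sqn M' g'"
    and a: "sqn M (\<lambda>x. f x + g x) = sqn M' (\<lambda>x. f' x + g' x)"
    and b: "sqn M (\<lambda>x. f x + \<i> * g x) = sqn M' (\<lambda>x. f' x + \<i> * g' x)"
  shows "ip M f g = ip M' f' g'"
proof (rule complex_eqI)
  show "Re (ip M f g) = Re (ip M' f' g')"
    using a assms(5,6) by (simp add: sqn_add f f')
  show "Im (ip M f g) = Im (ip M' f' g')"
    using b assms(5,6) by (simp add: sqn_add f f' L2_scale sqn_scale ip_scale_right)
qed

lemma op_linear_comb:
  assumes T: "T \<in> bounded_ops M" and f: "f \<in> L2 M" and g: "g \<in> L2 M"
    and f': "f' \<in> L2 M" "T (ae_class M f) = ae_class M f'"
    and g': "g' \<in> L2 M" "T (ae_class M g) = ae_class M g'"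
  shows "T (ae_class M (\<lambda>x. f x + c * g x)) = ae_class M (\<lambda>x. f' x + c * g' x)"
proof -
  have "T (ae_class M (\<lambda>x. f x + c * g x)) = T (l2_add M (ae_class M f) (l2_scale M c (ae_class M g)))"
    using f g by (simp add: l2_scale_ae_class l2_add_ae_class L2_scale)
  also have "\<dots> = l2_add M (T (ae_class M f)) (l2_scale M c (T (ae_class M g)))"
    using f g by (simp only: bounded_ops_add[OF T] bounded_ops_scale[OF T] ae_class_l2 l2_scale_closed)
  also have "\<dots> = ae_class M (\<lambda>x. f' x + c * g' x)"
    using f' g' by (simp add: l2_scale_ae_class l2_add_ae_class L2_scale)
  finally show ?thesis .
qed

lemma bounded_ops_sqn:
  assumes T: "T \<in> bounded_ops M"
  obtains K where "0 \<le> K"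
    "\<And>f f'. f \<in> L2 M \<Longrightarrow> f' \<in> L2 M \<Longrightarrow> T (ae_class M f) = ae_class M f' \<Longrightarrow> sqn M f' \<le> K * sqn M f"
proof -
  obtain K where K: "0 \<le> K" "\<And>c. c \<in> l2 M \<Longrightarrow> l2_norm M (T c) \<le> K * l2_norm M c"
    by (rule bounded_ops_bound[OF T]) blast
  have "sqn M f' \<le> K\<^sup>2 * sqn M f" if "f \<in> L2 M" "f' \<in> L2 M" "T (ae_class M f) = ae_class M f'" for f f'
  proof -
    have "sqrt (sqn M f') \<le> K * sqrt (sqn M f)"
      using K(2)[OF ae_class_l2[OF that(1)]] that by (simp add: l2_norm_ae_class)
    then have "(sqrt (sqn M f'))\<^sup>2 \<le> (K * sqrt (sqn M f))\<^sup>2" by (rule power_mono) simp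
    then show ?thesis by (simp add: power_mult_distrib)
  qed
  then show ?thesis using that[of "K\<^sup>2"] by simp
qed

context gms
begin

section \<open>Coefficients of adjoints, unitaries and elements of the group algebra\<close>

lemma ip_nice_right:
  assumes h: "h \<in> L2 N" and f: "f \<in> L2 Y" and \<mu>: "\<mu> \<in> carrier G"
  shows "ip N h (nice f \<mu>) = (LINT z|Y. h (z, \<mu>) * cnj (f z))"
proof -
  have "integrable N (\<lambda>p. h p * cnj (nice f \<mu> p))" by (intro ip_integrable h nice_L2 f \<mu>)
  then have "ip N h (nice f \<mu>) = (LINT z|Y. LINT \<rho>|C. h (z, \<rho>) * cnj (nice f \<mu> (z, \<rho>)))"
    unfolding ip_def gms_measure_def by (rule YC.integral_fst'[symmetric])
  also have "\<dots> = (LINT z|Y. h (z, \<mu>) * cnj (f z))"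
    by (intro Bochner_Integration.integral_cong refl, subst integral_C_single[OF \<mu>]) (auto simp: nice_def)
  finally show ?thesis .
qed

lemma section_L2:
  assumes h: "h \<in> L2 N" and \<mu>: "\<mu> \<in> carrier G"
  shows "(\<lambda>z. h (z, \<mu>)) \<in> L2 Y" "sqn Y (\<lambda>z. h (z, \<mu>)) \<le> sqn N h"
proof -
  have [measurable]: "h \<in> borel_measurable N" using h by (rule L2_measurable)
  have m: "(\<lambda>z. h (z, \<mu>)) \<in> borel_measurable Y" using \<mu> by measurable
  have "(\<integral>\<^sup>+z. ennreal ((cmod (h (z, \<mu>)))\<^sup>2) \<partial>Y) = (\<integral>\<^sup>+\<rho>. (\<integral>\<^sup>+z. ennreal ((cmod (h (z, \<mu>)))\<^sup>2) \<partial>Y) * indicator {\<mu>} \<rho> \<partial>C)"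
    using \<mu> by (simp add: nn_integral_cmult)
  also have "\<dots> \<le> (\<integral>\<^sup>+\<rho>. \<integral>\<^sup>+z. ennreal ((cmod (h (z, \<rho>)))\<^sup>2) \<partial>Y \<partial>C)"
    by (intro nn_integral_mono) (auto split: split_indicator)
  also have "\<dots> = ennreal (sqn N h)"
    by (subst nn_integral_N'[symmetric]) (auto simp: nn_integral_eq_sqn[OF h])
  finally have le: "(\<integral>\<^sup>+z. ennreal ((cmod (h (z, \<mu>)))\<^sup>2) \<partial>Y) \<le> ennreal (sqn N h)" .
  show "(\<lambda>z. h (z, \<mu>)) \<in> L2 Y" by (rule L2_bound(1)[OF m le])
  show "sqn Y (\<lambda>z. h (z, \<mu>)) \<le> sqn N h" by (rule L2_bound(2)[OF m le]) simp
qed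

text \<open>The difference of the two functions is tested against its own truncations at height
  \<open>n\<close>, which are bounded; all of them vanish, and they exhaust the difference.\<close>

lemma L2_Y_eqI:
  assumes f: "f \<in> L2 Y" and g: "g \<in> L2 Y"
    and eq: "\<And>b. bdd b \<Longrightarrow> (LINT z|Y. f z * cnj (b z)) = (LINT z|Y. g z * cnj (b z))"
  shows "AE z in Y. f z = g z"
proof -
  define h where "h z = f z - g z" for z
  have h: "h \<in> L2 Y" unfolding h_def by (intro L2_diff f g)
  note [measurable] = L2_measurable[OF h]
  have "AE z in Y. cmod (h z) \<le> real n \<longrightarrow> h z = 0" for n
  proof -
    define b where "b z = (if cmod (h z) \<le> real n then h z else 0)" for z
    have "b \<in> borel_measurable Y" unfolding b_def by measurable
    then have b: "bdd b" by (rule bddI[of _ "real n"]) (auto simp: b_def)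
    have bL: "b \<in> L2 Y" by (rule bdd_L2[OF b])
    have "ip Y b b = (LINT z|Y. h z * cnj (b z))"
      unfolding ip_def by (intro Bochner_Integration.integral_cong) (auto simp: b_def)
    also have "\<dots> = ip Y f b - ip Y g b"
      using f g bL ip_diff_left[OF f g bL] by (simp add: ip_def h_def)
    also have "\<dots> = 0" using eq[OF b] by (simp add: ip_def)
    finally have "sqn Y b = 0" by (simp add: ip_self)
    then have "AE z in Y. b z = 0" using sqn_eq_0_iff[OF bL] by simp
    then show ?thesis by eventually_elim (auto simp: b_def)
  qed
  then have "AE z in Y. \<forall>n. cmod (h z) \<le> real n \<longrightarrow> h z = 0"
    unfolding AE_all_countable by blast
  then show ?thesis by eventually_elim (metis h_def real_arch_simple right_minus_eq)
qed

text \<open>Pairing the coefficient at \<rho> with a bounded function means pairing with a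
  \<open>nice\<close> vector over \<rho>. Moving \<open>T\<close> to the other side leaves the
  single coefficient of \<open>T\<close> at \<rho>^-1, and invariance of the measure shifts the base
  point.\<close>

lemma kern_adj:
  assumes T: "T \<in> crossed_product G Y \<psi>"
  shows "AE z in Y. \<forall>\<rho>\<in>carrier G. kern (op_adj N T) (z, \<rho>) = cnj (kern T (\<psi> (inv \<rho>) z, inv \<rho>))"
  unfolding AE_ball_countable[OF countable_carrier]
proof
  fix \<rho> assume \<rho>: "\<rho> \<in> carrier G"
  note b = crossed_product_bounded[OF T]
  have k: "kern T \<in> L2 N" and k': "kern (op_adj N T) \<in> L2 N" using b by auto
  note [measurable] = L2_measurable[OF k]
  show "AE z in Y. kern (op_adj N T) (z, \<rho>) = cnj (kern T (\<psi> (inv \<rho>) z, inv \<rho>))"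
  proof (rule L2_Y_eqI)
    show "(\<lambda>z. kern (op_adj N T) (z, \<rho>)) \<in> L2 Y" by (rule section_L2(1)[OF k' \<rho>])
    have "(\<lambda>(z, \<sigma>). kern T (\<psi> (inv \<rho>) z, inv \<rho> \<otimes> \<sigma>)) \<in> L2 N"
      using L2_N_lshift(1)[OF k, of "inv \<rho>"] \<rho> by simp
    from section_L2(1)[OF this one_closed] show "(\<lambda>z. cnj (kern T (\<psi> (inv \<rho>) z, inv \<rho>))) \<in> L2 Y"
      using \<rho> by (simp add: L2_cnj)
    fix f assume f: "bdd f"
    note [measurable] = bdd_measurable[OF f]
    have n: "nice f \<rho> \<in> L2 N" by (intro nice_L2 bdd_L2 f \<rho>)
    have c: "conv (kern T) (nice f \<rho>) \<in> L2 N" by (rule conv_kern_L2[OF T n])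
    have "(LINT z|Y. kern (op_adj N T) (z, \<rho>) * cnj (f z)) = ip N (kern (op_adj N T)) (nice f \<rho>)"
      by (rule ip_nice_right[symmetric, OF k' bdd_L2[OF f] \<rho>])
    also have "\<dots> = l2_inner N (op_adj N T (ae_class N (delta \<one>))) (ae_class N (nice f \<rho>))"
      using k' n b by (simp add: l2_inner_ae_class ae_class_kern[symmetric])
    also have "\<dots> = l2_inner N (ae_class N (delta \<one>)) (T (ae_class N (nice f \<rho>)))"
      using b n by (intro op_adj_inner'[symmetric]) auto
    also have "\<dots> = ip N (delta \<one>) (conv (kern T) (nice f \<rho>))"
      using n c by (simp add: crossed_apply[OF T] l2_inner_ae_class)
    also have "\<dots> = cnj (LINT z|Y. conv (kern T) (nice f \<rho>) (z, \<one>))"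
      unfolding delta_nice by (subst ip_cnj, subst ip_nice_right[OF c bdd_L2 one_closed]) auto
    also have "\<dots> = cnj (LINT z|Y. kern T (z, inv \<rho>) * f (\<psi> \<rho> z))"
      using \<rho> by (simp add: conv_nice_right)
    also have "\<dots> = (LINT z|Y. cnj (kern T (z, inv \<rho>) * f (\<psi> \<rho> z)))"
      by (rule Bochner_Integration.integral_cnj[symmetric])
    also have "\<dots> = (LINT z|Y. cnj (kern T (\<psi> (inv \<rho>) z, inv \<rho>) * f (\<psi> \<rho> (\<psi> (inv \<rho>) z))))"
      using \<rho> by (intro integral_act[symmetric, of "inv \<rho>" "\<lambda>z. cnj (kern T (z, inv \<rho>) * f (\<psi> \<rho> z))"]) auto
    also have "\<dots> = (LINT z|Y. cnj (kern T (\<psi> (inv \<rho>) z, inv \<rho>)) * cnj (f z))"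
      using \<rho> by (intro Bochner_Integration.integral_cong) (auto simp: act_mult)
    finally show "(LINT z|Y. kern (op_adj N T) (z, \<rho>) * cnj (f z)) = (LINT z|Y. cnj (kern T (\<psi> (inv \<rho>) z, inv \<rho>)) * cnj (f z))" .
  qed
qed

text \<open>The coefficient at \<rho> is the inner product of the row of \<open>S\<close> at z with
  the \<rho>-translate of the row of \<open>T\<close> at \<rho>^-1 z. Unitarity of an operator
  thereby becomes orthonormality of its rows along orbits.\<close>

lemma kern_mult_adj:
  assumes S: "S \<in> crossed_product G Y \<psi>" and T: "T \<in> crossed_product G Y \<psi>"
  shows "AE z in Y. \<forall>\<rho>\<in>carrier G. kern (op_mult N S (op_adj N T)) (z, \<rho>) =
    (LINT \<sigma>|C. kern S (z, \<sigma>) * cnj (kern T (\<psi> (inv \<rho>) z, inv \<rho> \<otimes> \<sigma>)))"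
proof -
  have "AE z in Y. \<forall>\<rho>\<in>carrier G. kern (op_mult N S (op_adj N T)) (z, \<rho>) = conv (kern S) (kern (op_adj N T)) (z, \<rho>)"
    using kern_mult[OF S crossed_product_adj[OF T]] by (simp add: AE_N_iff)
  moreover note AE_act_all[OF kern_adj[OF T]] AE_space
  ultimately show ?thesis
  proof eventually_elim
    fix z assume 1: "\<forall>\<rho>\<in>carrier G. kern (op_mult N S (op_adj N T)) (z, \<rho>) = conv (kern S) (kern (op_adj N T)) (z, \<rho>)"
      and 2: "\<forall>g\<in>carrier G. \<forall>\<rho>\<in>carrier G. kern (op_adj N T) (\<psi> g z, \<rho>) = cnj (kern T (\<psi> (inv \<rho>) (\<psi> g z), inv \<rho>))"
      and z: "z \<in> space Y"
    show "\<forall>\<rho>\<in>carrier G. kern (op_mult N S (op_adj N T)) (z, \<rho>) =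
      (LINT \<sigma>|C. kern S (z, \<sigma>) * cnj (kern T (\<psi> (inv \<rho>) z, inv \<rho> \<otimes> \<sigma>)))"
    proof
      fix \<rho> assume \<rho>: "\<rho> \<in> carrier G"
      show "kern (op_mult N S (op_adj N T)) (z, \<rho>) =
        (LINT \<sigma>|C. kern S (z, \<sigma>) * cnj (kern T (\<psi> (inv \<rho>) z, inv \<rho> \<otimes> \<sigma>)))"
        unfolding 1[rule_format, OF \<rho>] conv_apply
        by (rule Bochner_Integration.integral_cong) (use \<rho> z 2 in \<open>auto simp: act_mult inv_mult_group m_assoc\<close>)
    qed
  qed
qed

lemma unitary_rows:
  assumes w: "w \<in> unitaries N (crossed_product G Y \<psi>)"
  shows "AE z in Y. \<forall>\<rho>\<in>carrier G. (LINT \<sigma>|C. kern w (z, \<sigma>) * cnj (kern w (\<psi> (inv \<rho>) z, inv \<rho> \<otimes> \<sigma>))) = (if \<rho> = \<one> then 1 else 0)"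
proof -
  have "AE z in Y. \<forall>\<rho>\<in>carrier G. kern (op_one N) (z, \<rho>) = delta \<one> (z, \<rho>)"
    using kern_one by (simp add: AE_N_iff)
  with kern_mult_adj[OF unitaries_mem[OF w] unitaries_mem[OF w]] show ?thesis
    unfolding unitaries_mult_adj[OF w] by eventually_elim (auto simp: delta_def)
qed

lemma unitary_row_sqn:
  assumes w: "w \<in> unitaries N (crossed_product G Y \<psi>)"
  shows "AE z in Y. (\<lambda>\<sigma>. kern w (z, \<sigma>)) \<in> L2 C \<and> sqn C (\<lambda>\<sigma>. kern w (z, \<sigma>)) = 1"
proof -
  have "kern w \<in> L2 N" using unitaries_mem[OF w] by simp
  from unitary_rows[OF w] L2_N_section[OF this] AE_space show ?thesis
  proof eventually_elim
    fix z assume 1: "\<forall>\<rho>\<in>carrier G. (LINT \<sigma>|C. kern w (z, \<sigma>) * cnj (kern w (\<psi> (inv \<rho>) z, inv \<rho> \<otimes> \<sigma>))) = (if \<rho> = \<one> then 1 else 0)"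
      and 2: "(\<lambda>\<sigma>. kern w (z, \<sigma>)) \<in> L2 C" and z: "z \<in> space Y"
    have "ip C (\<lambda>\<sigma>. kern w (z, \<sigma>)) (\<lambda>\<sigma>. kern w (z, \<sigma>)) = (LINT \<sigma>|C. kern w (z, \<sigma>) * cnj (kern w (\<psi> (inv \<one>) z, inv \<one> \<otimes> \<sigma>)))"
      unfolding ip_def using z by (intro Bochner_Integration.integral_cong) auto
    also have "\<dots> = 1" using 1 by (metis one_closed)
    finally show "(\<lambda>\<sigma>. kern w (z, \<sigma>)) \<in> L2 C \<and> sqn C (\<lambda>\<sigma>. kern w (z, \<sigma>)) = 1"
      using 2 by (simp add: ip_self)
  qed
qed

lemma unitaries_adj:
  assumes "w \<in> unitaries N (crossed_product G Y \<psi>)" shows "op_adj N w \<in> unitaries N (crossed_product G Y \<psi>)"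
  using assms by (auto simp: unitaries_def)

lemma unitaries_mult:
  assumes "v \<in> unitaries N (crossed_product G Y \<psi>)" "w \<in> unitaries N (crossed_product G Y \<psi>)"
  shows "op_mult N v w \<in> unitaries N (crossed_product G Y \<psi>)"
proof -
  have b: "v \<in> bounded_ops N" "w \<in> bounded_ops N" using assms by (auto simp: unitaries_def)
  have "op_mult N (op_mult N (op_adj N w) (op_adj N v)) (op_mult N v w) = op_mult N (op_adj N w) (op_mult N (op_mult N (op_adj N v) v) w)"
    using b by (simp add: op_mult_assoc)
  also have "\<dots> = op_one N" using assms b by (simp add: unitaries_def)
  finally have 1: "op_mult N (op_mult N (op_adj N w) (op_adj N v)) (op_mult N v w) = op_one N" .
  have "op_mult N (op_mult N v w) (op_mult N (op_adj N w) (op_adj N v)) = op_mult N v (op_mult N (op_mult N w (op_adj N w)) (op_adj N v))"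
    using b by (simp add: op_mult_assoc)
  also have "\<dots> = op_one N" using assms b by (simp add: unitaries_def)
  finally show ?thesis using 1 assms b by (simp add: unitaries_def op_adj_mult)
qed

text \<open>Averaging over \<open>Y\<close> commutes with \<open>L(\<Lambda>)\<close>, and this makes the coefficients of elements of \<open>L(\<Lambda>)\<close> scalar.\<close>

definition avg_op :: "('y \<times> 'g) l2op" where
  "avg_op = fun_op N (\<lambda>\<xi> (z, \<rho>). LINT y|Y. \<xi> (y, \<rho>))"

lemma avg_L2:
  assumes f: "f \<in> L2 N"
  shows "(\<lambda>(z, \<rho>). LINT y|Y. f (y, \<rho>)) \<in> L2 N" "sqn N (\<lambda>(z, \<rho>). LINT y|Y. f (y, \<rho>)) \<le> sqn N f"
proof -
  have [measurable]: "f \<in> borel_measurable N" using f by (rule L2_measurable)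
  have m: "(\<lambda>(z, \<rho>). LINT y|Y. f (y, \<rho>)) \<in> borel_measurable N" by (simp add: measurable_N_iff)
  note [measurable] = m
  have le: "ennreal ((cmod (LINT y|Y. f (y, \<rho>)))\<^sup>2) \<le> (\<integral>\<^sup>+z. ennreal ((cmod (f (z, \<rho>)))\<^sup>2) \<partial>Y)" if \<rho>: "\<rho> \<in> carrier G" for \<rho>
  proof -
    have s: "(\<lambda>z. f (z, \<rho>)) \<in> L2 Y" by (rule section_L2[OF f \<rho>])
    have "(cmod (ip Y (\<lambda>z. f (z, \<rho>)) (\<lambda>z. 1)))\<^sup>2 \<le> sqn Y (\<lambda>z. f (z, \<rho>)) * sqn Y (\<lambda>z. 1)"
      by (intro Cauchy_Schwarz_ip s bdd_L2) auto
    then have "(cmod (LINT y|Y. f (y, \<rho>)))\<^sup>2 \<le> sqn Y (\<lambda>z. f (z, \<rho>))"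
      by (simp add: ip_def sqn_def prob_space)
    then show ?thesis using nn_integral_eq_sqn[OF s] by simp
  qed
  have "(\<integral>\<^sup>+p. ennreal ((cmod ((\<lambda>(z, \<rho>). LINT y|Y. f (y, \<rho>)) p))\<^sup>2) \<partial>N)
      = (\<integral>\<^sup>+\<rho>. \<integral>\<^sup>+z. ennreal ((cmod (LINT y|Y. f (y, \<rho>)))\<^sup>2) \<partial>Y \<partial>C)"
    by (subst nn_integral_N') auto
  also have "\<dots> \<le> (\<integral>\<^sup>+\<rho>. \<integral>\<^sup>+z. ennreal ((cmod (f (z, \<rho>)))\<^sup>2) \<partial>Y \<partial>C)"
    using le by (intro nn_integral_mono[of C]) (simp add: emeasure_space_1)
  also have "\<dots> = ennreal (sqn N f)"
    by (subst nn_integral_N'[symmetric]) (auto simp: nn_integral_eq_sqn[OF f])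
  finally have *: "(\<integral>\<^sup>+p. ennreal ((cmod ((\<lambda>(z, \<rho>). LINT y|Y. f (y, \<rho>)) p))\<^sup>2) \<partial>N) \<le> ennreal (sqn N f)" .
  show "(\<lambda>(z, \<rho>). LINT y|Y. f (y, \<rho>)) \<in> L2 N" by (rule L2_bound(1)[OF m *])
  show "sqn N (\<lambda>(z, \<rho>). LINT y|Y. f (y, \<rho>)) \<le> sqn N f" by (rule L2_bound(2)[OF m *]) simp
qed

lemma avg_cong:
  assumes "f \<in> L2 N" "g \<in> L2 N" "AE p in N. f p = g p"
  shows "AE p in N. (case p of (z, \<rho>) \<Rightarrow> LINT y|Y. f (y, \<rho>)) = (case p of (z, \<rho>) \<Rightarrow> LINT y|Y. g (y, \<rho>))"
proof -
  have [measurable]: "f \<in> borel_measurable N" "g \<in> borel_measurable N" using assms by (auto intro: L2_measurable)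
  have "(LINT y|Y. f (y, \<rho>)) = (LINT y|Y. g (y, \<rho>))" if "\<rho> \<in> carrier G" for \<rho>
    by (rule integral_cong_AE) (use that assms(3) in \<open>auto simp: AE_N_iff\<close>)
  then show ?thesis by (simp add: AE_N_iff)
qed

lemma L2_Y_integrable: "f \<in> L2 Y \<Longrightarrow> integrable Y f"
  using ip_integrable[of f Y "\<lambda>z. 1"] bdd_L2[OF bdd_const[of 1]] by simp

lemma avg_op_bounded: "avg_op \<in> bounded_ops N"
  unfolding avg_op_def
proof (rule fun_op_bounded[where K=1])
  show "AE x in N. (case x of (z, \<rho>) \<Rightarrow> LINT y|Y. f (y, \<rho>) + g (y, \<rho>)) =
     (case x of (z, \<rho>) \<Rightarrow> LINT y|Y. f (y, \<rho>)) + (case x of (z, \<rho>) \<Rightarrow> LINT y|Y. g (y, \<rho>))"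
    if "f \<in> L2 N" "g \<in> L2 N" for f g
    using that by (auto simp: AE_N_iff L2_Y_integrable section_L2)
  show "AE x in N. (case x of (z, \<rho>) \<Rightarrow> LINT y|Y. f (y, \<rho>)) = (case x of (z, \<rho>) \<Rightarrow> LINT y|Y. g (y, \<rho>))"
    if "f \<in> L2 N" "g \<in> L2 N" "AE p in N. f p = g p" for f g
    using that by (rule avg_cong)
qed (auto simp: avg_L2 AE_N_iff)

lemma group_vN_kern:
  assumes T: "T \<in> group_vN G Y \<psi>"
  shows "\<exists>c\<in>L2 C. AE z in Y. \<forall>\<rho>\<in>carrier G. kern T (z, \<rho>) = c \<rho>"
proof -
  have Tc: "T \<in> crossed_product G Y \<psi>" using T group_vN_subset by blast
  note b = crossed_product_bounded[OF Tc]
  have k: "kern T \<in> L2 N" using b by simp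
  have avg_apply: "avg_op (ae_class N f) = ae_class N (\<lambda>(z, \<rho>). LINT y|Y. f (y, \<rho>))" if "f \<in> L2 N" for f
    unfolding avg_op_def by (rule fun_op_apply[OF avg_cong that])
  have "avg_op \<in> commutant N (group_unitary G Y \<psi> ` carrier G)"
  proof -
    have "op_mult N (group_unitary G Y \<psi> g) avg_op = op_mult N avg_op (group_unitary G Y \<psi> g)" if g: "g \<in> carrier G" for g
    proof (rule op_mult_commI[OF group_unitary_bounded[OF g] avg_op_bounded])
      fix f assume f: "f \<in> L2 N"
      note [measurable] = L2_measurable[OF f]
      have "(LINT y|Y. f (\<psi> (inv g) y, inv g \<otimes> \<rho>)) = (LINT y|Y. f (y, inv g \<otimes> \<rho>))" if "\<rho> \<in> carrier G" for \<rho>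
        by (rule integral_act[of "inv g" "\<lambda>y. f (y, inv g \<otimes> \<rho>)"]) (use g that in auto)
      then show "group_unitary G Y \<psi> g (avg_op (ae_class N f)) = avg_op (group_unitary G Y \<psi> g (ae_class N f))"
        using f g L2_N_lshift(1)[OF f, of "inv g"] avg_L2(1)[OF f]
        by (auto simp: avg_apply group_unitary_apply space_N intro!: ae_class_cong AE_I2)
    qed
    then show ?thesis using avg_op_bounded by (auto simp: commutant_def)
  qed
  then have comm: "op_mult N T avg_op (ae_class N (delta \<one>)) = op_mult N avg_op T (ae_class N (delta \<one>))"
    using T commutantD[of T N _ avg_op] by (simp add: group_vN_eq)
  have "avg_op (ae_class N (delta \<one>)) = ae_class N (delta \<one>)"
    unfolding avg_apply[OF delta_L2[OF one_closed]] by (intro ae_class_cong AE_I2) (auto simp: delta_def prob_space)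
  then have "T (ae_class N (delta \<one>)) = avg_op (T (ae_class N (delta \<one>)))"
    using comm unfolding op_mult_apply[OF ae_class_l2[OF delta_L2[OF one_closed]]] by argo
  then have "ae_class N (kern T) = avg_op (ae_class N (kern T))"
    unfolding ae_class_kern[OF b] .
  also have "\<dots> = ae_class N (\<lambda>(z, \<rho>). LINT y|Y. kern T (y, \<rho>))" by (rule avg_apply[OF k])
  finally have "AE p in N. kern T p = (\<lambda>(z, \<rho>). LINT y|Y. kern T (y, \<rho>)) p"
    by (rule ae_class_eqD[OF _ L2_measurable[OF k]])
  then have eq: "AE z in Y. \<forall>\<rho>\<in>carrier G. kern T (z, \<rho>) = (LINT y|Y. kern T (y, \<rho>))" by (simp add: AE_N_iff)
  then have "AE z in Y. (\<lambda>\<rho>. LINT y|Y. kern T (y, \<rho>)) \<in> L2 C"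
    using L2_N_section[OF k]
  proof eventually_elim
    fix z assume "\<forall>\<rho>\<in>carrier G. kern T (z, \<rho>) = (LINT y|Y. kern T (y, \<rho>))" "(\<lambda>\<sigma>. kern T (z, \<sigma>)) \<in> L2 C"
    then show "(\<lambda>\<rho>. LINT y|Y. kern T (y, \<rho>)) \<in> L2 C"
      using L2_cong_AE(1)[of "\<lambda>\<sigma>. kern T (z, \<sigma>)" C "\<lambda>\<rho>. LINT y|Y. kern T (y, \<rho>)"] by (auto simp: AE_count_space)
  qed
  then have "(\<lambda>\<rho>. LINT y|Y. kern T (y, \<rho>)) \<in> L2 C" by simp
  with eq show ?thesis by (intro bexI[of _ "\<lambda>\<rho>. LINT y|Y. kern T (y, \<rho>)"])
qed

end

section \<open>Normalisers and monomial kernels\<close>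

text \<open>A countable base of a T1 topology separates points. Such a family reduces an equality of
  points to countably many equivalences between memberships, each of which may be proved off its own
  null set.\<close>

lemma standard_separating:
  assumes "standard_prob_space M"
  shows "\<exists>U :: nat \<Rightarrow> 'a set. (\<forall>n. U n \<in> sets M) \<and>
    (\<forall>x\<in>space M. \<forall>y\<in>space M. x \<noteq> y \<longrightarrow> (\<exists>n. x \<in> U n \<and> y \<notin> U n))"
proof -
  from assms obtain T where T: "completely_metrizable_space T" "second_countable T" "topspace T = space M"
    "sets M = sigma_sets (space M) {U. openin T U}" and "prob_space M"
    by (auto simp: standard_prob_space_def)
  have t1: "t1_space T"
    using T(1) by (simp add: Hausdorff_imp_t1_space completely_metrizable_imp_metrizable_space metrizable_imp_Hausdorff_space)
  obtain B where B: "countable B" "\<And>V. V \<in> B \<Longrightarrow> openin T V"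
    "\<And>U x. openin T U \<Longrightarrow> x \<in> U \<Longrightarrow> \<exists>V \<in> B. x \<in> V \<and> V \<subseteq> U"
    using T(2) by (auto simp: second_countable_def)
  \<comment> \<open>The empty set is added so that the enumerated family is nonempty; it does not
    affect separation.\<close>
  define U where "U = from_nat_into (insert {} B)"
  have U: "range U = insert {} B" unfolding U_def using B(1) by (intro range_from_nat_into) auto
  show ?thesis
  proof (intro exI[of _ U] conjI allI ballI impI)
    fix n
    have "U n \<in> insert {} B" using U by auto
    then show "U n \<in> sets M" using B(2) unfolding T(4) by (auto intro: sigma_sets.intros)
  next
    fix x y assume xy: "x \<in> space M" "y \<in> space M" "x \<noteq> y"
    then obtain W where W: "openin T W" "x \<in> W" "y \<notin> W"
      using t1 unfolding t1_space_def T(3) by metis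
    with B(3) obtain V where "V \<in> B" "x \<in> V" "V \<subseteq> W" by blast
    moreover from this have "V \<in> range U" using U by auto
    ultimately show "\<exists>n. x \<in> U n \<and> y \<notin> U n" using W by auto
  qed
qed

context gms
begin

text \<open>The local form of a normalising unitary: at almost every point one group unitary with a
  unimodular factor, the group element depending on the point.\<close>

definition monomial :: "('y \<times> 'g \<Rightarrow> complex) \<Rightarrow> bool" where
  "monomial k \<longleftrightarrow> (AE z in Y. \<exists>\<sigma>\<in>carrier G. cmod (k (z, \<sigma>)) = 1 \<and> (\<forall>\<tau>\<in>carrier G. \<tau> \<noteq> \<sigma> \<longrightarrow> k (z, \<tau>) = 0))"

lemma sqn_C_finite_le:
  assumes f: "f \<in> L2 C" and F: "finite F" "F \<subseteq> carrier G"
  shows "(\<Sum>\<sigma>\<in>F. (cmod (f \<sigma>))\<^sup>2) \<le> sqn C f"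
proof -
  have "ennreal (\<Sum>\<sigma>\<in>F. (cmod (f \<sigma>))\<^sup>2) = (\<Sum>\<sigma>\<in>F. ennreal ((cmod (f \<sigma>))\<^sup>2))"
    by (simp add: sum_ennreal)
  also have "\<dots> = (\<integral>\<^sup>+\<sigma>. ennreal ((cmod (f \<sigma>))\<^sup>2) * indicator F \<sigma> \<partial>C)"
    using F by (subst nn_integral_count_space'[of F]) (auto simp: indicator_def)
  also have "\<dots> \<le> (\<integral>\<^sup>+\<sigma>. ennreal ((cmod (f \<sigma>))\<^sup>2) \<partial>C)"
    by (intro nn_integral_mono) (auto split: split_indicator)
  finally show ?thesis by (simp add: nn_integral_eq_sqn[OF f])
qed

lemma single_support_norm:
  assumes f: "f \<in> L2 C" "sqn C f = 1"
    and single: "\<And>\<sigma> \<tau>. \<sigma> \<in> carrier G \<Longrightarrow> \<tau> \<in> carrier G \<Longrightarrow> \<sigma> \<noteq> \<tau> \<Longrightarrow> f \<sigma> * f \<tau> = 0"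
  shows "\<exists>\<sigma>\<in>carrier G. cmod (f \<sigma>) = 1 \<and> (\<forall>\<tau>\<in>carrier G. \<tau> \<noteq> \<sigma> \<longrightarrow> f \<tau> = 0)"
proof -
  have "\<exists>\<sigma>\<in>carrier G. f \<sigma> \<noteq> 0"
  proof (rule ccontr)
    assume "\<not> ?thesis"
    then have "sqn C f = sqn C (\<lambda>_. 0)" unfolding sqn_def by (intro Bochner_Integration.integral_cong) auto
    then show False using f(2) by (simp add: sqn_def)
  qed
  then obtain \<sigma> where \<sigma>: "\<sigma> \<in> carrier G" "f \<sigma> \<noteq> 0" by blast
  have z: "f \<tau> = 0" if "\<tau> \<in> carrier G" "\<tau> \<noteq> \<sigma>" for \<tau>
    using single[OF \<sigma>(1) that(1)] \<sigma>(2) that(2) by auto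
  have "complex_of_real (sqn C f) = f \<sigma> * cnj (f \<sigma>)"
    unfolding ip_self[symmetric] ip_def by (rule integral_C_single[OF \<sigma>(1)]) (simp add: z)
  also have "\<dots> = complex_of_real ((cmod (f \<sigma>))\<^sup>2)" by (rule complex_norm_square[symmetric])
  finally have "(cmod (f \<sigma>))\<^sup>2 = 1" using f(2) by (metis of_real_eq_iff)
  then have "cmod (f \<sigma>) = 1" using abs_square_eq_1[of "cmod (f \<sigma>)"] by simp
  with \<sigma> z show ?thesis by blast
qed

text \<open>Two entries of modulus one would already give squared norm 2.\<close>

lemma unimodular_support_norm:
  assumes f: "f \<in> L2 C" "sqn C f = 1"
    and u: "\<And>\<sigma>. \<sigma> \<in> carrier G \<Longrightarrow> f \<sigma> = 0 \<or> cmod (f \<sigma>) = 1"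
  shows "\<exists>\<sigma>\<in>carrier G. cmod (f \<sigma>) = 1 \<and> (\<forall>\<tau>\<in>carrier G. \<tau> \<noteq> \<sigma> \<longrightarrow> f \<tau> = 0)"
proof (rule single_support_norm[OF f])
  fix \<sigma> \<tau> assume st: "\<sigma> \<in> carrier G" "\<tau> \<in> carrier G" "\<sigma> \<noteq> \<tau>"
  show "f \<sigma> * f \<tau> = 0"
  proof (rule ccontr)
    assume "f \<sigma> * f \<tau> \<noteq> 0"
    then have "cmod (f \<sigma>) = 1" "cmod (f \<tau>) = 1" using u st by auto
    then show False using sqn_C_finite_le[OF f(1), of "{\<sigma>, \<tau>}"] f(2) st by simp
  qed
qed

lemma unitary_monomialI:
  assumes w: "w \<in> unitaries N (crossed_product G Y \<psi>)"
    and "AE z in Y. \<forall>\<sigma>\<in>carrier G. kern w (z, \<sigma>) = 0 \<or> cmod (kern w (z, \<sigma>)) = 1"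
  shows "monomial (kern w)"
  unfolding monomial_def using unitary_row_sqn[OF w] assms(2)
  by eventually_elim (rule unimodular_support_norm, auto)

text \<open>The coefficients of the adjoint at one point come from coefficients of \<open>w\<close>
  at different points, so uniqueness of the nonzero one is not inherited directly. That each is zero
  or unimodular is inherited, and the row norm 1 of a unitary does the rest.\<close>

lemma monomial_adj:
  assumes w: "w \<in> unitaries N (crossed_product G Y \<psi>)" and m: "monomial (kern w)"
  shows "monomial (kern (op_adj N w))"
proof (rule unitary_monomialI[OF unitaries_adj[OF w]])
  show "AE z in Y. \<forall>\<sigma>\<in>carrier G. kern (op_adj N w) (z, \<sigma>) = 0 \<or> cmod (kern (op_adj N w) (z, \<sigma>)) = 1"
    using kern_adj[OF unitaries_mem[OF w]] AE_act_all[OF m[unfolded monomial_def]]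
  proof eventually_elim
    fix z assume 1: "\<forall>\<rho>\<in>carrier G. kern (op_adj N w) (z, \<rho>) = cnj (kern w (\<psi> (inv \<rho>) z, inv \<rho>))"
      and 2: "\<forall>g\<in>carrier G. \<exists>\<sigma>\<in>carrier G. cmod (kern w (\<psi> g z, \<sigma>)) = 1 \<and> (\<forall>\<tau>\<in>carrier G. \<tau> \<noteq> \<sigma> \<longrightarrow> kern w (\<psi> g z, \<tau>) = 0)"
    show "\<forall>\<sigma>\<in>carrier G. kern (op_adj N w) (z, \<sigma>) = 0 \<or> cmod (kern (op_adj N w) (z, \<sigma>)) = 1"
    proof
      fix \<sigma> assume s: "\<sigma> \<in> carrier G"
      then obtain \<tau> where "cmod (kern w (\<psi> (inv \<sigma>) z, \<tau>)) = 1" "\<forall>\<rho>\<in>carrier G. \<rho> \<noteq> \<tau> \<longrightarrow> kern w (\<psi> (inv \<sigma>) z, \<rho>) = 0"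
        using 2 inv_closed by meson
      then show "kern (op_adj N w) (z, \<sigma>) = 0 \<or> cmod (kern (op_adj N w) (z, \<sigma>)) = 1"
        using 1 s by (cases "inv \<sigma> = \<tau>") auto
    qed
  qed
qed

text \<open>If the coefficients at \<sigma> and \<tau> are both nonzero at z, comparing coefficients
  in \<open>w 1_U = b w\<close> shows that \<sigma>^-1 z and \<tau>^-1 z lie in the same sets U. For
  U running through a separating family the two points coincide, and freeness gives \<sigma> =
  \<tau>.\<close>

lemma normalizer_monomial:
  assumes free: "free_pmp G Y \<psi>" and w: "w \<in> unitaries N (crossed_product G Y \<psi>)"
    and norm: "\<And>a. bdd a \<Longrightarrow> \<exists>b. bdd b \<and> op_mult N w (mult_op G Y a) = op_mult N (mult_op G Y b) w"
  shows "monomial (kern w)"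
proof -
  have "standard_prob_space Y" using pmp by (simp add: pmp_action_def)
  from standard_separating[OF this] obtain U :: "nat \<Rightarrow> 'y set" where U: "\<And>n. U n \<in> sets Y"
    "\<And>x y. x \<in> space Y \<Longrightarrow> y \<in> space Y \<Longrightarrow> x \<noteq> y \<Longrightarrow> \<exists>n. x \<in> U n \<and> y \<notin> U n" by blast
  have "\<exists>b. bdd b \<and> op_mult N w (mult_op G Y (indicator (U n))) = op_mult N (mult_op G Y b) w" for n
    by (intro norm bdd_indicator U)
  then obtain b where b: "\<And>n. bdd (b n)"
    "\<And>n. op_mult N w (mult_op G Y (indicator (U n))) = op_mult N (mult_op G Y (b n)) w" by metis
  have wc: "w \<in> crossed_product G Y \<psi>" using w by (rule unitaries_mem)
  have "AE z in Y. \<forall>n. \<forall>\<rho>\<in>carrier G. kern w (z, \<rho>) * indicator (U n) (\<psi> (inv \<rho>) z) = b n z * kern w (z, \<rho>)"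
    unfolding AE_all_countable
  proof
    fix n
    show "AE z in Y. \<forall>\<rho>\<in>carrier G. kern w (z, \<rho>) * indicator (U n) (\<psi> (inv \<rho>) z) = b n z * kern w (z, \<rho>)"
      using kern_mult_op_left[OF b(1) wc, of n] kern_mult_op_right[OF bdd_indicator[OF U(1)] wc, of n]
      unfolding b(2) by eventually_elim auto
  qed
  moreover have "AE z in Y. \<forall>g\<in>carrier G. g \<noteq> \<one> \<longrightarrow> \<psi> g z \<noteq> z"
    unfolding AE_ball_countable[OF countable_carrier] using free by (auto simp: free_pmp_def)
  moreover note unitary_row_sqn[OF w] AE_space
  ultimately show ?thesis
    unfolding monomial_def
  proof eventually_elim
    fix z assume 1: "\<forall>n. \<forall>\<rho>\<in>carrier G. kern w (z, \<rho>) * indicator (U n) (\<psi> (inv \<rho>) z) = b n z * kern w (z, \<rho>)"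
      and 2: "\<forall>g\<in>carrier G. g \<noteq> \<one> \<longrightarrow> \<psi> g z \<noteq> z"
      and 3: "(\<lambda>\<sigma>. kern w (z, \<sigma>)) \<in> L2 C \<and> sqn C (\<lambda>\<sigma>. kern w (z, \<sigma>)) = 1" and z: "z \<in> space Y"
    show "\<exists>\<sigma>\<in>carrier G. cmod (kern w (z, \<sigma>)) = 1 \<and> (\<forall>\<tau>\<in>carrier G. \<tau> \<noteq> \<sigma> \<longrightarrow> kern w (z, \<tau>) = 0)"
    proof (rule single_support_norm)
      fix \<sigma> \<tau> assume st: "\<sigma> \<in> carrier G" "\<tau> \<in> carrier G" "\<sigma> \<noteq> \<tau>"
      show "kern w (z, \<sigma>) * kern w (z, \<tau>) = 0"
      proof (rule ccontr)
        assume "kern w (z, \<sigma>) * kern w (z, \<tau>) \<noteq> 0"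
        then have "(indicator (U n) (\<psi> (inv \<sigma>) z) :: complex) = b n z" "(indicator (U n) (\<psi> (inv \<tau>) z) :: complex) = b n z" for n
          using 1 st by (auto simp: mult.commute)
        then have "\<psi> (inv \<sigma>) z \<in> U n \<longleftrightarrow> \<psi> (inv \<tau>) z \<in> U n" for n by (metis indicator_eq_1_iff indicator_eq_0_iff)
        then have "\<psi> (inv \<sigma>) z = \<psi> (inv \<tau>) z" using U(2) st z by (metis act_space inv_closed)
        then have "\<psi> \<tau> (\<psi> (inv \<sigma>) z) = \<psi> \<tau> (\<psi> (inv \<tau>) z)" by simp
        then have "\<psi> (\<tau> \<otimes> inv \<sigma>) z = z" using st z by (simp add: act_mult)
        moreover have "\<tau> \<otimes> inv \<sigma> \<noteq> \<one>" using st by (simp add: inv_solve_right')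
        ultimately show False using 2 st by auto
      qed
    qed (use 3 in auto)
  qed
qed

lemma monomial_normalizes:
  assumes w: "w \<in> unitaries N (crossed_product G Y \<psi>)" and m: "monomial (kern w)" and a: "bdd a"
  shows "\<exists>b. bdd b \<and> op_conj N w (mult_op G Y a) = mult_op G Y b"
proof -
  have wc: "w \<in> crossed_product G Y \<psi>" using w by (rule unitaries_mem)
  have k: "kern w \<in> L2 N" using wc by simp
  note [measurable] = L2_measurable[OF k] bdd_measurable[OF a]
  \<comment> \<open>The intended value is \<open>a\<close> at \<sigma>^-1 z for the one \<sigma>
    carrying the coefficient at z. Averaging over \<sigma> with weight |k|^2 yields it without
    selecting \<sigma>, so measurability is immediate.\<close>
  define b where "b z = (LINT \<sigma>|C. kern w (z, \<sigma>) * cnj (kern w (z, \<sigma>)) * a (\<psi> (inv \<sigma>) z))" for z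
  have b: "b z = a (\<psi> (inv \<sigma>) z)" if s: "\<sigma> \<in> carrier G" "cmod (kern w (z, \<sigma>)) = 1" "\<forall>\<tau>\<in>carrier G. \<tau> \<noteq> \<sigma> \<longrightarrow> kern w (z, \<tau>) = 0" for z \<sigma>
  proof -
    have "b z = kern w (z, \<sigma>) * cnj (kern w (z, \<sigma>)) * a (\<psi> (inv \<sigma>) z)"
      unfolding b_def by (rule integral_C_single[OF s(1)]) (use s(3) in auto)
    then show ?thesis using s(2) by (simp add: complex_norm_square[symmetric])
  qed
  obtain K where "AE z in Y. cmod (a z) \<le> K" using a by (auto simp: bdd_def)
  note AE_act_all[OF this]
  have bb: "bdd b"
  proof (rule bddI)
    show "b \<in> borel_measurable Y" unfolding b_def by measurable
    show "AE z in Y. cmod (b z) \<le> K"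
      using m[unfolded monomial_def] \<open>AE z in Y. \<forall>g\<in>carrier G. cmod (a (\<psi> g z)) \<le> K\<close>
      by eventually_elim (use b in auto)
  qed
  have "op_mult N w (mult_op G Y a) = op_mult N (mult_op G Y b) w"
  proof (rule crossed_eqI)
    show "AE p in N. kern (op_mult N w (mult_op G Y a)) p = kern (op_mult N (mult_op G Y b) w) p"
      unfolding AE_N_iff
      using kern_mult_op_left[OF bb wc] kern_mult_op_right[OF a wc] m[unfolded monomial_def]
    proof eventually_elim
      fix z assume 1: "\<forall>\<rho>\<in>carrier G. kern (op_mult N (mult_op G Y b) w) (z, \<rho>) = b z * kern w (z, \<rho>)"
        and 2: "\<forall>\<rho>\<in>carrier G. kern (op_mult N w (mult_op G Y a)) (z, \<rho>) = kern w (z, \<rho>) * a (\<psi> (inv \<rho>) z)"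
        and "\<exists>\<sigma>\<in>carrier G. cmod (kern w (z, \<sigma>)) = 1 \<and> (\<forall>\<tau>\<in>carrier G. \<tau> \<noteq> \<sigma> \<longrightarrow> kern w (z, \<tau>) = 0)"
      then obtain \<sigma> where s: "\<sigma> \<in> carrier G" "cmod (kern w (z, \<sigma>)) = 1" "\<forall>\<tau>\<in>carrier G. \<tau> \<noteq> \<sigma> \<longrightarrow> kern w (z, \<tau>) = 0" by blast
      show "\<forall>\<rho>\<in>carrier G. kern (op_mult N w (mult_op G Y a)) (z, \<rho>) = kern (op_mult N (mult_op G Y b) w) (z, \<rho>)"
        using 1 2 s b[OF s] by (metis mult.commute mult_zero_left mult_zero_right)
    qed
  qed (use wc a bb in auto)
  then have "op_conj N w (mult_op G Y a) = op_mult N (op_mult N (mult_op G Y b) w) (op_adj N w)"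
    unfolding op_conj_def using wc a by (simp add: op_mult_assoc[symmetric] mult_op_bounded)
  also have "\<dots> = mult_op G Y b"
    using wc bb by (simp add: op_mult_assoc mult_op_bounded unitaries_mult_adj[OF w])
  finally show ?thesis using bb by blast
qed

text \<open>\<open>monomial_normalizes\<close> gives one inclusion; the adjoint is monomial too, and
  conjugating by it produces the preimages needed for equality.\<close>

lemma monomial_mem_normalizer:
  assumes w: "w \<in> unitaries N (crossed_product G Y \<psi>)" and m: "monomial (kern w)"
  shows "w \<in> vN_normalizer N (crossed_product G Y \<psi>) (Linf G Y)"
proof -
  have wb: "w \<in> bounded_ops N" using unitaries_mem[OF w] by simp
  have sub: "op_conj N v ` Linf G Y \<subseteq> Linf G Y" if "v \<in> unitaries N (crossed_product G Y \<psi>)" "monomial (kern v)" for v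
    using monomial_normalizes[OF that] by (auto simp: Linf_eq)
  have "T \<in> op_conj N w ` Linf G Y" if T: "T \<in> Linf G Y" for T
  proof
    have Tb: "T \<in> bounded_ops N" using T by (auto simp: Linf_eq mult_op_bounded)
    show "op_conj N (op_adj N w) T \<in> Linf G Y"
      using sub[OF unitaries_adj[OF w] monomial_adj[OF w m]] T by blast
    have "op_conj N w (op_conj N (op_adj N w) T) = op_mult N (op_mult N w (op_adj N w)) (op_mult N T (op_mult N w (op_adj N w)))"
      using wb Tb by (simp add: op_conj_def op_mult_assoc)
    then show "T = op_conj N w (op_conj N (op_adj N w) T)"
      using Tb by (simp add: unitaries_mult_adj[OF w])
  qed
  then show ?thesis using w sub[OF w m] by (auto simp: vN_normalizer_def)
qed

section \<open>Convolution unitaries\<close>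

lemma mult_inv_cancel [simp]:
  assumes "\<sigma> \<in> carrier G" "\<rho> \<in> carrier G"
  shows "\<sigma> \<otimes> (inv \<sigma> \<otimes> \<rho>) = \<rho>" "inv \<sigma> \<otimes> (\<sigma> \<otimes> \<rho>) = \<rho>"
  using assms by (simp_all flip: m_assoc)

text \<open>The linear combination of the vectors \<open>b \<sigma>\<close> with coefficients
  \<open>\<xi>\<close>, formed coordinate by coordinate. Both left and right convolutions on the
  group are instances, with translates of one vector as the family \<open>b\<close>.\<close>

definition comb :: "('g \<Rightarrow> 'g \<Rightarrow> complex) \<Rightarrow> ('g \<Rightarrow> complex) \<Rightarrow> 'g \<Rightarrow> complex" where
  "comb b \<xi> = (\<lambda>\<rho>. LINT \<sigma>|C. \<xi> \<sigma> * b \<sigma> \<rho>)"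

lemma sqn_C_cong: "(\<And>\<sigma>. \<sigma> \<in> carrier G \<Longrightarrow> f \<sigma> = g \<sigma>) \<Longrightarrow> sqn C f = sqn C g"
  unfolding sqn_def by (intro Bochner_Integration.integral_cong) auto

lemma ip_C_cong: "(\<And>\<sigma>. \<sigma> \<in> carrier G \<Longrightarrow> f \<sigma> = f' \<sigma>) \<Longrightarrow> (\<And>\<sigma>. \<sigma> \<in> carrier G \<Longrightarrow> g \<sigma> = g' \<sigma>) \<Longrightarrow> ip C f g = ip C f' g'"
  unfolding ip_def by (intro Bochner_Integration.integral_cong) auto

lemma L2_C_cong: "f \<in> L2 C \<Longrightarrow> (\<And>\<sigma>. \<sigma> \<in> carrier G \<Longrightarrow> f \<sigma> = g \<sigma>) \<Longrightarrow> g \<in> L2 C"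
  using L2_cong_AE(1)[of f C g] by (auto simp: AE_count_space)

text \<open>The orthogonality clause is carried along because it removes the cross term when a new
  vector is added.\<close>

lemma finite_comb:
  assumes b: "\<And>\<sigma>. \<sigma> \<in> carrier G \<Longrightarrow> b \<sigma> \<in> L2 C"
    and on: "\<And>\<sigma> \<tau>. \<sigma> \<in> carrier G \<Longrightarrow> \<tau> \<in> carrier G \<Longrightarrow> ip C (b \<sigma>) (b \<tau>) = (if \<sigma> = \<tau> then 1 else 0)"
    and F: "finite F" "F \<subseteq> carrier G"
  shows "(\<lambda>\<rho>. \<Sum>\<sigma>\<in>F. \<xi> \<sigma> * b \<sigma> \<rho>) \<in> L2 C \<and> sqn C (\<lambda>\<rho>. \<Sum>\<sigma>\<in>F. \<xi> \<sigma> * b \<sigma> \<rho>) = (\<Sum>\<sigma>\<in>F. (cmod (\<xi> \<sigma>))\<^sup>2)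
    \<and> (\<forall>\<mu>\<in>carrier G - F. ip C (b \<mu>) (\<lambda>\<rho>. \<Sum>\<sigma>\<in>F. \<xi> \<sigma> * b \<sigma> \<rho>) = 0)"
  using F
proof (induction F)
  case empty
  then show ?case by (simp add: sqn_def ip_def)
next
  case (insert \<tau> F)
  let ?s = "\<lambda>\<rho>. \<Sum>\<sigma>\<in>F. \<xi> \<sigma> * b \<sigma> \<rho>"
  have IH: "?s \<in> L2 C" "sqn C ?s = (\<Sum>\<sigma>\<in>F. (cmod (\<xi> \<sigma>))\<^sup>2)" "\<And>\<mu>. \<mu> \<in> carrier G - F \<Longrightarrow> ip C (b \<mu>) ?s = 0"
    using insert by auto
  have \<tau>: "\<tau> \<in> carrier G" "\<tau> \<notin> F" using insert by auto
  have t: "(\<lambda>\<rho>. \<xi> \<tau> * b \<tau> \<rho>) \<in> L2 C" by (rule L2_scale[OF b[OF \<tau>(1)]])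
  have "sqn C (b \<tau>) = 1" using on[OF \<tau>(1) \<tau>(1)] by (simp add: ip_self)
  then have "sqn C (\<lambda>\<rho>. \<xi> \<tau> * b \<tau> \<rho> + ?s \<rho>) = (cmod (\<xi> \<tau>))\<^sup>2 + (\<Sum>\<sigma>\<in>F. (cmod (\<xi> \<sigma>))\<^sup>2)"
    using \<tau> IH by (simp add: sqn_add[OF t IH(1)] ip_scale_left sqn_scale)
  moreover have "ip C (b \<mu>) (\<lambda>\<rho>. \<xi> \<tau> * b \<tau> \<rho> + ?s \<rho>) = 0" if "\<mu> \<in> carrier G - insert \<tau> F" for \<mu>
    using that \<tau> IH on[of \<mu> \<tau>] by (simp add: ip_add_right[OF t IH(1)] b ip_scale_right)
  ultimately show ?case using insert.hyps L2_add[OF t IH(1)] by simp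
qed

lemma comb_integrable:
  assumes "\<And>\<rho>. \<rho> \<in> carrier G \<Longrightarrow> (\<lambda>\<sigma>. b \<sigma> \<rho>) \<in> L2 C" "\<xi> \<in> L2 C" "\<rho> \<in> carrier G"
  shows "integrable C (\<lambda>\<sigma>. \<xi> \<sigma> * b \<sigma> \<rho>)"
  using assms by (intro ip_integrable') auto

lemma comb_add_scale:
  assumes row: "\<And>\<rho>. \<rho> \<in> carrier G \<Longrightarrow> (\<lambda>\<sigma>. b \<sigma> \<rho>) \<in> L2 C" and "\<xi> \<in> L2 C" "\<zeta> \<in> L2 C" "\<rho> \<in> carrier G"
  shows "comb b (\<lambda>\<sigma>. \<xi> \<sigma> + c * \<zeta> \<sigma>) \<rho> = comb b \<xi> \<rho> + c * comb b \<zeta> \<rho>"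
proof -
  have "integrable C (\<lambda>\<sigma>. \<xi> \<sigma> * b \<sigma> \<rho>)" "integrable C (\<lambda>\<sigma>. \<zeta> \<sigma> * b \<sigma> \<rho>)"
    using comb_integrable[where b=b, OF _ assms(2) assms(4)] comb_integrable[where b=b, OF _ assms(3) assms(4)] row by blast+
  then show ?thesis
    unfolding comb_def by (simp add: distrib_right mult.assoc)
qed

definition fin :: "nat \<Rightarrow> 'g set" where "fin n = from_nat_into (carrier G) ` {..n}"

lemma fin_finite [simp]: "finite (fin n)" and fin_carrier: "fin n \<subseteq> carrier G"
  by (auto simp: fin_def)

lemma fin_exhaust: assumes "\<sigma> \<in> carrier G" shows "\<exists>m. \<forall>n\<ge>m. \<sigma> \<in> fin n"
proof -
  obtain m where "\<sigma> = from_nat_into (carrier G) m"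
    using from_nat_into_surj[OF countable_carrier assms] by metis
  then show ?thesis by (auto simp: fin_def)
qed

lemma fin_tendsto:
  assumes "\<sigma> \<in> carrier G" shows "(\<lambda>n. if \<sigma> \<in> fin n then x else y) \<longlonglongrightarrow> x"
proof (rule tendsto_eventually)
  show "\<forall>\<^sub>F n in sequentially. (if \<sigma> \<in> fin n then x else y) = x"
    using fin_exhaust[OF assms] unfolding eventually_sequentially by auto
qed

lemma integral_C_finite:
  fixes f :: "'g \<Rightarrow> 'b :: {banach, second_countable_topology}"
  assumes "finite F" "F \<subseteq> carrier G" "\<And>\<sigma>. \<sigma> \<in> carrier G \<Longrightarrow> \<sigma> \<notin> F \<Longrightarrow> f \<sigma> = 0"
  shows "(LINT \<sigma>|C. f \<sigma>) = (\<Sum>\<sigma>\<in>F. f \<sigma>)"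
proof -
  have "(LINT \<tau>|C. f \<tau>) = (\<Sum>a | a \<in> carrier G \<and> f a \<noteq> 0. f a)"
    by (rule lebesgue_integral_count_space_finite_support, rule finite_subset[OF _ assms(1)]) (use assms in auto)
  also have "\<dots> = (\<Sum>a\<in>F. f a)"
    by (rule sum.mono_neutral_left) (use assms in auto)
  finally show ?thesis .
qed

text \<open>The series is only known to converge in each coordinate. Finite combinations are
  isometric, so Fatou's lemma makes \<open>comb b\<close> a contraction; applying the contraction to
  the tails of \<open>\<xi>\<close> gives the reverse inequality.\<close>

lemma comb_isometry:
  assumes b: "\<And>\<sigma>. \<sigma> \<in> carrier G \<Longrightarrow> b \<sigma> \<in> L2 C"
    and on: "\<And>\<sigma> \<tau>. \<sigma> \<in> carrier G \<Longrightarrow> \<tau> \<in> carrier G \<Longrightarrow> ip C (b \<sigma>) (b \<tau>) = (if \<sigma> = \<tau> then 1 else 0)"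
    and row: "\<And>\<rho>. \<rho> \<in> carrier G \<Longrightarrow> (\<lambda>\<sigma>. b \<sigma> \<rho>) \<in> L2 C"
    and \<xi>: "\<xi> \<in> L2 C"
  shows "comb b \<xi> \<in> L2 C" "sqn C (comb b \<xi>) = sqn C \<xi>"
proof -
  have fs: "(\<lambda>\<rho>. \<Sum>\<sigma>\<in>fin n. \<zeta> \<sigma> * b \<sigma> \<rho>) \<in> L2 C"
     "sqn C (\<lambda>\<rho>. \<Sum>\<sigma>\<in>fin n. \<zeta> \<sigma> * b \<sigma> \<rho>) = (\<Sum>\<sigma>\<in>fin n. (cmod (\<zeta> \<sigma>))\<^sup>2)" for n \<zeta>
    using finite_comb[of b "fin n" \<zeta>, OF b on fin_finite fin_carrier] by auto
  have contraction: "comb b \<zeta> \<in> L2 C \<and> sqn C (comb b \<zeta>) \<le> sqn C \<zeta>" if \<zeta>: "\<zeta> \<in> L2 C" for \<zeta>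
  proof -
    have lim: "(\<lambda>n. \<Sum>\<sigma>\<in>fin n. \<zeta> \<sigma> * b \<sigma> \<rho>) \<longlonglongrightarrow> comb b \<zeta> \<rho>" if \<rho>: "\<rho> \<in> carrier G" for \<rho>
    proof -
      have "(\<lambda>n. LINT \<sigma>|C. (if \<sigma> \<in> fin n then \<zeta> \<sigma> * b \<sigma> \<rho> else 0)) \<longlonglongrightarrow> comb b \<zeta> \<rho>"
        unfolding comb_def
      proof (rule integral_dominated_convergence[where w="\<lambda>\<sigma>. norm (\<zeta> \<sigma> * b \<sigma> \<rho>)"])
        show "integrable C (\<lambda>\<sigma>. norm (\<zeta> \<sigma> * b \<sigma> \<rho>))"
          by (intro integrable_norm comb_integrable row \<zeta> \<rho>)
        show "AE \<sigma> in C. (\<lambda>n. if \<sigma> \<in> fin n then \<zeta> \<sigma> * b \<sigma> \<rho> else 0) \<longlonglongrightarrow> \<zeta> \<sigma> * b \<sigma> \<rho>"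
          by (simp add: AE_count_space fin_tendsto)
      qed auto
      moreover have "(LINT \<sigma>|C. (if \<sigma> \<in> fin n then \<zeta> \<sigma> * b \<sigma> \<rho> else 0)) = (\<Sum>\<sigma>\<in>fin n. \<zeta> \<sigma> * b \<sigma> \<rho>)" for n
        by (subst integral_C_finite[OF fin_finite fin_carrier]) (auto intro: sum.cong)
      ultimately show ?thesis by simp
    qed
    have "(\<integral>\<^sup>+\<rho>. ennreal ((cmod (comb b \<zeta> \<rho>))\<^sup>2) \<partial>C) = (\<integral>\<^sup>+\<rho>. liminf (\<lambda>n. ennreal ((cmod (\<Sum>\<sigma>\<in>fin n. \<zeta> \<sigma> * b \<sigma> \<rho>))\<^sup>2)) \<partial>C)"
    proof (rule nn_integral_cong)
      fix \<rho> assume "\<rho> \<in> space C"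
      then have "(\<lambda>n. ennreal ((cmod (\<Sum>\<sigma>\<in>fin n. \<zeta> \<sigma> * b \<sigma> \<rho>))\<^sup>2)) \<longlonglongrightarrow> ennreal ((cmod (comb b \<zeta> \<rho>))\<^sup>2)"
        using lim[of \<rho>] by (intro tendsto_intros) auto
      then show "ennreal ((cmod (comb b \<zeta> \<rho>))\<^sup>2) = liminf (\<lambda>n. ennreal ((cmod (\<Sum>\<sigma>\<in>fin n. \<zeta> \<sigma> * b \<sigma> \<rho>))\<^sup>2))"
        using lim_imp_Liminf[OF trivial_limit_sequentially] by metis
    qed
    also have "\<dots> \<le> liminf (\<lambda>n. \<integral>\<^sup>+\<rho>. ennreal ((cmod (\<Sum>\<sigma>\<in>fin n. \<zeta> \<sigma> * b \<sigma> \<rho>))\<^sup>2) \<partial>C)"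
      by (rule nn_integral_liminf) auto
    also have "\<dots> \<le> liminf (\<lambda>n::nat. ennreal (sqn C \<zeta>))"
      using sqn_C_finite_le[OF \<zeta> fin_finite fin_carrier]
      by (intro Liminf_mono always_eventually allI) (simp add: nn_integral_eq_sqn[OF fs(1)] fs(2))
    finally have "(\<integral>\<^sup>+\<rho>. ennreal ((cmod (comb b \<zeta> \<rho>))\<^sup>2) \<partial>C) \<le> ennreal (sqn C \<zeta>)"
      by (simp add: Liminf_const)
    from L2_bound[OF _ this] show ?thesis by simp
  qed
  show B: "comb b \<xi> \<in> L2 C" using contraction[OF \<xi>] by simp
  define \<xi>n where "\<xi>n n \<sigma> = (if \<sigma> \<in> fin n then \<xi> \<sigma> else 0)" for n \<sigma>
  have d0: "(\<lambda>n. sqn C (\<lambda>\<sigma>. \<xi> \<sigma> - \<xi>n n \<sigma>)) \<longlonglongrightarrow> 0"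
  proof (rule sqn_dominated_limit[OF \<xi>])
    show "(\<lambda>n. \<xi> \<sigma> - \<xi>n n \<sigma>) \<longlonglongrightarrow> 0" if "\<sigma> \<in> space C" for \<sigma>
      using tendsto_diff[OF tendsto_const[of "\<xi> \<sigma>"] fin_tendsto[of \<sigma> "\<xi> \<sigma>" 0]] that by (simp add: \<xi>n_def)
  qed (auto simp: \<xi>n_def)
  have \<xi>n: "\<xi>n n \<in> L2 C" for n
  proof -
    have "(\<lambda>\<sigma>. (if \<sigma> \<in> fin n then 1 else 0) * \<xi> \<sigma>) \<in> L2 C"
      by (rule L2_bounded_mult(1)[OF \<xi>, where K=1]) auto
    then show ?thesis by (rule L2_C_cong) (simp add: \<xi>n_def)
  qed
  have Bn: "comb b (\<xi>n n) \<rho> = (\<Sum>\<sigma>\<in>fin n. \<xi> \<sigma> * b \<sigma> \<rho>)" for n \<rho>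
    unfolding comb_def by (subst integral_C_finite[OF fin_finite fin_carrier]) (auto simp: \<xi>n_def)
  have sn: "sqn C (\<xi>n n) = (\<Sum>\<sigma>\<in>fin n. (cmod (\<xi> \<sigma>))\<^sup>2)" for n
    unfolding sqn_def by (subst integral_C_finite[OF fin_finite fin_carrier]) (auto simp: \<xi>n_def)
  \<comment> \<open>The tail is paid for twice: when \<open>\<xi>\<close> is replaced by its finite
    part, and when the image of the finite part is replaced by the image of
    \<open>\<xi>\<close>.\<close>
  have "sqrt (sqn C \<xi>) \<le> sqrt (sqn C (comb b \<xi>)) + 2 * sqrt (sqn C (\<lambda>\<sigma>. \<xi> \<sigma> - \<xi>n n \<sigma>))" for n
  proof -
    let ?d = "\<lambda>\<sigma>. \<xi> \<sigma> - \<xi>n n \<sigma>"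
    have d: "?d \<in> L2 C" by (intro L2_diff \<xi> \<xi>n)
    have "sqrt (sqn C \<xi>) = sqrt (sqn C (\<lambda>\<sigma>. \<xi>n n \<sigma> + ?d \<sigma>))" by simp
    also have "\<dots> \<le> sqrt (sqn C (\<xi>n n)) + sqrt (sqn C ?d)" by (rule sqrt_sqn_triangle[OF \<xi>n d])
    also have "sqn C (\<xi>n n) = sqn C (comb b (\<xi>n n))" unfolding sn Bn by (simp add: fs)
    also have "\<dots> = sqn C (\<lambda>\<rho>. comb b \<xi> \<rho> + (-1) * comb b ?d \<rho>)"
    proof (rule sqn_C_cong)
      fix \<rho> assume "\<rho> \<in> carrier G"
      from comb_add_scale[OF row \<xi> d this, where c="-1"]
      show "comb b (\<xi>n n) \<rho> = comb b \<xi> \<rho> + (-1) * comb b ?d \<rho>" by simp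
    qed
    also have "sqrt \<dots> \<le> sqrt (sqn C (comb b \<xi>)) + sqrt (sqn C (\<lambda>\<rho>. (-1) * comb b ?d \<rho>))"
      using contraction[OF d] by (intro sqrt_sqn_triangle B L2_scale) auto
    also have "sqn C (\<lambda>\<rho>. (-1) * comb b ?d \<rho>) \<le> sqn C ?d"
      using contraction[OF d] sqn_scale[of C "-1" "comb b ?d"] by simp
    finally show ?thesis by simp
  qed
  moreover have "(\<lambda>n. sqrt (sqn C (comb b \<xi>)) + 2 * sqrt (sqn C (\<lambda>\<sigma>. \<xi> \<sigma> - \<xi>n n \<sigma>))) \<longlonglongrightarrow> sqrt (sqn C (comb b \<xi>)) + 2 * sqrt 0"
    by (intro tendsto_add tendsto_const tendsto_mult tendsto_real_sqrt d0)
  ultimately have "sqrt (sqn C \<xi>) \<le> sqrt (sqn C (comb b \<xi>)) + 2 * sqrt 0"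
    by (intro LIMSEQ_le_const) auto
  then show "sqn C (comb b \<xi>) = sqn C \<xi>" using contraction[OF \<xi>] by simp
qed

lemma comb_ip:
  assumes b: "\<And>\<sigma>. \<sigma> \<in> carrier G \<Longrightarrow> b \<sigma> \<in> L2 C"
    and on: "\<And>\<sigma> \<tau>. \<sigma> \<in> carrier G \<Longrightarrow> \<tau> \<in> carrier G \<Longrightarrow> ip C (b \<sigma>) (b \<tau>) = (if \<sigma> = \<tau> then 1 else 0)"
    and row: "\<And>\<rho>. \<rho> \<in> carrier G \<Longrightarrow> (\<lambda>\<sigma>. b \<sigma> \<rho>) \<in> L2 C"
    and \<xi>: "\<xi> \<in> L2 C" and \<zeta>: "\<zeta> \<in> L2 C"
  shows "ip C (comb b \<xi>) (comb b \<zeta>) = ip C \<xi> \<zeta>"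
proof -
  note iso = comb_isometry[OF b on row]
  have "sqn C (\<lambda>\<rho>. comb b \<xi> \<rho> + c * comb b \<zeta> \<rho>) = sqn C (\<lambda>\<sigma>. \<xi> \<sigma> + c * \<zeta> \<sigma>)" for c
  proof -
    have "sqn C (\<lambda>\<rho>. comb b \<xi> \<rho> + c * comb b \<zeta> \<rho>) = sqn C (comb b (\<lambda>\<sigma>. \<xi> \<sigma> + c * \<zeta> \<sigma>))"
      by (rule sqn_C_cong) (simp add: comb_add_scale[OF row \<xi> \<zeta>])
    also have "\<dots> = sqn C (\<lambda>\<sigma>. \<xi> \<sigma> + c * \<zeta> \<sigma>)"
      by (intro iso L2_add L2_scale \<xi> \<zeta>)
    finally show ?thesis .
  qed
  from this[of 1] this[of \<i>] show ?thesis
    by (intro ip_polarization iso \<xi> \<zeta>) auto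
qed

text \<open>The left translates of \<open>t\<close> are orthonormal. For the formal sum T with
  coefficients \<open>t\<close> this says that T T^* = 1.\<close>

definition orth :: "('g \<Rightarrow> complex) \<Rightarrow> bool" where
  "orth t \<longleftrightarrow> t \<in> L2 C \<and> (\<forall>\<kappa>\<in>carrier G. (LINT \<sigma>|C. t \<sigma> * cnj (t (inv \<kappa> \<otimes> \<sigma>))) = (if \<kappa> = \<one> then 1 else 0))"

lemma orth_translates:
  assumes t: "orth t" and "\<sigma> \<in> carrier G" "\<tau> \<in> carrier G"
  shows "ip C (\<lambda>\<rho>. t (inv \<sigma> \<otimes> \<rho>)) (\<lambda>\<rho>. t (inv \<tau> \<otimes> \<rho>)) = (if \<sigma> = \<tau> then 1 else 0)"
proof -
  have "ip C (\<lambda>\<rho>. t (inv \<sigma> \<otimes> \<rho>)) (\<lambda>\<rho>. t (inv \<tau> \<otimes> \<rho>))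
    = (LINT \<rho>|C. (\<lambda>\<rho>. t \<rho> * cnj (t (inv (inv \<sigma> \<otimes> \<tau>) \<otimes> \<rho>))) (inv \<sigma> \<otimes> \<rho>))"
    unfolding ip_def using assms
    by (intro Bochner_Integration.integral_cong) (auto simp: inv_mult_group m_assoc)
  also have "\<dots> = (LINT \<rho>|C. t \<rho> * cnj (t (inv (inv \<sigma> \<otimes> \<tau>) \<otimes> \<rho>)))"
    using assms by (intro integral_C_lmult) auto
  also have "\<dots> = (if inv \<sigma> \<otimes> \<tau> = \<one> then 1 else 0)" using t assms unfolding orth_def by blast
  also have "inv \<sigma> \<otimes> \<tau> = \<one> \<longleftrightarrow> \<sigma> = \<tau>" using assms by (auto simp: inv_solve_left')
  finally show ?thesis .
qed

text \<open>The passage from T T^* = 1 to T^* T = 1. The coefficients of T^* T form the vector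
  \<open>comb ?b ?x\<close>, which has norm 1 by \<open>comb_isometry\<close> and entry 1 at the
  identity, the squared norm of \<open>t\<close>. There is no mass left for any other entry.\<close>

lemma orth_adj:
  assumes t: "orth t" shows "orth (\<lambda>\<sigma>. cnj (t (inv \<sigma>)))"
proof -
  have tL: "t \<in> L2 C" using t by (simp add: orth_def)
  let ?b = "\<lambda>\<sigma> \<rho>. t (inv \<sigma> \<otimes> \<rho>)" and ?x = "\<lambda>\<sigma>. cnj (t (inv \<sigma>))"
  have x: "?x \<in> L2 C" by (intro L2_cnj L2_C_inv tL)
  have bL: "?b \<sigma> \<in> L2 C" if "\<sigma> \<in> carrier G" for \<sigma> by (intro L2_C_lmult tL inv_closed that)
  have row: "(\<lambda>\<sigma>. ?b \<sigma> \<rho>) \<in> L2 C" if "\<rho> \<in> carrier G" for \<rho>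
  proof -
    have "(\<lambda>\<sigma>. t (inv (inv \<rho> \<otimes> \<sigma>))) \<in> L2 C" using L2_C_lmult[OF inv_closed[OF that] L2_C_inv[OF tL]] .
    then show ?thesis by (rule L2_C_cong) (simp add: inv_mult_group that)
  qed
  note iso = comb_isometry[where b="?b", OF bL orth_translates[OF t] row x]
  have sx: "sqn C ?x = 1"
  proof -
    have "(LINT \<sigma>|C. t \<sigma> * cnj (t (inv \<one> \<otimes> \<sigma>))) = 1" using t by (metis one_closed orth_def)
    then have "ip C t t = 1" unfolding ip_def
      by (metis (no_types, lifting) Bochner_Integration.integral_cong inv_one l_one space_count_space)
    then have "sqn C t = 1" by (simp add: ip_self)
    moreover have "ip C ?x ?x = cnj (ip C t t)"
      unfolding ip_def Bochner_Integration.integral_cnj[symmetric]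
      by (subst integral_C_inv[symmetric]) (auto intro!: Bochner_Integration.integral_cong simp: ac_simps)
    ultimately show ?thesis by (simp add: ip_self)
  qed
  have one: "comb ?b ?x \<one> = 1"
  proof -
    have "comb ?b ?x \<one> = ip C ?x ?x"
      unfolding comb_def ip_def by (intro Bochner_Integration.integral_cong) auto
    then show ?thesis using sx by (simp add: ip_self)
  qed
  have zero: "comb ?b ?x \<rho> = 0" if "\<rho> \<in> carrier G" "\<rho> \<noteq> \<one>" for \<rho>
    using sqn_C_finite_le[OF iso(1), of "{\<one>, \<rho>}"] that one by (simp add: iso(2) sx)
  show ?thesis unfolding orth_def
  proof (intro conjI ballI x)
    fix \<kappa> assume k: "\<kappa> \<in> carrier G"
    have "(LINT \<sigma>|C. ?x \<sigma> * cnj (?x (inv \<kappa> \<otimes> \<sigma>))) = comb ?b ?x \<kappa>"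
      unfolding comb_def using k by (intro Bochner_Integration.integral_cong) (auto simp: inv_mult_group)
    then show "(LINT \<sigma>|C. ?x \<sigma> * cnj (?x (inv \<kappa> \<otimes> \<sigma>))) = (if \<kappa> = \<one> then 1 else 0)"
      using one zero k by auto
  qed
qed

text \<open>This is the finiteness of \<open>L(\<Lambda>)\<close>: an isometry given by a convolution is unitary.\<close>

lemma orth_right_translates:
  assumes t: "orth t" and s: "\<sigma> \<in> carrier G" "\<tau> \<in> carrier G"
  shows "ip C (\<lambda>\<rho>. t (\<rho> \<otimes> inv \<sigma>)) (\<lambda>\<rho>. t (\<rho> \<otimes> inv \<tau>)) = (if \<sigma> = \<tau> then 1 else 0)"
proof -
  let ?x = "\<lambda>\<sigma>. cnj (t (inv \<sigma>))"
  have "cnj (ip C (\<lambda>\<rho>. t (\<rho> \<otimes> inv \<sigma>)) (\<lambda>\<rho>. t (\<rho> \<otimes> inv \<tau>))) = (LINT \<rho>|C. cnj (t (\<rho> \<otimes> inv \<sigma>)) * t (\<rho> \<otimes> inv \<tau>))"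
    unfolding ip_def by (subst Bochner_Integration.integral_cnj[symmetric]) simp
  also have "\<dots> = (LINT \<rho>|C. cnj (t (inv \<rho> \<otimes> inv \<sigma>)) * t (inv \<rho> \<otimes> inv \<tau>))"
    by (rule integral_C_inv[symmetric])
  also have "\<dots> = ip C (\<lambda>\<rho>. ?x (\<sigma> \<otimes> \<rho>)) (\<lambda>\<rho>. ?x (\<tau> \<otimes> \<rho>))"
    unfolding ip_def using s by (intro Bochner_Integration.integral_cong) (auto simp: inv_mult_group)
  also have "\<dots> = (if \<sigma> = \<tau> then 1 else 0)"
    using orth_translates[OF orth_adj[OF t], of "inv \<sigma>" "inv \<tau>"] s inj_on_contraD[OF inv_inj] by auto
  finally show ?thesis by (metis complex_cnj_cancel_iff complex_cnj_one complex_cnj_zero)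
qed

text \<open>Density of the span of the \<open>nice\<close> vectors, through \<open>trunc\<close>. It
  is what allows commutation with \<open>conv_op\<close> to be tested on vectors for which each
  convolution coordinate has one term.\<close>

lemma bounded_ops_eq_nice:
  assumes S: "S \<in> bounded_ops N" and T: "T \<in> bounded_ops N"
    and eq: "\<And>f \<mu>. bdd f \<Longrightarrow> \<mu> \<in> carrier G \<Longrightarrow> S (ae_class N (nice f \<mu>)) = T (ae_class N (nice f \<mu>))"
  shows "S = T"
proof (rule bounded_ops_eqI[OF S T])
  fix c assume "c \<in> l2 N"
  then obtain \<xi> where \<xi>: "\<xi> \<in> L2 N" "c = ae_class N \<xi>" by (metis l2_cases)
  note [measurable] = L2_measurable[OF \<xi>(1)]
  obtain K where K: "0 \<le> K" "\<And>f f'. f \<in> L2 N \<Longrightarrow> f' \<in> L2 N \<Longrightarrow> S (ae_class N f) = ae_class N f' \<Longrightarrow> sqn N f' \<le> K * sqn N f"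
    by (rule bounded_ops_sqn[OF S]) blast
  obtain L where L: "0 \<le> L" "\<And>f f'. f \<in> L2 N \<Longrightarrow> f' \<in> L2 N \<Longrightarrow> T (ae_class N f) = ae_class N f' \<Longrightarrow> sqn N f' \<le> L * sqn N f"
    by (rule bounded_ops_sqn[OF T]) blast
  have tr: "trunc n \<xi> \<in> L2 N \<and> S (ae_class N (trunc n \<xi>)) = T (ae_class N (trunc n \<xi>))" for n
  proof -
    define h where "h \<mu> z = (if cmod (\<xi> (z, \<mu>)) \<le> real n then \<xi> (z, \<mu>) else 0)" for \<mu> z
    have h: "bdd (h \<mu>)" if "\<mu> \<in> carrier G" for \<mu>
    proof (rule bddI)
      show "h \<mu> \<in> borel_measurable Y" unfolding h_def using that by measurable
      show "AE z in Y. cmod (h \<mu> z) \<le> real n" by (auto simp: h_def)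
    qed
    have "(\<lambda>p. \<Sum>\<mu>\<in>F. nice (h \<mu>) \<mu> p) \<in> L2 N \<and>
        S (ae_class N (\<lambda>p. \<Sum>\<mu>\<in>F. nice (h \<mu>) \<mu> p)) = T (ae_class N (\<lambda>p. \<Sum>\<mu>\<in>F. nice (h \<mu>) \<mu> p))"
      if "finite F" "F \<subseteq> carrier G" for F
      using that
    proof (induction F)
      case empty
      have "nice (\<lambda>z. 0) \<one> = (\<lambda>p. 0)" by (auto simp: nice_def)
      then show ?case using eq[of "\<lambda>z. 0" \<one>] by simp
    next
      case (insert \<mu> F)
      have n: "nice (h \<mu>) \<mu> \<in> L2 N" using insert h by (intro nice_L2 bdd_L2) auto
      then show ?case using insert h eq[of "h \<mu>" \<mu>]
        by (simp add: l2_add_ae_class[symmetric] bounded_ops_add[OF S] bounded_ops_add[OF T] L2_add)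
    qed
    from this[OF fin_finite fin_carrier, of n] 
    have "(\<lambda>p. \<Sum>\<mu>\<in>fin n. nice (h \<mu>) \<mu> p) \<in> L2 N \<and>
        S (ae_class N (\<lambda>p. \<Sum>\<mu>\<in>fin n. nice (h \<mu>) \<mu> p)) = T (ae_class N (\<lambda>p. \<Sum>\<mu>\<in>fin n. nice (h \<mu>) \<mu> p))" .
    moreover have "trunc n \<xi> = (\<lambda>p. \<Sum>\<mu>\<in>fin n. nice (h \<mu>) \<mu> p)"
      by (auto simp: trunc_def h_def[abs_def] fin_def)
    ultimately show ?thesis by simp
  qed
  define s where "s = rep (S c)" define t where "t = rep (T c)"
  define r where "r n = rep (S (ae_class N (trunc n \<xi>)))" for n
  have s: "s \<in> L2 N" "ae_class N s = S c" and t: "t \<in> L2 N" "ae_class N t = T c"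
    using S T \<xi> by (auto simp: s_def t_def)
  have r: "r n \<in> L2 N" "ae_class N (r n) = S (ae_class N (trunc n \<xi>))" for n
  proof -
    have "S (ae_class N (trunc n \<xi>)) \<in> l2 N"
      by (rule bounded_ops_l2[OF S ae_class_l2]) (rule conjunct1[OF tr])
    then show "r n \<in> L2 N" "ae_class N (r n) = S (ae_class N (trunc n \<xi>))"
      unfolding r_def by (rule rep_L2, rule ae_class_rep)
  qed
  have d: "sqn N (\<lambda>p. s p - r n p) \<le> K * sqn N (\<lambda>p. \<xi> p - trunc n \<xi> p)" 
     "sqn N (\<lambda>p. t p - r n p) \<le> L * sqn N (\<lambda>p. \<xi> p - trunc n \<xi> p)" for n
  proof -
    have "S (ae_class N (\<lambda>p. \<xi> p + (-1) * trunc n \<xi> p)) = ae_class N (\<lambda>p. s p + (-1) * r n p)"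
      using tr s r \<xi> by (intro op_linear_comb[OF S]) auto
    then show "sqn N (\<lambda>p. s p - r n p) \<le> K * sqn N (\<lambda>p. \<xi> p - trunc n \<xi> p)"
      using tr by (intro K(2) L2_diff s r \<xi>) auto
    have "T (ae_class N (\<lambda>p. \<xi> p + (-1) * trunc n \<xi> p)) = ae_class N (\<lambda>p. t p + (-1) * r n p)"
      using tr t r \<xi> by (intro op_linear_comb[OF T]) auto
    then show "sqn N (\<lambda>p. t p - r n p) \<le> L * sqn N (\<lambda>p. \<xi> p - trunc n \<xi> p)"
      using tr by (intro L(2) L2_diff t r \<xi>) auto
  qed
  have "sqrt (sqn N (\<lambda>p. s p - t p)) \<le> sqrt (K * sqn N (\<lambda>p. \<xi> p - trunc n \<xi> p)) + sqrt (L * sqn N (\<lambda>p. \<xi> p - trunc n \<xi> p))" for n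
  proof -
    have "sqrt (sqn N (\<lambda>p. s p - t p)) = sqrt (sqn N (\<lambda>p. (s p - r n p) + (-1) * (t p - r n p)))" by simp
    also have "\<dots> \<le> sqrt (sqn N (\<lambda>p. s p - r n p)) + sqrt (sqn N (\<lambda>p. (-1) * (t p - r n p)))"
      by (intro sqrt_sqn_triangle L2_scale L2_diff s r t)
    also have "sqn N (\<lambda>p. (-1) * (t p - r n p)) = sqn N (\<lambda>p. t p - r n p)"
      by (subst sqn_scale) simp
    finally show ?thesis using real_sqrt_le_mono[OF d(1)[of n]] real_sqrt_le_mono[OF d(2)[of n]] by linarith
  qed
  moreover have "(\<lambda>n. sqrt (K * sqn N (\<lambda>p. \<xi> p - trunc n \<xi> p)) + sqrt (L * sqn N (\<lambda>p. \<xi> p - trunc n \<xi> p))) \<longlonglongrightarrow> sqrt (K * 0) + sqrt (L * 0)"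
    by (intro tendsto_add tendsto_real_sqrt tendsto_mult tendsto_const trunc_tendsto_L2 \<xi>)
  ultimately have "sqrt (sqn N (\<lambda>p. s p - t p)) \<le> sqrt (K * 0) + sqrt (L * 0)"
    by (intro LIMSEQ_le_const) auto
  then have "sqn N (\<lambda>p. s p - t p) = 0" using sqn_nonneg[of N "\<lambda>p. s p - t p"] by simp
  then have "AE p in N. s p = t p" using sqn_eq_0_iff[OF L2_diff[OF s(1) t(1)]] by simp
  then have "ae_class N s = ae_class N t" by (rule ae_class_cong)
  then show "S c = T c" using s t by simp
qed

lemma const_kernel_L2:
  assumes t: "t \<in> L2 C" shows "(\<lambda>(z, \<sigma>). t \<sigma>) \<in> L2 N"
proof -
  have [measurable]: "(\<lambda>(z, \<sigma>). t \<sigma>) \<in> borel_measurable N" by (simp add: measurable_N_iff)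
  have "(\<integral>\<^sup>+p. ennreal ((cmod ((\<lambda>(z, \<sigma>). t \<sigma>) p))\<^sup>2) \<partial>N) = (\<integral>\<^sup>+\<sigma>. ennreal ((cmod (t \<sigma>))\<^sup>2) \<partial>C)"
    by (subst nn_integral_N) (auto simp: emeasure_space_1)
  then show ?thesis using t by (simp add: L2_iff_nn_integral)
qed

definition conv_op :: "('g \<Rightarrow> complex) \<Rightarrow> ('y \<times> 'g) l2op" where
  "conv_op t = fun_op N (conv (\<lambda>(z, \<sigma>). t \<sigma>))"

context
  fixes t assumes t: "orth t"
begin

lemma t_L2: "t \<in> L2 C"
  using t by (simp add: orth_def)

text \<open>In the coordinates \<open>(y, \<rho>) \<mapsto> (\<rho> y, \<rho>)\<close> the convolution acts on the second variable only.\<close>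

lemma conv_t_isometry:
  assumes \<xi>: "\<xi> \<in> L2 N"
  shows "conv (\<lambda>(z, \<sigma>). t \<sigma>) \<xi> \<in> L2 N" "sqn N (conv (\<lambda>(z, \<sigma>). t \<sigma>) \<xi>) = sqn N \<xi>"
proof -
  let ?k = "\<lambda>(z, \<sigma>). t \<sigma>" let ?b = "\<lambda>\<mu> \<rho>. t (\<rho> \<otimes> inv \<mu>)"
  have [measurable]: "\<xi> \<in> borel_measurable N" "?k \<in> borel_measurable N"
    using L2_measurable[OF \<xi>] L2_measurable[OF const_kernel_L2[OF t_L2]] by auto
  have bL: "?b \<mu> \<in> L2 C" if "\<mu> \<in> carrier G" for \<mu> by (intro L2_C_rmult t_L2 inv_closed that)
  have row: "(\<lambda>\<mu>. ?b \<mu> \<rho>) \<in> L2 C" if "\<rho> \<in> carrier G" for \<rho>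
    using L2_C_inv[OF L2_C_lmult[OF that t_L2]] .
  have iso: "comb ?b \<zeta> \<in> L2 C" "sqn C (comb ?b \<zeta>) = sqn C \<zeta>" if "\<zeta> \<in> L2 C" for \<zeta>
    using comb_isometry[where b="?b", OF bL orth_right_translates[OF t] row that] by blast+
  have c: "conv ?k \<xi> (\<psi> \<rho> y, \<rho>) = comb ?b (\<lambda>\<mu>. \<xi> (\<psi> \<mu> y, \<mu>)) \<rho>" if "\<rho> \<in> carrier G" "y \<in> space Y" for \<rho> y
    unfolding conv_apply'[OF that(1)] comb_def using that
    by (intro Bochner_Integration.integral_cong) (auto simp: act_mult inv_mult_group m_assoc mult.commute)
  have [measurable]: "conv ?k \<xi> \<in> borel_measurable N" by measurable
  have change: "(\<integral>\<^sup>+p. ennreal ((cmod (f p))\<^sup>2) \<partial>N) = (\<integral>\<^sup>+y. \<integral>\<^sup>+\<rho>. ennreal ((cmod (f (\<psi> \<rho> y, \<rho>)))\<^sup>2) \<partial>C \<partial>Y)"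
    if [measurable]: "f \<in> borel_measurable N" for f :: "'y \<times> 'g \<Rightarrow> complex"
  proof -
    have "(\<integral>\<^sup>+p. ennreal ((cmod (f p))\<^sup>2) \<partial>N) = (\<integral>\<^sup>+\<rho>. \<integral>\<^sup>+z. ennreal ((cmod (f (z, \<rho>)))\<^sup>2) \<partial>Y \<partial>C)"
      by (subst nn_integral_N') auto
    also have "\<dots> = (\<integral>\<^sup>+\<rho>. \<integral>\<^sup>+z. ennreal ((cmod (f (\<psi> \<rho> z, \<rho>)))\<^sup>2) \<partial>Y \<partial>C)"
      by (intro nn_integral_cong nn_integral_act[symmetric, of _ "\<lambda>z. ennreal ((cmod (f (z, _)))\<^sup>2)"]) auto
    also have "\<dots> = (\<integral>\<^sup>+y. \<integral>\<^sup>+\<rho>. ennreal ((cmod (f (\<psi> \<rho> y, \<rho>)))\<^sup>2) \<partial>C \<partial>Y)"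
      by (rule nn_integral_swap[symmetric]) auto
    finally show ?thesis .
  qed
  have "(\<integral>\<^sup>+p. ennreal ((cmod (conv ?k \<xi> p))\<^sup>2) \<partial>N)
     = (\<integral>\<^sup>+y. \<integral>\<^sup>+\<rho>. ennreal ((cmod (conv ?k \<xi> (\<psi> \<rho> y, \<rho>)))\<^sup>2) \<partial>C \<partial>Y)"
    by (rule change) measurable
  also have "\<dots> = (\<integral>\<^sup>+y. \<integral>\<^sup>+\<rho>. ennreal ((cmod (\<xi> (\<psi> \<rho> y, \<rho>)))\<^sup>2) \<partial>C \<partial>Y)"
  proof (rule nn_integral_cong_AE, use L2_N_act[OF \<xi>] AE_space in eventually_elim)
    fix y assume "(\<lambda>\<sigma>. \<xi> (\<psi> (inv \<sigma>) y, inv \<sigma>)) \<in> L2 C" and y: "y \<in> space Y"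
    from L2_C_inv[OF this(1)] have x: "(\<lambda>\<sigma>. \<xi> (\<psi> \<sigma> y, \<sigma>)) \<in> L2 C"
      by (rule L2_C_cong) simp
    have "(\<integral>\<^sup>+\<rho>. ennreal ((cmod (conv ?k \<xi> (\<psi> \<rho> y, \<rho>)))\<^sup>2) \<partial>C) = (\<integral>\<^sup>+\<rho>. ennreal ((cmod (comb ?b (\<lambda>\<mu>. \<xi> (\<psi> \<mu> y, \<mu>)) \<rho>))\<^sup>2) \<partial>C)"
      by (intro nn_integral_cong) (simp add: c y)
    also have "\<dots> = (\<integral>\<^sup>+\<rho>. ennreal ((cmod (\<xi> (\<psi> \<rho> y, \<rho>)))\<^sup>2) \<partial>C)"
      using nn_integral_eq_sqn[OF iso(1)[OF x]] nn_integral_eq_sqn[OF x] iso(2)[OF x] by simp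
    finally show "(\<integral>\<^sup>+\<rho>. ennreal ((cmod (conv ?k \<xi> (\<psi> \<rho> y, \<rho>)))\<^sup>2) \<partial>C) = (\<integral>\<^sup>+\<rho>. ennreal ((cmod (\<xi> (\<psi> \<rho> y, \<rho>)))\<^sup>2) \<partial>C)" .
  qed
  also have "\<dots> = (\<integral>\<^sup>+p. ennreal ((cmod (\<xi> p))\<^sup>2) \<partial>N)"
    by (rule change[symmetric]) measurable
  finally have eq: "(\<integral>\<^sup>+p. ennreal ((cmod (conv ?k \<xi> p))\<^sup>2) \<partial>N) = (\<integral>\<^sup>+p. ennreal ((cmod (\<xi> p))\<^sup>2) \<partial>N)" .
  then show L: "conv ?k \<xi> \<in> L2 N" using \<xi> by (simp add: L2_iff_nn_integral)
  from eq show "sqn N (conv ?k \<xi>) = sqn N \<xi>" by (simp add: nn_integral_eq_sqn[OF L] nn_integral_eq_sqn[OF \<xi>])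
qed

lemma conv_op_apply: "\<xi> \<in> L2 N \<Longrightarrow> conv_op t (ae_class N \<xi>) = ae_class N (conv (\<lambda>(z, \<sigma>). t \<sigma>) \<xi>)"
  unfolding conv_op_def by (rule fun_op_apply[OF conv_cong_AE_right])

lemma conv_op_bounded: "conv_op t \<in> bounded_ops N"
  unfolding conv_op_def
proof (rule fun_op_bounded[where K=1])
  show "AE p in N. conv (\<lambda>(z, \<sigma>). t \<sigma>) (\<lambda>p. f p + g p) p = conv (\<lambda>(z, \<sigma>). t \<sigma>) f p + conv (\<lambda>(z, \<sigma>). t \<sigma>) g p"
    if "f \<in> L2 N" "g \<in> L2 N" for f g
    by (rule conv_add[OF const_kernel_L2[OF t_L2] that])
  show "AE p in N. conv (\<lambda>(z, \<sigma>). t \<sigma>) (\<lambda>p. c * f p) p = c * conv (\<lambda>(z, \<sigma>). t \<sigma>) f p" for c f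
  proof (rule AE_I2, clarify)
    fix z \<rho>
    have "(LINT \<sigma>|C. t \<sigma> * (c * f (\<psi> (inv \<sigma>) z, inv \<sigma> \<otimes> \<rho>))) = (LINT \<sigma>|C. c * (t \<sigma> * f (\<psi> (inv \<sigma>) z, inv \<sigma> \<otimes> \<rho>)))"
      by (simp add: ac_simps)
    then show "conv (\<lambda>(z, \<sigma>). t \<sigma>) (\<lambda>p. c * f p) (z, \<rho>) = c * conv (\<lambda>(z, \<sigma>). t \<sigma>) f (z, \<rho>)"
      unfolding conv_apply by simp
  qed
  show "AE p in N. conv (\<lambda>(z, \<sigma>). t \<sigma>) f p = conv (\<lambda>(z, \<sigma>). t \<sigma>) g p"
    if "AE p in N. f p = g p" for f g using that by (rule conv_cong_AE_right)
qed (auto simp: conv_t_isometry)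

text \<open>Membership in the group algebra means commuting with every \<open>S\<close> that
  commutes with the group unitaries. Finite partial sums of the convolution commute with
  \<open>S\<close>, but they need not converge to \<open>conv_op t\<close> boundedly. On a
  \<open>nice\<close> vector they do converge in norm, and this suffices to pass to the limit on
  both sides.\<close>

lemma conv_op_group_vN: "conv_op t \<in> group_vN G Y \<psi>"
proof -
  let ?k = "\<lambda>(z, \<sigma>). t \<sigma>"
  define kn where "kn n = (\<lambda>(z::'y, \<sigma>). if \<sigma> \<in> fin n then t \<sigma> else 0)" for n
  note kL = const_kernel_L2[OF t_L2]
  have conv_kn: "conv (kn n) \<xi> (z, \<rho>) = (\<Sum>\<sigma>\<in>fin n. t \<sigma> * \<xi> (\<psi> (inv \<sigma>) z, inv \<sigma> \<otimes> \<rho>))" for n \<xi> z \<rho>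
    unfolding conv_apply by (subst integral_C_finite[OF fin_finite fin_carrier]) (auto simp: kn_def)
  have "op_mult N S (conv_op t) = op_mult N (conv_op t) S" if S: "S \<in> commutant N (group_unitary G Y \<psi> ` carrier G)" for S
  proof (rule bounded_ops_eq_nice)
    have Sb: "S \<in> bounded_ops N" using S by (rule commutant_bounded)
    then show "op_mult N S (conv_op t) \<in> bounded_ops N" "op_mult N (conv_op t) S \<in> bounded_ops N"
      using conv_op_bounded by auto
    obtain K where K: "0 \<le> K" "\<And>f f'. f \<in> L2 N \<Longrightarrow> f' \<in> L2 N \<Longrightarrow> S (ae_class N f) = ae_class N f' \<Longrightarrow> sqn N f' \<le> K * sqn N f"
      by (rule bounded_ops_sqn[OF Sb]) blast
    fix f \<mu> assume f: "bdd f" and \<mu>: "\<mu> \<in> carrier G"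
    let ?\<eta> = "nice f \<mu>"
    define \<eta>' where "\<eta>' = rep (S (ae_class N ?\<eta>))"
    define s where "s = rep (S (ae_class N (conv ?k ?\<eta>)))"
    have \<eta>: "?\<eta> \<in> L2 N" by (intro nice_L2 bdd_L2 f \<mu>)
    have c\<eta>: "conv ?k ?\<eta> \<in> L2 N" by (rule conv_t_isometry[OF \<eta>])
    have \<eta>': "\<eta>' \<in> L2 N" "S (ae_class N ?\<eta>) = ae_class N \<eta>'" using Sb \<eta> by (auto simp: \<eta>'_def)
    have c\<eta>': "conv ?k \<eta>' \<in> L2 N" by (rule conv_t_isometry[OF \<eta>'(1)])
    have s: "s \<in> L2 N" "S (ae_class N (conv ?k ?\<eta>)) = ae_class N s" using Sb c\<eta> by (auto simp: s_def)
    have sg: "S (ae_class N (\<lambda>(z, \<rho>). ?\<eta> (\<psi> (inv \<sigma>) z, inv \<sigma> \<otimes> \<rho>))) = ae_class N (\<lambda>(z, \<rho>). \<eta>' (\<psi> (inv \<sigma>) z, inv \<sigma> \<otimes> \<rho>))"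
      if "\<sigma> \<in> carrier G" for \<sigma>
    proof -
      have "op_mult N S (group_unitary G Y \<psi> \<sigma>) (ae_class N ?\<eta>) = op_mult N (group_unitary G Y \<psi> \<sigma>) S (ae_class N ?\<eta>)"
        using commutantD[OF S, of "group_unitary G Y \<psi> \<sigma>"] that by simp
      then show ?thesis using \<eta> \<eta>' that by (simp add: group_unitary_apply)
    qed
    have ls: "(\<lambda>(z, \<rho>). \<xi> (\<psi> (inv \<sigma>) z, inv \<sigma> \<otimes> \<rho>)) \<in> L2 N" if "\<xi> \<in> L2 N" "\<sigma> \<in> carrier G" for \<xi> \<sigma>
      using L2_N_lshift(1)[OF that(1), of "inv \<sigma>"] that(2) by simp
    have part: "(\<lambda>(z, \<rho>). \<Sum>\<sigma>\<in>F. t \<sigma> * ?\<eta> (\<psi> (inv \<sigma>) z, inv \<sigma> \<otimes> \<rho>)) \<in> L2 N \<and>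
       (\<lambda>(z, \<rho>). \<Sum>\<sigma>\<in>F. t \<sigma> * \<eta>' (\<psi> (inv \<sigma>) z, inv \<sigma> \<otimes> \<rho>)) \<in> L2 N \<and>
       S (ae_class N (\<lambda>(z, \<rho>). \<Sum>\<sigma>\<in>F. t \<sigma> * ?\<eta> (\<psi> (inv \<sigma>) z, inv \<sigma> \<otimes> \<rho>))) =
         ae_class N (\<lambda>(z, \<rho>). \<Sum>\<sigma>\<in>F. t \<sigma> * \<eta>' (\<psi> (inv \<sigma>) z, inv \<sigma> \<otimes> \<rho>))"
      if "finite F" "F \<subseteq> carrier G" for F
      using that
    proof (induction F)
      case empty
      have "l2_scale N 0 (ae_class N (\<lambda>p. 0)) = ae_class N (\<lambda>p. 0)" by (simp add: l2_scale_ae_class)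
      then have "S (ae_class N (\<lambda>p. 0)) = l2_scale N 0 (S (ae_class N (\<lambda>p. 0)))"
        using bounded_ops_scale[OF Sb, of "ae_class N (\<lambda>p. 0)" 0] by simp
      also have "\<dots> = ae_class N (\<lambda>p. 0)" by (simp add: l2_scale_def)
      finally show ?case by (simp add: case_prod_unfold)
    next
      case (insert \<sigma> F)
      let ?f = "\<lambda>\<eta> (z, \<rho>). \<Sum>\<sigma>\<in>F. t \<sigma> * \<eta> (\<psi> (inv \<sigma>) z, inv \<sigma> \<otimes> \<rho>)"
      let ?g = "\<lambda>\<eta> (z, \<rho>). \<eta> (\<psi> (inv \<sigma>) z, inv \<sigma> \<otimes> \<rho>)"
      have IH: "?f ?\<eta> \<in> L2 N" "?f \<eta>' \<in> L2 N" "S (ae_class N (?f ?\<eta>)) = ae_class N (?f \<eta>')"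
        using insert by auto
      have \<sigma>: "\<sigma> \<in> carrier G" using insert by auto
      have "S (ae_class N (\<lambda>p. ?f ?\<eta> p + t \<sigma> * ?g ?\<eta> p)) = ae_class N (\<lambda>p. ?f \<eta>' p + t \<sigma> * ?g \<eta>' p)"
        using op_linear_comb[OF Sb IH(1) ls[OF \<eta> \<sigma>] IH(2,3) ls[OF \<eta>'(1) \<sigma>] sg[OF \<sigma>]] .
      moreover have "(\<lambda>p. ?f \<xi> p + t \<sigma> * ?g \<xi> p) = (\<lambda>(z, \<rho>). \<Sum>\<sigma>\<in>insert \<sigma> F. t \<sigma> * \<xi> (\<psi> (inv \<sigma>) z, inv \<sigma> \<otimes> \<rho>))" for \<xi>
        using insert.hyps by (auto simp: add.commute)
      ultimately show ?case
        using L2_add[OF IH(1) L2_scale[OF ls[OF \<eta> \<sigma>], of "t \<sigma>"]] L2_add[OF IH(2) L2_scale[OF ls[OF \<eta>'(1) \<sigma>], of "t \<sigma>"]] by simp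
    qed
    have kn_eq: "conv (kn n) \<xi> = (\<lambda>(z, \<rho>). \<Sum>\<sigma>\<in>fin n. t \<sigma> * \<xi> (\<psi> (inv \<sigma>) z, inv \<sigma> \<otimes> \<rho>))" for n \<xi>
      by (auto simp: conv_kn)
    have hn: "conv (kn n) ?\<eta> \<in> L2 N" "conv (kn n) \<eta>' \<in> L2 N" "S (ae_class N (conv (kn n) ?\<eta>)) = ae_class N (conv (kn n) \<eta>')" for n
      unfolding kn_eq using part[OF fin_finite fin_carrier, of n] by auto
    \<comment> \<open>Each coordinate has a single term, so a partial sum either reproduces it or
      omits it and is dominated by the full convolution.\<close>
    have d0: "(\<lambda>n. sqn N (\<lambda>p. conv ?k ?\<eta> p - conv (kn n) ?\<eta> p)) \<longlonglongrightarrow> 0"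
    proof (rule sqn_dominated_limit[OF c\<eta>])
      show "(\<lambda>p. conv ?k ?\<eta> p - conv (kn n) ?\<eta> p) \<in> borel_measurable N" for n
        using L2_measurable[OF L2_diff[OF c\<eta> hn(1)]] .
      fix p assume "p \<in> space N"
      then obtain z \<rho> where p: "p = (z, \<rho>)" "z \<in> space Y" "\<rho> \<in> carrier G" by (auto simp: space_N)
      show "cmod (conv ?k ?\<eta> p - conv (kn n) ?\<eta> p) \<le> cmod (conv ?k ?\<eta> p)" for n
        unfolding p(1) conv_nice_right[OF \<mu> p(3)] by (simp add: kn_def)
      have "(\<lambda>n. kn n (z, \<rho> \<otimes> inv \<mu>)) \<longlonglongrightarrow> t (\<rho> \<otimes> inv \<mu>)"
        unfolding kn_def using \<mu> p fin_tendsto[of "\<rho> \<otimes> inv \<mu>" "t (\<rho> \<otimes> inv \<mu>)" 0] by simp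
      then have "(\<lambda>n. conv ?k ?\<eta> p - kn n (z, \<rho> \<otimes> inv \<mu>) * f (\<psi> (inv (\<rho> \<otimes> inv \<mu>)) z)) \<longlonglongrightarrow> conv ?k ?\<eta> p - t (\<rho> \<otimes> inv \<mu>) * f (\<psi> (inv (\<rho> \<otimes> inv \<mu>)) z)"
        by (intro tendsto_intros)
      then show "(\<lambda>n. conv ?k ?\<eta> p - conv (kn n) ?\<eta> p) \<longlonglongrightarrow> 0"
        unfolding p(1) conv_nice_right[OF \<mu> p(3)] by simp
    qed
    \<comment> \<open>The partial sums at \<open>\<eta>'\<close> converge to \<open>s\<close> in
      norm because \<open>S\<close> is bounded and they are images under \<open>S\<close>; their
      pointwise limit is the convolution of \<open>\<eta>'\<close>. The two limits are
      identified.\<close>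
    have "AE p in N. s p = conv ?k \<eta>' p"
    proof (rule L2_limit_unique[OF s(1) hn(2) L2_measurable[OF c\<eta>']])
      have le: "sqn N (\<lambda>p. s p - conv (kn n) \<eta>' p) \<le> K * sqn N (\<lambda>p. conv ?k ?\<eta> p - conv (kn n) ?\<eta> p)" for n
      proof (rule K(2))
        show "S (ae_class N (\<lambda>p. conv ?k ?\<eta> p - conv (kn n) ?\<eta> p)) = ae_class N (\<lambda>p. s p - conv (kn n) \<eta>' p)"
          using op_linear_comb[OF Sb c\<eta> hn(1) s hn(2,3), of "-1"] by simp
      qed (intro L2_diff c\<eta> hn s)+
      show "(\<lambda>n. sqn N (\<lambda>p. s p - conv (kn n) \<eta>' p)) \<longlonglongrightarrow> 0"
      proof (rule tendsto_sandwich[of "\<lambda>_. 0" _ _ "\<lambda>n. K * sqn N (\<lambda>p. conv ?k ?\<eta> p - conv (kn n) ?\<eta> p)"])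
        show "(\<lambda>n. K * sqn N (\<lambda>p. conv ?k ?\<eta> p - conv (kn n) ?\<eta> p)) \<longlonglongrightarrow> 0"
          by (rule tendsto_mult_right_zero[OF d0])
      qed (use le in auto)
      show "AE p in N. (\<lambda>n. conv (kn n) \<eta>' p) \<longlonglongrightarrow> conv ?k \<eta>' p"
        unfolding AE_N_iff using conv_integrable[OF kL \<eta>'(1)]
      proof eventually_elim
        fix z assume i: "\<forall>\<rho>\<in>carrier G. integrable C (\<lambda>\<sigma>. (case (z, \<sigma>) of (z, \<sigma>) \<Rightarrow> t \<sigma>) * \<eta>' (\<psi> (inv \<sigma>) z, inv \<sigma> \<otimes> \<rho>))"
        show "\<forall>\<rho>\<in>carrier G. (\<lambda>n. conv (kn n) \<eta>' (z, \<rho>)) \<longlonglongrightarrow> conv ?k \<eta>' (z, \<rho>)"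
        proof
          fix \<rho> assume \<rho>: "\<rho> \<in> carrier G"
          show "(\<lambda>n. conv (kn n) \<eta>' (z, \<rho>)) \<longlonglongrightarrow> conv ?k \<eta>' (z, \<rho>)"
            unfolding conv_apply
          proof (rule integral_dominated_convergence[where w="\<lambda>\<sigma>. norm (t \<sigma> * \<eta>' (\<psi> (inv \<sigma>) z, inv \<sigma> \<otimes> \<rho>))"])
            show "integrable C (\<lambda>\<sigma>. norm (t \<sigma> * \<eta>' (\<psi> (inv \<sigma>) z, inv \<sigma> \<otimes> \<rho>)))"
              using i \<rho> by (intro integrable_norm) auto
            show "AE \<sigma> in C. (\<lambda>n. kn n (z, \<sigma>) * \<eta>' (\<psi> (inv \<sigma>) z, inv \<sigma> \<otimes> \<rho>))
                \<longlonglongrightarrow> (case (z, \<sigma>) of (z, \<sigma>) \<Rightarrow> t \<sigma>) * \<eta>' (\<psi> (inv \<sigma>) z, inv \<sigma> \<otimes> \<rho>)"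
              by (auto simp: AE_count_space kn_def intro!: tendsto_mult tendsto_const fin_tendsto)
            show "AE \<sigma> in C. norm (kn n (z, \<sigma>) * \<eta>' (\<psi> (inv \<sigma>) z, inv \<sigma> \<otimes> \<rho>))
                \<le> norm (t \<sigma> * \<eta>' (\<psi> (inv \<sigma>) z, inv \<sigma> \<otimes> \<rho>))" for n
              by (auto simp: norm_mult kn_def)
          qed auto
        qed
      qed
    qed
    then have "ae_class N s = ae_class N (conv ?k \<eta>')" by (rule ae_class_cong)
    then show "op_mult N S (conv_op t) (ae_class N ?\<eta>) = op_mult N (conv_op t) S (ae_class N ?\<eta>)"
      using \<eta> \<eta>' s by (simp add: conv_op_apply)
  qed
  then show ?thesis
    unfolding group_vN_eq commutant_def[of N "commutant _ _"] using conv_op_bounded by blast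
qed

lemma conv_op_crossed: "conv_op t \<in> crossed_product G Y \<psi>"
  using conv_op_group_vN group_vN_subset by blast

lemma kern_conv_op: "AE z in Y. \<forall>\<rho>\<in>carrier G. kern (conv_op t) (z, \<rho>) = t \<rho>"
proof -
  have "AE p in N. kern (conv_op t) p = conv (\<lambda>(z, \<sigma>). t \<sigma>) (delta \<one>) p"
    by (rule kern_unique[OF conv_op_bounded conv_op_apply]) simp
  then show ?thesis unfolding AE_N_iff delta_nice by eventually_elim (simp add: conv_nice_right)
qed

text \<open>The two halves have different sources. The isometry \<open>conv_t_isometry\<close> and
  polarisation give T^* T = 1, while T T^* = 1 is the definition of \<open>orth\<close> read off
  from kernels.\<close>

lemma conv_op_unitary: "conv_op t \<in> unitaries N (group_vN G Y \<psi>)"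
proof -
  note b = conv_op_bounded
  have "op_mult N (op_adj N (conv_op t)) (conv_op t) = op_one N"
  proof (rule bounded_ops_eqI[of _ N])
    fix c assume c: "c \<in> l2 N"
    then obtain \<xi> where \<xi>: "\<xi> \<in> L2 N" "c = ae_class N \<xi>" by (metis l2_cases)
    have "op_adj N (conv_op t) (conv_op t c) = c"
    proof (rule l2_eqI[of _ N])
      fix e assume e: "e \<in> l2 N"
      then obtain \<zeta> where \<zeta>: "\<zeta> \<in> L2 N" "e = ae_class N \<zeta>" by (metis l2_cases)
      have "l2_inner N e (op_adj N (conv_op t) (conv_op t c)) = l2_inner N (conv_op t e) (conv_op t c)"
        using b e c by (intro op_adj_inner[symmetric]) auto
      also have "\<dots> = ip N (conv (\<lambda>(z, \<sigma>). t \<sigma>) \<zeta>) (conv (\<lambda>(z, \<sigma>). t \<sigma>) \<xi>)"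
        using \<xi> \<zeta> by (simp add: conv_op_apply l2_inner_ae_class conv_t_isometry)
      also have "\<dots> = ip N \<zeta> \<xi>"
      proof -
        have "sqn N (\<lambda>p. conv (\<lambda>(z, \<sigma>). t \<sigma>) \<zeta> p + w * conv (\<lambda>(z, \<sigma>). t \<sigma>) \<xi> p) = sqn N (\<lambda>p. \<zeta> p + w * \<xi> p)" for w
        proof -
          let ?c = "conv (\<lambda>(z, \<sigma>). t \<sigma>)"
          have L: "(\<lambda>p. \<zeta> p + w * \<xi> p) \<in> L2 N" by (intro L2_add L2_scale \<xi> \<zeta>)
          have "ae_class N (?c (\<lambda>p. \<zeta> p + w * \<xi> p)) = ae_class N (\<lambda>p. ?c \<zeta> p + w * ?c \<xi> p)"
            unfolding conv_op_apply[OF L, symmetric]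
            by (intro op_linear_comb[OF b] \<xi> \<zeta> conv_t_isometry conv_op_apply)
          then have "AE p in N. ?c (\<lambda>p. \<zeta> p + w * \<xi> p) p = ?c \<zeta> p + w * ?c \<xi> p"
            by (rule ae_class_eqD[OF _ L2_measurable[OF conv_t_isometry(1)[OF L]]])
          then have "sqn N (\<lambda>p. ?c \<zeta> p + w * ?c \<xi> p) = sqn N (?c (\<lambda>p. \<zeta> p + w * \<xi> p))"
            by (intro L2_cong_AE(2) conv_t_isometry(1)[OF L] L2_measurable[OF L2_add[OF conv_t_isometry(1)[OF \<zeta>(1)] L2_scale[OF conv_t_isometry(1)[OF \<xi>(1)]]]])
          then show ?thesis using conv_t_isometry(2)[OF L] by simp
        qed
        from this[of 1] this[of \<i>] show ?thesis
          by (intro ip_polarization conv_t_isometry \<xi> \<zeta>) auto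
      qed
      also have "\<dots> = l2_inner N e c" using \<xi> \<zeta> by (simp add: l2_inner_ae_class)
      finally show "l2_inner N e (op_adj N (conv_op t) (conv_op t c)) = l2_inner N e c" .
    qed (use b c in auto)
    then show "op_mult N (op_adj N (conv_op t)) (conv_op t) c = op_one N c" using c by simp
  qed (use b in auto)
  moreover have "op_mult N (conv_op t) (op_adj N (conv_op t)) = op_one N"
  proof (rule crossed_eqI)
    have "AE z in Y. \<forall>\<rho>\<in>carrier G. kern (op_one N) (z, \<rho>) = delta \<one> (z, \<rho>)"
      using kern_one by (simp add: AE_N_iff)
    then show "AE p in N. kern (op_mult N (conv_op t) (op_adj N (conv_op t))) p = kern (op_one N) p"
      unfolding AE_N_iff using kern_mult_adj[OF conv_op_crossed conv_op_crossed] kern_conv_op AE_act_all[OF kern_conv_op]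
    proof eventually_elim
      fix z assume 1: "\<forall>\<rho>\<in>carrier G. kern (op_one N) (z, \<rho>) = delta \<one> (z, \<rho>)"
        and 2: "\<forall>\<rho>\<in>carrier G. kern (op_mult N (conv_op t) (op_adj N (conv_op t))) (z, \<rho>) =
          (LINT \<sigma>|C. kern (conv_op t) (z, \<sigma>) * cnj (kern (conv_op t) (\<psi> (inv \<rho>) z, inv \<rho> \<otimes> \<sigma>)))"
        and 3: "\<forall>\<rho>\<in>carrier G. kern (conv_op t) (z, \<rho>) = t \<rho>"
        and 4: "\<forall>g\<in>carrier G. \<forall>\<rho>\<in>carrier G. kern (conv_op t) (\<psi> g z, \<rho>) = t \<rho>"
      show "\<forall>\<rho>\<in>carrier G. kern (op_mult N (conv_op t) (op_adj N (conv_op t))) (z, \<rho>) = kern (op_one N) (z, \<rho>)"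
      proof
        fix \<rho> assume \<rho>: "\<rho> \<in> carrier G"
        have "(LINT \<sigma>|C. kern (conv_op t) (z, \<sigma>) * cnj (kern (conv_op t) (\<psi> (inv \<rho>) z, inv \<rho> \<otimes> \<sigma>))) =
          (LINT \<sigma>|C. t \<sigma> * cnj (t (inv \<rho> \<otimes> \<sigma>)))"
          using \<rho> 3 4 by (intro Bochner_Integration.integral_cong) auto
        then show "kern (op_mult N (conv_op t) (op_adj N (conv_op t))) (z, \<rho>) = kern (op_one N) (z, \<rho>)"
          using 1 2 \<rho> t by (simp add: orth_def delta_def)
      qed
    qed
  qed (use conv_op_crossed in auto)
  ultimately show ?thesis using conv_op_group_vN by (simp add: unitaries_def)
qed

end

end

section \<open>Rigidity\<close>

context gms
begin

text \<open>The inner product of \<eta> with the left translate of \<zeta> by \<rho>: matrix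
  coefficients of the regular representation.\<close>

definition pr :: "('g \<Rightarrow> complex) \<Rightarrow> ('g \<Rightarrow> complex) \<Rightarrow> 'g \<Rightarrow> complex" where
  "pr \<eta> \<zeta> \<rho> = (LINT \<sigma>|C. \<eta> \<sigma> * cnj (\<zeta> (inv \<rho> \<otimes> \<sigma>)))"

lemma pr_ip: "pr \<eta> \<zeta> \<rho> = ip C \<eta> (\<lambda>\<sigma>. \<zeta> (inv \<rho> \<otimes> \<sigma>))"
  by (simp add: pr_def ip_def)

lemma orth_row:
  assumes c: "c \<in> L2 C" and \<rho>: "\<rho> \<in> carrier G"
  shows "(\<lambda>\<kappa>. c (inv \<kappa> \<otimes> \<rho>)) \<in> L2 C"
proof -
  have "(\<lambda>\<kappa>. c (inv (inv \<rho> \<otimes> \<kappa>))) \<in> L2 C"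
    using L2_C_lmult[OF inv_closed[OF \<rho>] L2_C_inv[OF c]] .
  then show ?thesis by (rule L2_C_cong) (simp add: inv_mult_group \<rho>)
qed

text \<open>For this family \<open>comb\<close> is right convolution by \<open>c\<close>. Its
  invariance of inner products is what eliminates the unknown unitaries \<open>wg \<gamma>\<close>
  later on.\<close>

lemma orth_comb_ip:
  assumes c: "orth c" and "\<xi> \<in> L2 C" "\<zeta> \<in> L2 C"
  shows "ip C (comb (\<lambda>\<kappa> \<rho>. c (inv \<kappa> \<otimes> \<rho>)) \<xi>) (comb (\<lambda>\<kappa> \<rho>. c (inv \<kappa> \<otimes> \<rho>)) \<zeta>) = ip C \<xi> \<zeta>"
proof (rule comb_ip)
  have "c \<in> L2 C" using c by (simp add: orth_def)
  then show "(\<lambda>\<rho>. c (inv \<sigma> \<otimes> \<rho>)) \<in> L2 C" "(\<lambda>\<kappa>. c (inv \<kappa> \<otimes> \<sigma>)) \<in> L2 C" if "\<sigma> \<in> carrier G" for \<sigma>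
    using that by (auto intro: L2_C_lmult orth_row)
qed (use assms in \<open>auto simp: orth_translates\<close>)

text \<open>The translates of \<open>t\<close> form a complete orthonormal system: the coefficient
  vector \<open>pr \<eta> t\<close> is the right convolution of \<eta> by the adjoint of
  \<open>t\<close>, again isometric by \<open>orth_adj\<close>. With at most one nonzero coefficient
  it has exactly one, of modulus 1, and two unit vectors with inner product 1 are equal.\<close>

lemma orth_expansion:
  assumes t: "orth t" and \<eta>: "\<eta> \<in> L2 C" "sqn C \<eta> = 1"
    and single: "\<And>\<sigma> \<tau>. \<sigma> \<in> carrier G \<Longrightarrow> \<tau> \<in> carrier G \<Longrightarrow> \<sigma> \<noteq> \<tau> \<Longrightarrow> pr \<eta> t \<sigma> * pr \<eta> t \<tau> = 0"
  shows "\<exists>h\<in>carrier G. \<exists>b. cmod b = 1 \<and> (\<forall>\<tau>\<in>carrier G. \<eta> \<tau> = b * t (inv h \<otimes> \<tau>))"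
proof -
  have tL: "t \<in> L2 C" using t by (simp add: orth_def)
  let ?x = "\<lambda>\<sigma>. cnj (t (inv \<sigma>))" let ?b = "\<lambda>\<tau> \<rho>. ?x (inv \<tau> \<otimes> \<rho>)"
  have x: "orth ?x" by (rule orth_adj[OF t])
  have xL: "?x \<in> L2 C" using x by (simp add: orth_def)
  have pr_comb: "pr \<eta> t \<rho> = comb ?b \<eta> \<rho>" if "\<rho> \<in> carrier G" for \<rho>
    unfolding pr_def comb_def using that by (intro Bochner_Integration.integral_cong) (auto simp: inv_mult_group)
  have iso: "comb ?b \<eta> \<in> L2 C" "sqn C (comb ?b \<eta>) = sqn C \<eta>"
    by (rule comb_isometry[where b="?b", OF _ orth_translates[OF x] orth_row[OF xL] \<eta>(1)]; auto intro: L2_C_lmult xL)+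
  have "pr \<eta> t \<in> L2 C" using iso(1) by (rule L2_C_cong) (simp add: pr_comb)
  moreover have "sqn C (pr \<eta> t) = 1" using iso(2) \<eta>(2) sqn_C_cong[of "pr \<eta> t" "comb ?b \<eta>"] pr_comb by simp
  ultimately obtain h where h: "h \<in> carrier G" "cmod (pr \<eta> t h) = 1"
    using single_support_norm[of "pr \<eta> t"] single by blast
  define b where "b = pr \<eta> t h"
  let ?t = "\<lambda>\<tau>. t (inv h \<otimes> \<tau>)"
  have t': "?t \<in> L2 C" by (intro L2_C_lmult tL inv_closed h)
  have "ip C ?t ?t = 1" using orth_translates[OF t h(1) h(1)] by simp
  then have st: "sqn C ?t = 1" by (simp add: ip_self)
  have bt: "(\<lambda>\<tau>. b * ?t \<tau>) \<in> L2 C" by (rule L2_scale[OF t'])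
  have "ip C \<eta> (\<lambda>\<tau>. b * ?t \<tau>) = cnj b * b" by (simp add: ip_scale_right b_def pr_ip)
  also have "\<dots> = complex_of_real ((cmod b)\<^sup>2)" using complex_norm_square[of b] by (simp only: mult.commute)
  finally have "ip C \<eta> (\<lambda>\<tau>. b * ?t \<tau>) = 1" using h(2) by (simp add: b_def)
  then have "sqn C (\<lambda>\<tau>. \<eta> \<tau> - b * ?t \<tau>) = 0"
    using sqn_diff[OF \<eta>(1) bt] \<eta>(2) st h(2) by (simp add: sqn_scale b_def)
  then have "AE \<tau> in C. \<eta> \<tau> - b * ?t \<tau> = 0" using sqn_eq_0_iff[OF L2_diff[OF \<eta>(1) bt]] by simp
  then show ?thesis using h by (intro bexI[of _ h] exI[of _ b]) (auto simp: AE_count_space b_def)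
qed

text \<open>This is how infinite conjugacy classes enter: S will be a class and m a summable class
  function.\<close>

lemma summable_constant_infinite:
  fixes m :: "'g \<Rightarrow> ennreal"
  assumes "(\<integral>\<^sup>+\<kappa>. m \<kappa> \<partial>C) < \<infinity>" "infinite S" "S \<subseteq> carrier G" "\<And>s. s \<in> S \<Longrightarrow> m s = c"
  shows "c = 0"
proof (rule ccontr)
  assume "c \<noteq> 0"
  have "(\<integral>\<^sup>+\<kappa>. m \<kappa> \<partial>C) \<ge> (\<integral>\<^sup>+\<kappa>. c * indicator S \<kappa> \<partial>C)"
    using assms(4) by (intro nn_integral_mono) (auto split: split_indicator)
  also have "(\<integral>\<^sup>+\<kappa>. c * indicator S \<kappa> \<partial>C) = c * emeasure C S"
    using assms(3) by (intro nn_integral_cmult_indicator) auto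
  also have "emeasure C S = \<infinity>" using assms(2,3) by simp
  finally show False using assms(1) \<open>c \<noteq> 0\<close> by (simp add: ennreal_mult_top top_unique)
qed

end

text \<open>\<open>U\<close> stands for the coefficients of \<open>u\<close>, \<open>k \<gamma>\<close> for \<open>\<Theta>(u\<^sub>\<gamma>)\<close> and \<open>c \<gamma>\<close> for
  \<open>w\<^sub>\<gamma> = u\<^sup>*\<Theta>(u\<^sub>\<gamma>)u\<close>.  The assumption \<open>frame\<close> says that \<open>u\<close> is isometric, \<open>equivariance\<close> is \<open>\<Theta>(u\<^sub>\<gamma>)u = uw\<^sub>\<gamma>\<close>.\<close>

locale rigid = gms G Y \<psi>
  for G :: "('g, 'm) monoid_scheme" (structure) and Y :: "'y measure" and \<psi> :: "'g \<Rightarrow> 'y \<Rightarrow> 'y" +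
  fixes U :: "'y \<times> 'g \<Rightarrow> complex" and I :: "'i set" and k :: "'i \<Rightarrow> 'y \<times> 'g \<Rightarrow> complex" and c :: "'i \<Rightarrow> 'g \<Rightarrow> complex"
  assumes U_meas [measurable]: "U \<in> borel_measurable N"
    and U_norm: "AE z in Y. (\<lambda>\<rho>. U (z, \<rho>)) \<in> L2 C \<and> sqn C (\<lambda>\<rho>. U (z, \<rho>)) = 1"
    and frame: "\<And>\<zeta> \<zeta>'. \<zeta> \<in> L2 C \<Longrightarrow> \<zeta>' \<in> L2 C \<Longrightarrow>
      (\<lambda>(y, \<rho>). pr (\<lambda>\<sigma>. U (y, \<sigma>)) \<zeta> \<rho>) \<in> L2 N \<and>
      ip N (\<lambda>(y, \<rho>). pr (\<lambda>\<sigma>. U (y, \<sigma>)) \<zeta> \<rho>) (\<lambda>(y, \<rho>). pr (\<lambda>\<sigma>. U (y, \<sigma>)) \<zeta>' \<rho>) = ip C \<zeta>' \<zeta>"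
    and I_countable: "countable I"
    and k_meas: "\<And>i. i \<in> I \<Longrightarrow> k i \<in> borel_measurable N"
    and c_orth: "\<And>i. i \<in> I \<Longrightarrow> orth (c i)"
    and equivariance: "\<And>i. i \<in> I \<Longrightarrow> AE z in Y. \<forall>\<sigma>\<in>carrier G. k i (z, \<sigma>) \<noteq> 0 \<longrightarrow> cmod (k i (z, \<sigma>)) = 1 \<and>
      (\<forall>\<rho>\<in>carrier G. k i (z, \<sigma>) * U (\<psi> (inv \<sigma>) z, inv \<sigma> \<otimes> \<rho>) = (LINT \<kappa>|C. U (z, \<kappa>) * c i (inv \<kappa> \<otimes> \<rho>)))"
    and k_row: "\<And>i. i \<in> I \<Longrightarrow> AE z in Y. (\<integral>\<^sup>+\<sigma>. ennreal ((cmod (k i (z, \<sigma>)))\<^sup>2) \<partial>C) = 1"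
    and k_col: "\<And>i. i \<in> I \<Longrightarrow> AE z in Y. (\<integral>\<^sup>+\<sigma>. ennreal ((cmod (k i (\<psi> \<sigma> z, \<sigma>)))\<^sup>2) \<partial>C) = 1"
    and cover: "\<And>\<mu>. \<mu> \<in> carrier G \<Longrightarrow> AE z in Y. \<exists>i\<in>I. k i (z, \<mu>) \<noteq> 0"
    and icc: "icc G"
begin

definition F :: "'y \<Rightarrow> 'y \<Rightarrow> 'g \<Rightarrow> complex" where
  "F y z = pr (\<lambda>\<sigma>. U (y, \<sigma>)) (\<lambda>\<sigma>. U (z, \<sigma>))"

definition q :: "'y \<Rightarrow> 'y \<Rightarrow> ennreal" where
  "q y z = (\<integral>\<^sup>+\<rho>. ennreal ((cmod (F y z \<rho>))\<^sup>2) \<partial>C)"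

text \<open>The weight \<open>1/(1 + q)\<close> makes the sum over \<open>\<kappa>\<close> of the integrals of \<open>g \<kappa>\<close> finite.\<close>

definition g :: "'g \<Rightarrow> 'y \<Rightarrow> 'y \<Rightarrow> ennreal" where
  "g \<kappa> y z = (\<integral>\<^sup>+\<rho>. ennreal ((cmod (F y z \<rho>))\<^sup>2) * ennreal ((cmod (F y z (\<rho> \<otimes> \<kappa>)))\<^sup>2) \<partial>C) / (1 + q y z)"

definition GG :: "'g \<Rightarrow> 'y \<Rightarrow> ennreal" where
  "GG \<kappa> z = (\<integral>\<^sup>+y. g \<kappa> y z \<partial>Y)"

lemma F_meas [measurable]: "\<rho> \<in> carrier G \<Longrightarrow> (\<lambda>p. F (fst p) (snd p) \<rho>) \<in> borel_measurable (Y \<Otimes>\<^sub>M Y)"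
  unfolding F_def pr_def by measurable

lemma q_meas [measurable]: "(\<lambda>p. q (fst p) (snd p)) \<in> borel_measurable (Y \<Otimes>\<^sub>M Y)"
  unfolding q_def by measurable

lemma g_meas [measurable]: "\<kappa> \<in> carrier G \<Longrightarrow> (\<lambda>p. g \<kappa> (fst p) (snd p)) \<in> borel_measurable (Y \<Otimes>\<^sub>M Y)"
  unfolding g_def by measurable

lemma g_meas1 [measurable (raw)]:
  "\<kappa> \<in> carrier G \<Longrightarrow> f \<in> measurable K Y \<Longrightarrow> h \<in> measurable K Y \<Longrightarrow> (\<lambda>x. g \<kappa> (f x) (h x)) \<in> borel_measurable K"
  using measurable_compose[OF measurable_Pair g_meas, of f K h \<kappa>] by simp

lemma q_meas1 [measurable (raw)]:
  "f \<in> measurable K Y \<Longrightarrow> h \<in> measurable K Y \<Longrightarrow> (\<lambda>x. q (f x) (h x)) \<in> borel_measurable K"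
  using measurable_compose[OF measurable_Pair q_meas, of f K h] by simp

lemma GG_meas [measurable]: "\<kappa> \<in> carrier G \<Longrightarrow> GG \<kappa> \<in> borel_measurable Y"
  unfolding GG_def by measurable

text \<open>The same index \<open>i\<close> is used at y and at z, so both rows are moved by the
  same right convolution, which the inner product does not see. The phases \<open>a\<close> and
  \<open>b\<close> disappear in the modulus; the two left translations remain.\<close>

lemma F_equivariant:
  assumes c: "orth (c i)"
    and y: "(\<lambda>\<rho>. U (y, \<rho>)) \<in> L2 C" "cmod a = 1" "\<sigma> \<in> carrier G"
      "\<And>\<rho>. \<rho> \<in> carrier G \<Longrightarrow> a * U (\<psi> (inv \<sigma>) y, inv \<sigma> \<otimes> \<rho>) = (LINT \<kappa>|C. U (y, \<kappa>) * c i (inv \<kappa> \<otimes> \<rho>))"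
    and z: "(\<lambda>\<rho>. U (z, \<rho>)) \<in> L2 C" "cmod b = 1" "\<mu> \<in> carrier G"
      "\<And>\<rho>. \<rho> \<in> carrier G \<Longrightarrow> b * U (\<psi> (inv \<mu>) z, inv \<mu> \<otimes> \<rho>) = (LINT \<kappa>|C. U (z, \<kappa>) * c i (inv \<kappa> \<otimes> \<rho>))"
    and \<rho>: "\<rho> \<in> carrier G"
  shows "cmod (F y z \<rho>) = cmod (F (\<psi> (inv \<sigma>) y) (\<psi> (inv \<mu>) z) (inv \<sigma> \<otimes> \<rho> \<otimes> \<mu>))"
proof -
  let ?b = "\<lambda>\<kappa> \<rho>. c i (inv \<kappa> \<otimes> \<rho>)"
  let ?y' = "\<psi> (inv \<sigma>) y" and ?z' = "\<psi> (inv \<mu>) z"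
  let ?Lz = "\<lambda>\<tau>. U (z, inv \<rho> \<otimes> \<tau>)"
  have Lz: "?Lz \<in> L2 C" by (rule L2_C_lmult[OF inv_closed[OF \<rho>] z(1)])
  have cy: "comb ?b (\<lambda>\<rho>. U (y, \<rho>)) \<tau> = a * U (?y', inv \<sigma> \<otimes> \<tau>)" if "\<tau> \<in> carrier G" for \<tau>
    using y(4)[OF that] by (simp add: comb_def)
  \<comment> \<open>Left translation by \<rho> commutes with right convolution by
    \<open>c i\<close>.\<close>
  have cz: "comb ?b ?Lz \<tau> = b * U (?z', inv \<mu> \<otimes> (inv \<rho> \<otimes> \<tau>))" if "\<tau> \<in> carrier G" for \<tau>
  proof -
    have "comb ?b ?Lz \<tau> = (LINT \<kappa>|C. ?Lz (\<rho> \<otimes> \<kappa>) * c i (inv (\<rho> \<otimes> \<kappa>) \<otimes> \<tau>))"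
      unfolding comb_def by (rule integral_C_lmult[OF \<rho>, symmetric])
    also have "\<dots> = (LINT \<kappa>|C. U (z, \<kappa>) * c i (inv \<kappa> \<otimes> (inv \<rho> \<otimes> \<tau>)))"
      using \<rho> that by (intro Bochner_Integration.integral_cong) (auto simp: inv_mult_group m_assoc)
    finally show ?thesis using z(4)[of "inv \<rho> \<otimes> \<tau>"] \<rho> that by simp
  qed
  have "F y z \<rho> = ip C (\<lambda>\<rho>. U (y, \<rho>)) ?Lz" by (simp add: F_def pr_ip)
  also have "\<dots> = ip C (comb ?b (\<lambda>\<rho>. U (y, \<rho>))) (comb ?b ?Lz)"
    by (rule orth_comb_ip[OF c y(1) Lz, symmetric])
  also have "\<dots> = ip C (\<lambda>\<tau>. a * U (?y', inv \<sigma> \<otimes> \<tau>)) (\<lambda>\<tau>. b * U (?z', inv \<mu> \<otimes> (inv \<rho> \<otimes> \<tau>)))"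
    by (rule ip_C_cong) (auto simp: cy cz)
  also have "\<dots> = a * cnj b * ip C (\<lambda>\<tau>. U (?y', inv \<sigma> \<otimes> \<tau>)) (\<lambda>\<tau>. U (?z', inv \<mu> \<otimes> (inv \<rho> \<otimes> \<tau>)))"
    by (simp add: ip_scale_left ip_scale_right)
  also have "ip C (\<lambda>\<tau>. U (?y', inv \<sigma> \<otimes> \<tau>)) (\<lambda>\<tau>. U (?z', inv \<mu> \<otimes> (inv \<rho> \<otimes> \<tau>)))
      = (LINT \<tau>|C. U (?y', inv \<sigma> \<otimes> (\<sigma> \<otimes> \<tau>)) * cnj (U (?z', inv \<mu> \<otimes> (inv \<rho> \<otimes> (\<sigma> \<otimes> \<tau>)))))"
    unfolding ip_def by (rule integral_C_lmult[OF y(3), symmetric])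
  also have "\<dots> = F ?y' ?z' (inv \<sigma> \<otimes> \<rho> \<otimes> \<mu>)"
    unfolding F_def pr_def using \<rho> y(3) z(3)
    by (intro Bochner_Integration.integral_cong) (auto simp: inv_mult_group m_assoc)
  finally show ?thesis using y(2) z(2) by (simp add: norm_mult)
qed

lemma nn_integral_C_shift:
  assumes "\<sigma> \<in> carrier G" "\<mu> \<in> carrier G"
  shows "(\<integral>\<^sup>+\<rho>. f (inv \<sigma> \<otimes> \<rho> \<otimes> \<mu>) \<partial>C) = (\<integral>\<^sup>+\<rho>. f \<rho> \<partial>C)"
  using nn_integral_C_lmult[of "inv \<sigma>" "\<lambda>\<rho>. f (\<rho> \<otimes> \<mu>)"] nn_integral_C_rmult[of \<mu> f] assms by simp

text \<open>The sum over \<rho> is invariant under replacing \<rho> by \<sigma>^-1 \<rho> \<mu>, and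
  carrying the right factor \<kappa> past \<mu> conjugates it. The element \<sigma> belonging to y
  leaves no trace.\<close>

lemma g_equivariant:
  assumes eq: "\<And>\<rho>. \<rho> \<in> carrier G \<Longrightarrow> cmod (F y z \<rho>) = cmod (F y' z' (inv \<sigma> \<otimes> \<rho> \<otimes> \<mu>))"
    and s: "\<sigma> \<in> carrier G" "\<mu> \<in> carrier G" and \<kappa>: "\<kappa> \<in> carrier G"
  shows "g \<kappa> y z = g (inv \<mu> \<otimes> \<kappa> \<otimes> \<mu>) y' z'"
proof -
  have "q y z = (\<integral>\<^sup>+\<rho>. ennreal ((cmod (F y' z' (inv \<sigma> \<otimes> \<rho> \<otimes> \<mu>)))\<^sup>2) \<partial>C)"
    unfolding q_def by (intro nn_integral_cong) (simp add: eq)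
  also have "\<dots> = q y' z'"
    unfolding q_def by (rule nn_integral_C_shift[OF s])
  finally have 1: "q y z = q y' z'" .
  let ?f = "\<lambda>\<rho>. ennreal ((cmod (F y' z' \<rho>))\<^sup>2) * ennreal ((cmod (F y' z' (\<rho> \<otimes> (inv \<mu> \<otimes> \<kappa> \<otimes> \<mu>))))\<^sup>2)"
  have "(\<integral>\<^sup>+\<rho>. ennreal ((cmod (F y z \<rho>))\<^sup>2) * ennreal ((cmod (F y z (\<rho> \<otimes> \<kappa>)))\<^sup>2) \<partial>C) = (\<integral>\<^sup>+\<rho>. ?f (inv \<sigma> \<otimes> \<rho> \<otimes> \<mu>) \<partial>C)"
    by (intro nn_integral_cong) (use s \<kappa> in \<open>simp add: eq m_assoc\<close>)
  also have "\<dots> = (\<integral>\<^sup>+\<rho>. ?f \<rho> \<partial>C)" by (rule nn_integral_C_shift[OF s])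
  finally show ?thesis unfolding g_def 1 by simp
qed

text \<open>The element \<open>\<Theta>(u\<^sub>\<gamma>)\<close> implements a transformation of \<open>Y\<close>, piecewise given by group elements, which
  preserves the measure.\<close>

lemma piecewise_measure_preserving:
  assumes i: "i \<in> I" and f [measurable]: "f \<in> borel_measurable Y"
    and h: "AE y in Y. \<forall>\<sigma>\<in>carrier G. k i (y, \<sigma>) \<noteq> 0 \<longrightarrow> h y = f (\<psi> (inv \<sigma>) y)"
  shows "(\<integral>\<^sup>+y. h y \<partial>Y) = (\<integral>\<^sup>+y. f y \<partial>Y)"
proof -
  note [measurable] = k_meas[OF i]
  let ?k = "\<lambda>y \<sigma>. ennreal ((cmod (k i (y, \<sigma>)))\<^sup>2)"
  have "(\<integral>\<^sup>+y. h y \<partial>Y) = (\<integral>\<^sup>+y. \<integral>\<^sup>+\<sigma>. ?k y \<sigma> * f (\<psi> (inv \<sigma>) y) \<partial>C \<partial>Y)"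
  proof (rule nn_integral_cong_AE)
    show "AE y in Y. h y = (\<integral>\<^sup>+\<sigma>. ?k y \<sigma> * f (\<psi> (inv \<sigma>) y) \<partial>C)"
      using h k_row[OF i]
  proof eventually_elim
    fix y assume 1: "\<forall>\<sigma>\<in>carrier G. k i (y, \<sigma>) \<noteq> 0 \<longrightarrow> h y = f (\<psi> (inv \<sigma>) y)" and 2: "(\<integral>\<^sup>+\<sigma>. ?k y \<sigma> \<partial>C) = 1"
    have "h y = (\<integral>\<^sup>+\<sigma>. ?k y \<sigma> * h y \<partial>C)" by (simp add: nn_integral_multc 2)
    also have "\<dots> = (\<integral>\<^sup>+\<sigma>. ?k y \<sigma> * f (\<psi> (inv \<sigma>) y) \<partial>C)"
      by (intro nn_integral_cong) (use 1 in auto)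
    finally show "h y = (\<integral>\<^sup>+\<sigma>. ?k y \<sigma> * f (\<psi> (inv \<sigma>) y) \<partial>C)" .
  qed
  qed
  also have "\<dots> = (\<integral>\<^sup>+\<sigma>. \<integral>\<^sup>+y. ?k y \<sigma> * f (\<psi> (inv \<sigma>) y) \<partial>Y \<partial>C)"
    by (rule nn_integral_swap) measurable
  also have "\<dots> = (\<integral>\<^sup>+\<sigma>. \<integral>\<^sup>+y. ?k (\<psi> \<sigma> y) \<sigma> * f y \<partial>Y \<partial>C)"
  proof (rule nn_integral_cong)
    fix \<sigma> assume "\<sigma> \<in> space C" then have \<sigma>: "\<sigma> \<in> carrier G" by simp
    have "(\<integral>\<^sup>+y. ?k y \<sigma> * f (\<psi> (inv \<sigma>) y) \<partial>Y) = (\<integral>\<^sup>+y. ?k (\<psi> \<sigma> y) \<sigma> * f (\<psi> (inv \<sigma>) (\<psi> \<sigma> y)) \<partial>Y)"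
      using \<sigma> by (intro nn_integral_act[symmetric, of \<sigma> "\<lambda>y. ?k y \<sigma> * f (\<psi> (inv \<sigma>) y)"]) auto
    also have "\<dots> = (\<integral>\<^sup>+y. ?k (\<psi> \<sigma> y) \<sigma> * f y \<partial>Y)"
      by (intro nn_integral_cong) (simp add: act_mult \<sigma>)
    finally show "(\<integral>\<^sup>+y. ?k y \<sigma> * f (\<psi> (inv \<sigma>) y) \<partial>Y) = (\<integral>\<^sup>+y. ?k (\<psi> \<sigma> y) \<sigma> * f y \<partial>Y)" .
  qed
  also have "\<dots> = (\<integral>\<^sup>+y. \<integral>\<^sup>+\<sigma>. ?k (\<psi> \<sigma> y) \<sigma> * f y \<partial>C \<partial>Y)"
    by (rule nn_integral_swap[symmetric]) measurable
  also have "\<dots> = (\<integral>\<^sup>+y. f y \<partial>Y)"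
    by (rule nn_integral_cong_AE, use k_col[OF i] in eventually_elim) (simp add: nn_integral_multc)
  finally show ?thesis .
qed

text \<open>\<open>cover\<close> supplies at almost every z an index \<open>i\<close> whose
  transformation acts there by the given \<mu>; countably many indices may be used for different z.
  The element acting at y is not under control, but it has dropped out of \<open>g\<close>, so
  \<open>piecewise_measure_preserving\<close> handles the integral over y.\<close>

lemma GG_equivariant:
  assumes \<mu>: "\<mu> \<in> carrier G" and \<kappa>: "\<kappa> \<in> carrier G"
  shows "AE z in Y. GG \<kappa> z = GG (inv \<mu> \<otimes> \<kappa> \<otimes> \<mu>) (\<psi> (inv \<mu>) z)"
proof -
  have "AE z in Y. \<forall>i\<in>I. k i (z, \<mu>) \<noteq> 0 \<longrightarrow> GG \<kappa> z = GG (inv \<mu> \<otimes> \<kappa> \<otimes> \<mu>) (\<psi> (inv \<mu>) z)"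
    unfolding AE_ball_countable[OF I_countable]
  proof
    fix i assume i: "i \<in> I"
    show "AE z in Y. k i (z, \<mu>) \<noteq> 0 \<longrightarrow> GG \<kappa> z = GG (inv \<mu> \<otimes> \<kappa> \<otimes> \<mu>) (\<psi> (inv \<mu>) z)"
      using equivariance[OF i] U_norm AE_space
    proof eventually_elim
      fix z assume eq_z: "\<forall>\<sigma>\<in>carrier G. k i (z, \<sigma>) \<noteq> 0 \<longrightarrow> cmod (k i (z, \<sigma>)) = 1 \<and>
          (\<forall>\<rho>\<in>carrier G. k i (z, \<sigma>) * U (\<psi> (inv \<sigma>) z, inv \<sigma> \<otimes> \<rho>) = (LINT \<kappa>|C. U (z, \<kappa>) * c i (inv \<kappa> \<otimes> \<rho>)))"
        and z: "(\<lambda>\<rho>. U (z, \<rho>)) \<in> L2 C \<and> sqn C (\<lambda>\<rho>. U (z, \<rho>)) = 1" and zY: "z \<in> space Y"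
      show "k i (z, \<mu>) \<noteq> 0 \<longrightarrow> GG \<kappa> z = GG (inv \<mu> \<otimes> \<kappa> \<otimes> \<mu>) (\<psi> (inv \<mu>) z)"
      proof
        assume kz: "k i (z, \<mu>) \<noteq> 0"
        let ?z' = "\<psi> (inv \<mu>) z"
        have z': "?z' \<in> space Y" using \<mu> zY by simp
        have "(\<lambda>y. g (inv \<mu> \<otimes> \<kappa> \<otimes> \<mu>) y ?z') \<in> borel_measurable Y"
          using \<mu> \<kappa> z' by (intro g_meas1 measurable_ident_sets measurable_const) auto
        then show "GG \<kappa> z = GG (inv \<mu> \<otimes> \<kappa> \<otimes> \<mu>) ?z'" unfolding GG_def
        proof (rule piecewise_measure_preserving[OF i])
          show "AE y in Y. \<forall>\<sigma>\<in>carrier G. k i (y, \<sigma>) \<noteq> 0 \<longrightarrow> g \<kappa> y z = g (inv \<mu> \<otimes> \<kappa> \<otimes> \<mu>) (\<psi> (inv \<sigma>) y) ?z'"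
            using equivariance[OF i] U_norm
          proof eventually_elim
            fix y assume eq_y: "\<forall>\<sigma>\<in>carrier G. k i (y, \<sigma>) \<noteq> 0 \<longrightarrow> cmod (k i (y, \<sigma>)) = 1 \<and>
                (\<forall>\<rho>\<in>carrier G. k i (y, \<sigma>) * U (\<psi> (inv \<sigma>) y, inv \<sigma> \<otimes> \<rho>) = (LINT \<kappa>|C. U (y, \<kappa>) * c i (inv \<kappa> \<otimes> \<rho>)))"
              and y: "(\<lambda>\<rho>. U (y, \<rho>)) \<in> L2 C \<and> sqn C (\<lambda>\<rho>. U (y, \<rho>)) = 1"
            show "\<forall>\<sigma>\<in>carrier G. k i (y, \<sigma>) \<noteq> 0 \<longrightarrow> g \<kappa> y z = g (inv \<mu> \<otimes> \<kappa> \<otimes> \<mu>) (\<psi> (inv \<sigma>) y) ?z'"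
            proof (intro ballI impI)
              fix \<sigma> assume \<sigma>: "\<sigma> \<in> carrier G" "k i (y, \<sigma>) \<noteq> 0"
              show "g \<kappa> y z = g (inv \<mu> \<otimes> \<kappa> \<otimes> \<mu>) (\<psi> (inv \<sigma>) y) ?z'"
              proof (rule g_equivariant[OF _ \<sigma>(1) \<mu> \<kappa>])
                fix \<rho> assume \<rho>: "\<rho> \<in> carrier G"
                show "cmod (F y z \<rho>) = cmod (F (\<psi> (inv \<sigma>) y) ?z' (inv \<sigma> \<otimes> \<rho> \<otimes> \<mu>))"
                  by (rule F_equivariant[OF c_orth[OF i], of y "k i (y, \<sigma>)" \<sigma> z "k i (z, \<mu>)" \<mu> \<rho>])
                    (use eq_y eq_z y z \<sigma> \<mu> kz \<rho> in auto)
              qed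
            qed
          qed
        qed
      qed
    qed
  qed
  with cover[OF \<mu>] show ?thesis by eventually_elim auto
qed

text \<open>This is \<open>frame\<close> with both vectors equal to the row of \<open>U\<close> at
  z, which has norm 1.\<close>

lemma nn_integral_q: "AE z in Y. (\<integral>\<^sup>+y. q y z \<partial>Y) = 1"
  using U_norm
proof eventually_elim
  fix z assume z: "(\<lambda>\<rho>. U (z, \<rho>)) \<in> L2 C \<and> sqn C (\<lambda>\<rho>. U (z, \<rho>)) = 1"
  let ?\<zeta> = "\<lambda>\<rho>. U (z, \<rho>)" let ?f = "\<lambda>(y, \<rho>). pr (\<lambda>\<sigma>. U (y, \<sigma>)) ?\<zeta> \<rho>"
  have f: "?f \<in> L2 N" "ip N ?f ?f = ip C ?\<zeta> ?\<zeta>" using frame[of ?\<zeta> ?\<zeta>] z by auto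
  note [measurable] = L2_measurable[OF f(1)]
  have "sqn N ?f = 1" using f(2) z by (simp add: ip_self)
  then have "1 = (\<integral>\<^sup>+p. ennreal ((cmod (?f p))\<^sup>2) \<partial>N)" by (simp add: nn_integral_eq_sqn[OF f(1)])
  also have "\<dots> = (\<integral>\<^sup>+y. q y z \<partial>Y)" by (subst nn_integral_N) (auto simp: q_def F_def)
  finally show "(\<integral>\<^sup>+y. q y z \<partial>Y) = 1" by simp
qed

text \<open>By Fubini and translation invariance the numerators sum to q^2, and q^2 / (1 + q) is at
  most q. Where q is infinite the bound is trivial.\<close>

lemma sum_g_le: "(\<integral>\<^sup>+\<kappa>. g \<kappa> y z \<partial>C) \<le> q y z"
proof -
  let ?f = "\<lambda>\<rho>. ennreal ((cmod (F y z \<rho>))\<^sup>2)"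
  have "(\<integral>\<^sup>+\<kappa>. g \<kappa> y z \<partial>C) = (\<integral>\<^sup>+\<kappa>. \<integral>\<^sup>+\<rho>. ?f \<rho> * ?f (\<rho> \<otimes> \<kappa>) \<partial>C \<partial>C) / (1 + q y z)"
    unfolding g_def by (simp add: nn_integral_divide)
  also have "(\<integral>\<^sup>+\<kappa>. \<integral>\<^sup>+\<rho>. ?f \<rho> * ?f (\<rho> \<otimes> \<kappa>) \<partial>C \<partial>C) = (\<integral>\<^sup>+\<rho>. \<integral>\<^sup>+\<kappa>. ?f \<rho> * ?f (\<rho> \<otimes> \<kappa>) \<partial>C \<partial>C)"
  proof -
    interpret CC: pair_sigma_finite C C ..
    show ?thesis by (rule CC.Fubini', rule measurable_pair_C) simp
  qed
  also have "\<dots> = (\<integral>\<^sup>+\<rho>. ?f \<rho> * q y z \<partial>C)"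
    by (intro nn_integral_cong) (simp add: nn_integral_cmult nn_integral_C_lmult[of _ ?f] q_def)
  also have "\<dots> = q y z * q y z" by (simp add: nn_integral_multc q_def)
  also have "q y z * q y z / (1 + q y z) \<le> q y z"
  proof (cases "q y z = \<infinity>")
    case False
    have "q y z * q y z \<le> q y z * (1 + q y z)" by (intro mult_left_mono) auto
    then show ?thesis using False by (intro divide_le_posI_ennreal) (auto simp: mult.commute add_pos_nonneg)
  qed auto
  finally show ?thesis .
qed

text \<open>The double integral of \<open>g \<kappa>\<close> is a class function of \<kappa> by
  \<open>GG_equivariant\<close>, with sum at most the double integral of \<open>q\<close>, which is
  1. On an infinite class it has to vanish.\<close>

lemma m_zero:
  assumes \<kappa>: "\<kappa> \<in> carrier G" "\<kappa> \<noteq> \<one>"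
  shows "(\<integral>\<^sup>+z. GG \<kappa> z \<partial>Y) = 0"
proof -
  define m where "m \<kappa> = (\<integral>\<^sup>+z. GG \<kappa> z \<partial>Y)" for \<kappa>
  have conj: "m (\<mu> \<otimes> \<tau> \<otimes> inv \<mu>) = m \<tau>" if s: "\<mu> \<in> carrier G" "\<tau> \<in> carrier G" for \<mu> \<tau>
  proof -
    have "m (\<mu> \<otimes> \<tau> \<otimes> inv \<mu>) = (\<integral>\<^sup>+z. GG (inv \<mu> \<otimes> (\<mu> \<otimes> \<tau> \<otimes> inv \<mu>) \<otimes> \<mu>) (\<psi> (inv \<mu>) z) \<partial>Y)"
      unfolding m_def by (rule nn_integral_cong_AE[OF GG_equivariant]) (use s in auto)
    also have "inv \<mu> \<otimes> (\<mu> \<otimes> \<tau> \<otimes> inv \<mu>) \<otimes> \<mu> = \<tau>" using s by (simp add: m_assoc)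
    also have "(\<integral>\<^sup>+z. GG \<tau> (\<psi> (inv \<mu>) z) \<partial>Y) = m \<tau>"
      unfolding m_def using s by (intro nn_integral_act) auto
    finally show ?thesis .
  qed
  have "(\<integral>\<^sup>+\<kappa>. m \<kappa> \<partial>C) = (\<integral>\<^sup>+z. \<integral>\<^sup>+\<kappa>. GG \<kappa> z \<partial>C \<partial>Y)"
    unfolding m_def by (rule nn_integral_swap[symmetric]) measurable
  also have "\<dots> = (\<integral>\<^sup>+z. \<integral>\<^sup>+y. \<integral>\<^sup>+\<kappa>. g \<kappa> y z \<partial>C \<partial>Y \<partial>Y)"
    unfolding GG_def by (intro nn_integral_cong nn_integral_swap[symmetric]) measurable
  also have "\<dots> \<le> (\<integral>\<^sup>+z. \<integral>\<^sup>+y. q y z \<partial>Y \<partial>Y)"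
    by (intro nn_integral_mono sum_g_le)
  also have "\<dots> = (\<integral>\<^sup>+z. 1 \<partial>Y)" by (rule nn_integral_cong_AE[OF nn_integral_q])
  also have "\<dots> < \<infinity>" by (simp add: emeasure_space_1)
  finally have fin: "(\<integral>\<^sup>+\<kappa>. m \<kappa> \<partial>C) < \<infinity>" .
  let ?S = "{h \<otimes> \<kappa> \<otimes> inv h | h. h \<in> carrier G}"
  have "infinite ?S" using icc \<kappa> by (auto simp: icc_def)
  moreover have "?S \<subseteq> carrier G" using \<kappa> by auto
  moreover have "m s = m \<kappa>" if "s \<in> ?S" for s using that conj \<kappa> by auto
  ultimately have "m \<kappa> = 0" by (rule summable_constant_infinite[OF fin])
  then show ?thesis by (simp add: m_def)
qed

lemma F_single:
  "AE z in Y. AE y in Y. \<forall>\<sigma>\<in>carrier G. \<forall>\<tau>\<in>carrier G. \<sigma> \<noteq> \<tau> \<longrightarrow> F y z \<sigma> * F y z \<tau> = 0"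
proof -
  have "AE z in Y. \<forall>\<kappa>\<in>carrier G. \<kappa> \<noteq> \<one> \<longrightarrow> GG \<kappa> z = 0"
    unfolding AE_ball_countable[OF countable_carrier]
  proof
    fix \<kappa> assume \<kappa>: "\<kappa> \<in> carrier G"
    show "AE z in Y. \<kappa> \<noteq> \<one> \<longrightarrow> GG \<kappa> z = 0"
    proof (cases "\<kappa> = \<one>")
      case False
      then have "AE z in Y. GG \<kappa> z = 0"
        using m_zero[OF \<kappa> False] nn_integral_0_iff_AE[OF GG_meas[OF \<kappa>]] by simp
      then show ?thesis by eventually_elim simp
    qed simp
  qed
  with nn_integral_q AE_space show ?thesis
  proof eventually_elim
    fix z assume q: "(\<integral>\<^sup>+y. q y z \<partial>Y) = 1" and zY: "z \<in> space Y" and 0: "\<forall>\<kappa>\<in>carrier G. \<kappa> \<noteq> \<one> \<longrightarrow> GG \<kappa> z = 0"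
    have qm: "(\<lambda>y. q y z) \<in> borel_measurable Y"
      using zY by (intro q_meas1 measurable_ident_sets measurable_const) auto
    have "AE y in Y. q y z \<noteq> \<infinity>" by (rule nn_integral_noteq_infinite[OF qm]) (simp add: q)
    moreover have "AE y in Y. \<forall>\<kappa>\<in>carrier G. \<kappa> \<noteq> \<one> \<longrightarrow> g \<kappa> y z = 0"
      unfolding AE_ball_countable[OF countable_carrier]
    proof
      fix \<kappa> assume k: "\<kappa> \<in> carrier G"
      have gm: "(\<lambda>y. g \<kappa> y z) \<in> borel_measurable Y"
        using k zY by (intro g_meas1 measurable_ident_sets measurable_const) auto
      show "AE y in Y. \<kappa> \<noteq> \<one> \<longrightarrow> g \<kappa> y z = 0"
      proof (cases "\<kappa> = \<one>")
        case False
        then have "(\<integral>\<^sup>+y. g \<kappa> y z \<partial>Y) = 0" using 0 k unfolding GG_def by blast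
        then have "AE y in Y. g \<kappa> y z = 0" using nn_integral_0_iff_AE[OF gm] by simp
        then show ?thesis by eventually_elim simp
      qed simp
    qed
    ultimately show "AE y in Y. \<forall>\<sigma>\<in>carrier G. \<forall>\<tau>\<in>carrier G. \<sigma> \<noteq> \<tau> \<longrightarrow> F y z \<sigma> * F y z \<tau> = 0"
    proof eventually_elim
      fix y assume q: "q y z \<noteq> \<infinity>" and g0: "\<forall>\<kappa>\<in>carrier G. \<kappa> \<noteq> \<one> \<longrightarrow> g \<kappa> y z = 0"
      show "\<forall>\<sigma>\<in>carrier G. \<forall>\<tau>\<in>carrier G. \<sigma> \<noteq> \<tau> \<longrightarrow> F y z \<sigma> * F y z \<tau> = 0"
      proof (intro ballI impI)
        fix \<sigma> \<tau> assume st: "\<sigma> \<in> carrier G" "\<tau> \<in> carrier G" "\<sigma> \<noteq> \<tau>"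
        \<comment> \<open>With \<kappa> = \<sigma>^-1 \<tau>, the term at \<rho> = \<sigma> of the
          correlation is the product of the values at \<sigma> and \<tau>.\<close>
        have "inv \<sigma> \<otimes> \<tau> \<noteq> \<one>" using st mult_inv_cancel(1)[OF st(1,2)] r_one[OF st(1)] by metis
        then have "g (inv \<sigma> \<otimes> \<tau>) y z = 0" using g0 st by auto
        \<comment> \<open>Division by \<infinity> would make \<open>g\<close> vanish without
          information on the numerator, so finiteness of \<open>q\<close> is needed here.\<close>
        moreover have "1 + q y z \<noteq> \<top>" using q by (simp add: ennreal_add_eq_top)
        ultimately have "(\<integral>\<^sup>+\<rho>. ennreal ((cmod (F y z \<rho>))\<^sup>2) * ennreal ((cmod (F y z (\<rho> \<otimes> (inv \<sigma> \<otimes> \<tau>))))\<^sup>2) \<partial>C) = 0"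
          unfolding g_def ennreal_divide_eq_0_iff by blast
        then have "\<forall>\<rho>\<in>carrier G. ennreal ((cmod (F y z \<rho>))\<^sup>2) * ennreal ((cmod (F y z (\<rho> \<otimes> (inv \<sigma> \<otimes> \<tau>))))\<^sup>2) = 0"
          by (subst (asm) nn_integral_0_iff_AE) (simp_all only: AE_count_space measurable_count_space_eq1 space_borel UNIV_I Pi_I)
        then have "ennreal ((cmod (F y z \<sigma>))\<^sup>2) * ennreal ((cmod (F y z (\<sigma> \<otimes> (inv \<sigma> \<otimes> \<tau>))))\<^sup>2) = 0"
          using st(1) by blast
        then show "F y z \<sigma> * F y z \<tau> = 0"
          unfolding mult_inv_cancel(1)[OF st(1,2)] by (simp add: ennreal_eq_0_iff)
      qed
    qed
  qed
qed

text \<open>The diagonal \<open>F z z\<close> is recovered from the off-diagonal values through the frame identity.\<close>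

lemma U_orth: "AE z in Y. orth (\<lambda>\<rho>. U (z, \<rho>))"
  using F_single U_norm
proof eventually_elim
  fix z assume S: "AE y in Y. \<forall>\<sigma>\<in>carrier G. \<forall>\<tau>\<in>carrier G. \<sigma> \<noteq> \<tau> \<longrightarrow> F y z \<sigma> * F y z \<tau> = 0"
    and z: "(\<lambda>\<rho>. U (z, \<rho>)) \<in> L2 C \<and> sqn C (\<lambda>\<rho>. U (z, \<rho>)) = 1"
  let ?\<zeta> = "\<lambda>\<rho>. U (z, \<rho>)"
  show "orth ?\<zeta>" unfolding orth_def
  proof (intro conjI ballI)
    fix \<kappa> assume \<kappa>: "\<kappa> \<in> carrier G"
    let ?L = "\<lambda>\<sigma>. U (z, inv \<kappa> \<otimes> \<sigma>)"
    have L: "?L \<in> L2 C" using L2_C_lmult[OF inv_closed[OF \<kappa>]] z by blast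
    show "(LINT \<sigma>|C. ?\<zeta> \<sigma> * cnj (?\<zeta> (inv \<kappa> \<otimes> \<sigma>))) = (if \<kappa> = \<one> then 1 else 0)"
    proof (cases "\<kappa> = \<one>")
      case True
      have "(LINT \<sigma>|C. ?\<zeta> \<sigma> * cnj (?\<zeta> (inv \<kappa> \<otimes> \<sigma>))) = ip C ?\<zeta> ?\<zeta>"
        unfolding ip_def True by (intro Bochner_Integration.integral_cong) auto
      then show ?thesis using z True by (simp add: ip_self)
    next
      case False
      have prL: "pr (\<lambda>\<sigma>. U (y, \<sigma>)) ?L \<rho> = F y z (\<rho> \<otimes> \<kappa>)" if "\<rho> \<in> carrier G" for y \<rho>
        unfolding F_def pr_def using that \<kappa>
        by (intro Bochner_Integration.integral_cong) (auto simp: inv_mult_group m_assoc)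
      have fr: "(\<lambda>(y, \<rho>). pr (\<lambda>\<sigma>. U (y, \<sigma>)) ?\<zeta> \<rho>) \<in> L2 N" "(\<lambda>(y, \<rho>). pr (\<lambda>\<sigma>. U (y, \<sigma>)) ?L \<rho>) \<in> L2 N"
        using frame z L by auto
      note [measurable] = L2_measurable[OF fr(1)] L2_measurable[OF fr(2)]
      have "ip C ?L ?\<zeta> = ip N (\<lambda>(y, \<rho>). pr (\<lambda>\<sigma>. U (y, \<sigma>)) ?\<zeta> \<rho>) (\<lambda>(y, \<rho>). pr (\<lambda>\<sigma>. U (y, \<sigma>)) ?L \<rho>)"
        using frame[of ?\<zeta> ?L] z L by simp
      also have "\<dots> = (LINT p|N. 0)"
        unfolding ip_def
      proof (rule integral_cong_AE)
        have ne: "\<rho> \<noteq> \<rho> \<otimes> \<kappa>" if "\<rho> \<in> carrier G" for \<rho>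
          using that \<kappa> False by simp
        show "AE p in N. (case p of (y, \<rho>) \<Rightarrow> pr (\<lambda>\<sigma>. U (y, \<sigma>)) ?\<zeta> \<rho>) * cnj (case p of (y, \<rho>) \<Rightarrow> pr (\<lambda>\<sigma>. U (y, \<sigma>)) ?L \<rho>) = 0"
          unfolding AE_N_iff using S
        proof eventually_elim
          fix y assume y: "\<forall>\<sigma>\<in>carrier G. \<forall>\<tau>\<in>carrier G. \<sigma> \<noteq> \<tau> \<longrightarrow> F y z \<sigma> * F y z \<tau> = 0"
          show "\<forall>\<rho>\<in>carrier G. (case (y, \<rho>) of (y, \<rho>) \<Rightarrow> pr (\<lambda>\<sigma>. U (y, \<sigma>)) ?\<zeta> \<rho>) * cnj (case (y, \<rho>) of (y, \<rho>) \<Rightarrow> pr (\<lambda>\<sigma>. U (y, \<sigma>)) ?L \<rho>) = 0"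
          proof
            fix \<rho> assume \<rho>: "\<rho> \<in> carrier G"
            have "F y z \<rho> * F y z (\<rho> \<otimes> \<kappa>) = 0" using y ne[OF \<rho>] \<rho> \<kappa> by blast
            then show "(case (y, \<rho>) of (y, \<rho>) \<Rightarrow> pr (\<lambda>\<sigma>. U (y, \<sigma>)) ?\<zeta> \<rho>) * cnj (case (y, \<rho>) of (y, \<rho>) \<Rightarrow> pr (\<lambda>\<sigma>. U (y, \<sigma>)) ?L \<rho>) = 0"
              using prL[OF \<rho>, of y] by (auto simp: F_def)
          qed
        qed
      qed measurable
      finally have "ip C ?L ?\<zeta> = 0" by simp
      then have "ip C ?\<zeta> ?L = 0" using ip_cnj[of C ?L ?\<zeta>] by simp
      then show ?thesis using False by (simp add: ip_def)
    qed
  qed (use z in auto)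
qed

text \<open>One generic z is fixed and \<open>t\<close> is the row of \<open>U\<close> there. For
  almost every y the row at y has at most one nonzero coefficient against the translates of
  \<open>t\<close>, so \<open>orth_expansion\<close> makes it a unimodular multiple of one
  translate.\<close>

theorem U_monomial:
  "\<exists>t. orth t \<and> (AE y in Y. \<exists>h\<in>carrier G. \<exists>b. cmod b = 1 \<and> (\<forall>\<tau>\<in>carrier G. U (y, \<tau>) = b * t (inv h \<otimes> \<tau>)))"
proof -
  have "AE z in Y. orth (\<lambda>\<rho>. U (z, \<rho>)) \<and> (AE y in Y. \<forall>\<sigma>\<in>carrier G. \<forall>\<tau>\<in>carrier G. \<sigma> \<noteq> \<tau> \<longrightarrow> F y z \<sigma> * F y z \<tau> = 0)"
    using U_orth F_single by eventually_elim auto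
  then obtain z where z: "orth (\<lambda>\<rho>. U (z, \<rho>))"
    "AE y in Y. \<forall>\<sigma>\<in>carrier G. \<forall>\<tau>\<in>carrier G. \<sigma> \<noteq> \<tau> \<longrightarrow> F y z \<sigma> * F y z \<tau> = 0"
    using eventually_happens[of _ "ae_filter Y"] ae_filter_bot by blast
  have "AE y in Y. \<exists>h\<in>carrier G. \<exists>b. cmod b = 1 \<and> (\<forall>\<tau>\<in>carrier G. U (y, \<tau>) = b * U (z, inv h \<otimes> \<tau>))"
    using z(2) U_norm
  proof eventually_elim
    fix y assume "\<forall>\<sigma>\<in>carrier G. \<forall>\<tau>\<in>carrier G. \<sigma> \<noteq> \<tau> \<longrightarrow> F y z \<sigma> * F y z \<tau> = 0"
      "(\<lambda>\<rho>. U (y, \<rho>)) \<in> L2 C \<and> sqn C (\<lambda>\<rho>. U (y, \<rho>)) = 1"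
    then show "\<exists>h\<in>carrier G. \<exists>b. cmod b = 1 \<and> (\<forall>\<tau>\<in>carrier G. U (y, \<tau>) = b * U (z, inv h \<otimes> \<tau>))"
      using orth_expansion[OF z(1), of "\<lambda>\<rho>. U (y, \<rho>)"] by (auto simp: F_def)
  qed
  with z(1) show ?thesis by blast
qed

end

context gms
begin

section \<open>Normalising unitaries and elements of the group algebra\<close>

lemma AE_Y_const: "(AE z in Y. P) \<longleftrightarrow> P"
  by (rule AE_const)

lemma mult_op_eq_iff: 
  assumes "bdd a" "bdd b" shows "mult_op G Y a = mult_op G Y b \<longleftrightarrow> (AE z in Y. a z = b z)"
proof
  assume eq: "mult_op G Y a = mult_op G Y b"
  have "AE p in N. nice a \<one> p = nice b \<one> p"
    using kern_mult_op[OF assms(1)] kern_mult_op[OF assms(2)] unfolding eq by eventually_elim auto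
  then show "AE z in Y. a z = b z" unfolding AE_N_iff by eventually_elim (auto simp: nice_def dest: bspec[OF _ one_closed])
qed (rule mult_op_cong)

lemma mult_op_mult:
  assumes "bdd a" "bdd b" shows "op_mult N (mult_op G Y a) (mult_op G Y b) = mult_op G Y (\<lambda>z. a z * b z)"
  by (rule op_mult_eqI)
    (use assms in \<open>auto simp: mult_op_bounded bdd_mult mult_op_apply mult_op_L2 intro!: ae_class_cong\<close>)

lemma mult_op_const: "mult_op G Y (\<lambda>z. w) = op_scale N w (op_one N)"
proof (rule bounded_ops_eqI[of _ N])
  fix c assume "c \<in> l2 N"
  then obtain \<xi> where \<xi>: "\<xi> \<in> L2 N" "c = ae_class N \<xi>" by (metis l2_cases)
  then show "mult_op G Y (\<lambda>z. w) c = op_scale N w (op_one N) c"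
    by (auto simp: mult_op_apply op_scale_apply l2_scale_ae_class intro!: ae_class_cong)
qed (auto simp: mult_op_bounded)

text \<open>A one-sided condition written as an identity between products. In this form it passes
  through \<Theta> in both directions, and by freeness it already forces the kernel to be
  monomial.\<close>

definition normalizes :: "('y \<times> 'g) l2op \<Rightarrow> bool" where
  "normalizes w \<longleftrightarrow> w \<in> unitaries N (crossed_product G Y \<psi>) \<and>
     (\<forall>a. bdd a \<longrightarrow> (\<exists>b. bdd b \<and> op_mult N w (mult_op G Y a) = op_mult N (mult_op G Y b) w))"

lemma normalizes_unitary: "normalizes w \<Longrightarrow> w \<in> unitaries N (crossed_product G Y \<psi>)"
  by (simp add: normalizes_def)

lemma normalizes_monomial: "free_pmp G Y \<psi> \<Longrightarrow> normalizes w \<Longrightarrow> monomial (kern w)"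
  by (rule normalizer_monomial) (auto simp: normalizes_def)

lemma monomial_normalizes':
  assumes "w \<in> unitaries N (crossed_product G Y \<psi>)" "monomial (kern w)" shows "normalizes w"
  unfolding normalizes_def
proof (intro conjI allI impI assms(1))
  fix a assume a: "bdd a"
  then obtain b where b: "bdd b" "op_conj N w (mult_op G Y a) = mult_op G Y b"
    using monomial_normalizes[OF assms] by blast
  have wb: "w \<in> bounded_ops N" using unitaries_mem[OF assms(1)] by simp
  have "op_mult N (mult_op G Y b) w = op_mult N w (op_mult N (mult_op G Y a) (op_mult N (op_adj N w) w))"
    using wb a by (simp add: b(2)[symmetric] op_conj_def op_mult_assoc mult_op_bounded)
  also have "\<dots> = op_mult N w (mult_op G Y a)"
    using wb a by (simp add: unitaries_adj_mult[OF assms(1)] mult_op_bounded)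
  finally show "\<exists>b. bdd b \<and> op_mult N w (mult_op G Y a) = op_mult N (mult_op G Y b) w" using b(1) by metis
qed

lemma normalizes_mult:
  assumes v: "normalizes v" and w: "normalizes w" shows "normalizes (op_mult N v w)"
  unfolding normalizes_def
proof (intro conjI allI impI)
  show "op_mult N v w \<in> unitaries N (crossed_product G Y \<psi>)"
    using v w by (intro unitaries_mult normalizes_unitary)
  have vb: "v \<in> bounded_ops N" "w \<in> bounded_ops N"
    using v w by (auto simp: normalizes_def unitaries_def)
  fix a assume a: "bdd a"
  obtain b where b: "bdd b" "op_mult N w (mult_op G Y a) = op_mult N (mult_op G Y b) w"
    using w a unfolding normalizes_def by blast
  obtain c where c: "bdd c" "op_mult N v (mult_op G Y b) = op_mult N (mult_op G Y c) v"
    using v b(1) unfolding normalizes_def by blast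
  have "op_mult N (op_mult N v w) (mult_op G Y a) = op_mult N v (op_mult N (mult_op G Y b) w)"
    using vb a by (simp add: op_mult_assoc mult_op_bounded b(2))
  also have "\<dots> = op_mult N (op_mult N v (mult_op G Y b)) w"
    using vb b(1) by (simp add: op_mult_assoc mult_op_bounded)
  also have "\<dots> = op_mult N (mult_op G Y c) (op_mult N v w)"
    unfolding c(2) using vb c(1) by (simp add: op_mult_assoc mult_op_bounded)
  finally show "\<exists>b. bdd b \<and> op_mult N (op_mult N v w) (mult_op G Y a) = op_mult N (mult_op G Y b) (op_mult N v w)"
    using c(1) by blast
qed

lemma group_unitary_unitary:
  "g \<in> carrier G \<Longrightarrow> group_unitary G Y \<psi> g \<in> unitaries N (crossed_product G Y \<psi>)"
  by (simp add: unitaries_def group_unitary_adj group_unitary_mult group_unitary_one)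

lemma group_unitary_normalizes:
  assumes g: "g \<in> carrier G" shows "normalizes (group_unitary G Y \<psi> g)"
proof (rule monomial_normalizes'[OF group_unitary_unitary[OF g]])
  show "monomial (kern (group_unitary G Y \<psi> g))"
    unfolding monomial_def using kern_group_unitary[OF g, unfolded AE_N_iff]
    by eventually_elim (rule bexI[OF _ g], use g in \<open>auto simp: delta_def\<close>)
qed

lemma group_unitary_mult_op:
  assumes g: "g \<in> carrier G" and a: "bdd a"
  shows "op_mult N (group_unitary G Y \<psi> g) (mult_op G Y a) = op_mult N (mult_op G Y (\<lambda>z. a (\<psi> (inv g) z))) (group_unitary G Y \<psi> g)"
proof -
  have a': "bdd (\<lambda>z. a (\<psi> (inv g) z))" by (rule bdd_act[OF a]) (use g in simp)
  show ?thesis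
  proof (rule bounded_ops_eqI[of _ N])
    fix c assume "c \<in> l2 N"
    then obtain \<xi> where \<xi>: "\<xi> \<in> L2 N" "c = ae_class N \<xi>" by (metis l2_cases)
    then show "op_mult N (group_unitary G Y \<psi> g) (mult_op G Y a) c = op_mult N (mult_op G Y (\<lambda>z. a (\<psi> (inv g) z))) (group_unitary G Y \<psi> g) c"
      using mult_op_L2[OF a \<xi>(1)] L2_N_lshift(1)[OF \<xi>(1), of "inv g"] g
      by (auto simp: mult_op_apply group_unitary_apply intro!: ae_class_cong)
  qed (use g a a' in \<open>auto simp: mult_op_bounded group_unitary_bounded\<close>)
qed

lemma monomial_norm_le:
  assumes "monomial k" "g \<in> carrier G" shows "AE z in Y. cmod (k (z, g)) \<le> 1"
  using assms(1) unfolding monomial_def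
proof eventually_elim
  fix z assume "\<exists>\<sigma>\<in>carrier G. cmod (k (z, \<sigma>)) = 1 \<and> (\<forall>\<tau>\<in>carrier G. \<tau> \<noteq> \<sigma> \<longrightarrow> k (z, \<tau>) = 0)"
  then obtain \<sigma> where "\<sigma> \<in> carrier G" "cmod (k (z, \<sigma>)) = 1" "\<forall>\<tau>\<in>carrier G. \<tau> \<noteq> \<sigma> \<longrightarrow> k (z, \<tau>) = 0" by blast
  then show "cmod (k (z, g)) \<le> 1" using assms(2) by (cases "g = \<sigma>") auto
qed

text \<open>Multiplying by the indicator of the set where the coefficient at \<open>g\<close> is
  nonzero isolates a piece of the form function times group unitary. Unlike the kernel, such a
  product identity can be transported by \<Theta>.\<close>

lemma monomial_cut:
  assumes S: "S \<in> crossed_product G Y \<psi>" "monomial (kern S)" and g: "g \<in> carrier G"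
  shows "\<exists>p s. bdd p \<and> bdd s \<and> (\<forall>z. p z = (if kern S (z, g) \<noteq> 0 then 1 else 0)) \<and>
    op_mult N (mult_op G Y p) S = op_mult N (mult_op G Y s) (group_unitary G Y \<psi> g)"
proof -
  define s where "s z = kern S (z, g)" for z
  define p where "p z = (if kern S (z, g) \<noteq> 0 then 1 else 0 :: complex)" for z
  have [measurable]: "kern S \<in> borel_measurable N" using S by (intro L2_measurable kern_L2) simp
  have s: "bdd s" unfolding s_def by (rule bddI[OF _ monomial_norm_le[OF S(2) g]]) (use g in measurable)
  have "p \<in> borel_measurable Y" unfolding p_def using g by measurable
  then have p: "bdd p" by (rule bddI[where K=1]) (auto simp: p_def)
  have "op_mult N (mult_op G Y p) S = op_mult N (mult_op G Y s) (group_unitary G Y \<psi> g)"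
  proof (rule crossed_eqI)
    show "AE q in N. kern (op_mult N (mult_op G Y p) S) q = kern (op_mult N (mult_op G Y s) (group_unitary G Y \<psi> g)) q"
      unfolding AE_N_iff
      using kern_mult_op_left[OF p S(1)] kern_mult_op_left[OF s group_unitary_crossed[OF g]] kern_group_unitary[OF g, unfolded AE_N_iff]
        S(2)[unfolded monomial_def]
    proof eventually_elim
      fix z assume 1: "\<forall>\<rho>\<in>carrier G. kern (op_mult N (mult_op G Y p) S) (z, \<rho>) = p z * kern S (z, \<rho>)"
        and 2: "\<forall>\<rho>\<in>carrier G. kern (op_mult N (mult_op G Y s) (group_unitary G Y \<psi> g)) (z, \<rho>) = s z * kern (group_unitary G Y \<psi> g) (z, \<rho>)"
        and 3: "\<forall>\<rho>\<in>carrier G. kern (group_unitary G Y \<psi> g) (z, \<rho>) = delta g (z, \<rho>)"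
        and "\<exists>\<sigma>\<in>carrier G. cmod (kern S (z, \<sigma>)) = 1 \<and> (\<forall>\<tau>\<in>carrier G. \<tau> \<noteq> \<sigma> \<longrightarrow> kern S (z, \<tau>) = 0)"
      then obtain \<sigma> where \<sigma>: "\<sigma> \<in> carrier G" "\<forall>\<tau>\<in>carrier G. \<tau> \<noteq> \<sigma> \<longrightarrow> kern S (z, \<tau>) = 0" by blast
      show "\<forall>\<rho>\<in>carrier G. kern (op_mult N (mult_op G Y p) S) (z, \<rho>) = kern (op_mult N (mult_op G Y s) (group_unitary G Y \<psi> g)) (z, \<rho>)"
        using 1 2 3 \<sigma> g by (cases "g = \<sigma>") (auto simp: delta_def p_def s_def)
    qed
  qed (use S p s g in auto)
  with p s show ?thesis by (intro exI[of _ p] exI[of _ s] conjI) (simp_all add: p_def)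
qed

lemma kern_scale_group_unitary:
  assumes g: "g \<in> carrier G"
  shows "AE z in Y. \<forall>\<rho>\<in>carrier G. kern (op_scale N w (group_unitary G Y \<psi> g)) (z, \<rho>) = (if \<rho> = g then w else 0)"
  using kern_scale[OF group_unitary_bounded[OF g], of w, unfolded AE_N_iff] kern_group_unitary[OF g, unfolded AE_N_iff]
  by eventually_elim (auto simp: delta_def)

lemma scale_group_unitary_inj:
  assumes g: "g \<in> carrier G" "h \<in> carrier G" and w: "w \<noteq> 0"
    and eq: "op_scale N w (group_unitary G Y \<psi> g) = op_scale N w' (group_unitary G Y \<psi> h)"
  shows "g = h \<and> w = w'"
proof -
  have "AE z in Y. \<forall>\<rho>\<in>carrier G. (if \<rho> = g then w else 0) = (if \<rho> = h then w' else 0)"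
    using kern_scale_group_unitary[OF g(1), of w] kern_scale_group_unitary[OF g(2), of w'] unfolding eq by eventually_elim auto
  then show ?thesis using g w by (auto simp: AE_Y_const dest: bspec[of _ _ g] split: if_splits)
qed

text \<open>Coefficients of an element of the group algebra are constant over \<open>Y\<close>, and
  those of a monomial operator are concentrated at one group element per point; together they leave
  one constant at one fixed element.\<close>

lemma scalar_monomial:
  assumes V: "V \<in> group_vN G Y \<psi>" "V \<in> unitaries N (crossed_product G Y \<psi>)" "monomial (kern V)"
  shows "\<exists>w g. g \<in> carrier G \<and> cmod w = 1 \<and> V = op_scale N w (group_unitary G Y \<psi> g)"
proof -
  have Vc: "V \<in> crossed_product G Y \<psi>" using V(2) by (rule unitaries_mem)
  obtain d where d: "AE z in Y. \<forall>\<rho>\<in>carrier G. kern V (z, \<rho>) = d \<rho>" using group_vN_kern[OF V(1)] by blast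
  have "AE z in Y. \<exists>\<sigma>\<in>carrier G. cmod (d \<sigma>) = 1 \<and> (\<forall>\<tau>\<in>carrier G. \<tau> \<noteq> \<sigma> \<longrightarrow> d \<tau> = 0)"
    using V(3)[unfolded monomial_def] d by eventually_elim auto
  then obtain g where g: "g \<in> carrier G" "cmod (d g) = 1" "\<forall>\<tau>\<in>carrier G. \<tau> \<noteq> g \<longrightarrow> d \<tau> = 0"
    by (auto simp: AE_Y_const)
  have "V = op_scale N (d g) (group_unitary G Y \<psi> g)"
  proof (rule crossed_eqI[OF Vc])
    show "AE p in N. kern V p = kern (op_scale N (d g) (group_unitary G Y \<psi> g)) p"
      unfolding AE_N_iff using d kern_scale_group_unitary[OF g(1), of "d g"]
      by eventually_elim (use g in auto)
  qed (use g in simp)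
  with g show ?thesis by blast
qed

text \<open>For scalar coefficients the row relations of a unitary no longer involve the point z, so
  holding almost everywhere means holding.\<close>

lemma group_vN_unitary_orth:
  assumes w: "w \<in> group_vN G Y \<psi>" "w \<in> unitaries N (crossed_product G Y \<psi>)"
  shows "\<exists>c. orth c \<and> (AE z in Y. \<forall>\<rho>\<in>carrier G. kern w (z, \<rho>) = c \<rho>)"
proof -
  obtain c where c: "c \<in> L2 C" "AE z in Y. \<forall>\<rho>\<in>carrier G. kern w (z, \<rho>) = c \<rho>" using group_vN_kern[OF w(1)] by blast
  have "AE z in Y. \<forall>\<rho>\<in>carrier G. (LINT \<sigma>|C. c \<sigma> * cnj (c (inv \<rho> \<otimes> \<sigma>))) = (if \<rho> = \<one> then 1 else 0)"
    using unitary_rows[OF w(2)] c(2) AE_act_all[OF c(2)]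
  proof eventually_elim
    fix z assume 1: "\<forall>\<rho>\<in>carrier G. (LINT \<sigma>|C. kern w (z, \<sigma>) * cnj (kern w (\<psi> (inv \<rho>) z, inv \<rho> \<otimes> \<sigma>))) = (if \<rho> = \<one> then 1 else 0)"
      and 2: "\<forall>\<rho>\<in>carrier G. kern w (z, \<rho>) = c \<rho>" and 3: "\<forall>g\<in>carrier G. \<forall>\<rho>\<in>carrier G. kern w (\<psi> g z, \<rho>) = c \<rho>"
    show "\<forall>\<rho>\<in>carrier G. (LINT \<sigma>|C. c \<sigma> * cnj (c (inv \<rho> \<otimes> \<sigma>))) = (if \<rho> = \<one> then 1 else 0)"
    proof
      fix \<rho> assume \<rho>: "\<rho> \<in> carrier G"
      have "(LINT \<sigma>|C. c \<sigma> * cnj (c (inv \<rho> \<otimes> \<sigma>))) = (LINT \<sigma>|C. kern w (z, \<sigma>) * cnj (kern w (\<psi> (inv \<rho>) z, inv \<rho> \<otimes> \<sigma>)))"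
        using \<rho> 2 3 by (intro Bochner_Integration.integral_cong) auto
      then show "(LINT \<sigma>|C. c \<sigma> * cnj (c (inv \<rho> \<otimes> \<sigma>))) = (if \<rho> = \<one> then 1 else 0)" using 1 \<rho> by simp
    qed
  qed
  then have "orth c" using c(1) unfolding AE_Y_const orth_def by blast
  with c(2) show ?thesis by blast
qed

lemma ip_const_kernel:
  assumes "\<xi> \<in> L2 C" "\<zeta> \<in> L2 C"
  shows "ip N (\<lambda>(z, \<sigma>). \<xi> \<sigma>) (\<lambda>(z, \<sigma>). \<zeta> \<sigma>) = ip C \<xi> \<zeta>"
proof -
  let ?f = "\<lambda>(z::'y, \<sigma>). \<xi> \<sigma>" let ?h = "\<lambda>(z::'y, \<sigma>). \<zeta> \<sigma>"
  have "integrable N (\<lambda>p. ?f p * cnj (?h p))" by (intro ip_integrable const_kernel_L2 assms)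
  then have "ip N ?f ?h = (LINT z|Y. LINT \<rho>|C. ?f (z, \<rho>) * cnj (?h (z, \<rho>)))"
    unfolding ip_def gms_measure_def by (rule YC.integral_fst'[symmetric])
  also have "\<dots> = ip C \<xi> \<zeta>" by (simp add: ip_def prob_space)
  finally show ?thesis .
qed

text \<open>The function built from \<open>pr\<close> is \<open>u\<close> applied to the constant
  kernel with coefficients \<open>cnj (\<zeta> (inv \<sigma>))\<close>. Since \<open>u\<close>
  preserves inner products, the value is that of the two constant kernels; the conjugation exchanges
  the arguments.\<close>

lemma unitary_frame:
  assumes u: "u \<in> unitaries N (crossed_product G Y \<psi>)" and \<zeta>: "\<zeta> \<in> L2 C" "\<zeta>' \<in> L2 C"
  shows "(\<lambda>(y, \<rho>). pr (\<lambda>\<sigma>. kern u (y, \<sigma>)) \<zeta> \<rho>) \<in> L2 N \<and>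
    ip N (\<lambda>(y, \<rho>). pr (\<lambda>\<sigma>. kern u (y, \<sigma>)) \<zeta> \<rho>) (\<lambda>(y, \<rho>). pr (\<lambda>\<sigma>. kern u (y, \<sigma>)) \<zeta>' \<rho>) = ip C \<zeta>' \<zeta>"
proof -
  have uc: "u \<in> crossed_product G Y \<psi>" using u by (rule unitaries_mem)
  note b = crossed_product_bounded[OF uc]
  note [measurable] = L2_measurable[OF kern_L2[OF b]]
  let ?x = "\<lambda>\<zeta> (z::'y, \<sigma>). cnj (\<zeta> (inv \<sigma>))"
  let ?p = "\<lambda>\<zeta> (y, \<rho>). pr (\<lambda>\<sigma>. kern u (y, \<sigma>)) \<zeta> \<rho>"
  have x: "?x \<zeta> \<in> L2 N" if "\<zeta> \<in> L2 C" for \<zeta>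
    using const_kernel_L2[OF L2_cnj[OF L2_C_inv[OF that]]] .
  have eq: "AE p in N. conv (kern u) (?x \<zeta>) p = ?p \<zeta> p" for \<zeta>
    unfolding AE_N_iff
  proof (intro AE_I2 ballI)
    fix z \<rho> assume \<rho>: "\<rho> \<in> carrier G"
    show "conv (kern u) (?x \<zeta>) (z, \<rho>) = ?p \<zeta> (z, \<rho>)"
      unfolding conv_apply prod.case pr_def
      by (intro Bochner_Integration.integral_cong) (auto simp: inv_mult_group \<rho>)
  qed
  have m: "?p \<zeta> \<in> borel_measurable N" for \<zeta>
    unfolding measurable_N_iff prod.case pr_def by measurable
  have L: "?p \<zeta> \<in> L2 N" if "\<zeta> \<in> L2 C" for \<zeta>
    by (rule L2_cong_AE(1)[OF conv_kern_L2[OF uc x[OF that]] m eq])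
  have ap: "u (ae_class N (?x \<zeta>)) = ae_class N (?p \<zeta>)" if "\<zeta> \<in> L2 C" for \<zeta>
    unfolding crossed_apply[OF uc x[OF that]] by (rule ae_class_cong[OF eq])
  have "ip N (?p \<zeta>) (?p \<zeta>') = l2_inner N (u (ae_class N (?x \<zeta>))) (u (ae_class N (?x \<zeta>')))"
    unfolding ap[OF \<zeta>(1)] ap[OF \<zeta>(2)] by (rule l2_inner_ae_class[symmetric, OF L[OF \<zeta>(1)] L[OF \<zeta>(2)]])
  also have "\<dots> = l2_inner N (ae_class N (?x \<zeta>)) (op_adj N u (u (ae_class N (?x \<zeta>'))))"
    by (rule op_adj_inner[OF b]) (use x \<zeta> b in auto)
  also have "op_adj N u (u (ae_class N (?x \<zeta>'))) = op_mult N (op_adj N u) u (ae_class N (?x \<zeta>'))"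
    using x \<zeta> by simp
  also have "\<dots> = ae_class N (?x \<zeta>')" unfolding unitaries_adj_mult[OF u] using x \<zeta> by simp
  also have "l2_inner N (ae_class N (?x \<zeta>)) (ae_class N (?x \<zeta>')) = ip N (?x \<zeta>) (?x \<zeta>')"
    by (rule l2_inner_ae_class[OF x[OF \<zeta>(1)] x[OF \<zeta>(2)]])
  also have "\<dots> = ip C (\<lambda>\<sigma>. cnj (\<zeta> (inv \<sigma>))) (\<lambda>\<sigma>. cnj (\<zeta>' (inv \<sigma>)))"
    by (rule ip_const_kernel[OF L2_cnj[OF L2_C_inv[OF \<zeta>(1)]] L2_cnj[OF L2_C_inv[OF \<zeta>(2)]]])
  also have "\<dots> = (LINT \<sigma>|C. \<zeta>' (inv \<sigma>) * cnj (\<zeta> (inv \<sigma>)))"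
    by (simp add: ip_def mult.commute)
  also have "\<dots> = ip C \<zeta>' \<zeta>" unfolding ip_def by (rule integral_C_inv)
  finally show ?thesis using L[OF \<zeta>(1)] by blast
qed

lemma unitary_row_nn: 
  assumes w: "w \<in> unitaries N (crossed_product G Y \<psi>)"
  shows "AE z in Y. (\<integral>\<^sup>+\<sigma>. ennreal ((cmod (kern w (z, \<sigma>)))\<^sup>2) \<partial>C) = 1"
  using unitary_row_sqn[OF w] by eventually_elim (auto simp: nn_integral_eq_sqn)

lemma unitary_col_nn: 
  assumes w: "w \<in> unitaries N (crossed_product G Y \<psi>)"
  shows "AE z in Y. (\<integral>\<^sup>+\<sigma>. ennreal ((cmod (kern w (\<psi> \<sigma> z, \<sigma>)))\<^sup>2) \<partial>C) = 1"
  using unitary_row_nn[OF unitaries_adj[OF w]] kern_adj[OF unitaries_mem[OF w]]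
proof eventually_elim
  fix z assume 1: "(\<integral>\<^sup>+\<sigma>. ennreal ((cmod (kern (op_adj N w) (z, \<sigma>)))\<^sup>2) \<partial>C) = 1"
    and 2: "\<forall>\<rho>\<in>carrier G. kern (op_adj N w) (z, \<rho>) = cnj (kern w (\<psi> (inv \<rho>) z, inv \<rho>))"
  have "(\<integral>\<^sup>+\<sigma>. ennreal ((cmod (kern w (\<psi> \<sigma> z, \<sigma>)))\<^sup>2) \<partial>C) = (\<integral>\<^sup>+\<sigma>. ennreal ((cmod (kern w (\<psi> (inv \<sigma>) z, inv \<sigma>)))\<^sup>2) \<partial>C)"
    by (rule nn_integral_C_inv[symmetric])
  also have "\<dots> = (\<integral>\<^sup>+\<sigma>. ennreal ((cmod (kern (op_adj N w) (z, \<sigma>)))\<^sup>2) \<partial>C)"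
    by (intro nn_integral_cong) (simp add: 2)
  finally show "(\<integral>\<^sup>+\<sigma>. ennreal ((cmod (kern w (\<psi> \<sigma> z, \<sigma>)))\<^sup>2) \<partial>C) = 1" using 1 by simp
qed

text \<open>Applied to a finite conjugacy class this gives the class sum, a central element of the
  group algebra.\<close>

lemma finite_sum_group_vN:
  assumes "finite F" "F \<subseteq> carrier G"
  shows "\<exists>T\<in>group_vN G Y \<psi>. AE z in Y. \<forall>\<rho>\<in>carrier G. kern T (z, \<rho>) = (if \<rho> \<in> F then 1 else 0)"
  using assms
proof (induction F)
  case empty
  have "op_scale N 0 (group_unitary G Y \<psi> \<one>) \<in> group_vN G Y \<psi>" by (intro group_vN_scale) simp
  then show ?case using kern_scale_group_unitary[OF one_closed, of 0] by (intro bexI) auto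
next
  case (insert g F)
  then obtain T where T: "T \<in> group_vN G Y \<psi>" "AE z in Y. \<forall>\<rho>\<in>carrier G. kern T (z, \<rho>) = (if \<rho> \<in> F then 1 else 0)" by auto
  have g: "g \<in> carrier G" using insert by auto
  have Tb: "T \<in> bounded_ops N" using T group_vN_subset by (auto intro: crossed_product_bounded)
  have "op_add N T (group_unitary G Y \<psi> g) \<in> group_vN G Y \<psi>" by (intro group_vN_add T) (simp add: g)
  moreover have "AE z in Y. \<forall>\<rho>\<in>carrier G. kern (op_add N T (group_unitary G Y \<psi> g)) (z, \<rho>) = (if \<rho> \<in> insert g F then 1 else 0)"
    using kern_add[OF Tb group_unitary_bounded[OF g], unfolded AE_N_iff] T(2) kern_group_unitary[OF g, unfolded AE_N_iff]
    by eventually_elim (use insert.hyps in \<open>auto simp: delta_def\<close>)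
  ultimately show ?case by blast
qed

text \<open>The coefficients are constant on conjugacy classes and square summable, hence vanish on
  infinite classes. Only the identity remains.\<close>

lemma commuting_group_vN_scalar:
  assumes icc: "icc G" and S: "S \<in> group_vN G Y \<psi>"
    and comm: "\<And>g. g \<in> carrier G \<Longrightarrow> op_mult N S (group_unitary G Y \<psi> g) = op_mult N (group_unitary G Y \<psi> g) S"
  shows "\<exists>w. S = op_scale N w (op_one N)"
proof -
  have Sc: "S \<in> crossed_product G Y \<psi>" using S group_vN_subset by blast
  obtain s where s: "s \<in> L2 C" "AE z in Y. \<forall>\<rho>\<in>carrier G. kern S (z, \<rho>) = s \<rho>" using group_vN_kern[OF S] by blast
  have inv: "s (\<rho> \<otimes> inv g) = s (inv g \<otimes> \<rho>)" if g: "g \<in> carrier G" "\<rho> \<in> carrier G" for g \<rho>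
  proof -
    have "AE z in Y. s (\<rho> \<otimes> inv g) = s (inv g \<otimes> \<rho>)"
      using kern_group_unitary_right[OF g(1) Sc] kern_group_unitary_left[OF g(1) Sc] s(2) AE_act_all[OF s(2)]
      unfolding comm[OF g(1)]
    proof eventually_elim
      fix z assume 1: "\<forall>\<rho>\<in>carrier G. kern (op_mult N (group_unitary G Y \<psi> g) S) (z, \<rho>) = kern S (z, \<rho> \<otimes> inv g)"
        and 2: "\<forall>\<rho>\<in>carrier G. kern (op_mult N (group_unitary G Y \<psi> g) S) (z, \<rho>) = kern S (\<psi> (inv g) z, inv g \<otimes> \<rho>)"
        and 3: "\<forall>\<rho>\<in>carrier G. kern S (z, \<rho>) = s \<rho>" and 4: "\<forall>g\<in>carrier G. \<forall>\<rho>\<in>carrier G. kern S (\<psi> g z, \<rho>) = s \<rho>"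
      have "s (\<rho> \<otimes> inv g) = kern S (z, \<rho> \<otimes> inv g)" using 3 g by simp
      also have "\<dots> = kern S (\<psi> (inv g) z, inv g \<otimes> \<rho>)" using 1 2 g(2) by metis
      also have "\<dots> = s (inv g \<otimes> \<rho>)" using 4 g by simp
      finally show "s (\<rho> \<otimes> inv g) = s (inv g \<otimes> \<rho>)" .
    qed
    then show ?thesis by simp
  qed
  have zero: "s \<kappa> = 0" if \<kappa>: "\<kappa> \<in> carrier G" "\<kappa> \<noteq> \<one>" for \<kappa>
  proof -
    let ?S = "{h \<otimes> \<kappa> \<otimes> inv h | h. h \<in> carrier G}"
    have "(\<integral>\<^sup>+\<sigma>. ennreal ((cmod (s \<sigma>))\<^sup>2) \<partial>C) < \<infinity>" using s(1) by (simp add: L2_C_iff)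
    moreover have "infinite ?S" using icc \<kappa> by (auto simp: icc_def)
    moreover have "?S \<subseteq> carrier G" using \<kappa> by auto
    moreover have "ennreal ((cmod (s \<sigma>))\<^sup>2) = ennreal ((cmod (s \<kappa>))\<^sup>2)" if "\<sigma> \<in> ?S" for \<sigma>
    proof -
      obtain h where h: "h \<in> carrier G" "\<sigma> = h \<otimes> \<kappa> \<otimes> inv h" using \<open>\<sigma> \<in> ?S\<close> by blast
      have "s \<sigma> = s (inv h \<otimes> (h \<otimes> \<kappa>))" using inv[of h "h \<otimes> \<kappa>"] h \<kappa> by simp
      then show ?thesis using h \<kappa> by simp
    qed
    ultimately have "ennreal ((cmod (s \<kappa>))\<^sup>2) = 0" by (rule summable_constant_infinite)
    then show ?thesis by (simp add: ennreal_eq_0_iff)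
  qed
  have "S = op_scale N (s \<one>) (op_one N)"
  proof (rule crossed_eqI[OF Sc])
    show "AE p in N. kern S p = kern (op_scale N (s \<one>) (op_one N)) p"
      unfolding AE_N_iff group_unitary_one[symmetric] using s(2) kern_scale_group_unitary[OF one_closed, of "s \<one>"]
      by eventually_elim (use zero in auto)
  qed simp
  then show ?thesis by blast
qed

end

section \<open>Isomorphisms preserving the Cartan and the group subalgebra\<close>

locale gms_pair = X: gms \<Gamma> X \<phi> + Y: gms \<Lambda> Y \<psi>
  for \<Gamma> :: "('g, 'm) monoid_scheme" and X :: "'x measure" and \<phi> :: "'g \<Rightarrow> 'x \<Rightarrow> 'x"
    and \<Lambda> :: "('h, 'n) monoid_scheme" and Y :: "'y measure" and \<psi> :: "'h \<Rightarrow> 'y \<Rightarrow> 'y" +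
  fixes \<Theta> :: "('x \<times> 'g) l2op \<Rightarrow> ('y \<times> 'h) l2op" and u :: "('y \<times> 'h) l2op"
  assumes free_X: "free_pmp \<Gamma> X \<phi>" and free_Y: "free_pmp \<Lambda> Y \<psi>" and icc_\<Gamma>: "icc \<Gamma>"
    and iso: "star_isomorphism X.N (crossed_product \<Gamma> X \<phi>) Y.N (crossed_product \<Lambda> Y \<psi>) \<Theta>"
    and Theta_Linf: "\<Theta> ` Linf \<Gamma> X = Linf \<Lambda> Y"
    and u: "u \<in> unitaries Y.N (crossed_product \<Lambda> Y \<psi>)"
    and Theta_group: "\<Theta> ` group_vN \<Gamma> X \<phi> = op_conj Y.N u ` group_vN \<Lambda> Y \<psi>"
begin

abbreviation "CX \<equiv> crossed_product \<Gamma> X \<phi>"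
abbreviation "CY \<equiv> crossed_product \<Lambda> Y \<psi>"
abbreviation "LX \<equiv> group_vN \<Gamma> X \<phi>"
abbreviation "LY \<equiv> group_vN \<Lambda> Y \<psi>"
abbreviation "ug \<equiv> group_unitary \<Gamma> X \<phi>"
abbreviation "vg \<equiv> group_unitary \<Lambda> Y \<psi>"
abbreviation mulX (infixl "\<cdot>\<^sub>X" 70) where "S \<cdot>\<^sub>X T \<equiv> op_mult X.N S T"
abbreviation mulY (infixl "\<cdot>" 70) where "S \<cdot> T \<equiv> op_mult Y.N S T"
abbreviation "adjX \<equiv> op_adj X.N"
abbreviation "adjY \<equiv> op_adj Y.N"
abbreviation "mX \<equiv> mult_op \<Gamma> X"
abbreviation "mY \<equiv> mult_op \<Lambda> Y"

lemma Theta_bij: "bij_betw \<Theta> CX CY"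
  using iso by (simp add: star_isomorphism_def)

lemma Theta_mem [simp]: "S \<in> CX \<Longrightarrow> \<Theta> S \<in> CY"
  using Theta_bij by (auto simp: bij_betw_def)

lemma Theta_inj: "S \<in> CX \<Longrightarrow> T \<in> CX \<Longrightarrow> \<Theta> S = \<Theta> T \<Longrightarrow> S = T"
  using Theta_bij by (auto simp: bij_betw_def inj_on_def)

lemma Theta_surj: "T \<in> CY \<Longrightarrow> \<exists>S\<in>CX. \<Theta> S = T"
proof -
  assume "T \<in> CY"
  then have "T \<in> \<Theta> ` CX" using Theta_bij by (simp add: bij_betw_def)
  then show ?thesis by (rule imageE) (rule bexI, rule sym)
qed

lemma Theta_mult: "S \<in> CX \<Longrightarrow> T \<in> CX \<Longrightarrow> \<Theta> (S \<cdot>\<^sub>X T) = \<Theta> S \<cdot> \<Theta> T"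
  using iso by (simp add: star_isomorphism_def)

lemma Theta_scale: "T \<in> CX \<Longrightarrow> \<Theta> (op_scale X.N w T) = op_scale Y.N w (\<Theta> T)"
  using iso by (simp add: star_isomorphism_def)

lemma Theta_adj: "T \<in> CX \<Longrightarrow> \<Theta> (adjX T) = adjY (\<Theta> T)"
  using iso by (simp add: star_isomorphism_def)

text \<open>Preservation of the unit is not part of \<open>star_isomorphism\<close>; it follows by
  multiplying with a preimage of the unit.\<close>

lemma Theta_one [simp]: "\<Theta> (op_one X.N) = op_one Y.N"
proof -
  obtain S where S: "S \<in> CX" "\<Theta> S = op_one Y.N" using Theta_surj[OF Y.crossed_product_one] by blast
  have "\<Theta> S = \<Theta> (op_one X.N \<cdot>\<^sub>X S)" using S by simp
  also have "\<dots> = \<Theta> (op_one X.N) \<cdot> \<Theta> S" by (rule Theta_mult) (use S in auto)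
  also have "\<dots> = \<Theta> (op_one X.N)" unfolding S(2) by (simp add: Y.crossed_product_bounded)
  finally show ?thesis using S by simp
qed

lemma boundedY [simp]: "T \<in> CY \<Longrightarrow> T \<in> bounded_ops Y.N"
  by (rule Y.crossed_product_bounded)

lemma mult_assocY: "\<lbrakk>R \<in> CY; S \<in> CY; T \<in> CY\<rbrakk> \<Longrightarrow> R \<cdot> S \<cdot> T = R \<cdot> (S \<cdot> T)"
  by (simp add: op_mult_assoc)

lemma Theta_mX: "X.bdd a \<Longrightarrow> \<exists>b. Y.bdd b \<and> \<Theta> (mX a) = mY b"
  using Theta_Linf by (auto simp: X.Linf_eq Y.Linf_eq)

lemma mY_Theta: "Y.bdd b \<Longrightarrow> \<exists>a. X.bdd a \<and> \<Theta> (mX a) = mY b"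
  using Theta_Linf unfolding X.Linf_eq Y.Linf_eq by (metis (no_types, lifting) imageE image_eqI mem_Collect_eq)

lemma Theta_unitary_iff:
  assumes S: "S \<in> CX" shows "\<Theta> S \<in> unitaries Y.N CY \<longleftrightarrow> S \<in> unitaries X.N CX"
proof -
  have "\<Theta> (adjX S) \<cdot> \<Theta> S = op_one Y.N \<longleftrightarrow> adjX S \<cdot>\<^sub>X S = op_one X.N"
    using S Theta_inj[of "adjX S \<cdot>\<^sub>X S" "op_one X.N"] by (auto simp: Theta_mult[symmetric])
  moreover have "\<Theta> S \<cdot> \<Theta> (adjX S) = op_one Y.N \<longleftrightarrow> S \<cdot>\<^sub>X adjX S = op_one X.N"
    using S Theta_inj[of "S \<cdot>\<^sub>X adjX S" "op_one X.N"] by (auto simp: Theta_mult[symmetric])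
  ultimately show ?thesis using S by (simp add: unitaries_def Theta_adj)
qed

lemma Theta_normalizes:
  assumes S: "S \<in> CX" shows "Y.normalizes (\<Theta> S) \<longleftrightarrow> X.normalizes S"
proof
  assume n: "X.normalizes S"
  show "Y.normalizes (\<Theta> S)" unfolding Y.normalizes_def
  proof (intro conjI allI impI)
    show "\<Theta> S \<in> unitaries Y.N CY" using n S by (simp add: Theta_unitary_iff X.normalizes_def)
    fix b assume "Y.bdd b"
    then obtain a where a: "X.bdd a" "\<Theta> (mX a) = mY b" using mY_Theta by blast
    then obtain a' where a': "X.bdd a'" "S \<cdot>\<^sub>X mX a = mX a' \<cdot>\<^sub>X S" using n unfolding X.normalizes_def by blast
    obtain b' where b': "Y.bdd b'" "\<Theta> (mX a') = mY b'" using Theta_mX[OF a'(1)] by blast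
    have "\<Theta> S \<cdot> mY b = mY b' \<cdot> \<Theta> S"
    proof -
      have "\<Theta> S \<cdot> mY b = \<Theta> (S \<cdot>\<^sub>X mX a)" using S a by (simp add: Theta_mult)
      also have "\<dots> = mY b' \<cdot> \<Theta> S" unfolding a'(2) using S a' b' by (simp add: Theta_mult)
      finally show ?thesis .
    qed
    with b' show "\<exists>b'. Y.bdd b' \<and> \<Theta> S \<cdot> mY b = mY b' \<cdot> \<Theta> S" by blast
  qed
next
  assume n: "Y.normalizes (\<Theta> S)"
  show "X.normalizes S" unfolding X.normalizes_def
  proof (intro conjI allI impI)
    show "S \<in> unitaries X.N CX" using n S by (simp add: Theta_unitary_iff[symmetric] Y.normalizes_def)
    fix a assume a: "X.bdd a"
    then obtain b where b: "Y.bdd b" "\<Theta> (mX a) = mY b" using Theta_mX by blast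
    then obtain b' where b': "Y.bdd b'" "\<Theta> S \<cdot> mY b = mY b' \<cdot> \<Theta> S" using n unfolding Y.normalizes_def by blast
    obtain a' where a': "X.bdd a'" "\<Theta> (mX a') = mY b'" using mY_Theta[OF b'(1)] by blast
    have "\<Theta> (S \<cdot>\<^sub>X mX a) = \<Theta> (mX a' \<cdot>\<^sub>X S)"
      using b'(2) S a a' b by (simp add: Theta_mult)
    then have "S \<cdot>\<^sub>X mX a = mX a' \<cdot>\<^sub>X S" by (rule Theta_inj[rotated 2]) (use S a a' in auto)
    with a' show "\<exists>b. X.bdd b \<and> S \<cdot>\<^sub>X mX a = mX b \<cdot>\<^sub>X S" by blast
  qed
qed

definition tg :: "'g \<Rightarrow> ('y \<times> 'h) l2op" where "tg \<gamma> = \<Theta> (ug \<gamma>)"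

lemma tg_normalizes: "\<gamma> \<in> carrier \<Gamma> \<Longrightarrow> Y.normalizes (tg \<gamma>)"
  unfolding tg_def by (simp add: Theta_normalizes X.group_unitary_normalizes)

lemma tg_mem [simp]: "\<gamma> \<in> carrier \<Gamma> \<Longrightarrow> tg \<gamma> \<in> CY"
  by (simp add: tg_def)

lemma tg_unitary: "\<gamma> \<in> carrier \<Gamma> \<Longrightarrow> tg \<gamma> \<in> unitaries Y.N CY"
  by (rule Y.normalizes_unitary[OF tg_normalizes])

lemma u_mem [simp]: "u \<in> CY"
  using u by (rule unitaries_mem)

lemma LY_mem [simp]: "T \<in> LY \<Longrightarrow> T \<in> CY"
  using Y.group_vN_subset by blast

lemma LX_mem [simp]: "T \<in> LX \<Longrightarrow> T \<in> CX"
  using X.group_vN_subset by blast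

lemma u_cancel [simp]:
  assumes "T \<in> CY"
  shows "u \<cdot> (adjY u \<cdot> T) = T" "adjY u \<cdot> (u \<cdot> T) = T"
  using assms by (simp_all add: mult_assocY[symmetric] unitaries_mult_adj[OF u] unitaries_adj_mult[OF u])

lemma LX_conj:
  assumes "S \<in> LX" shows "\<exists>w\<in>LY. \<Theta> S \<cdot> u = u \<cdot> w \<and> w = adjY u \<cdot> (\<Theta> S \<cdot> u)"
proof -
  obtain w where w: "w \<in> LY" "\<Theta> S = op_conj Y.N u w" using Theta_group assms by blast
  have "\<Theta> S \<cdot> u = u \<cdot> w"
    using w by (simp add: op_conj_def mult_assocY unitaries_adj_mult[OF u])
  with w show ?thesis by (intro bexI[of _ w]) auto
qed

definition wg :: "'g \<Rightarrow> ('y \<times> 'h) l2op" where "wg \<gamma> = adjY u \<cdot> (tg \<gamma> \<cdot> u)"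

lemma wg:
  assumes "\<gamma> \<in> carrier \<Gamma>"
  shows "wg \<gamma> \<in> LY" "tg \<gamma> \<cdot> u = u \<cdot> wg \<gamma>" "wg \<gamma> \<in> unitaries Y.N CY"
proof -
  show "wg \<gamma> \<in> LY" "tg \<gamma> \<cdot> u = u \<cdot> wg \<gamma>"
    using LX_conj[of "ug \<gamma>"] assms by (auto simp: wg_def tg_def)
  show "wg \<gamma> \<in> unitaries Y.N CY"
    unfolding wg_def by (intro Y.unitaries_mult Y.unitaries_adj u tg_unitary assms)
qed

text \<open>A finite conjugacy class of \<open>\<Lambda>\<close> gives a central element of \<open>L\<Lambda> \<cong> L\<Gamma>\<close>, which is a factor.\<close>

lemma icc_\<Lambda>: "icc \<Lambda>"
  unfolding icc_def
proof (intro conjI ballI impI Y.is_group)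
  fix \<kappa> assume \<kappa>: "\<kappa> \<in> carrier \<Lambda>" "\<kappa> \<noteq> \<one>\<^bsub>\<Lambda>\<^esub>"
  let ?F = "{h \<otimes>\<^bsub>\<Lambda>\<^esub> \<kappa> \<otimes>\<^bsub>\<Lambda>\<^esub> inv\<^bsub>\<Lambda>\<^esub> h |h. h \<in> carrier \<Lambda>}"
  show "infinite ?F"
  proof
    assume fin: "finite ?F"
    have sub: "?F \<subseteq> carrier \<Lambda>" using \<kappa> by auto
    have conj: "inv\<^bsub>\<Lambda>\<^esub> \<rho> \<otimes>\<^bsub>\<Lambda>\<^esub> \<tau> \<otimes>\<^bsub>\<Lambda>\<^esub> \<rho> \<in> ?F \<longleftrightarrow> \<tau> \<in> ?F" if s: "\<rho> \<in> carrier \<Lambda>" "\<tau> \<in> carrier \<Lambda>" for \<rho> \<tau>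
    proof
      assume "inv\<^bsub>\<Lambda>\<^esub> \<rho> \<otimes>\<^bsub>\<Lambda>\<^esub> \<tau> \<otimes>\<^bsub>\<Lambda>\<^esub> \<rho> \<in> ?F"
      then obtain h where h: "h \<in> carrier \<Lambda>" "inv\<^bsub>\<Lambda>\<^esub> \<rho> \<otimes>\<^bsub>\<Lambda>\<^esub> \<tau> \<otimes>\<^bsub>\<Lambda>\<^esub> \<rho> = h \<otimes>\<^bsub>\<Lambda>\<^esub> \<kappa> \<otimes>\<^bsub>\<Lambda>\<^esub> inv\<^bsub>\<Lambda>\<^esub> h" by blast
      have "\<tau> = \<rho> \<otimes>\<^bsub>\<Lambda>\<^esub> (inv\<^bsub>\<Lambda>\<^esub> \<rho> \<otimes>\<^bsub>\<Lambda>\<^esub> \<tau> \<otimes>\<^bsub>\<Lambda>\<^esub> \<rho>) \<otimes>\<^bsub>\<Lambda>\<^esub> inv\<^bsub>\<Lambda>\<^esub> \<rho>" using s by (simp add: Y.m_assoc)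
      also have "\<dots> = (\<rho> \<otimes>\<^bsub>\<Lambda>\<^esub> h) \<otimes>\<^bsub>\<Lambda>\<^esub> \<kappa> \<otimes>\<^bsub>\<Lambda>\<^esub> inv\<^bsub>\<Lambda>\<^esub> (\<rho> \<otimes>\<^bsub>\<Lambda>\<^esub> h)"
        unfolding h(2) using s h(1) \<kappa> by (simp add: Y.m_assoc Y.inv_mult_group)
      finally show "\<tau> \<in> ?F" using s h(1) by blast
    next
      assume "\<tau> \<in> ?F"
      then obtain h where h: "h \<in> carrier \<Lambda>" "\<tau> = h \<otimes>\<^bsub>\<Lambda>\<^esub> \<kappa> \<otimes>\<^bsub>\<Lambda>\<^esub> inv\<^bsub>\<Lambda>\<^esub> h" by blast
      have "inv\<^bsub>\<Lambda>\<^esub> \<rho> \<otimes>\<^bsub>\<Lambda>\<^esub> \<tau> \<otimes>\<^bsub>\<Lambda>\<^esub> \<rho> = (inv\<^bsub>\<Lambda>\<^esub> \<rho> \<otimes>\<^bsub>\<Lambda>\<^esub> h) \<otimes>\<^bsub>\<Lambda>\<^esub> \<kappa> \<otimes>\<^bsub>\<Lambda>\<^esub> inv\<^bsub>\<Lambda>\<^esub> (inv\<^bsub>\<Lambda>\<^esub> \<rho> \<otimes>\<^bsub>\<Lambda>\<^esub> h)"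
        unfolding h(2) using s h(1) \<kappa> by (simp add: Y.m_assoc Y.inv_mult_group)
      then show "inv\<^bsub>\<Lambda>\<^esub> \<rho> \<otimes>\<^bsub>\<Lambda>\<^esub> \<tau> \<otimes>\<^bsub>\<Lambda>\<^esub> \<rho> \<in> ?F" using s h(1) by blast
    qed
    obtain T where T: "T \<in> LY" "AE z in Y. \<forall>\<rho>\<in>carrier \<Lambda>. Y.kern T (z, \<rho>) = (if \<rho> \<in> ?F then 1 else 0)"
      using Y.finite_sum_group_vN[OF fin sub] by blast
    \<comment> \<open>Commutation with all of \<open>LY\<close> is required, because the elements
      \<open>wg \<gamma>\<close> coming from the other side are not group unitaries. Conjugation
      invariance of \<open>?F\<close> matches the two convolutions term by term.\<close>
    have central: "T \<cdot> w = w \<cdot> T" if w: "w \<in> LY" for w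
    proof (rule Y.crossed_eqI)
      obtain c where c: "AE z in Y. \<forall>\<rho>\<in>carrier \<Lambda>. Y.kern w (z, \<rho>) = c \<rho>" using Y.group_vN_kern[OF w] by blast
      show "AE p in Y.N. Y.kern (T \<cdot> w) p = Y.kern (w \<cdot> T) p"
        unfolding Y.AE_N_iff
        using Y.kern_mult[OF LY_mem[OF T(1)] LY_mem[OF w], unfolded Y.AE_N_iff] Y.kern_mult[OF LY_mem[OF w] LY_mem[OF T(1)], unfolded Y.AE_N_iff]
          T(2) c Y.AE_act_all[OF T(2)] Y.AE_act_all[OF c]
      proof eventually_elim
        fix z assume 1: "\<forall>\<rho>\<in>carrier \<Lambda>. Y.kern (T \<cdot> w) (z, \<rho>) = Y.conv (Y.kern T) (Y.kern w) (z, \<rho>)"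
          and 2: "\<forall>\<rho>\<in>carrier \<Lambda>. Y.kern (w \<cdot> T) (z, \<rho>) = Y.conv (Y.kern w) (Y.kern T) (z, \<rho>)"
          and 3: "\<forall>\<rho>\<in>carrier \<Lambda>. Y.kern T (z, \<rho>) = (if \<rho> \<in> ?F then 1 else 0)"
          and 4: "\<forall>\<rho>\<in>carrier \<Lambda>. Y.kern w (z, \<rho>) = c \<rho>"
          and 5: "\<forall>g\<in>carrier \<Lambda>. \<forall>\<rho>\<in>carrier \<Lambda>. Y.kern T (\<psi> g z, \<rho>) = (if \<rho> \<in> ?F then 1 else 0)"
          and 6: "\<forall>g\<in>carrier \<Lambda>. \<forall>\<rho>\<in>carrier \<Lambda>. Y.kern w (\<psi> g z, \<rho>) = c \<rho>"
        show "\<forall>\<rho>\<in>carrier \<Lambda>. Y.kern (T \<cdot> w) (z, \<rho>) = Y.kern (w \<cdot> T) (z, \<rho>)"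
        proof
          fix \<rho> assume \<rho>: "\<rho> \<in> carrier \<Lambda>"
          have "Y.kern (w \<cdot> T) (z, \<rho>) = (LINT \<tau>|Y.C. (if \<tau> \<in> ?F then 1 else 0) * c (inv\<^bsub>\<Lambda>\<^esub> \<tau> \<otimes>\<^bsub>\<Lambda>\<^esub> \<rho>))"
          proof -
            let ?f = "\<lambda>\<sigma>. c \<sigma> * (if inv\<^bsub>\<Lambda>\<^esub> \<sigma> \<otimes>\<^bsub>\<Lambda>\<^esub> \<rho> \<in> ?F then 1 else 0)"
            have "Y.kern (w \<cdot> T) (z, \<rho>) = (LINT \<sigma>|Y.C. ?f \<sigma>)"
              unfolding 2[rule_format, OF \<rho>] Y.conv_apply
              by (intro Bochner_Integration.integral_cong refl) (use \<rho> 4 5 in simp)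
            also have "\<dots> = (LINT \<tau>|Y.C. ?f (\<tau> \<otimes>\<^bsub>\<Lambda>\<^esub> \<rho>))" by (rule Y.integral_C_rmult[OF \<rho>, symmetric])
            also have "\<dots> = (LINT \<tau>|Y.C. ?f (inv\<^bsub>\<Lambda>\<^esub> \<tau> \<otimes>\<^bsub>\<Lambda>\<^esub> \<rho>))"
              by (rule Y.integral_C_inv[symmetric])
            also have "\<dots> = (LINT \<tau>|Y.C. (if \<tau> \<in> ?F then 1 else 0) * c (inv\<^bsub>\<Lambda>\<^esub> \<tau> \<otimes>\<^bsub>\<Lambda>\<^esub> \<rho>))"
            proof (intro Bochner_Integration.integral_cong refl)
              fix \<tau> assume "\<tau> \<in> space Y.C" then have \<tau>: "\<tau> \<in> carrier \<Lambda>" by simp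
              have "inv\<^bsub>\<Lambda>\<^esub> (inv\<^bsub>\<Lambda>\<^esub> \<tau> \<otimes>\<^bsub>\<Lambda>\<^esub> \<rho>) \<otimes>\<^bsub>\<Lambda>\<^esub> \<rho> = inv\<^bsub>\<Lambda>\<^esub> \<rho> \<otimes>\<^bsub>\<Lambda>\<^esub> \<tau> \<otimes>\<^bsub>\<Lambda>\<^esub> \<rho>"
                using \<tau> \<rho> by (simp add: Y.inv_mult_group)
              then show "?f (inv\<^bsub>\<Lambda>\<^esub> \<tau> \<otimes>\<^bsub>\<Lambda>\<^esub> \<rho>) = (if \<tau> \<in> ?F then 1 else 0) * c (inv\<^bsub>\<Lambda>\<^esub> \<tau> \<otimes>\<^bsub>\<Lambda>\<^esub> \<rho>)"
                using conj[OF \<rho> \<tau>] by simp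
            qed
            finally show ?thesis .
          qed
          moreover have "Y.kern (T \<cdot> w) (z, \<rho>) = (LINT \<tau>|Y.C. (if \<tau> \<in> ?F then 1 else 0) * c (inv\<^bsub>\<Lambda>\<^esub> \<tau> \<otimes>\<^bsub>\<Lambda>\<^esub> \<rho>))"
            unfolding 1[rule_format, OF \<rho>] Y.conv_apply
            by (intro Bochner_Integration.integral_cong) (use \<rho> 3 6 in auto)
          ultimately show "Y.kern (T \<cdot> w) (z, \<rho>) = Y.kern (w \<cdot> T) (z, \<rho>)" by simp
        qed
      qed
    qed (use T w in auto)
    \<comment> \<open>The class sum is pulled back to the group algebra of \<Gamma>, where
      commutation with all \<open>ug \<gamma>\<close> forces it to be a scalar.\<close>
    obtain S where S: "S \<in> LX" "\<Theta> S = op_conj Y.N u T" using Theta_group T(1) by (metis (no_types, lifting) imageE image_eqI)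
    have S_u: "\<Theta> S = u \<cdot> T \<cdot> adjY u" using S T by (simp add: op_conj_def mult_assocY)
    have tg_u: "tg \<gamma> = u \<cdot> wg \<gamma> \<cdot> adjY u" if \<gamma>: "\<gamma> \<in> carrier \<Gamma>" for \<gamma>
    proof -
      have "tg \<gamma> = tg \<gamma> \<cdot> u \<cdot> adjY u" using \<gamma> by (simp add: mult_assocY unitaries_mult_adj[OF u])
      then show ?thesis using wg(2)[OF \<gamma>] by simp
    qed
    have comm: "S \<cdot>\<^sub>X ug \<gamma> = ug \<gamma> \<cdot>\<^sub>X S" if \<gamma>: "\<gamma> \<in> carrier \<Gamma>" for \<gamma>
    proof (rule Theta_inj)
      have "\<Theta> (S \<cdot>\<^sub>X ug \<gamma>) = u \<cdot> T \<cdot> adjY u \<cdot> (u \<cdot> wg \<gamma> \<cdot> adjY u)"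
        using S \<gamma> tg_u[OF \<gamma>] by (simp add: Theta_mult S_u tg_def)
      also have "\<dots> = u \<cdot> (T \<cdot> wg \<gamma>) \<cdot> adjY u"
        using T wg[OF \<gamma>] by (simp add: mult_assocY)
      also have "T \<cdot> wg \<gamma> = wg \<gamma> \<cdot> T" by (rule central[OF wg(1)[OF \<gamma>]])
      also have "u \<cdot> (wg \<gamma> \<cdot> T) \<cdot> adjY u = u \<cdot> wg \<gamma> \<cdot> adjY u \<cdot> (u \<cdot> T \<cdot> adjY u)"
        using T wg[OF \<gamma>] by (simp add: mult_assocY)
      also have "\<dots> = \<Theta> (ug \<gamma> \<cdot>\<^sub>X S)"
        using S \<gamma> tg_u[OF \<gamma>] by (simp add: Theta_mult S_u tg_def)
      finally show "\<Theta> (S \<cdot>\<^sub>X ug \<gamma>) = \<Theta> (ug \<gamma> \<cdot>\<^sub>X S)" .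
    qed (use S \<gamma> in auto)
    obtain s where "S = op_scale X.N s (op_one X.N)" using X.commuting_group_vN_scalar[OF icc_\<Gamma> S(1) comm] by blast
    then have "u \<cdot> T \<cdot> adjY u = op_scale Y.N s (op_one Y.N)" using S_u by (simp add: Theta_scale)
    then have "adjY u \<cdot> (u \<cdot> T \<cdot> adjY u) \<cdot> u = adjY u \<cdot> op_scale Y.N s (op_one Y.N) \<cdot> u" by simp
    moreover have "adjY u \<cdot> (u \<cdot> T \<cdot> adjY u) \<cdot> u = T"
      using T by (simp add: mult_assocY unitaries_adj_mult[OF u])
    moreover have "adjY u \<cdot> op_scale Y.N s (op_one Y.N) \<cdot> u = op_scale Y.N s (op_one Y.N)"
      by (simp add: op_mult_scale unitaries_adj_mult[OF u])
    ultimately have "T = op_scale Y.N s (vg \<one>\<^bsub>\<Lambda>\<^esub>)" by (simp add: Y.group_unitary_one)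
    \<comment> \<open>A scalar has coefficient 0 at \<kappa>, whereas the class sum has coefficient
      1 there.\<close>
    then have "AE z in Y. \<forall>\<rho>\<in>carrier \<Lambda>. (if \<rho> \<in> ?F then 1 else 0) = (if \<rho> = \<one>\<^bsub>\<Lambda>\<^esub> then s else 0)"
    proof -
      assume eq: "T = op_scale Y.N s (vg \<one>\<^bsub>\<Lambda>\<^esub>)"
      show ?thesis using T(2) Y.kern_scale_group_unitary[OF Y.one_closed, of s]
        unfolding eq by eventually_elim simp
    qed
    then have "\<forall>\<rho>\<in>carrier \<Lambda>. (if \<rho> \<in> ?F then 1 else 0) = (if \<rho> = \<one>\<^bsub>\<Lambda>\<^esub> then s else 0)" unfolding Y.AE_Y_const .
    from bspec[OF this \<kappa>(1)] have *: "(if \<kappa> \<in> ?F then 1 else 0) = (if \<kappa> = \<one>\<^bsub>\<Lambda>\<^esub> then s else 0)" .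
    have mem: "\<kappa> \<in> ?F" using \<kappa> by (intro CollectI exI[of _ "\<one>\<^bsub>\<Lambda>\<^esub>"]) simp
    from * show False unfolding if_P[OF mem] if_not_P[OF \<kappa>(2)] by simp
  qed
qed

text \<open>The supports of the coefficients of \<open>\<Theta>(u\<^sub>\<gamma>)\<close> at a fixed \<open>\<mu> \<in> \<Lambda>\<close> cover \<open>Y\<close>: cut
  \<open>\<Theta>\<^sup>-\<^sup>1(v\<^sub>\<mu>)\<close> into pieces of the form \<open>s u\<^sub>\<gamma>\<close>.\<close>

lemma cover:
  assumes \<mu>: "\<mu> \<in> carrier \<Lambda>"
  shows "AE z in Y. \<exists>\<gamma>\<in>carrier \<Gamma>. Y.kern (tg \<gamma>) (z, \<mu>) \<noteq> 0"
proof -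
  obtain S where S: "S \<in> CX" "\<Theta> S = vg \<mu>" using Theta_surj[OF Y.group_unitary_crossed[OF \<mu>]] by blast
  have "X.normalizes S" using Theta_normalizes[OF S(1)] Y.group_unitary_normalizes[OF \<mu>] S(2) by simp
  then have mono: "X.monomial (X.kern S)" by (rule X.normalizes_monomial[OF free_X])
  define B where "B = {z\<in>space Y. \<forall>\<gamma>\<in>carrier \<Gamma>. Y.kern (tg \<gamma>) (z, \<mu>) = 0}"
  have B: "B \<in> sets Y"
  proof -
    have "(\<lambda>z. Y.kern (tg \<gamma>) (z, \<mu>)) \<in> borel_measurable Y" if "\<gamma> \<in> carrier \<Gamma>" for \<gamma>
      using L2_measurable[OF Y.kern_L2[OF boundedY[OF tg_mem[OF that]]]] \<mu> by (simp add: Y.measurable_N_iff)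
    then have "{z\<in>space Y. Y.kern (tg \<gamma>) (z, \<mu>) \<noteq> 0} \<in> sets Y" if "\<gamma> \<in> carrier \<Gamma>" for \<gamma>
      using that by measurable
    then have "(\<Union>\<gamma>\<in>carrier \<Gamma>. {z\<in>space Y. Y.kern (tg \<gamma>) (z, \<mu>) \<noteq> 0}) \<in> sets Y"
      by (intro sets.countable_UN'[OF X.countable_carrier] image_subsetI)
    moreover have "B = space Y - (\<Union>\<gamma>\<in>carrier \<Gamma>. {z\<in>space Y. Y.kern (tg \<gamma>) (z, \<mu>) \<noteq> 0})"
      by (auto simp: B_def)
    ultimately show ?thesis by simp
  qed
  have 1: "Y.bdd (indicator B)" by (rule Y.bdd_indicator[OF B])
  obtain b where b: "X.bdd b" "\<Theta> (mX b) = mY (indicator B)" using mY_Theta[OF 1] by blast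
  \<comment> \<open>\<open>b\<close> corresponds to the indicator of the uncovered set
    \<open>B\<close>. It is shown to vanish on each piece of \<open>S\<close>; the pieces exhaust X
    because \<open>S\<close> is monomial.\<close>
  have "AE x in X. \<forall>\<gamma>\<in>carrier \<Gamma>. X.kern S (x, \<gamma>) \<noteq> 0 \<longrightarrow> b x = 0"
    unfolding AE_ball_countable[OF X.countable_carrier]
  proof
    fix \<gamma> assume \<gamma>: "\<gamma> \<in> carrier \<Gamma>"
    obtain p s where p: "X.bdd p" "X.bdd s" "\<And>x. p x = (if X.kern S (x, \<gamma>) \<noteq> 0 then 1 else 0)"
      "mX p \<cdot>\<^sub>X S = mX s \<cdot>\<^sub>X ug \<gamma>" using X.monomial_cut[OF S(1) mono \<gamma>] by metis
    obtain p' where p': "Y.bdd p'" "\<Theta> (mX p) = mY p'" using Theta_mX[OF p(1)] by blast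
    obtain s' where s': "Y.bdd s'" "\<Theta> (mX s) = mY s'" using Theta_mX[OF p(2)] by blast
    have "mY p' \<cdot> vg \<mu> = \<Theta> (mX p \<cdot>\<^sub>X S)" using S p(1) p' by (simp add: Theta_mult)
    also have "\<dots> = mY s' \<cdot> tg \<gamma>" unfolding p(4) using p(2) s' \<gamma> by (simp add: Theta_mult tg_def)
    finally have eq: "mY p' \<cdot> vg \<mu> = mY s' \<cdot> tg \<gamma>" .
    \<comment> \<open>Coefficients at \<mu> of the two expressions for the image of the piece are
      compared. The right side vanishes on \<open>B\<close> by definition of
      \<open>B\<close>.\<close>
    have "AE z in Y. p' z = s' z * Y.kern (tg \<gamma>) (z, \<mu>)"
      using Y.kern_mult_op_left[OF p'(1) Y.group_unitary_crossed[OF \<mu>]] Y.kern_mult_op_left[OF s'(1) tg_mem[OF \<gamma>]]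
        Y.kern_group_unitary[OF \<mu>, unfolded Y.AE_N_iff]
      unfolding eq by eventually_elim (use \<mu> in \<open>auto simp: Y.delta_def\<close>)
    then have "AE z in Y. indicator B z * p' z = 0"
      by eventually_elim (use \<gamma> in \<open>auto simp: B_def indicator_def\<close>)
    then have "mY (\<lambda>z. indicator B z * p' z) = mY (\<lambda>z. 0)" by (rule Y.mult_op_cong)
    then have "\<Theta> (mX b \<cdot>\<^sub>X mX p) = \<Theta> (mX (\<lambda>x. 0))"
      using b p p' 1 by (simp add: Theta_mult Y.mult_op_mult X.mult_op_const Y.mult_op_const Theta_scale)
    then have "mX b \<cdot>\<^sub>X mX p = mX (\<lambda>x. 0)" by (rule Theta_inj[rotated 2]) (use b p in auto)
    then have "AE x in X. b x * p x = 0"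
      using b p X.mult_op_eq_iff[OF X.bdd_mult[OF b(1) p(1)] X.bdd_const[of 0]] by (simp add: X.mult_op_mult)
    then show "AE x in X. X.kern S (x, \<gamma>) \<noteq> 0 \<longrightarrow> b x = 0"
      by eventually_elim (auto simp: p(3))
  qed
  then have "AE x in X. b x = 0" using mono[unfolded X.monomial_def]
    by eventually_elim (metis norm_zero zero_neq_one)
  then have "mX b = mX (\<lambda>x. 0)" by (rule X.mult_op_cong)
  then have "mY (indicator B) = mY (\<lambda>z. 0)" using b by (simp add: X.mult_op_const Y.mult_op_const Theta_scale)
  then have "AE z in Y. indicator B z = (0::complex)" using Y.mult_op_eq_iff[OF 1 Y.bdd_const[of 0]] by simp
  then show ?thesis using AE_space by eventually_elim (auto simp: B_def indicator_def split: if_splits)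
qed

definition cf :: "'g \<Rightarrow> 'h \<Rightarrow> complex" where
  "cf \<gamma> = (SOME c. Y.orth c \<and> (AE z in Y. \<forall>\<rho>\<in>carrier \<Lambda>. Y.kern (wg \<gamma>) (z, \<rho>) = c \<rho>))"

lemma cf:
  assumes "\<gamma> \<in> carrier \<Gamma>"
  shows "Y.orth (cf \<gamma>)" "AE z in Y. \<forall>\<rho>\<in>carrier \<Lambda>. Y.kern (wg \<gamma>) (z, \<rho>) = cf \<gamma> \<rho>"
  using someI_ex[OF Y.group_vN_unitary_orth[OF wg(1)[OF assms] wg(3)[OF assms]]] unfolding cf_def by auto

lemma tg_monomial: "\<gamma> \<in> carrier \<Gamma> \<Longrightarrow> Y.monomial (Y.kern (tg \<gamma>))"
  by (rule Y.normalizes_monomial[OF free_Y tg_normalizes])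

text \<open>Both sides are the coefficient at \<rho> of the operator \<open>tg \<gamma>\<close>
  times \<open>u\<close>, which equals \<open>u\<close> times \<open>wg \<gamma>\<close>. In the
  first product a single term survives since \<open>tg \<gamma>\<close> is monomial; in the second
  the coefficients of \<open>wg \<gamma>\<close> are constants.\<close>

lemma u_equivariant:
  assumes \<gamma>: "\<gamma> \<in> carrier \<Gamma>"
  shows "AE z in Y. \<forall>\<sigma>\<in>carrier \<Lambda>. Y.kern (tg \<gamma>) (z, \<sigma>) \<noteq> 0 \<longrightarrow> cmod (Y.kern (tg \<gamma>) (z, \<sigma>)) = 1 \<and>
      (\<forall>\<rho>\<in>carrier \<Lambda>. Y.kern (tg \<gamma>) (z, \<sigma>) * Y.kern u (\<psi> (inv\<^bsub>\<Lambda>\<^esub> \<sigma>) z, inv\<^bsub>\<Lambda>\<^esub> \<sigma> \<otimes>\<^bsub>\<Lambda>\<^esub> \<rho>)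
        = (LINT \<kappa>|Y.C. Y.kern u (z, \<kappa>) * cf \<gamma> (inv\<^bsub>\<Lambda>\<^esub> \<kappa> \<otimes>\<^bsub>\<Lambda>\<^esub> \<rho>)))"
  using tg_monomial[OF \<gamma>, unfolded Y.monomial_def] Y.kern_mult[OF tg_mem[OF \<gamma>] u_mem, unfolded Y.AE_N_iff wg(2)[OF \<gamma>]]
    Y.kern_mult[OF u_mem LY_mem[OF wg(1)[OF \<gamma>]], unfolded Y.AE_N_iff] Y.AE_act_all[OF cf(2)[OF \<gamma>]]
proof eventually_elim
  fix z assume 1: "\<exists>\<sigma>\<in>carrier \<Lambda>. cmod (Y.kern (tg \<gamma>) (z, \<sigma>)) = 1 \<and> (\<forall>\<tau>\<in>carrier \<Lambda>. \<tau> \<noteq> \<sigma> \<longrightarrow> Y.kern (tg \<gamma>) (z, \<tau>) = 0)"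
    and 2: "\<forall>\<rho>\<in>carrier \<Lambda>. Y.kern (u \<cdot> wg \<gamma>) (z, \<rho>) = Y.conv (Y.kern (tg \<gamma>)) (Y.kern u) (z, \<rho>)"
    and 3: "\<forall>\<rho>\<in>carrier \<Lambda>. Y.kern (u \<cdot> wg \<gamma>) (z, \<rho>) = Y.conv (Y.kern u) (Y.kern (wg \<gamma>)) (z, \<rho>)"
    and 4: "\<forall>g\<in>carrier \<Lambda>. \<forall>\<rho>\<in>carrier \<Lambda>. Y.kern (wg \<gamma>) (\<psi> g z, \<rho>) = cf \<gamma> \<rho>"
  show "\<forall>\<sigma>\<in>carrier \<Lambda>. Y.kern (tg \<gamma>) (z, \<sigma>) \<noteq> 0 \<longrightarrow> cmod (Y.kern (tg \<gamma>) (z, \<sigma>)) = 1 \<and>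
      (\<forall>\<rho>\<in>carrier \<Lambda>. Y.kern (tg \<gamma>) (z, \<sigma>) * Y.kern u (\<psi> (inv\<^bsub>\<Lambda>\<^esub> \<sigma>) z, inv\<^bsub>\<Lambda>\<^esub> \<sigma> \<otimes>\<^bsub>\<Lambda>\<^esub> \<rho>)
        = (LINT \<kappa>|Y.C. Y.kern u (z, \<kappa>) * cf \<gamma> (inv\<^bsub>\<Lambda>\<^esub> \<kappa> \<otimes>\<^bsub>\<Lambda>\<^esub> \<rho>)))"
  proof (intro ballI impI)
    fix \<sigma> assume \<sigma>: "\<sigma> \<in> carrier \<Lambda>" "Y.kern (tg \<gamma>) (z, \<sigma>) \<noteq> 0"
    with 1 have s: "cmod (Y.kern (tg \<gamma>) (z, \<sigma>)) = 1" "\<forall>\<tau>\<in>carrier \<Lambda>. \<tau> \<noteq> \<sigma> \<longrightarrow> Y.kern (tg \<gamma>) (z, \<tau>) = 0" by metis+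
    show "cmod (Y.kern (tg \<gamma>) (z, \<sigma>)) = 1 \<and>
      (\<forall>\<rho>\<in>carrier \<Lambda>. Y.kern (tg \<gamma>) (z, \<sigma>) * Y.kern u (\<psi> (inv\<^bsub>\<Lambda>\<^esub> \<sigma>) z, inv\<^bsub>\<Lambda>\<^esub> \<sigma> \<otimes>\<^bsub>\<Lambda>\<^esub> \<rho>)
        = (LINT \<kappa>|Y.C. Y.kern u (z, \<kappa>) * cf \<gamma> (inv\<^bsub>\<Lambda>\<^esub> \<kappa> \<otimes>\<^bsub>\<Lambda>\<^esub> \<rho>)))"
    proof (intro conjI ballI s(1))
      fix \<rho> assume \<rho>: "\<rho> \<in> carrier \<Lambda>"
      have "Y.kern (tg \<gamma>) (z, \<sigma>) * Y.kern u (\<psi> (inv\<^bsub>\<Lambda>\<^esub> \<sigma>) z, inv\<^bsub>\<Lambda>\<^esub> \<sigma> \<otimes>\<^bsub>\<Lambda>\<^esub> \<rho>) = Y.conv (Y.kern (tg \<gamma>)) (Y.kern u) (z, \<rho>)"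
        unfolding Y.conv_apply by (rule Y.integral_C_single[OF \<sigma>(1), symmetric]) (use s in auto)
      also have "\<dots> = Y.conv (Y.kern u) (Y.kern (wg \<gamma>)) (z, \<rho>)" using 2 3 \<rho> by metis
      also have "\<dots> = (LINT \<kappa>|Y.C. Y.kern u (z, \<kappa>) * cf \<gamma> (inv\<^bsub>\<Lambda>\<^esub> \<kappa> \<otimes>\<^bsub>\<Lambda>\<^esub> \<rho>))"
        unfolding Y.conv_apply by (intro Bochner_Integration.integral_cong refl) (use 4 \<rho> in simp)
      finally show "Y.kern (tg \<gamma>) (z, \<sigma>) * Y.kern u (\<psi> (inv\<^bsub>\<Lambda>\<^esub> \<sigma>) z, inv\<^bsub>\<Lambda>\<^esub> \<sigma> \<otimes>\<^bsub>\<Lambda>\<^esub> \<rho>)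
        = (LINT \<kappa>|Y.C. Y.kern u (z, \<kappa>) * cf \<gamma> (inv\<^bsub>\<Lambda>\<^esub> \<kappa> \<otimes>\<^bsub>\<Lambda>\<^esub> \<rho>))" .
    qed
  qed
qed

sublocale R: rigid \<Lambda> Y \<psi> "Y.kern u" "carrier \<Gamma>" "\<lambda>\<gamma>. Y.kern (tg \<gamma>)" cf
proof unfold_locales
  show "Y.kern u \<in> borel_measurable Y.N" by (rule L2_measurable[OF Y.kern_L2]) simp
  show "AE z in Y. (\<lambda>\<rho>. Y.kern u (z, \<rho>)) \<in> L2 Y.C \<and> sqn Y.C (\<lambda>\<rho>. Y.kern u (z, \<rho>)) = 1" by (rule Y.unitary_row_sqn[OF u])
  show "(\<lambda>(y, \<rho>). Y.pr (\<lambda>\<sigma>. Y.kern u (y, \<sigma>)) \<zeta> \<rho>) \<in> L2 Y.N \<and>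
    ip Y.N (\<lambda>(y, \<rho>). Y.pr (\<lambda>\<sigma>. Y.kern u (y, \<sigma>)) \<zeta> \<rho>) (\<lambda>(y, \<rho>). Y.pr (\<lambda>\<sigma>. Y.kern u (y, \<sigma>)) \<zeta>' \<rho>) = ip Y.C \<zeta>' \<zeta>"
    if "\<zeta> \<in> L2 Y.C" "\<zeta>' \<in> L2 Y.C" for \<zeta> \<zeta>' by (rule Y.unitary_frame[OF u that])
  show "countable (carrier \<Gamma>)" by (rule X.countable_carrier)
  show "icc \<Lambda>" by (rule icc_\<Lambda>)
  show "Y.kern (tg \<gamma>) \<in> borel_measurable Y.N" if "\<gamma> \<in> carrier \<Gamma>" for \<gamma>
    by (rule L2_measurable[OF Y.kern_L2]) (simp add: that)
qed (rule cf u_equivariant cover Y.unitary_row_nn Y.unitary_col_nn tg_unitary | assumption)+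

section \<open>The normalising unitary, the character and the group isomorphism\<close>

definition tvec :: "'h \<Rightarrow> complex" where
  "tvec = (SOME t. Y.orth t \<and> (AE y in Y. \<exists>h\<in>carrier \<Lambda>. \<exists>b. cmod b = 1 \<and>
     (\<forall>\<tau>\<in>carrier \<Lambda>. Y.kern u (y, \<tau>) = b * t (inv\<^bsub>\<Lambda>\<^esub> h \<otimes>\<^bsub>\<Lambda>\<^esub> \<tau>))))"

lemma tvec: "Y.orth tvec" "AE y in Y. \<exists>h\<in>carrier \<Lambda>. \<exists>b. cmod b = 1 \<and>
     (\<forall>\<tau>\<in>carrier \<Lambda>. Y.kern u (y, \<tau>) = b * tvec (inv\<^bsub>\<Lambda>\<^esub> h \<otimes>\<^bsub>\<Lambda>\<^esub> \<tau>))"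
  using someI_ex[OF R.U_monomial] unfolding tvec_def by auto

abbreviation "T \<equiv> Y.conv_op tvec"

definition xop :: "('y \<times> 'h) l2op" where "xop = T \<cdot> adjY u"

lemma T_LY [simp]: "T \<in> LY"
  by (rule Y.conv_op_group_vN[OF tvec(1)])

lemma T_unitary_LY: "T \<in> unitaries Y.N LY"
  by (rule Y.conv_op_unitary[OF tvec(1)])

lemma T_unitary: "T \<in> unitaries Y.N CY"
  using T_unitary_LY by (simp add: unitaries_def)

lemma xop_unitary: "xop \<in> unitaries Y.N CY"
  unfolding xop_def by (intro Y.unitaries_mult T_unitary Y.unitaries_adj u)

lemma xop_mem [simp]: "xop \<in> CY"
  using xop_unitary by (rule unitaries_mem)

lemma xop_cancel [simp]:
  assumes "S \<in> CY"
  shows "xop \<cdot> (adjY xop \<cdot> S) = S" "adjY xop \<cdot> (xop \<cdot> S) = S"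
  using assms by (simp_all add: mult_assocY[symmetric] unitaries_mult_adj[OF xop_unitary] unitaries_adj_mult[OF xop_unitary])

lemma xop_u: "xop \<cdot> u = T"
  unfolding xop_def by (simp add: mult_assocY unitaries_adj_mult[OF u])

lemma adj_xop: "adjY xop = u \<cdot> adjY T"
  unfolding xop_def by (simp add: op_adj_mult)

text \<open>The coefficient of \<open>adjY xop\<close> at \<rho> is the inner product of the row of
  \<open>u\<close> with the \<rho>-translate of \<open>tvec\<close>. The row is a phase times a
  translate of \<open>tvec\<close>, and translates are orthonormal.\<close>

lemma adj_xop_monomial: "Y.monomial (Y.kern (adjY xop))"
  unfolding Y.monomial_def adj_xop
  using Y.kern_mult_adj[OF u_mem LY_mem[OF T_LY]] tvec(2) Y.AE_act_all[OF Y.kern_conv_op[OF tvec(1)]]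
proof eventually_elim
  fix z assume 1: "\<forall>\<rho>\<in>carrier \<Lambda>. Y.kern (u \<cdot> adjY T) (z, \<rho>) =
      (LINT \<sigma>|Y.C. Y.kern u (z, \<sigma>) * cnj (Y.kern T (\<psi> (inv\<^bsub>\<Lambda>\<^esub> \<rho>) z, inv\<^bsub>\<Lambda>\<^esub> \<rho> \<otimes>\<^bsub>\<Lambda>\<^esub> \<sigma>)))"
    and "\<exists>h\<in>carrier \<Lambda>. \<exists>b. cmod b = 1 \<and> (\<forall>\<tau>\<in>carrier \<Lambda>. Y.kern u (z, \<tau>) = b * tvec (inv\<^bsub>\<Lambda>\<^esub> h \<otimes>\<^bsub>\<Lambda>\<^esub> \<tau>))"
    and 3: "\<forall>g\<in>carrier \<Lambda>. \<forall>\<rho>\<in>carrier \<Lambda>. Y.kern T (\<psi> g z, \<rho>) = tvec \<rho>"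
  then obtain h b where h: "h \<in> carrier \<Lambda>" "cmod b = 1" "\<forall>\<tau>\<in>carrier \<Lambda>. Y.kern u (z, \<tau>) = b * tvec (inv\<^bsub>\<Lambda>\<^esub> h \<otimes>\<^bsub>\<Lambda>\<^esub> \<tau>)" by blast
  have k: "Y.kern (u \<cdot> adjY T) (z, \<rho>) = (if h = \<rho> then b else 0)" if \<rho>: "\<rho> \<in> carrier \<Lambda>" for \<rho>
  proof -
    have "Y.kern (u \<cdot> adjY T) (z, \<rho>) = (LINT \<sigma>|Y.C. b * (tvec (inv\<^bsub>\<Lambda>\<^esub> h \<otimes>\<^bsub>\<Lambda>\<^esub> \<sigma>) * cnj (tvec (inv\<^bsub>\<Lambda>\<^esub> \<rho> \<otimes>\<^bsub>\<Lambda>\<^esub> \<sigma>))))"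
      unfolding 1[rule_format, OF \<rho>] by (intro Bochner_Integration.integral_cong refl) (use \<rho> h(3) 3 in simp)
    also have "\<dots> = b * ip Y.C (\<lambda>\<sigma>. tvec (inv\<^bsub>\<Lambda>\<^esub> h \<otimes>\<^bsub>\<Lambda>\<^esub> \<sigma>)) (\<lambda>\<sigma>. tvec (inv\<^bsub>\<Lambda>\<^esub> \<rho> \<otimes>\<^bsub>\<Lambda>\<^esub> \<sigma>))"
      by (simp add: ip_def)
    finally show ?thesis using Y.orth_translates[OF tvec(1) h(1) \<rho>] by simp
  qed
  show "\<exists>\<sigma>\<in>carrier \<Lambda>. cmod (Y.kern (u \<cdot> adjY T) (z, \<sigma>)) = 1 \<and> (\<forall>\<tau>\<in>carrier \<Lambda>. \<tau> \<noteq> \<sigma> \<longrightarrow> Y.kern (u \<cdot> adjY T) (z, \<tau>) = 0)"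
    by (rule bexI[OF _ h(1)]) (use k h in auto)
qed

lemma xop_monomial: "Y.monomial (Y.kern xop)"
  using Y.monomial_adj[OF Y.unitaries_adj[OF xop_unitary] adj_xop_monomial] by simp

lemma xop_normalizer: "xop \<in> vN_normalizer Y.N CY (Linf \<Lambda> Y)"
  by (rule Y.monomial_mem_normalizer[OF xop_unitary xop_monomial])

lemma xop_normalizes: "Y.normalizes xop" and adj_xop_normalizes: "Y.normalizes (adjY xop)"
  using Y.monomial_normalizes'[OF xop_unitary xop_monomial]
    Y.monomial_normalizes'[OF Y.unitaries_adj[OF xop_unitary] adj_xop_monomial] by auto

lemma ex_scalar:
  assumes \<gamma>: "\<gamma> \<in> carrier \<Gamma>"
  shows "\<exists>w g. g \<in> carrier \<Lambda> \<and> cmod w = 1 \<and> xop \<cdot> (tg \<gamma> \<cdot> adjY xop) = op_scale Y.N w (vg g)"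
proof (rule Y.scalar_monomial)
  have "Y.normalizes (xop \<cdot> (tg \<gamma> \<cdot> adjY xop))"
    by (intro Y.normalizes_mult xop_normalizes adj_xop_normalizes tg_normalizes \<gamma>)
  then show "Y.monomial (Y.kern (xop \<cdot> (tg \<gamma> \<cdot> adjY xop)))" "xop \<cdot> (tg \<gamma> \<cdot> adjY xop) \<in> unitaries Y.N CY"
    by (auto intro: Y.normalizes_monomial[OF free_Y] Y.normalizes_unitary)
  have "xop \<cdot> (tg \<gamma> \<cdot> adjY xop) = T \<cdot> (wg \<gamma> \<cdot> adjY T)"
    unfolding adj_xop wg_def using \<gamma> by (simp add: xop_def mult_assocY)
  then show "xop \<cdot> (tg \<gamma> \<cdot> adjY xop) \<in> LY" using wg(1)[OF \<gamma>] by simp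
qed

definition \<eta>\<delta> :: "'g \<Rightarrow> complex \<times> 'h" where
  "\<eta>\<delta> \<gamma> = (SOME p. snd p \<in> carrier \<Lambda> \<and> cmod (fst p) = 1 \<and> xop \<cdot> (tg \<gamma> \<cdot> adjY xop) = op_scale Y.N (fst p) (vg (snd p)))"

definition "\<eta> \<gamma> = fst (\<eta>\<delta> \<gamma>)"
definition "\<delta> \<gamma> = snd (\<eta>\<delta> \<gamma>)"

lemma \<eta>\<delta>:
  assumes "\<gamma> \<in> carrier \<Gamma>"
  shows "\<delta> \<gamma> \<in> carrier \<Lambda>" "cmod (\<eta> \<gamma>) = 1" "xop \<cdot> (tg \<gamma> \<cdot> adjY xop) = op_scale Y.N (\<eta> \<gamma>) (vg (\<delta> \<gamma>))"
proof -
  have "\<exists>p. snd p \<in> carrier \<Lambda> \<and> cmod (fst p) = 1 \<and> xop \<cdot> (tg \<gamma> \<cdot> adjY xop) = op_scale Y.N (fst p) (vg (snd p))"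
    using ex_scalar[OF assms] by auto
  from someI_ex[OF this]
  show "\<delta> \<gamma> \<in> carrier \<Lambda>" "cmod (\<eta> \<gamma>) = 1" "xop \<cdot> (tg \<gamma> \<cdot> adjY xop) = op_scale Y.N (\<eta> \<gamma>) (vg (\<delta> \<gamma>))"
    unfolding \<eta>_def \<delta>_def \<eta>\<delta>_def by auto
qed

lemma vg_mem [simp]: "g \<in> carrier \<Lambda> \<Longrightarrow> vg g \<in> CY"
  by (rule Y.group_unitary_crossed)

lemma tg_eq:
  assumes \<gamma>: "\<gamma> \<in> carrier \<Gamma>"
  shows "tg \<gamma> = op_scale Y.N (\<eta> \<gamma>) (adjY xop \<cdot> (vg (\<delta> \<gamma>) \<cdot> xop))"
proof -
  have "tg \<gamma> = adjY xop \<cdot> ((xop \<cdot> (tg \<gamma> \<cdot> adjY xop)) \<cdot> xop)"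
    using \<gamma> by (simp add: mult_assocY unitaries_adj_mult[OF xop_unitary])
  then show ?thesis unfolding \<eta>\<delta>(3)[OF \<gamma>] using \<eta>\<delta>(1)[OF \<gamma>] by (simp add: op_mult_scale)
qed

lemma Theta_formula:
  assumes a: "a \<in> Linf \<Gamma> X" and \<gamma>: "\<gamma> \<in> carrier \<Gamma>"
  shows "\<Theta> (a \<cdot>\<^sub>X ug \<gamma>) = op_scale Y.N (\<eta> \<gamma>) (\<Theta> a \<cdot> (adjY xop \<cdot> (vg (\<delta> \<gamma>) \<cdot> xop)))"
proof -
  have "a \<in> CX" using a by (auto simp: X.Linf_eq)
  then show ?thesis using \<gamma> tg_eq[OF \<gamma>] \<eta>\<delta>(1)[OF \<gamma>] by (simp add: Theta_mult tg_def op_mult_scale)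
qed

text \<open>Multiplicativity holds for the operators
  \<open>xop \<cdot> (tg \<gamma> \<cdot> adjY xop)\<close>. A nonzero multiple of a group unitary
  determines both the scalar and the group element, so it splits into the two homomorphism
  laws.\<close>

lemma \<eta>\<delta>_mult:
  assumes g: "\<gamma> \<in> carrier \<Gamma>" "\<gamma>' \<in> carrier \<Gamma>"
  shows "\<delta> (\<gamma> \<otimes>\<^bsub>\<Gamma>\<^esub> \<gamma>') = \<delta> \<gamma> \<otimes>\<^bsub>\<Lambda>\<^esub> \<delta> \<gamma>' \<and> \<eta> (\<gamma> \<otimes>\<^bsub>\<Gamma>\<^esub> \<gamma>') = \<eta> \<gamma> * \<eta> \<gamma>'"
proof (rule Y.scale_group_unitary_inj)
  have gg: "\<gamma> \<otimes>\<^bsub>\<Gamma>\<^esub> \<gamma>' \<in> carrier \<Gamma>" using g by simp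
  show "\<delta> (\<gamma> \<otimes>\<^bsub>\<Gamma>\<^esub> \<gamma>') \<in> carrier \<Lambda>" "\<delta> \<gamma> \<otimes>\<^bsub>\<Lambda>\<^esub> \<delta> \<gamma>' \<in> carrier \<Lambda>" "\<eta> (\<gamma> \<otimes>\<^bsub>\<Gamma>\<^esub> \<gamma>') \<noteq> 0"
    using \<eta>\<delta>[OF gg] \<eta>\<delta>[OF g(1)] \<eta>\<delta>[OF g(2)] by auto
  have "tg (\<gamma> \<otimes>\<^bsub>\<Gamma>\<^esub> \<gamma>') = tg \<gamma> \<cdot> tg \<gamma>'"
    unfolding tg_def using g by (simp add: Theta_mult[symmetric] X.group_unitary_mult)
  then have "op_scale Y.N (\<eta> (\<gamma> \<otimes>\<^bsub>\<Gamma>\<^esub> \<gamma>')) (vg (\<delta> (\<gamma> \<otimes>\<^bsub>\<Gamma>\<^esub> \<gamma>'))) = xop \<cdot> (tg \<gamma> \<cdot> tg \<gamma>' \<cdot> adjY xop)"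
    using \<eta>\<delta>(3)[OF gg] by simp
  also have "\<dots> = (xop \<cdot> (tg \<gamma> \<cdot> adjY xop)) \<cdot> (xop \<cdot> (tg \<gamma>' \<cdot> adjY xop))"
    using g by (simp add: mult_assocY)
  also have "\<dots> = op_scale Y.N (\<eta> \<gamma> * \<eta> \<gamma>') (vg (\<delta> \<gamma> \<otimes>\<^bsub>\<Lambda>\<^esub> \<delta> \<gamma>'))"
    unfolding \<eta>\<delta>(3)[OF g(1)] \<eta>\<delta>(3)[OF g(2)] using \<eta>\<delta>(1)[OF g(1)] \<eta>\<delta>(1)[OF g(2)]
    by (simp add: op_mult_scale op_scale_scale Y.group_unitary_mult mult.commute)
  finally show "op_scale Y.N (\<eta> (\<gamma> \<otimes>\<^bsub>\<Gamma>\<^esub> \<gamma>')) (vg (\<delta> (\<gamma> \<otimes>\<^bsub>\<Gamma>\<^esub> \<gamma>'))) = op_scale Y.N (\<eta> \<gamma> * \<eta> \<gamma>') (vg (\<delta> \<gamma> \<otimes>\<^bsub>\<Lambda>\<^esub> \<delta> \<gamma>'))" .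
qed

lemma \<eta>_hom: "\<eta> \<in> hom \<Gamma> circle_group"
  using \<eta>\<delta>(2) \<eta>\<delta>_mult by (auto simp: hom_def circle_group_def)

text \<open>Equal values of \<open>\<delta>\<close> make the two \<open>tg\<close> proportional,
  hence also the two \<open>ug\<close> by injectivity of \<Theta>; kernels of different group
  unitaries have disjoint supports.\<close>

lemma \<delta>_inj: "inj_on \<delta> (carrier \<Gamma>)"
proof (rule inj_onI)
  fix \<gamma> \<gamma>' assume g: "\<gamma> \<in> carrier \<Gamma>" "\<gamma>' \<in> carrier \<Gamma>" "\<delta> \<gamma> = \<delta> \<gamma>'"
  have ne: "\<eta> \<gamma> \<noteq> 0" "\<eta> \<gamma>' \<noteq> 0" using \<eta>\<delta>(2)[OF g(1)] \<eta>\<delta>(2)[OF g(2)] by auto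
  have "tg \<gamma> = op_scale Y.N (\<eta> \<gamma> / \<eta> \<gamma>') (tg \<gamma>')"
    using tg_eq[OF g(1)] tg_eq[OF g(2)] g(3) ne \<eta>\<delta>(1)[OF g(2)] by (simp add: op_scale_scale)
  then have "\<Theta> (op_scale X.N 1 (ug \<gamma>)) = \<Theta> (op_scale X.N (\<eta> \<gamma> / \<eta> \<gamma>') (ug \<gamma>'))"
    using g by (simp add: tg_def Theta_scale X.crossed_product_bounded)
  then have "op_scale X.N 1 (ug \<gamma>) = op_scale X.N (\<eta> \<gamma> / \<eta> \<gamma>') (ug \<gamma>')"
    by (rule Theta_inj[rotated 2]) (use g in auto)
  then show "\<gamma> = \<gamma>'" using X.scale_group_unitary_inj[OF g(1,2), of 1] by simp
qed

text \<open>The preimage \<open>S\<close> of \<open>?S'\<close> normalises the functions on X, hence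
  is monomial. If \<mu> is missed by \<open>\<delta>\<close>, each piece of \<open>S\<close>,
  carried to Y and conjugated by \<open>xop\<close>, equates a function times
  \<open>vg \<mu>\<close> with a function times some \<open>vg (\<delta> \<gamma>)\<close>. The
  supports differ, so every piece vanishes, which a monomial kernel does not permit.\<close>

lemma \<delta>_surj:
  assumes \<mu>: "\<mu> \<in> carrier \<Lambda>" shows "\<mu> \<in> \<delta> ` carrier \<Gamma>"
proof (rule ccontr)
  assume not: "\<mu> \<notin> \<delta> ` carrier \<Gamma>"
  let ?S' = "adjY xop \<cdot> (vg \<mu> \<cdot> xop)"
  have S': "Y.normalizes ?S'"
    by (intro Y.normalizes_mult xop_normalizes adj_xop_normalizes Y.group_unitary_normalizes \<mu>)
  have "?S' \<in> CY" using \<mu> by simp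
  then obtain S where S: "S \<in> CX" "\<Theta> S = ?S'" using Theta_surj by blast
  have "X.normalizes S" using Theta_normalizes[OF S(1)] S' S(2) by simp
  then have mono: "X.monomial (X.kern S)" by (rule X.normalizes_monomial[OF free_X])
  have "AE x in X. \<forall>\<gamma>\<in>carrier \<Gamma>. X.kern S (x, \<gamma>) = 0"
    unfolding AE_ball_countable[OF X.countable_carrier]
  proof
    fix \<gamma> assume \<gamma>: "\<gamma> \<in> carrier \<Gamma>"
    obtain p s where p: "X.bdd p" "X.bdd s" "\<And>x. p x = (if X.kern S (x, \<gamma>) \<noteq> 0 then 1 else 0)"
      "mX p \<cdot>\<^sub>X S = mX s \<cdot>\<^sub>X ug \<gamma>" using X.monomial_cut[OF S(1) mono \<gamma>] by metis
    obtain p' where p': "Y.bdd p'" "\<Theta> (mX p) = mY p'" using Theta_mX[OF p(1)] by blast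
    obtain s' where s': "Y.bdd s'" "\<Theta> (mX s) = mY s'" using Theta_mX[OF p(2)] by blast
    obtain p'' where p'': "Y.bdd p''" "xop \<cdot> mY p' = mY p'' \<cdot> xop" using xop_normalizes p'(1) unfolding Y.normalizes_def by blast
    obtain s'' where s'': "Y.bdd s''" "xop \<cdot> mY s' = mY s'' \<cdot> xop" using xop_normalizes s'(1) unfolding Y.normalizes_def by blast
    have "mY p' \<cdot> ?S' = \<Theta> (mX p \<cdot>\<^sub>X S)" using S p(1) p' by (simp add: Theta_mult)
    also have "\<dots> = mY s' \<cdot> tg \<gamma>" unfolding p(4) using p(2) s' \<gamma> by (simp add: Theta_mult tg_def)
    finally have "xop \<cdot> (mY p' \<cdot> ?S' \<cdot> adjY xop) = xop \<cdot> (mY s' \<cdot> tg \<gamma> \<cdot> adjY xop)" by simp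
    moreover have "xop \<cdot> (mY p' \<cdot> ?S' \<cdot> adjY xop) = mY p'' \<cdot> vg \<mu>"
    proof -
      have "xop \<cdot> (mY p' \<cdot> ?S' \<cdot> adjY xop) = xop \<cdot> mY p' \<cdot> (?S' \<cdot> adjY xop)" using p' \<mu> by (simp add: mult_assocY)
      also have "\<dots> = mY p'' \<cdot> (xop \<cdot> (?S' \<cdot> adjY xop))" unfolding p''(2) using p'' \<mu> by (simp add: mult_assocY)
      also have "xop \<cdot> (?S' \<cdot> adjY xop) = vg \<mu>" using \<mu> by (simp add: mult_assocY unitaries_mult_adj[OF xop_unitary])
      finally show ?thesis .
    qed
    moreover have "xop \<cdot> (mY s' \<cdot> tg \<gamma> \<cdot> adjY xop) = mY s'' \<cdot> op_scale Y.N (\<eta> \<gamma>) (vg (\<delta> \<gamma>))"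
    proof -
      have "xop \<cdot> (mY s' \<cdot> tg \<gamma> \<cdot> adjY xop) = xop \<cdot> mY s' \<cdot> (tg \<gamma> \<cdot> adjY xop)" using s' \<gamma> by (simp add: mult_assocY)
      also have "\<dots> = mY s'' \<cdot> (xop \<cdot> (tg \<gamma> \<cdot> adjY xop))" unfolding s''(2) using s'' \<gamma> by (simp add: mult_assocY)
      finally show ?thesis unfolding \<eta>\<delta>(3)[OF \<gamma>] .
    qed
    ultimately have eq: "mY p'' \<cdot> vg \<mu> = mY s'' \<cdot> op_scale Y.N (\<eta> \<gamma>) (vg (\<delta> \<gamma>))" by simp
    have d: "\<delta> \<gamma> \<in> carrier \<Lambda>" "\<delta> \<gamma> \<noteq> \<mu>" using \<eta>\<delta>(1)[OF \<gamma>] not \<gamma> by auto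
    have "AE z in Y. p'' z = 0"
      using Y.kern_mult_op_left[OF p''(1) vg_mem[OF \<mu>]] Y.kern_mult_op_left[OF s''(1) Y.crossed_product_scale[OF vg_mem[OF d(1)]], of "\<eta> \<gamma>"]
        Y.kern_group_unitary[OF \<mu>, unfolded Y.AE_N_iff] Y.kern_scale_group_unitary[OF d(1), of "\<eta> \<gamma>"]
      unfolding eq by eventually_elim (use \<mu> d in \<open>auto simp: Y.delta_def\<close>)
    then have "mY p'' = mY (\<lambda>z. 0)" by (rule Y.mult_op_cong)
    then have "xop \<cdot> mY p' = op_scale Y.N 0 xop" unfolding p''(2) by (simp add: Y.mult_op_const op_mult_scale)
    then have "adjY xop \<cdot> (xop \<cdot> mY p') = adjY xop \<cdot> op_scale Y.N 0 xop" by simp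
    then have "mY p' = mY (\<lambda>z. 0)" using p' by (simp add: op_mult_scale unitaries_adj_mult[OF xop_unitary] Y.mult_op_const)
    then have "\<Theta> (mX p) = \<Theta> (mX (\<lambda>x. 0))" using p' by (simp add: X.mult_op_const Y.mult_op_const Theta_scale)
    then have "mX p = mX (\<lambda>x. 0)" by (rule Theta_inj[rotated 2]) (use p in auto)
    then have "AE x in X. p x = 0" using X.mult_op_eq_iff[OF p(1) X.bdd_const[of 0]] by simp
    then show "AE x in X. X.kern S (x, \<gamma>) = 0" by eventually_elim (auto simp: p(3) split: if_splits)
  qed
  then have "AE x in X. False" using mono[unfolded X.monomial_def]
    by eventually_elim (metis norm_zero zero_neq_one)
  then show False by (simp add: X.AE_Y_const)
qed

lemma \<delta>_iso: "\<delta> \<in> iso \<Gamma> \<Lambda>"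
proof (rule isoI)
  show "\<delta> \<in> hom \<Gamma> \<Lambda>" using \<eta>\<delta>(1) \<eta>\<delta>_mult by (auto simp: hom_def)
  show "bij_betw \<delta> (carrier \<Gamma>) (carrier \<Lambda>)"
    using \<delta>_inj \<delta>_surj \<eta>\<delta>(1) by (auto simp: bij_betw_def)
qed

section \<open>The induced isomorphism of the function algebras\<close>

definition alpha :: "('x \<times> 'g) l2op \<Rightarrow> ('y \<times> 'h) l2op" where
  "alpha S = xop \<cdot> (\<Theta> S \<cdot> adjY xop)"

lemma alpha_mX: "X.bdd a \<Longrightarrow> \<exists>b. Y.bdd b \<and> alpha (mX a) = mY b"
proof -
  assume "X.bdd a"
  then obtain b where b: "Y.bdd b" "\<Theta> (mX a) = mY b" using Theta_mX by blast
  then show ?thesis using Y.monomial_normalizes[OF xop_unitary xop_monomial b(1)] by (simp add: alpha_def op_conj_def)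
qed

lemma mY_alpha: assumes "Y.bdd b" shows "\<exists>a. X.bdd a \<and> alpha (mX a) = mY b"
proof -
  obtain b' where b': "Y.bdd b'" "op_conj Y.N (adjY xop) (mY b) = mY b'"
    using Y.monomial_normalizes[OF Y.unitaries_adj[OF xop_unitary] adj_xop_monomial assms] by blast
  obtain a where a: "X.bdd a" "\<Theta> (mX a) = mY b'" using mY_Theta[OF b'(1)] by blast
  have "alpha (mX a) = mY b"
    unfolding alpha_def a(2) b'(2)[symmetric] op_conj_def using assms
    by (simp add: mult_assocY unitaries_mult_adj[OF xop_unitary])
  with a show ?thesis by blast
qed

lemma alpha_mult: "S \<in> CX \<Longrightarrow> S' \<in> CX \<Longrightarrow> alpha (S \<cdot>\<^sub>X S') = alpha S \<cdot> alpha S'"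
  by (simp add: alpha_def Theta_mult mult_assocY)

lemma alpha_inj: "S \<in> CX \<Longrightarrow> S' \<in> CX \<Longrightarrow> alpha S = alpha S' \<Longrightarrow> S = S'"
proof -
  assume S: "S \<in> CX" "S' \<in> CX" "alpha S = alpha S'"
  have "\<Theta> R = adjY xop \<cdot> (alpha R \<cdot> xop)" if "R \<in> CX" for R
    unfolding alpha_def using that by (simp add: mult_assocY unitaries_adj_mult[OF xop_unitary])
  then have "\<Theta> S = \<Theta> S'" using S by metis
  then show ?thesis using Theta_inj S by blast
qed

lemma alpha_const: "alpha (mX (\<lambda>x. w)) = mY (\<lambda>z. w)"
  unfolding alpha_def X.mult_op_const Y.mult_op_const
  by (simp add: Theta_scale op_mult_scale unitaries_mult_adj[OF xop_unitary])

text \<open>\<open>alpha\<close> sends \<open>ug \<gamma>\<close> to a multiple of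
  \<open>vg (\<delta> \<gamma>)\<close>, and the actions on functions are implemented by these
  unitaries. The scalar \<open>\<eta> \<gamma>\<close> appears on both sides and cancels.\<close>

lemma alpha_equivariant:
  assumes \<gamma>: "\<gamma> \<in> carrier \<Gamma>" and a: "X.bdd a" and b: "Y.bdd b" "alpha (mX a) = mY b"
  shows "alpha (mX (\<lambda>x. a (\<phi> (inv\<^bsub>\<Gamma>\<^esub> \<gamma>) x))) = mY (\<lambda>z. b (\<psi> (inv\<^bsub>\<Lambda>\<^esub> (\<delta> \<gamma>)) z))"
proof -
  have a': "X.bdd (\<lambda>x. a (\<phi> (inv\<^bsub>\<Gamma>\<^esub> \<gamma>) x))" by (rule X.bdd_act[OF a]) (use \<gamma> in simp)
  have b': "Y.bdd (\<lambda>z. b (\<psi> (inv\<^bsub>\<Lambda>\<^esub> (\<delta> \<gamma>)) z))" by (rule Y.bdd_act[OF b(1)]) (use \<eta>\<delta>(1)[OF \<gamma>] in simp)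
  note d = \<eta>\<delta>(1)[OF \<gamma>]
  have ne: "\<eta> \<gamma> \<noteq> 0" using \<eta>\<delta>(2)[OF \<gamma>] by auto
  have au: "alpha (ug \<gamma>) = op_scale Y.N (\<eta> \<gamma>) (vg (\<delta> \<gamma>))"
    using \<eta>\<delta>(3)[OF \<gamma>] by (simp add: alpha_def tg_def)
  have "alpha (mX (\<lambda>x. a (\<phi> (inv\<^bsub>\<Gamma>\<^esub> \<gamma>) x))) \<cdot> alpha (ug \<gamma>) = alpha (ug \<gamma> \<cdot>\<^sub>X mX a)"
    using \<gamma> a a' by (simp add: alpha_mult[symmetric] X.group_unitary_mult_op)
  also have "\<dots> = alpha (ug \<gamma>) \<cdot> mY b" using \<gamma> a b by (simp add: alpha_mult)
  also have "\<dots> = op_scale Y.N (\<eta> \<gamma>) (mY (\<lambda>z. b (\<psi> (inv\<^bsub>\<Lambda>\<^esub> (\<delta> \<gamma>)) z)) \<cdot> vg (\<delta> \<gamma>))"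
    unfolding au using d b(1) b' by (simp add: op_mult_scale Y.group_unitary_mult_op)
  finally have "op_scale Y.N (\<eta> \<gamma>) (alpha (mX (\<lambda>x. a (\<phi> (inv\<^bsub>\<Gamma>\<^esub> \<gamma>) x))) \<cdot> vg (\<delta> \<gamma>)) 
      = op_scale Y.N (\<eta> \<gamma>) (mY (\<lambda>z. b (\<psi> (inv\<^bsub>\<Lambda>\<^esub> (\<delta> \<gamma>)) z)) \<cdot> vg (\<delta> \<gamma>))"
    unfolding au using d a' by (simp add: op_mult_scale alpha_def)
  then have "op_scale Y.N (inverse (\<eta> \<gamma>)) (op_scale Y.N (\<eta> \<gamma>) (alpha (mX (\<lambda>x. a (\<phi> (inv\<^bsub>\<Gamma>\<^esub> \<gamma>) x))) \<cdot> vg (\<delta> \<gamma>)))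
      = op_scale Y.N (inverse (\<eta> \<gamma>)) (op_scale Y.N (\<eta> \<gamma>) (mY (\<lambda>z. b (\<psi> (inv\<^bsub>\<Lambda>\<^esub> (\<delta> \<gamma>)) z)) \<cdot> vg (\<delta> \<gamma>)))" by simp
  then have "alpha (mX (\<lambda>x. a (\<phi> (inv\<^bsub>\<Gamma>\<^esub> \<gamma>) x))) \<cdot> vg (\<delta> \<gamma>) = mY (\<lambda>z. b (\<psi> (inv\<^bsub>\<Lambda>\<^esub> (\<delta> \<gamma>)) z)) \<cdot> vg (\<delta> \<gamma>)"
    using d a' b' ne by (simp add: op_scale_scale alpha_def)
  then have "alpha (mX (\<lambda>x. a (\<phi> (inv\<^bsub>\<Gamma>\<^esub> \<gamma>) x))) \<cdot> (vg (\<delta> \<gamma>) \<cdot> vg (inv\<^bsub>\<Lambda>\<^esub> (\<delta> \<gamma>))) = mY (\<lambda>z. b (\<psi> (inv\<^bsub>\<Lambda>\<^esub> (\<delta> \<gamma>)) z)) \<cdot> (vg (\<delta> \<gamma>) \<cdot> vg (inv\<^bsub>\<Lambda>\<^esub> (\<delta> \<gamma>)))"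
    using d a' b' by (simp add: mult_assocY[symmetric] alpha_def)
  then show ?thesis using d a' b' by (simp add: Y.group_unitary_mult Y.group_unitary_one alpha_def)
qed

end

section \<open>Point realisation\<close>

text \<open>A sigma-homomorphism of measure algebras given by a choice of representing sets, so the
  Boolean identities hold only up to null sets of \<open>Y\<close>.\<close>

locale sigma_hom =
  fixes X :: "'x measure" and Y :: "'y measure" and F :: "'x set \<Rightarrow> 'y set"
  assumes standard: "standard_prob_space X"
    and F_sets: "A \<in> sets X \<Longrightarrow> F A \<in> sets Y"
    and F_Compl: "A \<in> sets X \<Longrightarrow> AE y in Y. y \<in> F (space X - A) \<longleftrightarrow> y \<notin> F A"
    and F_UN: "\<And>A :: nat \<Rightarrow> 'x set. range A \<subseteq> sets X \<Longrightarrow> AE y in Y. y \<in> F (\<Union>n. A n) \<longleftrightarrow> (\<exists>n. y \<in> F (A n))"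
begin

lemma F_mono:
  assumes "A \<in> sets X" "B \<in> sets X" "A \<subseteq> B" shows "AE y in Y. y \<in> F A \<longrightarrow> y \<in> F B"
proof -
  \<comment> \<open>Monotonicity is obtained from the axiom on countable unions, applied to the
    sequence A, B, B, and so on.\<close>
  let ?A = "\<lambda>n::nat. if n = 0 then A else B"
  have "(\<Union>n. ?A n) = B"
  proof (rule equalityI)
    have "B = ?A 1" by simp
    then show "B \<subseteq> (\<Union>n. ?A n)" by blast
  qed (use assms in \<open>auto split: if_splits\<close>)
  moreover have "AE y in Y. y \<in> F (\<Union>n. ?A n) \<longleftrightarrow> (\<exists>n. y \<in> F (?A n))"
    by (rule F_UN) (use assms in auto)
  ultimately have "AE y in Y. y \<in> F B \<longleftrightarrow> (\<exists>n. y \<in> F (?A n))" by simp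
  then show ?thesis
  proof eventually_elim
    fix y assume *: "y \<in> F B \<longleftrightarrow> (\<exists>n. y \<in> F (?A n))"
    show "y \<in> F A \<longrightarrow> y \<in> F B" unfolding * by (intro impI exI[of _ 0]) simp
  qed
qed

lemma F_disjoint:
  assumes "A \<in> sets X" "B \<in> sets X" "A \<inter> B = {}" shows "AE y in Y. \<not> (y \<in> F A \<and> y \<in> F B)"
proof -
  have "AE y in Y. y \<in> F A \<longrightarrow> y \<in> F (space X - B)"
    by (rule F_mono) (use assms sets.sets_into_space in auto)
  with F_Compl[OF assms(2)] show ?thesis by eventually_elim auto
qed

lemma F_space: "AE y in Y. y \<in> F (space X)"
proof -
  have "AE y in Y. y \<in> F {} \<longrightarrow> y \<in> F (space X)" by (rule F_mono) auto
  with F_Compl[OF sets.empty_sets] show ?thesis by eventually_elim auto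
qed

lemma F_empty: "AE y in Y. y \<notin> F {}"
  using F_Compl[OF sets.top] F_space by auto

lemma F_countable_UN:
  assumes "countable I" "\<And>i. i \<in> I \<Longrightarrow> A i \<in> sets X"
  shows "AE y in Y. y \<in> F (\<Union>i\<in>I. A i) \<longleftrightarrow> (\<exists>i\<in>I. y \<in> F (A i))"
proof (cases "I = {}")
  case False
  then have r: "range (from_nat_into I) = I" using assms by (intro range_from_nat_into) auto
  have "AE y in Y. y \<in> F (\<Union>n. A (from_nat_into I n)) \<longleftrightarrow> (\<exists>n. y \<in> F (A (from_nat_into I n)))"
    by (rule F_UN) (use assms r in auto)
  moreover have "(\<Union>n. A (from_nat_into I n)) = (\<Union>i\<in>I. A i)" using r by (metis image_image)
  moreover have "(\<exists>n. y \<in> F (A (from_nat_into I n))) \<longleftrightarrow> (\<exists>i\<in>I. y \<in> F (A i))" for y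
    using r by (metis imageE rangeI)
  ultimately show ?thesis by simp
qed (use F_empty in simp)

text \<open>Cover \<open>X\<close> by balls of radius \<open>2\<^sup>-\<^sup>n\<close> around a dense sequence and let \<open>k n y\<close> be the index of
  the first such ball whose image contains \<open>y\<close>.  The corresponding centres form a Cauchy
  sequence for almost every \<open>y\<close>, and \<open>\<theta> y\<close> is its limit.\<close>

theorem point_realisation:
  "\<exists>\<theta>\<in>Y \<rightarrow>\<^sub>M X. \<forall>A\<in>sets X. AE y in Y. \<theta> y \<in> A \<longleftrightarrow> y \<in> F A"
proof -
  from standard obtain T where T: "completely_metrizable_space T" "second_countable T" "topspace T = space X"
    "sets X = sigma_sets (space X) {U. openin T U}" and "prob_space X"
    by (auto simp: standard_prob_space_def)
  from this(5) have "space X \<noteq> {}" by (rule prob_space.not_empty)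
  obtain M d where Md: "Metric_space M d" "Metric_space.mcomplete M d" "T = Metric_space.mtopology M d"
    using T(1) by (auto simp: completely_metrizable_space_def)
  interpret Metric_space M d by fact
  note complete = Md(2) and Teq = Md(3)
  have M: "M = space X" using T(3) Teq by simp
  obtain D where D: "countable D" "D \<subseteq> M" "mtopology closure_of D = M"
    using second_countable_imp_separable_space[OF T(2)] Teq by (auto simp: separable_space_def)
  have "D \<noteq> {}" using D(3) \<open>space X \<noteq> {}\<close> M by auto
  define c where "c = from_nat_into D"
  have c: "range c = D" unfolding c_def using D \<open>D \<noteq> {}\<close> by (intro range_from_nat_into) auto
  have cM [simp]: "c k \<in> M" for k using c D by auto
  have dense: "\<exists>k. d (c k) p < r" if p: "p \<in> M" "0 < r" for p r
  proof -
    have "p \<in> mtopology closure_of D" using p D by simp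
    then obtain y where "y \<in> D" "y \<in> mball p r" using p unfolding metric_closure_of by blast
    then show ?thesis using c by (metis commute in_mball rangeE)
  qed
  have open_sets: "U \<in> sets X" if "openin mtopology U" for U
    unfolding T(4) using that Teq by (auto intro: sigma_sets.Basic)
  define e :: "nat \<Rightarrow> real" where "e n = (1/2) ^ n" for n
  have e0: "0 < e n" for n by (simp add: e_def)
  have e_small: "\<exists>n. C * e n < r" if "0 < r" "0 < C" for r C :: real
  proof -
    have "0 < r / C" using that by simp
    from real_arch_pow_inv[OF this, of "1/2"] show ?thesis using that by (auto simp: e_def field_simps)
  qed
  have e_mono: "n \<le> m \<Longrightarrow> e m \<le> e n" for n m by (simp add: e_def power_decreasing)
  define B where "B n k = mball (c k) (e n)" for n k
  have B [measurable]: "B n k \<in> sets X" for n k unfolding B_def by (intro open_sets openin_mball)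
  have [measurable]: "F (B n k) \<in> sets Y" for n k by (rule F_sets[OF B])
  have inter: "d (c k) (c l) < e n + e m" if "B n k \<inter> B m l \<noteq> {}" for n k m l
  proof -
    from that obtain p where "p \<in> M" "d (c k) p < e n" "d (c l) p < e m" by (auto simp: B_def)
    then show ?thesis using triangle[of "c k" p "c l"] commute[of p "c l"] by simp
  qed
  \<comment> \<open>Each relation between images of balls holds off its own null set; on
    \<open>G\<close> all countably many hold at once. Outside \<open>G\<close> the map is
    constant.\<close>
  define G where "G = {y\<in>space Y. (\<forall>n. \<exists>k. y \<in> F (B n k)) \<and>
    (\<forall>n k m l. B n k \<inter> B m l = {} \<longrightarrow> \<not> (y \<in> F (B n k) \<and> y \<in> F (B m l)))}"
  have G [measurable]: "G \<in> sets Y" unfolding G_def by measurable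
  have AE_G: "AE y in Y. y \<in> G"
  proof -
    have "AE y in Y. \<exists>k. y \<in> F (B n k)" for n
    proof -
      have "(\<Union>k. B n k) = space X"
        using dense[OF _ e0] sets.sets_into_space[OF B] by (fastforce simp: B_def M[symmetric])
      with F_UN[of "B n", OF image_subsetI[OF B]] have "AE y in Y. y \<in> F (space X) \<longleftrightarrow> (\<exists>k. y \<in> F (B n k))" by simp
      with F_space show ?thesis by eventually_elim auto
    qed
    moreover have "AE y in Y. B n k \<inter> B m l = {} \<longrightarrow> \<not> (y \<in> F (B n k) \<and> y \<in> F (B m l))" for n k m l
      using F_disjoint[OF B[of n k] B[of m l]] by (cases "B n k \<inter> B m l = {}") auto
    ultimately show ?thesis unfolding G_def by (simp add: AE_all_countable)
  qed
  define k where "k n y = (LEAST k. y \<in> F (B n k))" for n y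
  have k [measurable]: "k n \<in> Y \<rightarrow>\<^sub>M count_space UNIV" for n unfolding k_def by measurable
  have Fk: "y \<in> F (B n (k n y))" if "y \<in> G" for n y
    unfolding k_def by (rule LeastI_ex) (use that in \<open>auto simp: G_def\<close>)
  \<comment> \<open>On \<open>G\<close>, images of disjoint balls do not share a point, so two balls
    whose images contain y must meet and their centres are close. This yields both the Cauchy
    property and the distance to the limit.\<close>
  have dk: "d (c i) (c (k n y)) < e m + e n" if "y \<in> G" "y \<in> F (B m i)" for n m y i
  proof (rule inter)
    show "B m i \<inter> B n (k n y) \<noteq> {}" using Fk[OF that(1), of n] that unfolding G_def by blast
  qed
  have lim: "\<exists>p. limitin mtopology (\<lambda>n. c (k n y)) p sequentially" if y: "y \<in> G" for y
  proof -
    have "MCauchy (\<lambda>n. c (k n y))" unfolding MCauchy_def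
    proof (intro conjI allI impI)
      fix r :: real assume "0 < r"
      then obtain n where n: "2 * e n < r" using e_small[of r 2] by auto
      have "d (c (k m y)) (c (k m' y)) < r" if "n \<le> m" "n \<le> m'" for m m'
        using dk[OF y Fk[OF y, of m], of m'] e_mono[OF that(1)] e_mono[OF that(2)] n by linarith
      then show "\<exists>n. \<forall>m m'. n \<le> m \<longrightarrow> n \<le> m' \<longrightarrow> d (c (k m y)) (c (k m' y)) < r" by blast
    qed auto
    then show ?thesis using complete unfolding mcomplete_def by blast
  qed
  define \<theta> where "\<theta> y = (if y \<in> G then SOME p. limitin mtopology (\<lambda>n. c (k n y)) p sequentially else c 0)" for y
  have \<theta>: "limitin mtopology (\<lambda>n. c (k n y)) (\<theta> y) sequentially" if "y \<in> G" for y
    using someI_ex[OF lim[OF that]] that by (simp add: \<theta>_def)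
  have \<theta>0: "\<theta> y = c 0" if "y \<notin> G" for y using that by (simp add: \<theta>_def)
  have \<theta>M [simp]: "\<theta> y \<in> M" for y
    using limitin_mspace[OF \<theta>[of y]] by (cases "y \<in> G") (auto simp: \<theta>_def)
  have d_\<theta>: "d (c i) (\<theta> y) \<le> e m" if y: "y \<in> G" "y \<in> F (B m i)" for y m i
  proof (rule field_le_epsilon)
    fix r :: real assume r: "0 < r"
    obtain n where n: "2 * e n < r" using e_small[OF r, of 2] by auto
    have "eventually (\<lambda>j. c (k j y) \<in> M \<and> d (c (k j y)) (\<theta> y) < e n) sequentially"
      using \<theta>[OF y(1)] e0 unfolding limitin_metric by blast
    then obtain j where j: "n \<le> j" "d (c (k j y)) (\<theta> y) < e n"
      using eventually_happens'[OF sequentially_bot eventually_conj[OF eventually_ge_at_top[of n]]] by blast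
    have "d (c i) (\<theta> y) \<le> d (c i) (c (k j y)) + d (c (k j y)) (\<theta> y)" by (rule triangle) auto
    then show "d (c i) (\<theta> y) \<le> e m + r" using dk[OF y, of j] e_mono[OF j(1)] j(2) n by linarith
  qed
  \<comment> \<open>The limit is known only to lie within the closed radius \<open>e m\<close> of a
    centre, so balls are doubled to contain it. Radius 2 e m plus a distance e m explains the factor
    3.\<close>
  have ball: "mball (c i) (2 * e m) \<subseteq> mball p r" if "p \<in> M" "d (c i) p \<le> e m" "3 * e m < r" for p m i r
  proof
    fix q assume "q \<in> mball (c i) (2 * e m)"
    then show "q \<in> mball p r" using that triangle[of p "c i" q] commute[of p "c i"] by simp
  qed
  \<comment> \<open>Membership in an open set is expressed through the discrete functions
    \<open>k n\<close>, which makes \<theta> measurable without a limit theorem for metric-valued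
    maps.\<close>
  have open_iff: "\<theta> y \<in> U \<longleftrightarrow> (\<exists>n. mball (c (k n y)) (2 * e n) \<subseteq> U)" if U: "openin mtopology U" and y: "y \<in> G" for U y
  proof
    assume "\<theta> y \<in> U"
    then obtain r where r: "0 < r" "mball (\<theta> y) r \<subseteq> U" using U unfolding openin_mtopology by blast
    obtain n where n: "3 * e n < r" using e_small[OF r(1), of 3] by auto
    from ball[OF \<theta>M d_\<theta>[OF y Fk[OF y]] n] r(2) show "\<exists>n. mball (c (k n y)) (2 * e n) \<subseteq> U" by blast
  next
    assume "\<exists>n. mball (c (k n y)) (2 * e n) \<subseteq> U"
    then obtain n where n: "mball (c (k n y)) (2 * e n) \<subseteq> U" ..
    have "\<theta> y \<in> mball (c (k n y)) (2 * e n)" using d_\<theta>[OF y Fk[OF y, of n]] e0[of n] by simp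
    with n show "\<theta> y \<in> U" by blast
  qed
  have [measurable]: "\<theta> \<in> Y \<rightarrow>\<^sub>M X"
  proof (rule measurable_sigma_sets[OF T(4)])
    fix U assume "U \<in> {U. openin T U}"
    then have U: "openin mtopology U" using Teq by simp
    have "\<theta> y \<in> U \<longleftrightarrow> (y \<in> G \<and> (\<exists>n. k n y \<in> {i. mball (c i) (2 * e n) \<subseteq> U})) \<or> (y \<notin> G \<and> c 0 \<in> U)" for y
      using open_iff[OF U, of y] \<theta>0[of y] by (cases "y \<in> G") simp_all
    then have "\<theta> -` U \<inter> space Y = (G \<inter> (\<Union>n. k n -` {i. mball (c i) (2 * e n) \<subseteq> U} \<inter> space Y)) \<union>
        (if c 0 \<in> U then space Y - G else {})"
      by auto
    also have "\<dots> \<in> sets Y"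
      by (intro sets.Un sets.Int G sets.countable_UN image_subsetI measurable_sets[OF k]) auto
    finally show "\<theta> -` U \<inter> space Y \<in> sets Y" .
  next
    show "{U. openin T U} \<subseteq> Pow (space X)" using openin_subset[of T] T(3) by blast
    show "\<theta> \<in> space Y \<rightarrow> space X" using \<theta>M unfolding M by blast
  qed
  have "AE y in Y. \<theta> y \<in> A \<longleftrightarrow> y \<in> F A" if "A \<in> sigma_sets (space X) {U. openin T U}" for A
    using that
  proof induction
    case (Basic U)
    then have U: "openin mtopology U" using Teq by simp
    have [measurable]: "U \<in> sets X" by (rule open_sets[OF U])
    \<comment> \<open>Balls whose doubles still lie in U. They exhaust U, and a point whose
      image-membership selects such a ball has its limit inside the double, hence in U.\<close>
    let ?J = "{(n, i). mball (c i) (2 * e n) \<subseteq> U}"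
    have "U = (\<Union>p\<in>?J. B (fst p) (snd p))"
    proof (intro equalityI subsetI)
      fix q assume "q \<in> U"
      then obtain r where r: "0 < r" "mball q r \<subseteq> U" and q: "q \<in> M" using U unfolding openin_mtopology by blast
      obtain n where n: "3 * e n < r" using e_small[OF r(1), of 3] by auto
      obtain i where i: "d (c i) q < e n" using dense[OF q e0] by blast
      have "(n, i) \<in> ?J" "q \<in> B n i" using ball[OF q _ n, of i] i r(2) q by (auto simp: B_def)
      then show "q \<in> (\<Union>p\<in>?J. B (fst p) (snd p))" by force
    next
      fix q assume "q \<in> (\<Union>p\<in>?J. B (fst p) (snd p))"
      then obtain n i where ni: "mball (c i) (2 * e n) \<subseteq> U" "q \<in> B n i" by auto
      then have "q \<in> mball (c i) (2 * e n)" using e0[of n] by (auto simp: B_def)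
      with ni show "q \<in> U" by blast
    qed
    moreover have "AE y in Y. y \<in> F (\<Union>p\<in>?J. B (fst p) (snd p)) \<longleftrightarrow> (\<exists>p\<in>?J. y \<in> F (B (fst p) (snd p)))"
      by (rule F_countable_UN) auto
    ultimately have "AE y in Y. y \<in> F U \<longleftrightarrow> (\<exists>p\<in>?J. y \<in> F (B (fst p) (snd p)))" by simp
    with AE_G show ?case
    proof eventually_elim
      fix y assume y: "y \<in> G" and iff: "y \<in> F U \<longleftrightarrow> (\<exists>p\<in>?J. y \<in> F (B (fst p) (snd p)))"
      show "\<theta> y \<in> U \<longleftrightarrow> y \<in> F U" unfolding iff
      proof
        assume "\<theta> y \<in> U"
        then obtain n where "mball (c (k n y)) (2 * e n) \<subseteq> U" using open_iff[OF U y] by blast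
        then show "\<exists>p\<in>?J. y \<in> F (B (fst p) (snd p))"
          by (intro bexI[of _ "(n, k n y)"]) (auto simp: Fk[OF y])
      next
        assume "\<exists>p\<in>?J. y \<in> F (B (fst p) (snd p))"
        then obtain n i where ni: "mball (c i) (2 * e n) \<subseteq> U" "y \<in> F (B n i)" by auto
        have "\<theta> y \<in> mball (c i) (2 * e n)" using d_\<theta>[OF y ni(2)] e0[of n] by simp
        with ni(1) show "\<theta> y \<in> U" by blast
      qed
    qed
  next
    case Empty
    show ?case using F_empty by simp
  next
    case (Compl A)
    then have "A \<in> sets X" by (simp add: T(4))
    from F_Compl[OF this] Compl.IH show ?case
      by eventually_elim (use \<theta>M M in auto)
  next
    case (Union A)
    then have "range A \<subseteq> sets X" by (auto simp: T(4))
    moreover have "AE y in Y. \<forall>n. \<theta> y \<in> A n \<longleftrightarrow> y \<in> F (A n)" using Union.IH by (simp add: AE_all_countable)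
    ultimately show ?case using F_UN[of A] by (auto elim: eventually_elim2)
  qed
  then show ?thesis by (intro bexI[of _ \<theta>] ballI) (auto simp: T(4))
qed

end

text \<open>An isomorphism of measure algebras, given by the relation between representing sets.\<close>

locale bool_iso =
  fixes X :: "'x measure" and Y :: "'y measure" and R :: "'x set \<Rightarrow> 'y set \<Rightarrow> bool"
  assumes standard_X: "standard_prob_space X" and standard_Y: "standard_prob_space Y"
    and total: "A \<in> sets X \<Longrightarrow> \<exists>B\<in>sets Y. R A B" and surj: "B \<in> sets Y \<Longrightarrow> \<exists>A\<in>sets X. R A B"
    and Int: "\<lbrakk>A \<in> sets X; A' \<in> sets X; B \<in> sets Y; B' \<in> sets Y; R A B; R A' B'\<rbrakk> \<Longrightarrow> R (A \<inter> A') (B \<inter> B')"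
    and AE_iff: "\<lbrakk>A \<in> sets X; A' \<in> sets X; B \<in> sets Y; B' \<in> sets Y; R A B; R A' B'\<rbrakk> \<Longrightarrow>
      (AE x in X. x \<in> A \<longleftrightarrow> x \<in> A') \<longleftrightarrow> (AE y in Y. y \<in> B \<longleftrightarrow> y \<in> B')"
    and empty: "R {} {}"
begin

lemma null_iff:
  assumes "A \<in> sets X" "B \<in> sets Y" "R A B"
  shows "(AE x in X. x \<notin> A) \<longleftrightarrow> (AE y in Y. y \<notin> B)"
  using AE_iff[OF assms(1) sets.empty_sets assms(2) sets.empty_sets assms(3) empty] by simp

lemma subset:
  assumes s: "A \<in> sets X" "A' \<in> sets X" "B \<in> sets Y" "B' \<in> sets Y" and R: "R A B" "R A' B'"
  shows "(AE x in X. x \<in> A \<longrightarrow> x \<in> A') \<longleftrightarrow> (AE y in Y. y \<in> B \<longrightarrow> y \<in> B')"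
proof -
  have "(AE x in X. x \<in> A \<inter> A' \<longleftrightarrow> x \<in> A) \<longleftrightarrow> (AE y in Y. y \<in> B \<inter> B' \<longleftrightarrow> y \<in> B)"
    by (rule AE_iff) (use s R Int[OF s R] in auto)
  moreover have "(x \<in> A \<inter> A' \<longleftrightarrow> x \<in> A) \<longleftrightarrow> (x \<in> A \<longrightarrow> x \<in> A')" for x by auto
  moreover have "(y \<in> B \<inter> B' \<longleftrightarrow> y \<in> B) \<longleftrightarrow> (y \<in> B \<longrightarrow> y \<in> B')" for y by auto
  ultimately show ?thesis by simp
qed

lemma disjoint:
  assumes s: "A \<in> sets X" "A' \<in> sets X" "B \<in> sets Y" "B' \<in> sets Y" and R: "R A B" "R A' B'"
  shows "(AE x in X. \<not> (x \<in> A \<and> x \<in> A')) \<longleftrightarrow> (AE y in Y. \<not> (y \<in> B \<and> y \<in> B'))"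
  using null_iff[OF _ _ Int[OF s R]] s by auto

text \<open>Countable unions are suprema and hence determined by the order. A part of
  \<open>D\<close> outside all \<open>B n\<close> corresponds to a set almost contained in the union
  of the \<open>A n\<close> and almost disjoint from each of them, which is null.\<close>

lemma countable_UN:
  assumes A: "range A \<subseteq> sets X" and B: "range B \<subseteq> sets Y" "D \<in> sets Y"
    and R: "\<And>n::nat. R (A n) (B n)" "R (\<Union>n. A n) D"
  shows "AE y in Y. y \<in> D \<longleftrightarrow> (\<exists>n. y \<in> B n)"
proof -
  have An: "A n \<in> sets X" "B n \<in> sets Y" for n using A B by auto
  then have U: "(\<Union>n. A n) \<in> sets X" "(\<Union>n. B n) \<in> sets Y" by auto
  have 1: "AE y in Y. \<forall>n. y \<in> B n \<longrightarrow> y \<in> D"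
    unfolding AE_all_countable
  proof
    fix n show "AE y in Y. y \<in> B n \<longrightarrow> y \<in> D"
      using subset[OF An(1) U(1) An(2) B(2) R(1) R(2)] by (auto intro: AE_I2)
  qed
  have "D - (\<Union>n. B n) \<in> sets Y" using B U by auto
  then obtain A0 where A0: "A0 \<in> sets X" "R A0 (D - (\<Union>n. B n))" using surj by blast
  have "AE x in X. \<forall>n. \<not> (x \<in> A0 \<and> x \<in> A n)"
    unfolding AE_all_countable
  proof
    fix n show "AE x in X. \<not> (x \<in> A0 \<and> x \<in> A n)"
      using disjoint[OF A0(1) An(1) _ An(2) A0(2) R(1)] B U by auto
  qed
  moreover have "AE x in X. x \<in> A0 \<longrightarrow> x \<in> (\<Union>n. A n)"
    using subset[OF A0(1) U(1) _ B(2) A0(2) R(2)] B U by auto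
  ultimately have "AE x in X. x \<notin> A0" by eventually_elim auto
  then have "AE y in Y. y \<notin> D - (\<Union>n. B n)" using null_iff[OF A0(1) _ A0(2)] B U by auto
  with 1 show ?thesis by eventually_elim auto
qed

text \<open>What lies outside both \<open>B\<close> and \<open>B'\<close> corresponds to a set
  almost disjoint from \<open>A\<close> and from its complement, so it is null.\<close>

lemma Compl:
  assumes A: "A \<in> sets X" and B: "B \<in> sets Y" "B' \<in> sets Y" and R: "R A B" "R (space X - A) B'"
  shows "AE y in Y. y \<in> B' \<longleftrightarrow> y \<notin> B"
proof -
  have A': "space X - A \<in> sets X" using A by auto
  have 1: "AE y in Y. \<not> (y \<in> B \<and> y \<in> B')"
    using disjoint[OF A A' B R] by auto
  have "space Y - (B \<union> B') \<in> sets Y" using B by auto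
  then obtain A0 where A0: "A0 \<in> sets X" "R A0 (space Y - (B \<union> B'))" using surj by blast
  have "AE x in X. \<not> (x \<in> A0 \<and> x \<in> A)" using disjoint[OF A0(1) A _ B(1) A0(2) R(1)] B by auto
  moreover have "AE x in X. \<not> (x \<in> A0 \<and> x \<in> space X - A)" using disjoint[OF A0(1) A' _ B(2) A0(2) R(2)] B by auto
  ultimately have "AE x in X. x \<notin> A0" using AE_space by eventually_elim auto
  then have "AE y in Y. y \<notin> space Y - (B \<union> B')" using null_iff[OF A0(1) _ A0(2)] B by auto
  with 1 AE_space show ?thesis by eventually_elim auto
qed

lemma flip: "bool_iso Y X (\<lambda>B A. R A B)"
  by unfold_locales (use standard_X standard_Y total surj Int AE_iff empty in auto)

text \<open>The point map runs against the correspondence of sets: sets of X are matched with their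
  preimages in Y. A representative is chosen for each set, and \<open>AE_iff\<close> makes the
  choice immaterial.\<close>

lemma ex_map: "\<exists>\<theta>\<in>Y \<rightarrow>\<^sub>M X. \<forall>A\<in>sets X. \<forall>B\<in>sets Y. R A B \<longrightarrow> (AE y in Y. \<theta> y \<in> A \<longleftrightarrow> y \<in> B)"
proof -
  define F where "F A = (SOME B. B \<in> sets Y \<and> R A B)" for A
  have F: "F A \<in> sets Y" "R A (F A)" if "A \<in> sets X" for A
    using someI_ex[OF total[OF that, unfolded Bex_def]] by (auto simp: F_def)
  interpret F: sigma_hom X Y F
  proof
    show "standard_prob_space X" by (rule standard_X)
    show "F A \<in> sets Y" if "A \<in> sets X" for A using F that by blast
    show "AE y in Y. y \<in> F (space X - A) \<longleftrightarrow> y \<notin> F A" if A: "A \<in> sets X" for A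
      by (rule Compl[OF A]) (use F A in auto)
    show "AE y in Y. y \<in> F (\<Union>n. A n) \<longleftrightarrow> (\<exists>n. y \<in> F (A n))" if A: "range A \<subseteq> sets X" for A :: "nat \<Rightarrow> 'x set"
      by (rule countable_UN[OF A]) (use F A in auto)
  qed
  from F.point_realisation obtain \<theta> where \<theta>: "\<theta> \<in> Y \<rightarrow>\<^sub>M X" "\<forall>A\<in>sets X. AE y in Y. \<theta> y \<in> A \<longleftrightarrow> y \<in> F A" by blast
  have "AE y in Y. \<theta> y \<in> A \<longleftrightarrow> y \<in> B" if A: "A \<in> sets X" "B \<in> sets Y" "R A B" for A B
  proof -
    have "AE y in Y. y \<in> B \<longleftrightarrow> y \<in> F A" using AE_iff[OF A(1) A(1) A(2) F(1)[OF A(1)] A(3) F(2)[OF A(1)]] by simp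
    with bspec[OF \<theta>(2) A(1)] show ?thesis by eventually_elim simp
  qed
  with \<theta>(1) show ?thesis by blast
qed

text \<open>The map is nonsingular, since the correspondence matches null sets with null
  sets.\<close>

lemma map_AE:
  assumes \<theta>: "\<theta> \<in> Y \<rightarrow>\<^sub>M X" "\<forall>A\<in>sets X. \<forall>B\<in>sets Y. R A B \<longrightarrow> (AE y in Y. \<theta> y \<in> A \<longleftrightarrow> y \<in> B)"
    and P: "AE x in X. P x"
  shows "AE y in Y. P (\<theta> y)"
proof -
  obtain N where N: "N \<in> null_sets X" "{x\<in>space X. \<not> P x} \<subseteq> N" using P by (auto simp: eventually_ae_filter)
  then have Ns: "N \<in> sets X" by auto
  obtain B where B: "B \<in> sets Y" "R N B" using total[OF Ns] by blast
  have "AE x in X. x \<notin> N" using N(1) by (rule AE_not_in)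
  then have "AE y in Y. y \<notin> B" using null_iff[OF Ns B] by simp
  with \<theta>(2)[rule_format, OF Ns B] AE_space show ?thesis
    by eventually_elim (use N(2) measurable_space[OF \<theta>(1)] in blast)
qed

text \<open>Each member of a countable separating family pulls back to itself, up to a null set,
  under the composite. Off the union of these null sets the composite fixes the point.\<close>

lemma map_inverse:
  assumes \<theta>: "\<theta> \<in> Y \<rightarrow>\<^sub>M X" "\<forall>A\<in>sets X. \<forall>B\<in>sets Y. R A B \<longrightarrow> (AE y in Y. \<theta> y \<in> A \<longleftrightarrow> y \<in> B)"
    and \<theta>': "\<theta>' \<in> X \<rightarrow>\<^sub>M Y" "\<forall>A\<in>sets X. \<forall>B\<in>sets Y. R A B \<longrightarrow> (AE x in X. \<theta>' x \<in> B \<longleftrightarrow> x \<in> A)"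
  shows "{y\<in>space Y. \<theta>' (\<theta> y) = y} \<in> sets Y \<and> (AE y in Y. \<theta>' (\<theta> y) = y)"
proof -
  obtain U :: "nat \<Rightarrow> 'y set" where U: "\<And>n. U n \<in> sets Y"
    "\<And>x y. x \<in> space Y \<Longrightarrow> y \<in> space Y \<Longrightarrow> x \<noteq> y \<Longrightarrow> \<exists>n. x \<in> U n \<and> y \<notin> U n"
    using standard_separating[OF standard_Y] by blast
  note [measurable] = \<theta>(1) \<theta>'(1) U(1)
  have sp: "\<theta>' (\<theta> y) \<in> space Y" if "y \<in> space Y" for y
    using that measurable_space[OF \<theta>(1)] measurable_space[OF \<theta>'(1)] by blast
  have eq: "\<theta>' (\<theta> y) = y \<longleftrightarrow> (\<forall>n. \<theta>' (\<theta> y) \<in> U n \<longleftrightarrow> y \<in> U n)" if "y \<in> space Y" for y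
    using U(2)[OF sp[OF that] that] by auto
  have "{y\<in>space Y. \<theta>' (\<theta> y) = y} = {y\<in>space Y. \<forall>n. \<theta>' (\<theta> y) \<in> U n \<longleftrightarrow> y \<in> U n}"
    by (rule Collect_cong) (use eq in blast)
  also have "\<dots> \<in> sets Y" by measurable
  finally have "{y\<in>space Y. \<theta>' (\<theta> y) = y} \<in> sets Y" .
  moreover have "AE y in Y. \<forall>n. \<theta>' (\<theta> y) \<in> U n \<longleftrightarrow> y \<in> U n"
    unfolding AE_all_countable
  proof
    fix n
    obtain A where A: "A \<in> sets X" "R A (U n)" using surj[OF U(1)] by blast
    from map_AE[OF \<theta> \<theta>'(2)[rule_format, OF A(1) U(1) A(2)]] \<theta>(2)[rule_format, OF A(1) U(1) A(2)]
    show "AE y in Y. \<theta>' (\<theta> y) \<in> U n \<longleftrightarrow> y \<in> U n" by eventually_elim simp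
  qed
  then have "AE y in Y. \<theta>' (\<theta> y) = y" using AE_space by eventually_elim (use eq in blast)
  ultimately show ?thesis by blast
qed

end

text \<open>The fixed-point sets of the two composites are mapped onto each other bijectively, with
  \<theta>' as inverse, so they serve as the conull sets in \<open>iso_mod_null\<close>.\<close>

lemma iso_mod_nullI:
  assumes \<theta>: "\<theta> \<in> X \<rightarrow>\<^sub>M Y" and \<theta>': "\<theta>' \<in> Y \<rightarrow>\<^sub>M X"
    and A: "{x\<in>space X. \<theta>' (\<theta> x) = x} \<in> sets X" "AE x in X. \<theta>' (\<theta> x) = x"
    and B: "{y\<in>space Y. \<theta> (\<theta>' y) = y} \<in> sets Y" "AE y in Y. \<theta> (\<theta>' y) = y"
    and distr: "distr X Y \<theta> = Y"
  shows "iso_mod_null X Y \<theta>"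
proof -
  let ?A = "{x\<in>space X. \<theta>' (\<theta> x) = x}" and ?B = "{y\<in>space Y. \<theta> (\<theta>' y) = y}"
  have m1: "\<theta> \<in> restrict_space X ?A \<rightarrow>\<^sub>M restrict_space Y ?B"
    using measurable_space[OF \<theta>] by (intro measurable_restrict_space3[OF \<theta>]) auto
  have m2: "\<theta>' \<in> restrict_space Y ?B \<rightarrow>\<^sub>M restrict_space X ?A"
    using measurable_space[OF \<theta>'] by (intro measurable_restrict_space3[OF \<theta>']) auto
  have bij: "bij_betw \<theta> ?A ?B"
    by (rule bij_betwI[where g=\<theta>']) (use measurable_space[OF \<theta>] measurable_space[OF \<theta>'] in auto)
  have inv: "the_inv_into ?A \<theta> y = \<theta>' y" if "y \<in> ?B" for y
    by (rule the_inv_into_f_eq[OF bij_betw_imp_inj_on[OF bij]]) (use that measurable_space[OF \<theta>'] in auto)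
  have "the_inv_into ?A \<theta> \<in> restrict_space Y ?B \<rightarrow>\<^sub>M restrict_space X ?A"
    using m2 by (rule measurable_cong[THEN iffD1, rotated]) (use inv in \<open>auto simp: space_restrict_space\<close>)
  moreover have "distr (restrict_space X ?A) (restrict_space Y ?B) \<theta> = restrict_space Y ?B"
  proof (rule measure_eqI)
    fix E assume "E \<in> sets (distr (restrict_space X ?A) (restrict_space Y ?B) \<theta>)"
    then have E: "E \<in> sets (restrict_space Y ?B)" by simp
    then have E': "E \<in> sets Y" "E \<subseteq> ?B" using B(1) by (auto simp: sets_restrict_space)
    have "emeasure (distr (restrict_space X ?A) (restrict_space Y ?B) \<theta>) E
        = emeasure (restrict_space X ?A) (\<theta> -` E \<inter> ?A)"
      unfolding emeasure_distr[OF m1 E] by (rule arg_cong[where f="emeasure _"]) (auto simp: space_restrict_space)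
    also have "\<dots> = emeasure X (\<theta> -` E \<inter> ?A)"
      using A(1) by (intro emeasure_restrict_space) auto
    also have "\<dots> = emeasure X (\<theta> -` E \<inter> space X)"
    proof (rule emeasure_eq_AE)
      show "AE x in X. x \<in> \<theta> -` E \<inter> ?A \<longleftrightarrow> x \<in> \<theta> -` E \<inter> space X" using A(2) by eventually_elim auto
      have "\<theta> -` E \<inter> ?A = (\<theta> -` E \<inter> space X) \<inter> ?A" by auto
      then show "\<theta> -` E \<inter> ?A \<in> sets X" using A(1) measurable_sets[OF \<theta> E'(1)] by auto
      show "\<theta> -` E \<inter> space X \<in> sets X" by (rule measurable_sets[OF \<theta> E'(1)])
    qed
    also have "\<dots> = emeasure (distr X Y \<theta>) E" using \<theta> E' by (simp add: emeasure_distr)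
    also have "\<dots> = emeasure (restrict_space Y ?B) E"
      unfolding distr using B(1) E' by (intro emeasure_restrict_space[symmetric]) auto
    finally show "emeasure (distr (restrict_space X ?A) (restrict_space Y ?B) \<theta>) E = emeasure (restrict_space Y ?B) E" .
  qed simp
  moreover have "AE x in X. x \<in> ?A" "AE y in Y. y \<in> ?B" using A(2) B(2) AE_space by auto
  ultimately show ?thesis unfolding iso_mod_null_def using A(1) B(1) bij m1 by blast
qed

section \<open>Conjugacy of the actions\<close>

text \<open>Applied to complements, the inequality reverses because both total masses are 1.\<close>

lemma prob_space_eqI_le:
  assumes M: "prob_space M" and N: "prob_space N" and sets: "sets M = sets N"
    and le: "\<And>A. A \<in> sets M \<Longrightarrow> emeasure M A \<le> emeasure N A"
  shows "M = N"
proof (rule measure_eqI[OF sets])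
  interpret M: prob_space M by (rule M)
  interpret N: prob_space N by (rule N)
  have le': "measure M A \<le> measure N A" if "A \<in> sets M" for A
    using le[OF that] by (simp add: M.emeasure_eq_measure N.emeasure_eq_measure)
  fix A assume A: "A \<in> sets M"
  have "measure M (space M - A) \<le> measure N (space M - A)" using A by (intro le') auto
  then have "measure N A \<le> measure M A"
    using A sets sets_eq_imp_space_eq[OF sets] M.prob_compl[of A] N.prob_compl[of A] by simp
  with le'[OF A] show "emeasure M A = emeasure N A" by (simp add: M.emeasure_eq_measure N.emeasure_eq_measure)
qed

context gms
begin

text \<open>The Radon-Nikodym derivative of \<open>\<nu>\<close> is invariant, so by ergodicity it is almost everywhere
  above \<open>1\<close> or almost everywhere at most \<open>1\<close>.\<close>

lemma ergodic_invariant_unique: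
  assumes erg: "ergodic_pmp G Y \<psi>" and \<nu>: "prob_space \<nu>" "sets \<nu> = sets Y" "absolutely_continuous Y \<nu>"
    and inv: "\<And>g. g \<in> carrier G \<Longrightarrow> distr \<nu> Y (\<psi> g) = \<nu>"
  shows "\<nu> = Y"
proof -
  obtain f where f [measurable]: "f \<in> borel_measurable Y" and dens: "density Y f = \<nu>"
    using Radon_Nikodym[OF \<nu>(3,2)] by blast
  have f_act [measurable]: "(\<lambda>z. f (\<psi> g z)) \<in> borel_measurable Y" if "g \<in> carrier G" for g
    by (rule measurable_compose[OF act_measurable[OF that] f])
  have f_inv: "AE z in Y. f (\<psi> g z) = f z" if g: "g \<in> carrier G" for g
  proof -
    note [measurable] = act_measurable[OF g] act_measurable[OF inv_closed[OF g]] f_act[OF g]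
    have "density Y (\<lambda>z. f (\<psi> g z)) = density Y f"
    proof (rule measure_eqI)
      fix A assume "A \<in> sets (density Y (\<lambda>z. f (\<psi> g z)))"
      then have A [measurable]: "A \<in> sets Y" by simp
      let ?A = "\<psi> (inv g) -` A \<inter> space Y"
      have A' [measurable]: "?A \<in> sets Y" by measurable
      have "emeasure (density Y (\<lambda>z. f (\<psi> g z))) A = (\<integral>\<^sup>+z. f (\<psi> g z) * indicator A z \<partial>Y)"
        by (rule emeasure_density) measurable
      also have "\<dots> = (\<integral>\<^sup>+z. f (\<psi> g z) * indicator ?A (\<psi> g z) \<partial>Y)"
        by (rule nn_integral_cong) (use g in \<open>auto simp: act_mult indicator_def\<close>)
      also have "\<dots> = (\<integral>\<^sup>+z. f z * indicator ?A z \<partial>Y)" by (rule nn_integral_act[OF g]) measurable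
      also have "\<dots> = emeasure \<nu> ?A" unfolding dens[symmetric] by (rule emeasure_density[symmetric]) measurable
      also have "\<dots> = emeasure (distr \<nu> Y (\<psi> (inv g))) A"
        using sets_eq_imp_space_eq[OF \<nu>(2)]
        by (subst emeasure_distr) (auto simp: measurable_cong_sets[OF \<nu>(2) refl] act_measurable g)
      also have "\<dots> = emeasure (density Y f) A" using inv[of "inv g"] g dens by simp
      finally show "emeasure (density Y (\<lambda>z. f (\<psi> g z))) A = emeasure (density Y f) A" .
    qed simp
    then show ?thesis by (subst (asm) density_unique_iff) measurable
  qed
  \<comment> \<open>The density is invariant only almost everywhere, whereas
    \<open>ergodic_pmp\<close> concerns strictly invariant sets. Quantifying over the whole group
    gives a strictly invariant set that agrees with the set where 1 < f up to a null set.\<close>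
  define B where "B = {z\<in>space Y. \<forall>g\<in>carrier G. 1 < f (\<psi> g z)}"
  have B_sets: "B \<in> sets Y"
  proof -
    have "{z\<in>space Y. 1 < f (\<psi> g z)} \<in> sets Y" if "g \<in> carrier G" for g using f_act[OF that] by measurable
    moreover have "B = (\<Inter>g\<in>carrier G. {z\<in>space Y. 1 < f (\<psi> g z)})" using one_closed by (auto simp: B_def)
    moreover have "carrier G \<noteq> {}" using one_closed by blast
    ultimately show ?thesis using countable_carrier by (auto intro: sets.countable_INT')
  qed
  have B_inv: "\<psi> g ` B = B" if g: "g \<in> carrier G" for g
  proof -
    have sub: "\<psi> h z \<in> B" if "h \<in> carrier G" "z \<in> B" for h z
      using that by (auto simp: B_def act_mult)
    have "z \<in> \<psi> g ` B" if z: "z \<in> B" for z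
    proof (rule image_eqI)
      show "z = \<psi> g (\<psi> (inv g) z)" using z g by (simp add: B_def act_mult)
      show "\<psi> (inv g) z \<in> B" using sub[OF inv_closed[OF g] z] .
    qed
    with sub[OF g] show ?thesis by blast
  qed
  have "measure Y B = 0 \<or> measure Y B = 1"
    by (rule erg[unfolded ergodic_pmp_def, rule_format, OF B_sets B_inv])
  moreover have B: "AE z in Y. z \<in> B \<longleftrightarrow> 1 < f z"
  proof -
    have "AE z in Y. \<forall>g\<in>carrier G. f (\<psi> g z) = f z" unfolding AE_ball_countable[OF countable_carrier] using f_inv by blast
    then show ?thesis using AE_space by eventually_elim (use one_closed in \<open>auto simp: B_def\<close>)
  qed
  ultimately show ?thesis
  proof (elim disjE)
    assume "measure Y B = 0"
    then have "AE z in Y. z \<notin> B" using B_sets by (simp add: prob_eq_0)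
    with B have le: "AE z in Y. f z \<le> 1" by eventually_elim auto
    show ?thesis
    proof (rule prob_space_eqI_le[OF \<nu>(1) prob_space_axioms \<nu>(2)])
      fix A assume "A \<in> sets \<nu>"
      then have A [measurable]: "A \<in> sets Y" using \<nu> by simp
      have "emeasure \<nu> A = (\<integral>\<^sup>+z. f z * indicator A z \<partial>Y)" unfolding dens[symmetric] by (rule emeasure_density) measurable
      also have "\<dots> \<le> (\<integral>\<^sup>+z. indicator A z \<partial>Y)"
        by (rule nn_integral_mono_AE, use le in eventually_elim) (auto split: split_indicator)
      finally show "emeasure \<nu> A \<le> emeasure Y A" by simp
    qed
  next
    assume "measure Y B = 1"
    then have "AE z in Y. z \<in> B" using B_sets by (simp add: prob_eq_1)
    with B have le: "AE z in Y. 1 \<le> f z" by eventually_elim auto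
    show ?thesis
    proof (rule prob_space_eqI_le[OF prob_space_axioms \<nu>(1) \<nu>(2)[symmetric], symmetric])
      fix A assume A [measurable]: "A \<in> sets Y"
      have "emeasure Y A = (\<integral>\<^sup>+z. indicator A z \<partial>Y)" by simp
      also have "\<dots> \<le> (\<integral>\<^sup>+z. f z * indicator A z \<partial>Y)"
        by (rule nn_integral_mono_AE, use le in eventually_elim) (auto split: split_indicator)
      also have "\<dots> = emeasure \<nu> A" unfolding dens[symmetric] by (rule emeasure_density[symmetric]) measurable
      finally show "emeasure Y A \<le> emeasure \<nu> A" .
    qed
  qed
qed

end

context gms_pair
begin

definition corr :: "'x set \<Rightarrow> 'y set \<Rightarrow> bool" where
  "corr A B \<longleftrightarrow> alpha (mX (indicator A)) = mY (indicator B)"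

text \<open>An idempotent bounded function is the indicator of a set, whence \<open>Ad(x) \<circ> \<Theta>\<close> matches sets
  with sets.\<close>

lemma corr_bool_iso: "bool_iso X Y corr"
proof
  show "standard_prob_space X" "standard_prob_space Y"
    using X.pmp Y.pmp by (auto simp: pmp_action_def)
  show "corr {} {}" using alpha_const[of 0] by (simp add: corr_def indicator_def[abs_def])
next
  fix A assume A: "A \<in> sets X"
  obtain b where b: "Y.bdd b" "alpha (mX (indicator A)) = mY b" using alpha_mX[OF X.bdd_indicator[OF A]] by blast
  have "mY (\<lambda>z. b z * b z) = alpha (mX (indicator A) \<cdot>\<^sub>X mX (indicator A))"
    using b X.bdd_indicator[OF A] by (simp add: alpha_mult Y.mult_op_mult)
  also have "\<dots> = mY b"
    using b X.bdd_indicator[OF A] by (simp add: X.mult_op_mult indicator_def[abs_def] of_bool_conj[symmetric])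
  finally have "AE z in Y. b z * b z = b z" using b by (simp add: Y.mult_op_eq_iff Y.bdd_mult)
  then have "AE z in Y. b z = indicator {z\<in>space Y. b z = 1} z"
    using AE_space by eventually_elim (auto simp: indicator_def)
  then have "corr A {z\<in>space Y. b z = 1}" unfolding corr_def b(2) by (rule Y.mult_op_cong)
  moreover have "{z\<in>space Y. b z = 1} \<in> sets Y" using Y.bdd_measurable[OF b(1)] by measurable
  ultimately show "\<exists>B\<in>sets Y. corr A B" by blast
next
  fix B assume B: "B \<in> sets Y"
  obtain a where a: "X.bdd a" "alpha (mX a) = mY (indicator B)" using mY_alpha[OF Y.bdd_indicator[OF B]] by blast
  have "alpha (mX (\<lambda>x. a x * a x)) = mY (indicator B) \<cdot> mY (indicator B)"
    using a by (simp add: alpha_mult X.mult_op_mult[symmetric])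
  also have "\<dots> = alpha (mX a)"
    using a Y.bdd_indicator[OF B] by (simp add: Y.mult_op_mult indicator_def[abs_def] of_bool_conj[symmetric])
  finally have "mX (\<lambda>x. a x * a x) = mX a"
    by (rule alpha_inj[rotated 2]) (use a X.bdd_mult in auto)
  then have "AE x in X. a x * a x = a x" using a by (simp add: X.mult_op_eq_iff X.bdd_mult)
  then have "AE x in X. a x = indicator {x\<in>space X. a x = 1} x"
    using AE_space by eventually_elim (auto simp: indicator_def)
  then have "mX a = mX (indicator {x\<in>space X. a x = 1})" by (rule X.mult_op_cong)
  then have "corr {x\<in>space X. a x = 1} B" using a by (simp add: corr_def)
  moreover have "{x\<in>space X. a x = 1} \<in> sets X" using X.bdd_measurable[OF a(1)] by measurable
  ultimately show "\<exists>A\<in>sets X. corr A B" by blast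
next
  fix A A' B B' assume s: "A \<in> sets X" "A' \<in> sets X" "B \<in> sets Y" "B' \<in> sets Y" and c: "corr A B" "corr A' B'"
  note bdd = X.bdd_indicator[OF s(1)] X.bdd_indicator[OF s(2)] Y.bdd_indicator[OF s(3)] Y.bdd_indicator[OF s(4)]
  have "alpha (mX (indicator A) \<cdot>\<^sub>X mX (indicator A')) = mY (indicator B) \<cdot> mY (indicator B')"
    using c bdd by (simp add: alpha_mult corr_def)
  then show "corr (A \<inter> A') (B \<inter> B')"
    using bdd by (simp add: corr_def X.mult_op_mult Y.mult_op_mult indicator_inter_arith[abs_def])
  have "mX (indicator A) = mX (indicator A') \<longleftrightarrow> mY (indicator B) = mY (indicator B')"
    using c alpha_inj[OF _ _, of "mX (indicator A)" "mX (indicator A')"] bdd unfolding corr_def by auto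
  then show "(AE x in X. x \<in> A \<longleftrightarrow> x \<in> A') \<longleftrightarrow> (AE y in Y. y \<in> B \<longleftrightarrow> y \<in> B')"
    using bdd by (simp add: X.mult_op_eq_iff Y.mult_op_eq_iff indicator_def of_bool_eq_iff)
qed

text \<open>\<open>alpha_equivariant\<close> is used at \<gamma>^-1, so that both sides become
  preimages under the acting elements themselves.\<close>

lemma corr_act:
  assumes \<gamma>: "\<gamma> \<in> carrier \<Gamma>" and s: "A \<in> sets X" "B \<in> sets Y" and c: "corr A B"
  shows "corr (\<phi> \<gamma> -` A \<inter> space X) (\<psi> (\<delta> \<gamma>) -` B \<inter> space Y)"
proof -
  have d: "\<delta> (inv\<^bsub>\<Gamma>\<^esub> \<gamma>) = inv\<^bsub>\<Lambda>\<^esub> (\<delta> \<gamma>)"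
    using \<delta>_iso \<gamma> group_hom.hom_inv[of \<Gamma> \<Lambda> \<delta>] X.is_group Y.is_group
    by (simp add: group_hom_def group_hom_axioms_def iso_def)
  have "alpha (mX (\<lambda>x. indicator A (\<phi> \<gamma> x))) = mY (\<lambda>z. indicator B (\<psi> (\<delta> \<gamma>) z))"
    using alpha_equivariant[OF X.inv_closed[OF \<gamma>] X.bdd_indicator[OF s(1)] Y.bdd_indicator[OF s(2)] c[unfolded corr_def]] \<gamma> d
      \<eta>\<delta>(1)[OF \<gamma>] by simp
  moreover have "mX (\<lambda>x. indicator A (\<phi> \<gamma> x)) = mX (indicator (\<phi> \<gamma> -` A \<inter> space X))"
    by (rule X.mult_op_cong) (auto simp: indicator_def)
  moreover have "mY (\<lambda>z. indicator B (\<psi> (\<delta> \<gamma>) z)) = mY (indicator (\<psi> (\<delta> \<gamma>) -` B \<inter> space Y))"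
    by (rule Y.mult_op_cong) (auto simp: indicator_def)
  ultimately show ?thesis by (simp add: corr_def)
qed

text \<open>\<open>alpha\<close> is an isomorphism of algebras with no integral attached, so a
  priori \<theta> is only nonsingular. The transported measure is invariant under the action on Y
  and absolutely continuous; \<open>ergodic_invariant_unique\<close> identifies it with
  \<open>Y\<close>.\<close>

theorem conjugate:
  assumes erg: "ergodic_pmp \<Lambda> Y \<psi>"
  shows "conjugate_actions \<Gamma> X \<phi> \<Lambda> Y \<psi>"
proof -
  interpret B: bool_iso X Y corr by (rule corr_bool_iso)
  interpret B': bool_iso Y X "\<lambda>B A. corr A B" by (rule B.flip)
  obtain \<theta>' where \<theta>': "\<theta>' \<in> Y \<rightarrow>\<^sub>M X"
    "\<forall>A\<in>sets X. \<forall>B\<in>sets Y. corr A B \<longrightarrow> (AE y in Y. \<theta>' y \<in> A \<longleftrightarrow> y \<in> B)" using B.ex_map by blast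
  obtain \<theta> where \<theta>0: "\<theta> \<in> X \<rightarrow>\<^sub>M Y"
    "\<forall>B\<in>sets Y. \<forall>A\<in>sets X. corr A B \<longrightarrow> (AE x in X. \<theta> x \<in> B \<longleftrightarrow> x \<in> A)" using B'.ex_map by blast
  then have \<theta>: "\<theta> \<in> X \<rightarrow>\<^sub>M Y" "\<forall>A\<in>sets X. \<forall>B\<in>sets Y. corr A B \<longrightarrow> (AE x in X. \<theta> x \<in> B \<longleftrightarrow> x \<in> A)" by auto
  have \<theta>'0: "\<forall>B\<in>sets Y. \<forall>A\<in>sets X. corr A B \<longrightarrow> (AE y in Y. \<theta>' y \<in> A \<longleftrightarrow> y \<in> B)" using \<theta>' by auto
  note [measurable] = \<theta>(1)
  have \<theta>_AE: "AE x in X. P (\<theta> x)" if "AE y in Y. P y" for P by (rule B'.map_AE[OF \<theta>0 that])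
  have equi: "AE x in X. \<theta> (\<phi> \<gamma> x) = \<psi> (\<delta> \<gamma>) (\<theta> x)" if \<gamma>: "\<gamma> \<in> carrier \<Gamma>" for \<gamma>
  proof -
    note d = \<eta>\<delta>(1)[OF \<gamma>]
    obtain U :: "nat \<Rightarrow> 'y set" where U: "\<And>n. U n \<in> sets Y"
      "\<And>x y. x \<in> space Y \<Longrightarrow> y \<in> space Y \<Longrightarrow> x \<noteq> y \<Longrightarrow> \<exists>n. x \<in> U n \<and> y \<notin> U n"
      using standard_separating[OF B.standard_Y] by blast
    have "AE x in X. \<forall>n. \<theta> (\<phi> \<gamma> x) \<in> U n \<longleftrightarrow> \<psi> (\<delta> \<gamma>) (\<theta> x) \<in> U n"
      unfolding AE_all_countable
    proof
      fix n
      obtain A where A: "A \<in> sets X" "corr A (U n)" using B.surj[OF U(1)] by blast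
      have sA: "\<phi> \<gamma> -` A \<inter> space X \<in> sets X" using X.act_measurable[OF \<gamma>] A(1) by (rule measurable_sets)
      have sB: "\<psi> (\<delta> \<gamma>) -` U n \<inter> space Y \<in> sets Y" using Y.act_measurable[OF d] U(1) by (rule measurable_sets)
      show "AE x in X. \<theta> (\<phi> \<gamma> x) \<in> U n \<longleftrightarrow> \<psi> (\<delta> \<gamma>) (\<theta> x) \<in> U n"
        using X.AE_act[OF \<gamma> \<theta>(2)[rule_format, OF A(1) U(1) A(2)]]
          \<theta>(2)[rule_format, OF sA sB corr_act[OF \<gamma> A(1) U(1) A(2)]] AE_space
        by eventually_elim (use measurable_space[OF \<theta>(1)] in auto)
    qed
    then show ?thesis using AE_space
    proof eventually_elim
      fix x assume "\<forall>n. \<theta> (\<phi> \<gamma> x) \<in> U n \<longleftrightarrow> \<psi> (\<delta> \<gamma>) (\<theta> x) \<in> U n" "x \<in> space X"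
      then show "\<theta> (\<phi> \<gamma> x) = \<psi> (\<delta> \<gamma>) (\<theta> x)"
        using U(2) measurable_space[OF \<theta>(1)] d \<gamma> by (metis X.act_space Y.act_space)
    qed
  qed
  have "distr X Y \<theta> = Y"
  proof (rule Y.ergodic_invariant_unique[OF erg])
    show "prob_space (distr X Y \<theta>)" by (rule X.prob_space_distr) measurable
    show "absolutely_continuous Y (distr X Y \<theta>)" unfolding absolutely_continuous_def
    proof
      fix N assume N: "N \<in> null_sets Y"
      then have "AE x in X. \<theta> x \<notin> N" by (intro \<theta>_AE AE_not_in)
      then show "N \<in> null_sets (distr X Y \<theta>)"
        using N by (subst null_sets_distr_iff) (auto simp: AE_iff_null vimage_def Int_def conj_commute intro: measurable_sets)
    qed
    \<comment> \<open>Every element of \<Lambda> has the form \<open>\<delta> \<gamma>\<close>, so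
      equivariance of \<theta> turns invariance of X under \<gamma> into invariance of the image
      measure.\<close>
    fix g assume g: "g \<in> carrier \<Lambda>"
    then obtain \<gamma> where \<gamma>: "\<gamma> \<in> carrier \<Gamma>" "g = \<delta> \<gamma>" using \<delta>_surj by blast
    note [measurable] = Y.act_measurable[OF g] X.act_measurable[OF \<gamma>(1)]
    have "distr (distr X Y \<theta>) Y (\<psi> g) = distr X Y (\<lambda>x. \<psi> g (\<theta> x))" by (simp add: distr_distr comp_def)
    also have "\<dots> = distr X Y (\<lambda>x. \<theta> (\<phi> \<gamma> x))"
      by (rule distr_cong_AE[symmetric]) (use equi[OF \<gamma>(1)] in \<open>simp_all add: \<gamma>(2)[symmetric]\<close>)
    also have "\<dots> = distr (distr X X (\<phi> \<gamma>)) Y \<theta>" by (simp add: distr_distr comp_def)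
    finally show "distr (distr X Y \<theta>) Y (\<psi> g) = distr X Y \<theta>" by (simp add: X.distr_act[OF \<gamma>(1)])
  qed simp
  note inverse = B'.map_inverse[OF \<theta>0 \<theta>'(1) \<theta>'0] B.map_inverse[OF \<theta>' \<theta>]
  have "iso_mod_null X Y \<theta>"
    by (rule iso_mod_nullI[OF \<theta>(1) \<theta>'(1) conjunct1[OF inverse(1)] conjunct2[OF inverse(1)]
      conjunct1[OF inverse(2)] conjunct2[OF inverse(2)] \<open>distr X Y \<theta> = Y\<close>])
  then show ?thesis unfolding conjugate_actions_def
    by (intro exI[of _ \<theta>] exI[of _ \<delta>] conjI \<delta>_iso ballI equi)
qed

end

theorem theorem4p5:
  fixes \<Gamma> :: "('g, 'm) monoid_scheme" and X :: "'x measure" and \<phi> :: "'g \<Rightarrow> 'x \<Rightarrow> 'x"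
    and \<Lambda> :: "('h, 'n) monoid_scheme" and Y :: "'y measure" and \<psi> :: "'h \<Rightarrow> 'y \<Rightarrow> 'y"
    and \<Theta> :: "('x \<times> 'g) l2op \<Rightarrow> ('y \<times> 'h) l2op" and u :: "('y \<times> 'h) l2op"
  defines "MX \<equiv> gms_measure \<Gamma> X" and "MY \<equiv> gms_measure \<Lambda> Y"
  assumes "countable (carrier \<Gamma>)" and "countable (carrier \<Lambda>)"
    and "pmp_action \<Gamma> X \<phi>" and "free_pmp \<Gamma> X \<phi>" and "ergodic_pmp \<Gamma> X \<phi>"
    and "pmp_action \<Lambda> Y \<psi>" and "free_pmp \<Lambda> Y \<psi>" and "ergodic_pmp \<Lambda> Y \<psi>"
    and "icc \<Gamma>"
    and "star_isomorphism MX (crossed_product \<Gamma> X \<phi>) MY (crossed_product \<Lambda> Y \<psi>) \<Theta>"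
    and "\<Theta> ` Linf \<Gamma> X = Linf \<Lambda> Y"
    and "u \<in> unitaries MY (crossed_product \<Lambda> Y \<psi>)"
    and "\<Theta> ` group_vN \<Gamma> X \<phi> = op_conj MY u ` group_vN \<Lambda> Y \<psi>"
  shows "(\<exists>x \<eta> \<delta>.
            x \<in> vN_normalizer MY (crossed_product \<Lambda> Y \<psi>) (Linf \<Lambda> Y) \<and>
            \<eta> \<in> hom \<Gamma> circle_group \<and>
            \<delta> \<in> iso \<Gamma> \<Lambda> \<and>
            op_mult MY x u \<in> unitaries MY (group_vN \<Lambda> Y \<psi>) \<and>
            (\<forall>a \<in> Linf \<Gamma> X. \<forall>\<gamma> \<in> carrier \<Gamma>.
               \<Theta> (op_mult MX a (group_unitary \<Gamma> X \<phi> \<gamma>)) =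
               op_scale MY (\<eta> \<gamma>)
                 (op_mult MY (\<Theta> a)
                   (op_mult MY (op_adj MY x)
                     (op_mult MY (group_unitary \<Lambda> Y \<psi> (\<delta> \<gamma>)) x)))))
         \<and> conjugate_actions \<Gamma> X \<phi> \<Lambda> Y \<psi>"
proof -
  interpret gms_pair \<Gamma> X \<phi> \<Lambda> Y \<psi> \<Theta> u
    by unfold_locales (use assms(3-) in \<open>simp_all add: MX_def MY_def\<close>)
  \<comment> \<open>The product \<open>xop \<cdot> u\<close> is the convolution unitary by
    \<open>xop_u\<close>, which is how the claim on \<open>xu\<close> is met.\<close>
  show ?thesis unfolding MX_def MY_def
    using xop_normalizer \<eta>_hom \<delta>_iso T_unitary_LY[folded xop_u] Theta_formula conjugate[OF assms(10)] by blast
qed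

end
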